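(* Let $\lambda_1,\dots,\lambda_n>0$, let $S^{(0)}$ denote the Szegő projection onto $\mathcal H^0_b(H_{n+1})$ with distribution kernel $S^{(0)}(x,y)$, and let $\tilde P$ be the operator on $L^2(H_{n+1})$ given by $$\tilde P(u)(z,x_{2n+1})=\frac1{2\pi}\int_{\mathbb R}e^{-itx_{2n+1}}\Bigl(\int_{\mathbb C^n}P_{t\psi}(z,w)\Bigl(\int_{\mathbb R}e^{ity_{2n+1}}u(w,y_{2n+1})\,dy_{2n+1}\Bigr)d\mu(w)\Bigr)dt,$$ where $P_{t\psi}(z,w)$ is the weighted Bergman kernel on $\mathbb C^n$ with respect to $t\psi$, $\psi(z)=\sum_{j=1}^n\lambda_j|z_j|^2$. Then $\tilde P=S^{(0)}$, and hence formally, with $x=(z,x_{2n+1})$, $y=(w,y_{2n+1})$, $$S^{(0)}(x,y)=\frac{1}{2\pi}\int_{\mathbb R}e^{-it(x_{2n+1}-y_{2n+1})}P_{t\psi}(z,w)\,dt,$$ meaning that for $u\in C_0^\infty(H_{n+1})$, $$(S^{(0)}u)(x)=\lim_{\varepsilon\to0^+}\frac{1}{2\pi}\int_{\mathbb R}\int_{H_{n+1}}\chi(\varepsilon t)e^{-it(x_{2n+1}-y_{2n+1})}P_{t\psi}(z,w)u(y)\,d\mu_{H_{n+1}}(y)\,dt,$$ where $\chi\in C_0^\infty(\mathbb R)$ with $\chi(s)=1$ for $|s|\le1$ and $\chi(s)=0$ for $|s|>2$.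
   Context: Let $n\ge1$. Coordinates on $H_{n+1}=\mathbb C^n\times\mathbb R$ are $x=(z,x_{2n+1})=(x_1,\dots,x_{2n+1})$, $z_j=x_{2j-1}+ix_{2j}$. Measures: $d\mu(z)=2^n\,dx_1\cdots dx_{2n}$ on $\mathbb C^n$ and $d\mu_{H_{n+1}}=2^n\,dx_1\cdots dx_{2n+1}$ on $H_{n+1}$; $L^2(H_{n+1})$ is taken with respect to $d\mu_{H_{n+1}}$. The CR structure is spanned by $Z_j=\frac{\partial}{\partial z_j}-i\lambda_j\overline z_j\frac{\partial}{\partial x_{2n+1}}$, $\overline Z_j=\frac{\partial}{\partial\overline z_j}+i\lambda_jz_j\frac{\partial}{\partial x_{2n+1}}$, with the $d\overline z_j$ orthonormal. On functions $\overline\partial_bu=\sum_j(\overline Z_ju)d\overline z_j$, with $L^2$ domain $\{u\in L^2:\overline\partial_bu\in L^2\}$ (distributional sense), $\overline\partial_b^*$ its Hilbert space adjoint, $\Box_b^{(0)}=\overline\partial_b^*\overline\partial_b$ with domain $\{u\in\mathrm{Dom}\,\overline\partial_b:\overline\partial_bu\in\mathrm{Dom}\,\overline\partial^*_b\}$, and $\mathcal H^0_b(H_{n+1})=\mathrm{Ker}\,\Box^{(0)}_b$. $S^{(0)}$ is the orthogonal projection of $L^2(H_{n+1})$ onto $\mathcal H_b^0(H_{n+1})$. For a smooth $\phi:\mathbb C^n\to\mathbb R$, $H^0_\phi(\mathbb C^n)$ is the Hilbert space of holomorphic $f$ on $\mathbb C^n$ with $\|f\|_\phi^2=\int_{\mathbb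 C^n}|f|^2e^{-2\phi}d\mu<\infty$, and the Bergman kernel is $P_\phi(z,w)=e^{-(\phi(z)+\phi(w))}\sum_js_j(z)\overline{s_j(w)}$ for an orthonormal basis $\{s_j\}$ of $H^0_\phi(\mathbb C^n)$ (zero if the space is $\{0\}$). In the definition of $\tilde P$ the order of integration is important: first the inverse partial Fourier transform in the last variable (extended to $L^2(H_{n+1})$), then the integral over $\mathbb C^n$ for a.e. $t$, which yields an element of $L^2(H_{n+1})$, then the partial Fourier transform in the last variable (extended to $L^2(H_{n+1})$). *)

theory Defs
  imports "HOL-Analysis.Analysis"
begin

text \<open>
  Elements of the various $L^2$ spaces are represented by square-integrable functions, and an
  operator on an $L^2$ space is represented by its graph, a relation between representatives that
  is invariant under changing both arguments on null sets. The dimension is \<open>n = CARD('n) \<ge> 1\<close>, and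
  a point of the Heisenberg group is \<open>x = (z, s)\<close> with \<open>s\<close> the last coordinate \<open>x_{2n+1}\<close>.
\<close>

subsection \<open>Test functions and square-integrable functions\<close>

primrec C_k :: "nat \<Rightarrow> ('a::euclidean_space \<Rightarrow> 'b::euclidean_space) \<Rightarrow> bool" where
  "C_k 0 f \<longleftrightarrow> continuous_on UNIV f"
| "C_k (Suc k) f \<longleftrightarrow>
     f differentiable_on UNIV \<and> (\<forall>v. C_k k (\<lambda>x. frechet_derivative f (at x) v))"

definition test_function :: "('a::euclidean_space \<Rightarrow> complex) \<Rightarrow> bool" where
  "test_function f \<longleftrightarrow> (\<forall>k. C_k k f) \<and> compact (closure {x. f x \<noteq> 0})"

definition L2 :: "'a measure \<Rightarrow> ('a \<Rightarrow> 'b::euclidean_space) set" where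
  "L2 M = {f \<in> borel_measurable M. integrable M (\<lambda>x. (norm (f x))\<^sup>2)}"

definition L2_tendsto ::
    "'a measure \<Rightarrow> (nat \<Rightarrow> 'a \<Rightarrow> complex) \<Rightarrow> ('a \<Rightarrow> complex) \<Rightarrow> bool" where
  "L2_tendsto M f g \<longleftrightarrow>
     (\<lambda>k. \<integral>\<^sup>+x. ennreal ((cmod (f k x - g x))\<^sup>2) \<partial>M) \<longlonglongrightarrow> 0"

definition L2_inner :: "'a measure \<Rightarrow> ('a \<Rightarrow> complex) \<Rightarrow> ('a \<Rightarrow> complex) \<Rightarrow> complex" where
  "L2_inner M f g = (LINT x|M. f x * cnj (g x))"

text \<open>Inner product of \<open>(0,1)\<close>-forms; the \<open>j\<close>-th component is the coefficient of the \<open>j\<close>-th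
  conjugate differential, and these differentials are orthonormal.\<close>

definition L2_inner_forms ::
    "'a measure \<Rightarrow> ('a \<Rightarrow> complex^'n) \<Rightarrow> ('a \<Rightarrow> complex^'n) \<Rightarrow> complex" where
  "L2_inner_forms M f g = (LINT x|M. (\<Sum>j\<in>UNIV. f x $ j * cnj (g x $ j)))"

subsection \<open>The Heisenberg group and the Szego projection\<close>

type_synonym 'n heis = "(complex^'n) \<times> real"

definition mu :: "(complex^'n) measure" where
  "mu = scale_measure (2 ^ CARD('n)) lborel"

definition mu_heis :: "('n::finite) heis measure" where
  "mu_heis = scale_measure (2 ^ CARD('n)) lborel"

definition Zbar :: "real^'n \<Rightarrow> 'n \<Rightarrow> ('n heis \<Rightarrow> complex) \<Rightarrow> 'n heis \<Rightarrow> complex" where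
  "Zbar lam j u x =
     (let D = frechet_derivative u (at x) in
        (D (axis j 1, 0) + \<i> * D (axis j \<i>, 0)) / 2
        + \<i> * complex_of_real (lam $ j) * (fst x $ j) * D (0, 1))"

text \<open>The formal transpose of \<open>Zbar lam j\<close> is \<open>- Zbar lam j\<close>, because its coefficient \<open>\<i> \<lambda>\<^sub>j z\<^sub>j\<close> does
  not depend on the last variable in which it differentiates. Hence the equation below says that
  \<open>f\<close> is the distributional tangential Cauchy-Riemann derivative of \<open>u\<close>.\<close>

definition dbar_b ::
    "real^'n \<Rightarrow> ('n heis \<Rightarrow> complex) \<Rightarrow> ('n heis \<Rightarrow> complex^'n) \<Rightarrow> bool" where
  "dbar_b lam u f \<longleftrightarrow>
     u \<in> L2 mu_heis \<and> f \<in> L2 mu_heis \<and>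
     (\<forall>j g. test_function g \<longrightarrow>
        (LINT x|mu_heis. f x $ j * g x) = - (LINT x|mu_heis. u x * Zbar lam j g x))"

definition dbar_b_adj ::
    "real^'n \<Rightarrow> ('n heis \<Rightarrow> complex^'n) \<Rightarrow> ('n heis \<Rightarrow> complex) \<Rightarrow> bool" where
  "dbar_b_adj lam f g \<longleftrightarrow>
     f \<in> L2 mu_heis \<and> g \<in> L2 mu_heis \<and>
     (\<forall>u h. dbar_b lam u h \<longrightarrow> L2_inner_forms mu_heis h f = L2_inner mu_heis u g)"

definition box_b ::
    "real^'n \<Rightarrow> ('n heis \<Rightarrow> complex) \<Rightarrow> ('n heis \<Rightarrow> complex) \<Rightarrow> bool" where
  "box_b lam u g \<longleftrightarrow> (\<exists>f. dbar_b lam u f \<and> dbar_b_adj lam f g)"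

definition ker_box_b :: "real^'n \<Rightarrow> ('n heis \<Rightarrow> complex) set" where
  "ker_box_b lam = {u. box_b lam u (\<lambda>_. 0)}"

text \<open>\<open>szego lam u v\<close>: \<open>v\<close> is the orthogonal projection of \<open>u\<close> onto the kernel of \<open>box_b lam\<close>.\<close>

definition szego ::
    "real^'n \<Rightarrow> ('n heis \<Rightarrow> complex) \<Rightarrow> ('n heis \<Rightarrow> complex) \<Rightarrow> bool" where
  "szego lam u v \<longleftrightarrow>
     u \<in> L2 mu_heis \<and> v \<in> ker_box_b lam \<and>
     (\<forall>h\<in>ker_box_b lam. L2_inner mu_heis (\<lambda>x. u x - v x) h = 0)"

subsection \<open>Weighted Bergman kernels\<close>

definition holomorphic_Cn :: "(complex^'n \<Rightarrow> complex) \<Rightarrow> bool" where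
  "holomorphic_Cn f \<longleftrightarrow>
     (\<forall>z. \<exists>D. (f has_derivative D) (at z) \<and> (\<forall>c v. D (c *s v) = c * D v))"

definition bergman_space :: "(complex^'n \<Rightarrow> real) \<Rightarrow> (complex^'n \<Rightarrow> complex) set" where
  "bergman_space \<phi> =
     {f. holomorphic_Cn f \<and> integrable mu (\<lambda>z. (cmod (f z))\<^sup>2 * exp (- 2 * \<phi> z))}"

definition bergman_inner ::
    "(complex^'n \<Rightarrow> real) \<Rightarrow> (complex^'n \<Rightarrow> complex) \<Rightarrow> (complex^'n \<Rightarrow> complex) \<Rightarrow> complex" where
  "bergman_inner \<phi> f g = (LINT z|mu. f z * cnj (g z) * complex_of_real (exp (- 2 * \<phi> z)))"

definition bergman_onb :: "(complex^'n \<Rightarrow> real) \<Rightarrow> (complex^'n \<Rightarrow> complex) set \<Rightarrow> bool" where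
  "bergman_onb \<phi> B \<longleftrightarrow>
     B \<subseteq> bergman_space \<phi> \<and>
     (\<forall>s\<in>B. \<forall>s'\<in>B. bergman_inner \<phi> s s' = (if s = s' then 1 else 0)) \<and>
     (\<forall>f\<in>bergman_space \<phi>. \<forall>e>0. \<exists>F c. finite F \<and> F \<subseteq> B \<and>
        (LINT z|mu. (cmod (f z - (\<Sum>s\<in>F. c s * s z)))\<^sup>2 * exp (- 2 * \<phi> z)) < e)"

text \<open>The value does not depend on the orthonormal basis that is chosen; if the space is trivial,
  the only orthonormal basis is empty and the kernel is \<open>0\<close>.\<close>

definition bergman_kernel ::
    "(complex^'n \<Rightarrow> real) \<Rightarrow> complex^'n \<Rightarrow> complex^'n \<Rightarrow> complex" where
  "bergman_kernel \<phi> z w =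
     complex_of_real (exp (- (\<phi> z + \<phi> w))) *
     (\<Sum>\<^sub>\<infinity>s\<in>(SOME B. bergman_onb \<phi> B). s z * cnj (s w))"

definition psi :: "real^'n \<Rightarrow> complex^'n \<Rightarrow> real" where
  "psi lam z = (\<Sum>j\<in>UNIV. lam $ j * (cmod (z $ j))\<^sup>2)"

abbreviation bergman_t :: "real^'n \<Rightarrow> real \<Rightarrow> complex^'n \<Rightarrow> complex^'n \<Rightarrow> complex" where
  "bergman_t lam t \<equiv> bergman_kernel (\<lambda>z. t * psi lam z)"

subsection \<open>The partial Fourier transform and the operator built from Bergman kernels\<close>

definition pft_test :: "real \<Rightarrow> ('n heis \<Rightarrow> complex) \<Rightarrow> ('n::finite) heis \<Rightarrow> complex" where
  "pft_test \<sigma> u x = (LINT s|lborel. cis (\<sigma> * snd x * s) * u (fst x, s))"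

text \<open>Extension of \<open>pft_test \<sigma>\<close> from test functions to the \<open>L2\<close> space by continuity. The sign
  \<open>\<sigma> = 1\<close> gives the kernel \<open>exp (\<i> t s)\<close>, the sign \<open>\<sigma> = -1\<close> gives \<open>exp (- \<i> t s)\<close>; neither is
  normalised.\<close>

definition pft :: "real \<Rightarrow> ('n heis \<Rightarrow> complex) \<Rightarrow> (('n::finite) heis \<Rightarrow> complex) \<Rightarrow> bool" where
  "pft \<sigma> u U \<longleftrightarrow>
     u \<in> L2 mu_heis \<and> U \<in> L2 mu_heis \<and>
     (\<exists>g. (\<forall>k. test_function (g k)) \<and> L2_tendsto mu_heis g u \<and>
          L2_tendsto mu_heis (\<lambda>k. pft_test \<sigma> (g k)) U)"

definition P_tilde ::
    "real^'n \<Rightarrow> ('n heis \<Rightarrow> complex) \<Rightarrow> ('n heis \<Rightarrow> complex) \<Rightarrow> bool" where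
  "P_tilde lam u v \<longleftrightarrow>
     (\<exists>U V W. pft 1 u U \<and>
        V \<in> L2 mu_heis \<and>
        (AE t in lborel. AE z in mu.
           has_bochner_integral mu (\<lambda>w. bergman_t lam t z w * U (w, t)) (V (z, t))) \<and>
        pft (-1) V W \<and>
        v = (\<lambda>x. 1 / (2 * complex_of_real pi) * W x))"

end

theory Submission
  imports Defs "HOL-Probability.Probability" "HOL-Complex_Analysis.Complex_Analysis"
begin

text \<open>
  At frequency \<open>t\<close> the partial Fourier transform turns \<open>Zbar lam j\<close> into the operator that annihilates
  exactly the functions \<open>f exp (- t psi)\<close> with holomorphic \<open>f\<close>. Thus the kernel of the Kohn Laplacian
  should consist of the functions whose slices at almost every frequency \<open>t\<close> have this form, and the
  Szego projection should act on slices as the weighted Bergman projection.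

  To make this rigorous, the weak equation for \<open>h\<close> in the kernel is tested against
  \<open>Zbar\<close>-derivatives of Gaussians centred at \<open>z0\<close>. For a slice \<open>\<phi>\<close> of the transform this says that the
  normalised mean of \<open>\<phi>\<close> against the twisted Gaussian \<open>exp (- b psi (z - z0) + 2 \<i> t om z0 z)\<close> does not
  depend on \<open>b > 0\<close>. As \<open>b\<close> tends to infinity it becomes \<open>\<phi> z0\<close>; at \<open>b = t\<close> it is the integral of \<open>\<phi>\<close>
  against the explicit Gaussian kernel \<open>Pker\<close>; and for \<open>t < 0\<close> its normalisation vanishes at \<open>b = - t\<close>.
  So slices of kernel elements are reproduced by \<open>Pker\<close>. The same statement, applied to
  \<open>f exp (- t psi)\<close> with \<open>t\<close> in a short interval, shows that \<open>Pker\<close> reproduces the Bergman space, hence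
  is the Bergman kernel. As \<open>Pker\<close> is Hermitian, Parseval's identity gives the orthogonality that
  characterises the projection. On test functions the transform decays like \<open>1 / (1 + t\<^sup>2)\<close>, so the
  oscillatory integral converges dominatedly.
\<close>

section \<open>Square-integrable functions\<close>

text \<open>Origin of the twisted Gaussian: let h be the Hermitian form with diagonal
  \<open>psi\<close> and imaginary part \<open>om\<close>. Then - t psi z + 2 i t om z0 z = - t psi
  (z - z0) + t psi z0 - 2 t h z z0. The phase thus turns f exp (- t psi) into a holomorphic function
  of z times a Gaussian centred at z0. By the mean value property its mean against exp (- b psi (z -
  z0)) scales like (b + t)^(-n), which explains the factor (b + t)^n in \<open>Gmean\<close>. Up to
  the factor (b + t)^(n - 1), the b-derivative of the integrand is the sum over j of the transformed
  \<open>Zbar lam j\<close> of conj (z - z0)_j times the Gaussian, so the weak equation applies to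
  it and no regularity of the slices enters. Two obstacles shape the rest. A single frequency is a
  null set: slices are controlled only almost everywhere, after fixing b and z0, and a given t is
  reached through t' > t, the side on which psi \<ge> 0 keeps f exp (- t' psi) square-integrable.
  And \<open>bergman_kernel\<close> uses a chosen basis: one has to be constructed, and the kernel
  sum must be shown to have the same value for each. Frequency 0 is discarded as a null set.\<close>

lemma scale_measure_density: "scale_measure r M = density M (\<lambda>_. r)"
  by (rule measure_eqI) (auto simp: emeasure_density_const)

lemma sets_mu [simp, measurable_cong]: "sets (mu :: (complex^'n) measure) = sets borel"
  by (simp add: mu_def)

lemma space_mu [simp]: "space (mu :: (complex^'n) measure) = UNIV"
  by (simp add: mu_def space_scale_measure)

lemma mu_density: "(mu :: (complex^'n) measure) = density lborel (\<lambda>_. ennreal (2 ^ CARD('n)))"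
  by (simp add: mu_def scale_measure_density ennreal_power flip: ennreal_numeral)

lemma mu_heis_density:
  "(mu_heis :: ('n::finite) heis measure) = density lborel (\<lambda>_. ennreal (2 ^ CARD('n)))"
  by (simp add: mu_heis_def scale_measure_density ennreal_power flip: ennreal_numeral)

lemma sigma_finite_mu: "sigma_finite_measure (mu :: (complex^'n) measure)"
  unfolding mu_density
  by (subst sigma_finite_measure.sigma_finite_iff_density_finite) (auto intro: sigma_finite_lborel)

interpretation mu: sigma_finite_measure "mu :: (complex^'n) measure"
  by (rule sigma_finite_mu)

interpretation heis: pair_sigma_finite "mu :: (complex^'n) measure" "lborel :: real measure" ..

interpretation mu_mu: pair_sigma_finite "mu :: (complex^'n) measure" "mu :: (complex^'n) measure" ..

text \<open>The constant 2^n is carried by \<open>mu\<close> alone, so the last variable is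
  integrated against plain Lebesgue measure in every iterated integral below.\<close>

lemma mu_heis_eq: "(mu_heis :: ('n::finite) heis measure) = mu \<Otimes>\<^sub>M lborel"
proof -
  have "(mu :: (complex^'n) measure) \<Otimes>\<^sub>M lborel
      = density lborel (\<lambda>_. ennreal (2 ^ CARD('n))) \<Otimes>\<^sub>M density lborel (\<lambda>_::real. 1)"
    by (simp add: mu_density density_1)
  also have "\<dots> = density (lborel \<Otimes>\<^sub>M lborel) (\<lambda>(x,y). ennreal (2 ^ CARD('n)) * 1)"
    by (rule pair_measure_density)
      (auto simp: density_1 intro: sigma_finite_lborel)
  finally show ?thesis
    by (simp add: mu_heis_density lborel_prod split_beta')
qed

lemma sets_mu_heis [simp, measurable_cong]: "sets (mu_heis :: ('n::finite) heis measure) = sets borel"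
  by (simp add: mu_heis_def)

lemma space_mu_heis [simp]: "space (mu_heis :: ('n::finite) heis measure) = UNIV"
  by (simp add: mu_heis_def space_scale_measure)

lemma AE_mu_iff: "(AE z in (mu :: (complex^'n) measure). P z) \<longleftrightarrow> (AE z in lborel. P z)"
  unfolding mu_density by (simp add: AE_density)

lemma AE_mu_heis_iff:
  "(AE x in (mu_heis :: ('n::finite) heis measure). P x) \<longleftrightarrow> (AE x in lborel. P x)"
  unfolding mu_heis_density by (simp add: AE_density)

lemma borel_measurable_cnj [measurable]: "cnj \<in> borel_measurable borel"
  by (intro borel_measurable_continuous_onI continuous_intros)

text \<open>Squared norms keep the estimates polynomial: \<open>norm_add_sq_le\<close> with its
  factor 2 replaces the triangle inequality. A non-integrable square yields the value 0, so a bound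
  on \<open>nsq\<close> is informative only together with membership in \<open>L2\<close>.\<close>

definition nsq :: "'a measure \<Rightarrow> ('a \<Rightarrow> complex) \<Rightarrow> real" where
  "nsq M f = (LINT x|M. (cmod (f x))\<^sup>2)"

lemma nsq_nonneg [simp]: "0 \<le> nsq M f"
  by (simp add: nsq_def)

lemma L2_measurable: "f \<in> L2 M \<Longrightarrow> f \<in> borel_measurable M"
  by (simp add: L2_def)

lemma L2_bound:
  fixes f :: "'a \<Rightarrow> 'b::euclidean_space"
  assumes "f \<in> borel_measurable M" "integrable M w" "AE x in M. (norm (f x))\<^sup>2 \<le> w x"
  shows "f \<in> L2 M"
  unfolding L2_def
  using assms by (auto intro!: Bochner_Integration.integrable_bound[OF assms(2)])

lemma L2_iff_nn_integral:
  fixes f :: "'a \<Rightarrow> 'b::euclidean_space"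
  shows "f \<in> L2 M \<longleftrightarrow> f \<in> borel_measurable M \<and> (\<integral>\<^sup>+x. ennreal ((norm (f x))\<^sup>2) \<partial>M) < \<infinity>"
  unfolding L2_def by (auto simp: integrable_iff_bounded)

lemma nn_integral_nsq:
  assumes "f \<in> L2 M"
  shows "(\<integral>\<^sup>+x. ennreal ((cmod (f x))\<^sup>2) \<partial>M) = ennreal (nsq M f)"
  unfolding nsq_def using assms by (intro nn_integral_eq_integral) (auto simp: L2_def)

lemma norm_add_sq_le: "(norm (a + b :: 'a::real_normed_vector))\<^sup>2 \<le> 2 * (norm a)\<^sup>2 + 2 * (norm b)\<^sup>2"
proof -
  have "(norm (a + b))\<^sup>2 \<le> (norm a + norm b)\<^sup>2"
    by (simp add: norm_triangle_ineq power_mono)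
  also have "\<dots> \<le> 2 * (norm a)\<^sup>2 + 2 * (norm b)\<^sup>2"
    using sum_squares_bound[of "norm a" "norm b"] by (simp add: power2_sum)
  finally show ?thesis .
qed

lemma L2_add:
  fixes f g :: "'a \<Rightarrow> 'b::euclidean_space"
  assumes "f \<in> L2 M" "g \<in> L2 M"
  shows "(\<lambda>x. f x + g x) \<in> L2 M"
  by (rule L2_bound[where w = "\<lambda>x. 2 * (norm (f x))\<^sup>2 + 2 * (norm (g x))\<^sup>2"])
    (use assms in \<open>auto simp: L2_def norm_add_sq_le\<close>)

lemma L2_mult_bounded:
  assumes "f \<in> L2 M" "c \<in> borel_measurable M" "\<And>x. cmod (c x) \<le> C"
  shows "(\<lambda>x. c x * f x) \<in> L2 M"
proof (rule L2_bound[where w = "\<lambda>x. C\<^sup>2 * (cmod (f x))\<^sup>2"])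
  show "AE x in M. (cmod (c x * f x))\<^sup>2 \<le> C\<^sup>2 * (cmod (f x))\<^sup>2"
    using assms(3) by (auto simp: norm_mult power_mult_distrib intro!: mult_right_mono power_mono)
qed (use assms in \<open>auto simp: L2_def\<close>)

lemma L2_cmult: "f \<in> L2 M \<Longrightarrow> (\<lambda>x. c * f x :: complex) \<in> L2 M"
  by (rule L2_mult_bounded[where C = "cmod c"]) auto

lemma L2_diff: "f \<in> L2 M \<Longrightarrow> g \<in> L2 M \<Longrightarrow> (\<lambda>x. f x - g x :: complex) \<in> L2 M"
  using L2_add[of f M "\<lambda>x. (-1) * g x"] L2_cmult[of g M "-1"] by simp

lemma L2_cnj: "f \<in> L2 M \<Longrightarrow> (\<lambda>x. cnj (f x)) \<in> L2 M"
  unfolding L2_def by (auto intro: measurable_compose[OF _ borel_measurable_cnj])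

lemma L2_zero [simp]: "(\<lambda>x. 0) \<in> L2 M"
  by (simp add: L2_def)

lemma L2_sum:
  fixes f :: "'i \<Rightarrow> 'a \<Rightarrow> complex"
  assumes "\<And>i. i \<in> I \<Longrightarrow> f i \<in> L2 M"
  shows "(\<lambda>x. \<Sum>i\<in>I. f i x) \<in> L2 M"
  using assms by (induction I rule: infinite_finite_induct) (auto intro: L2_add)

lemma L2_cong_AE:
  fixes f g :: "'a \<Rightarrow> 'b::euclidean_space"
  assumes "f \<in> L2 M" "g \<in> borel_measurable M" "AE x in M. f x = g x"
  shows "g \<in> L2 M"
  by (rule L2_bound[where w = "\<lambda>x. (norm (f x))\<^sup>2"]) (use assms in \<open>auto simp: L2_def\<close>)

lemma L2_mult_integrable:
  assumes "f \<in> L2 M" "g \<in> L2 M"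
  shows "integrable M (\<lambda>x. f x * g x :: complex)"
proof (rule Bochner_Integration.integrable_bound)
  show "integrable M (\<lambda>x. (cmod (f x))\<^sup>2 + (cmod (g x))\<^sup>2)"
    using assms by (auto simp: L2_def)
  show "AE x in M. cmod (f x * g x) \<le> norm ((cmod (f x))\<^sup>2 + (cmod (g x))\<^sup>2)"
  proof (intro AE_I2)
    fix x
    show "cmod (f x * g x) \<le> norm ((cmod (f x))\<^sup>2 + (cmod (g x))\<^sup>2)"
      using sum_squares_bound[of "cmod (f x)" "cmod (g x)"]
        mult_nonneg_nonneg[OF norm_ge_zero[of "f x"] norm_ge_zero[of "g x"]]
      by (simp add: norm_mult del: mult_nonneg_nonneg)
  qed
qed (use assms in \<open>auto simp: L2_def\<close>)

lemma L2_Cauchy_Schwarz_abs: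
  assumes f: "f \<in> L2 M" and g: "g \<in> L2 M"
  shows "(LINT x|M. cmod (f x) * cmod (g x))\<^sup>2 \<le> nsq M f * nsq M g"
proof -
  define c where "c = (LINT x|M. cmod (f x) * cmod (g x))"
  have i: "integrable M (\<lambda>x. cmod (f x) * cmod (g x))"
    using integrable_norm[OF L2_mult_integrable[OF f g]] by (simp add: norm_mult)
  \<comment> \<open>The discriminant argument. If \<open>nsq M g\<close> vanishes, the polynomial is
    affine in y, and the witness chosen below for \<open>c \<noteq> 0\<close> gives it the value
    -1.\<close>
  have q: "0 \<le> nsq M f + 2 * y * c + y\<^sup>2 * nsq M g" for y
  proof -
    have "0 \<le> (LINT x|M. (cmod (f x) + y * cmod (g x))\<^sup>2)"
      by simp
    also have "\<dots> = (LINT x|M. (cmod (f x))\<^sup>2 + 2 * y * (cmod (f x) * cmod (g x)) + y\<^sup>2 * (cmod (g x))\<^sup>2)"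
      by (simp add: power2_eq_square algebra_simps)
    also have "\<dots> = nsq M f + 2 * y * c + y\<^sup>2 * nsq M g"
      using i f g by (simp add: nsq_def c_def L2_def)
    finally show ?thesis .
  qed
  show ?thesis
  proof (cases "nsq M g = 0")
    case True
    have "c = 0"
    proof (rule ccontr)
      assume "c \<noteq> 0"
      then show False
        using q[of "- (nsq M f + 1) / (2 * c)"] True by (simp add: field_simps)
    qed
    then show ?thesis using True by (simp add: c_def)
  next
    case False
    then have "nsq M g > 0"
      using nsq_nonneg[of M g] by linarith
    then show ?thesis
      using q[of "- c / nsq M g"] by (simp add: c_def[symmetric] power2_eq_square field_simps)
  qed
qed

lemma L2_Cauchy_Schwarz:
  assumes f: "f \<in> L2 M" and g: "g \<in> L2 M"
  shows "(cmod (LINT x|M. f x * g x))\<^sup>2 \<le> nsq M f * nsq M g"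
proof -
  have "cmod (LINT x|M. f x * g x) \<le> (LINT x|M. cmod (f x * g x))"
    by (rule integral_norm_bound)
  then have "(cmod (LINT x|M. f x * g x))\<^sup>2 \<le> (LINT x|M. cmod (f x) * cmod (g x))\<^sup>2"
    by (intro power_mono) (auto simp: norm_mult)
  then show ?thesis
    using L2_Cauchy_Schwarz_abs[OF f g] by linarith
qed

lemma nsq_add_le:
  assumes "f \<in> L2 M" "g \<in> L2 M"
  shows "nsq M (\<lambda>x. f x + g x) \<le> 2 * nsq M f + 2 * nsq M g"
proof -
  have "nsq M (\<lambda>x. f x + g x) \<le> (LINT x|M. 2 * (cmod (f x))\<^sup>2 + 2 * (cmod (g x))\<^sup>2)"
    unfolding nsq_def
    using assms L2_add[OF assms] by (intro integral_mono) (auto simp: L2_def norm_add_sq_le)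
  also have "\<dots> = 2 * nsq M f + 2 * nsq M g"
    using assms by (simp add: nsq_def L2_def)
  finally show ?thesis .
qed

lemma nsq_cmult: "nsq M (\<lambda>x. c * f x) = (cmod c)\<^sup>2 * nsq M f"
  by (simp add: nsq_def norm_mult power_mult_distrib)

lemma nsq_commute: "nsq M (\<lambda>x. f x - g x) = nsq M (\<lambda>x. g x - f x)"
  by (simp add: nsq_def norm_minus_commute)

lemma nsq_triangle:
  assumes "f \<in> L2 M" "g \<in> L2 M" "h \<in> L2 M"
  shows "nsq M (\<lambda>x. f x - h x) \<le> 2 * nsq M (\<lambda>x. f x - g x) + 2 * nsq M (\<lambda>x. g x - h x)"
  using nsq_add_le[OF L2_diff[OF assms(1,2)] L2_diff[OF assms(2,3)]] by simp

lemma nsq_eq_0: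
  assumes "f \<in> L2 M" "nsq M f = 0"
  shows "AE x in M. f x = 0"
  using assms integral_nonneg_eq_0_iff_AE[of M "\<lambda>x. (cmod (f x))\<^sup>2"] by (auto simp: nsq_def L2_def)

lemma L2_tendsto_iff:
  assumes "\<And>k. f k \<in> L2 M" "g \<in> L2 M"
  shows "L2_tendsto M f g \<longleftrightarrow> (\<lambda>k. nsq M (\<lambda>x. f k x - g x)) \<longlonglongrightarrow> 0"
  unfolding L2_tendsto_def nn_integral_nsq[OF L2_diff[OF assms]]
  by (simp add: tendsto_ennreal_iff flip: ennreal_0)

lemma L2_tendsto_cong_AE:
  assumes "AE x in M. g x = g' x" "L2_tendsto M f g"
  shows "L2_tendsto M f g'"
proof -
  have "(\<integral>\<^sup>+x. ennreal ((cmod (f k x - g x))\<^sup>2) \<partial>M) = (\<integral>\<^sup>+x. ennreal ((cmod (f k x - g' x))\<^sup>2) \<partial>M)" for k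
    by (rule nn_integral_cong_AE) (use assms(1) in auto)
  then show ?thesis
    using assms(2) by (simp add: L2_tendsto_def)
qed

text \<open>The error splits into the product of both errors and two mixed terms, each controlled by
  Cauchy-Schwarz. The pairing is bilinear; sesquilinear limits follow with
  \<open>L2_tendsto_cnj\<close>.\<close>

lemma L2_tendsto_integral_mult:
  assumes f: "\<And>k. f k \<in> L2 M" "F \<in> L2 M" "L2_tendsto M f F"
    and g: "\<And>k. g k \<in> L2 M" "G \<in> L2 M" "L2_tendsto M g G"
  shows "(\<lambda>k. LINT x|M. f k x * g k x) \<longlonglongrightarrow> (LINT x|M. F x * G x)"
proof (rule LIM_zero_cancel)
  let ?a = "\<lambda>k. nsq M (\<lambda>x. f k x - F x)" and ?b = "\<lambda>k. nsq M (\<lambda>x. g k x - G x)"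
  have ab: "?a \<longlonglongrightarrow> 0" "?b \<longlonglongrightarrow> 0"
    using f g L2_tendsto_iff by blast+
  have i1: "integrable M (\<lambda>x. (f k x - F x) * (g k x - G x))"
    and i2: "integrable M (\<lambda>x. (f k x - F x) * G x)"
    and i3: "integrable M (\<lambda>x. F x * (g k x - G x))"
    and i4: "integrable M (\<lambda>x. F x * G x)" for k
    using f g by (auto intro!: L2_mult_integrable L2_diff)
  have "(LINT x|M. f k x * g k x) = (LINT x|M. (f k x - F x) * (g k x - G x) + (f k x - F x) * G x
      + F x * (g k x - G x) + F x * G x)" for k
    by (intro Bochner_Integration.integral_cong) (auto simp: algebra_simps)
  then have "(LINT x|M. f k x * g k x) - (LINT x|M. F x * G x)
     = (LINT x|M. (f k x - F x) * (g k x - G x)) + (LINT x|M. (f k x - F x) * G x)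
      + (LINT x|M. F x * (g k x - G x))" for k
    using i1 i2 i3 i4 by simp
  moreover have "cmod (LINT x|M. (f k x - F x) * (g k x - G x)) \<le> sqrt (?a k * ?b k)"
    "cmod (LINT x|M. (f k x - F x) * G x) \<le> sqrt (?a k * nsq M G)"
    "cmod (LINT x|M. F x * (g k x - G x)) \<le> sqrt (nsq M F * ?b k)" for k
    using f g by (auto intro!: real_le_rsqrt L2_Cauchy_Schwarz L2_diff)
  ultimately have bnd: "cmod ((LINT x|M. f k x * g k x) - (LINT x|M. F x * G x))
      \<le> sqrt (?a k * ?b k) + sqrt (?a k * nsq M G) + sqrt (nsq M F * ?b k)" for k
    by (simp add: norm_triangle_mono)
  have "(\<lambda>k. sqrt (?a k * ?b k) + sqrt (?a k * nsq M G) + sqrt (nsq M F * ?b k))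
      \<longlonglongrightarrow> sqrt (0 * 0) + sqrt (0 * nsq M G) + sqrt (nsq M F * 0)"
    by (intro tendsto_intros ab)
  then have "(\<lambda>k. sqrt (?a k * ?b k) + sqrt (?a k * nsq M G) + sqrt (nsq M F * ?b k)) \<longlonglongrightarrow> 0"
    by simp
  then show "(\<lambda>k. (LINT x|M. f k x * g k x) - (LINT x|M. F x * G x)) \<longlonglongrightarrow> 0"
    by (rule Lim_null_comparison[OF always_eventually, rotated]) (intro allI bnd)
qed

lemma L2_tendsto_const [simp]: "L2_tendsto M (\<lambda>k. f) f"
  by (simp add: L2_tendsto_def)

lemma L2_tendsto_cnj: "L2_tendsto M f F \<Longrightarrow> L2_tendsto M (\<lambda>k x. cnj (f k x)) (\<lambda>x. cnj (F x))"
  unfolding L2_tendsto_def by (simp flip: complex_cnj_diff)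

lemma L2_tendsto_nsq:
  assumes f: "\<And>k. f k \<in> L2 M" "F \<in> L2 M" "L2_tendsto M f F"
  shows "(\<lambda>k. nsq M (f k)) \<longlonglongrightarrow> nsq M F"
proof -
  have e: "complex_of_real (nsq M h) = (LINT x|M. h x * cnj (h x))" for h
    by (simp add: nsq_def complex_norm_square flip: integral_complex_of_real of_real_power)
  have "(\<lambda>k. complex_of_real (nsq M (f k))) \<longlonglongrightarrow> of_real (nsq M F)"
    unfolding e by (intro L2_tendsto_integral_mult f L2_cnj L2_tendsto_cnj)
  then show ?thesis by (simp only: tendsto_of_real_iff)
qed

text \<open>Fatou's lemma in the index k turns the Cauchy bound between \<open>f m\<close> and
  \<open>f k\<close> into the same bound between \<open>f m\<close> and the pointwise limit. It
  gives completeness, and later it identifies an L2 limit with a limit of point values.\<close>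

lemma L2_tendsto_of_pointwise:
  assumes f: "\<And>k. f k \<in> L2 M" and F: "F \<in> borel_measurable M"
    and Cauchy: "\<And>e. e > 0 \<Longrightarrow> \<exists>N. \<forall>m\<ge>N. \<forall>k\<ge>N. nsq M (\<lambda>x. f m x - f k x) \<le> e"
    and lim: "AE x in M. (\<lambda>k. f k x) \<longlonglongrightarrow> F x"
  shows "F \<in> L2 M" "L2_tendsto M f F"
proof -
  have [measurable]: "f k \<in> borel_measurable M" for k
    using f by (rule L2_measurable)
  note F [measurable]
  have fatou: "\<exists>N. \<forall>m\<ge>N. (\<integral>\<^sup>+x. ennreal ((cmod (f m x - F x))\<^sup>2) \<partial>M) \<le> ennreal e" if e: "e > 0" for e
  proof -
    obtain N where N: "\<And>m k. m \<ge> N \<Longrightarrow> k \<ge> N \<Longrightarrow> nsq M (\<lambda>x. f m x - f k x) \<le> e"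
      using Cauchy[OF e] by metis
    show ?thesis
    proof (intro exI[of _ N] allI impI)
      fix m assume m: "m \<ge> N"
      have "(\<integral>\<^sup>+x. ennreal ((cmod (f m x - F x))\<^sup>2) \<partial>M)
          = (\<integral>\<^sup>+x. liminf (\<lambda>k. ennreal ((cmod (f m x - f k x))\<^sup>2)) \<partial>M)"
      proof (rule nn_integral_cong_AE, use lim in eventually_elim)
        fix x assume "(\<lambda>k. f k x) \<longlonglongrightarrow> F x"
        then have "(\<lambda>k. ennreal ((cmod (f m x - f k x))\<^sup>2)) \<longlonglongrightarrow> ennreal ((cmod (f m x - F x))\<^sup>2)"
          by (intro tendsto_intros)
        then show "ennreal ((cmod (f m x - F x))\<^sup>2) = liminf (\<lambda>k. ennreal ((cmod (f m x - f k x))\<^sup>2))"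
          by (intro lim_imp_Liminf[symmetric]) auto
      qed
      also have "\<dots> \<le> liminf (\<lambda>k. \<integral>\<^sup>+x. ennreal ((cmod (f m x - f k x))\<^sup>2) \<partial>M)"
        by (rule nn_integral_liminf) simp
      also have "\<dots> \<le> limsup (\<lambda>k. \<integral>\<^sup>+x. ennreal ((cmod (f m x - f k x))\<^sup>2) \<partial>M)"
        by (rule Liminf_le_Limsup) simp
      also have "\<dots> \<le> ennreal e"
      proof (rule Limsup_bounded)
        show "\<forall>\<^sub>F k in sequentially. (\<integral>\<^sup>+x. ennreal ((cmod (f m x - f k x))\<^sup>2) \<partial>M) \<le> ennreal e"
          using eventually_ge_at_top[of N]
          by eventually_elim (use N[OF m] f in \<open>auto simp: nn_integral_nsq L2_diff intro!: ennreal_leI\<close>)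
      qed
      finally show "(\<integral>\<^sup>+x. ennreal ((cmod (f m x - F x))\<^sup>2) \<partial>M) \<le> ennreal e" .
    qed
  qed
  obtain N where N: "(\<integral>\<^sup>+x. ennreal ((cmod (f N x - F x))\<^sup>2) \<partial>M) \<le> ennreal 1"
    using fatou[of 1] by auto
  have "(\<lambda>x. f N x - F x) \<in> L2 M"
    unfolding L2_iff_nn_integral using N by (auto simp: top_unique less_top intro: order.strict_trans1)
  from L2_diff[OF f[of N] this] show "F \<in> L2 M" by simp
  show "L2_tendsto M f F"
    unfolding L2_tendsto_def
  proof (rule order_tendstoI)
    fix a :: ennreal assume "0 < a"
    then obtain e where e: "0 < e" "ennreal e < a"
    proof (cases a)
      case (real r)
      with \<open>0 < a\<close> show ?thesis
        by (intro that[of "r / 2"]) (auto simp: ennreal_less_iff)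
    qed (use that[of 1] in auto)
    obtain N where "\<And>m. m \<ge> N \<Longrightarrow> (\<integral>\<^sup>+x. ennreal ((cmod (f m x - F x))\<^sup>2) \<partial>M) \<le> ennreal e"
      using fatou[OF e(1)] by metis
    then show "\<forall>\<^sub>F k in sequentially. (\<integral>\<^sup>+x. ennreal ((cmod (f k x - F x))\<^sup>2) \<partial>M) < a"
      unfolding eventually_sequentially using e(2) by (blast intro: le_less_trans)
  qed simp
qed

section \<open>Smooth functions and test functions\<close>

lemma C_k_Suc_iff:
  "C_k (Suc k) f \<longleftrightarrow> (\<forall>x. f differentiable (at x)) \<and> (\<forall>v. C_k k (\<lambda>x. frechet_derivative f (at x) v))"
  by (simp add: differentiable_on_def C_k.simps)

declare C_k.simps(2) [simp del]

lemma C_k_SucI: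
  assumes "\<And>x. (f has_derivative D x) (at x)" "\<And>v. C_k k (\<lambda>x. D x v)"
  shows "C_k (Suc k) f"
proof -
  have "frechet_derivative f (at x) = D x" for x
    using frechet_derivative_at[OF assms(1)] by simp
  with assms show ?thesis
    unfolding C_k_Suc_iff by (auto simp: differentiable_def)
qed

lemma C_k_SucD:
  assumes "C_k (Suc k) f"
  shows "(f has_derivative frechet_derivative f (at x)) (at x)"
  using assms unfolding C_k_Suc_iff by (auto simp: frechet_derivative_works)

lemma C_k_Suc_imp: "C_k (Suc k) f \<Longrightarrow> C_k k f"
proof (induction k arbitrary: f)
  case 0
  then show ?case
    using differentiable_imp_continuous_on by (auto simp: C_k.simps)
next
  case (Suc k)
  then show ?case
    by (metis C_k_Suc_iff)
qed

lemma C_k_continuous: "C_k k f \<Longrightarrow> continuous_on UNIV f"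
proof (induction k)
  case (Suc k)
  then show ?case using C_k_Suc_imp by blast
qed simp

lemma C_k_const: "C_k k (\<lambda>x. c)"
  by (induction k arbitrary: c) (auto intro!: C_k_SucI[where D = "\<lambda>x v. 0"])

lemma C_k_compose_bounded_linear:
  assumes "bounded_linear L"
  shows "C_k k f \<Longrightarrow> C_k k (\<lambda>x. L (f x))"
proof (induction k arbitrary: f)
  case 0
  then show ?case
    using bounded_linear.continuous_on[OF assms] by simp
next
  case (Suc k)
  show ?case
    by (rule C_k_SucI[where D = "\<lambda>x v. L (frechet_derivative f (at x) v)"])
      (use Suc in \<open>auto intro!: bounded_linear.has_derivative[OF assms] C_k_SucD simp: C_k_Suc_iff[of _ f]\<close>)
qed

lemma C_k_add:
  "C_k k f \<Longrightarrow> C_k k g \<Longrightarrow> C_k k (\<lambda>x. f x + g x)"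
proof (induction k arbitrary: f g)
  case 0
  then show ?case by (auto intro: continuous_intros)
next
  case (Suc k)
  show ?case
    by (rule C_k_SucI[where D = "\<lambda>x v. frechet_derivative f (at x) v + frechet_derivative g (at x) v"])
      (use Suc in \<open>auto intro!: has_derivative_add C_k_SucD simp: C_k_Suc_iff[of _ f] C_k_Suc_iff[of _ g]\<close>)
qed

lemma C_k_bilinear:
  assumes "bounded_bilinear op2"
  shows "C_k k f \<Longrightarrow> C_k k g \<Longrightarrow> C_k k (\<lambda>x. op2 (f x) (g x))"
proof (induction k arbitrary: f g)
  case 0
  then show ?case
    using bounded_bilinear.continuous_on[OF assms] by simp
next
  case (Suc k)
  show ?case
  proof (rule C_k_SucI)
    fix x
    show "((\<lambda>x. op2 (f x) (g x)) has_derivative (\<lambda>v. op2 (f x) (frechet_derivative g (at x) v) +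
        op2 (frechet_derivative f (at x) v) (g x))) (at x)"
      by (rule bounded_bilinear.FDERIV[OF assms C_k_SucD[OF Suc.prems(1)] C_k_SucD[OF Suc.prems(2)]])
  next
    fix v
    have "C_k k f" "C_k k g" "C_k k (\<lambda>x. frechet_derivative f (at x) v)"
      "C_k k (\<lambda>x. frechet_derivative g (at x) v)"
      using Suc.prems C_k_Suc_imp C_k_Suc_iff by blast+
    then show "C_k k (\<lambda>x. op2 (f x) (frechet_derivative g (at x) v) +
        op2 (frechet_derivative f (at x) v) (g x))"
      by (intro C_k_add Suc.IH)
  qed
qed

text \<open>With an outer function of one real variable the chain rule yields scalar times vector,
  so the product rule closes the induction. Bumps, exponentials and \<open>band_kernel\<close> are
  all composed in this way.\<close>

lemma C_k_compose_real:
  fixes g :: "real \<Rightarrow> 'b::euclidean_space" and f :: "'a::euclidean_space \<Rightarrow> real"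
  shows "C_k k g \<Longrightarrow> C_k k f \<Longrightarrow> C_k k (\<lambda>x. g (f x))"
proof (induction k arbitrary: f g)
  case 0
  then show ?case
    by (auto intro!: continuous_on_compose2[of UNIV g])
next
  case (Suc k)
  let ?g' = "\<lambda>y. frechet_derivative g (at y) 1"
  show ?case
  proof (rule C_k_SucI)
    fix x
    show "((\<lambda>x. g (f x)) has_derivative
        (\<lambda>v. frechet_derivative f (at x) v *\<^sub>R ?g' (f x))) (at x)"
    proof -
      have lin: "frechet_derivative g (at y) r = r *\<^sub>R ?g' y" for y r
        using linear_simps(5)[OF has_derivative_bounded_linear[OF C_k_SucD[OF Suc.prems(1), of y]], of r 1]
        by (simp only: real_scaleR_def mult_1_right)
      show ?thesis
        using has_derivative_compose[OF C_k_SucD[OF Suc.prems(2), of x] C_k_SucD[OF Suc.prems(1)]]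
        by (subst lin[symmetric])
    qed
  next
    fix v
    have "C_k k (\<lambda>x. ?g' (f x))"
      using Suc.IH[of ?g' f] Suc.prems(1) C_k_Suc_imp[OF Suc.prems(2)] by (simp only: C_k_Suc_iff[of _ g])
    then show "C_k k (\<lambda>x. frechet_derivative f (at x) v *\<^sub>R ?g' (f x))"
      using Suc.prems(2) by (intro C_k_bilinear[OF bounded_bilinear_scaleR]) (auto simp only: C_k_Suc_iff[of _ f])
  qed
qed

lemma C_k_id: "C_k k (\<lambda>x. x)"
proof (cases k)
  case (Suc k')
  then show ?thesis
    by (auto intro!: C_k_SucI[where D = "\<lambda>x v. v"] C_k_const derivative_eq_intros)
qed simp

lemma C_k_bounded_linear: "bounded_linear L \<Longrightarrow> C_k k L"
  by (rule C_k_compose_bounded_linear[OF _ C_k_id])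

text \<open>A set closed under differentiation consists of smooth functions. One computation of a
  derivative within a parametrised family therefore gives all orders at once.\<close>

lemma C_k_family:
  fixes S :: "(real \<Rightarrow> 'b::euclidean_space) set"
  assumes S: "\<And>g. g \<in> S \<Longrightarrow> \<exists>g'\<in>S. \<forall>x. (g has_vector_derivative g' x) (at x)"
  shows "g \<in> S \<Longrightarrow> C_k k g"
proof (induction k arbitrary: g)
  case 0
  then obtain g' where "\<And>x. (g has_vector_derivative g' x) (at x)"
    using S by blast
  then show ?case
    by (auto simp: continuous_on_eq_continuous_at intro: has_vector_derivative_continuous)
next
  case (Suc k)
  then obtain g' where g': "g' \<in> S" "\<And>x. (g has_vector_derivative g' x) (at x)"
    using S by blast
  show ?case
  proof (rule C_k_SucI)
    show "(g has_derivative (\<lambda>v. v *\<^sub>R g' x)) (at x)" for x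
      using g'(2)[of x] by (simp only: has_vector_derivative_def)
    show "C_k k (\<lambda>x. v *\<^sub>R g' x)" for v
      by (rule C_k_compose_bounded_linear[OF bounded_linear_scaleR_right Suc.IH[OF g'(1)]])
  qed
qed

lemma C_k_exp: "C_k k (exp :: real \<Rightarrow> real)"
  by (rule C_k_family[of "{exp}"])
    (auto simp flip: has_real_derivative_iff_has_vector_derivative intro: DERIV_exp)

text \<open>Every derivative of exp (- 1 / x) on the positive axis is a polynomial in 1 / x times
  exp (- 1 / x). Indexing by that polynomial makes the family closed under differentiation.\<close>

definition bump_aux :: "real poly \<Rightarrow> real \<Rightarrow> real" where
  "bump_aux p x = (if x > 0 then poly p (1 / x) * exp (- 1 / x) else 0)"

lemma bump_aux_limit: "((\<lambda>x. poly p (1 / x) * exp (- 1 / x) / x) \<longlongrightarrow> 0) (at_right (0::real))"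
proof -
  have "((\<lambda>y. poly q y / exp y) \<longlongrightarrow> 0) at_top" for q :: "real poly"
  proof -
    have "((\<lambda>y. \<Sum>i\<le>degree q. coeff q i * (y ^ i / exp y)) \<longlongrightarrow> (\<Sum>i\<le>degree q. coeff q i * 0)) at_top"
      by (intro tendsto_intros tendsto_power_div_exp_0)
    then show ?thesis
      by (simp add: poly_altdef sum_divide_distrib)
  qed
  \<comment> \<open>With y = 1 / x the extra division by x becomes a multiplication by y, that is,
    the polynomial \<open>pCons 0 p\<close>.\<close>
  from filterlim_compose[OF this[of "pCons 0 p"] filterlim_inverse_at_top_right]
  show ?thesis
    by (rule Lim_transform_eventually)
      (auto simp: eventually_at_filter exp_minus field_simps)
qed

text \<open>The polynomial comes from differentiating p (1 / x) exp (- 1 / x): both factors produce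
  1 / x^2, once with - pderiv p and once with p. At 0 the left quotient vanishes and the right one
  is \<open>bump_aux_limit\<close>.\<close>

lemma bump_aux_deriv:
  "(bump_aux p has_real_derivative bump_aux ([:0, 0, 1:] * (p - pderiv p)) x) (at x)"
proof -
  consider "x > 0" | "x < 0" | "x = 0" by linarith
  then show ?thesis
  proof cases
    case 1
    have "((\<lambda>x. poly p (1 / x) * exp (- 1 / x)) has_real_derivative
        bump_aux ([:0, 0, 1:] * (p - pderiv p)) x) (at x)"
      using 1 by (auto intro!: derivative_eq_intros poly_DERIV[THEN DERIV_chain2]
          simp: bump_aux_def field_simps power2_eq_square)
    then show ?thesis
      by (rule DERIV_cong_ev[THEN iffD1, OF refl _ refl, rotated])
        (use 1 eventually_gt_at_top in \<open>auto simp: bump_aux_def eventually_nhds intro!: exI[of _ "{0<..}"]\<close>)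
  next
    case 2
    have "((\<lambda>x. 0) has_real_derivative bump_aux ([:0, 0, 1:] * (p - pderiv p)) x) (at x)"
      using 2 by (auto simp: bump_aux_def)
    then show ?thesis
      by (rule DERIV_cong_ev[THEN iffD1, OF refl _ refl, rotated])
        (use 2 in \<open>auto simp: bump_aux_def eventually_nhds intro!: exI[of _ "{..<0}"]\<close>)
  next
    case 3
    have "((\<lambda>h. (bump_aux p (0 + h) - bump_aux p 0) / h) \<longlongrightarrow> 0) (at 0)"
      unfolding filterlim_at_split
    proof
      show "((\<lambda>h. (bump_aux p (0 + h) - bump_aux p 0) / h) \<longlongrightarrow> 0) (at_left 0)"
        by (rule Lim_transform_eventually[OF tendsto_const])
          (auto simp: bump_aux_def eventually_at_filter)
      show "((\<lambda>h. (bump_aux p (0 + h) - bump_aux p 0) / h) \<longlongrightarrow> 0) (at_right 0)"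
        by (rule Lim_transform_eventually[OF bump_aux_limit[of p]])
          (auto simp: bump_aux_def eventually_at_filter)
    qed
    then show ?thesis
      using 3 by (simp add: DERIV_def bump_aux_def)
  qed
qed

lemma C_k_bump_aux: "C_k k (bump_aux p)"
  by (rule C_k_family[of "range bump_aux"])
    (auto simp flip: has_real_derivative_iff_has_vector_derivative intro: bump_aux_deriv)

definition bump :: "real \<Rightarrow> real" where
  "bump = bump_aux 1"

lemma bump_pos: "x > 0 \<Longrightarrow> bump x = exp (- 1 / x)"
  and bump_nonpos: "x \<le> 0 \<Longrightarrow> bump x = 0"
  by (auto simp: bump_def bump_aux_def)

lemma C_k_bump: "C_k k bump"
  by (simp add: bump_def C_k_bump_aux)

lemma bump_nonneg: "0 \<le> bump x" and bump_le_1: "bump x \<le> 1"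
  by (auto simp: bump_def bump_aux_def)

text \<open>Dilating the argument sharpens the bump into the indicator of the open half-line.
  Products over the coordinates then give indicators of open boxes, approximated from
  inside.\<close>

lemma bump_tendsto: "(\<lambda>m. bump (real m * x)) \<longlonglongrightarrow> indicator {0<..} x"
proof (cases "x > 0")
  case True
  have "(\<lambda>m. exp (- (1 / x) * inverse (real m))) \<longlonglongrightarrow> exp (- (1 / x) * 0)"
    by (intro tendsto_intros LIMSEQ_inverse_real_of_nat[THEN LIMSEQ_imp_Suc]) 
  moreover have "\<forall>\<^sub>F m in sequentially. exp (- (1 / x) * inverse (real m)) = bump (real m * x)"
    using eventually_gt_at_top[of 0] by eventually_elim (use True in \<open>auto simp: bump_pos field_simps\<close>)
  ultimately show ?thesis
    using True by (auto intro: Lim_transform_eventually)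
next
  case False
  then show ?thesis
    by (simp add: bump_nonpos mult_nonneg_nonpos)
qed

lemma C_k_mult:
  fixes f g :: "'a::euclidean_space \<Rightarrow> 'b::{real_normed_algebra, euclidean_space}"
  shows "C_k k f \<Longrightarrow> C_k k g \<Longrightarrow> C_k k (\<lambda>x. f x * g x)"
  by (rule C_k_bilinear[OF bounded_bilinear_mult])

lemma C_k_of_real: "C_k k f \<Longrightarrow> C_k k (\<lambda>x. complex_of_real (f x))"
  by (rule C_k_compose_bounded_linear[OF bounded_linear_of_real])

lemma C_k_minus: "C_k k f \<Longrightarrow> C_k k (\<lambda>x. - f x)"
  by (rule C_k_compose_bounded_linear[OF bounded_linear_minus[OF bounded_linear_ident]])

lemma C_k_diff: "C_k k f \<Longrightarrow> C_k k g \<Longrightarrow> C_k k (\<lambda>x. f x - g x)"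
  using C_k_add[OF _ C_k_minus, of k f g] by simp

lemma C_k_sum: "(\<And>i. i \<in> I \<Longrightarrow> C_k k (f i)) \<Longrightarrow> C_k k (\<lambda>x. \<Sum>i\<in>I. f i x)"
  by (induction I rule: infinite_finite_induct) (auto intro: C_k_add C_k_const)

lemma C_k_prod:
  fixes f :: "'i \<Rightarrow> 'a::euclidean_space \<Rightarrow> 'b::{real_normed_field, euclidean_space}"
  shows "(\<And>i. i \<in> I \<Longrightarrow> C_k k (f i)) \<Longrightarrow> C_k k (\<lambda>x. \<Prod>i\<in>I. f i x)"
  by (induction I rule: infinite_finite_induct) (auto intro: C_k_mult C_k_const)

lemma test_functionI:
  assumes "\<And>k. C_k k f" "\<And>x. f x \<noteq> 0 \<Longrightarrow> x \<in> S" "compact S"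
  shows "test_function f"
  unfolding test_function_def
proof (intro conjI allI)
  have "closure {x. f x \<noteq> 0} \<subseteq> S"
    using assms(2,3) by (intro closure_minimal) (auto intro: compact_imp_closed)
  then show "compact (closure {x. f x \<noteq> 0})"
    using assms(3) compact_Int_closed[of S "closure {x. f x \<noteq> 0}"] by (simp add: Int_absorb1)
qed (rule assms)

lemma test_function_C_k: "test_function f \<Longrightarrow> C_k k f"
  by (simp add: test_function_def)

lemma test_function_continuous: "test_function f \<Longrightarrow> continuous_on UNIV f"
  using C_k_continuous test_function_C_k by blast

lemma test_function_support:
  assumes "test_function f"
  obtains R where "R > 0" "\<And>x. f x \<noteq> 0 \<Longrightarrow> norm x \<le> R"
proof -
  have "bounded {x. f x \<noteq> 0}"
    using assms bounded_subset[OF compact_imp_bounded closure_subset] by (auto simp: test_function_def)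
  then show ?thesis using that unfolding bounded_pos by auto
qed

lemma test_function_bounded:
  assumes "test_function f"
  obtains C where "C > 0" "\<And>x. cmod (f x) \<le> C"
proof -
  let ?K = "closure {x. f x \<noteq> 0}"
  have "compact (f ` ?K)"
    using assms test_function_continuous[OF assms]
    by (intro compact_continuous_image) (auto simp: test_function_def intro: continuous_on_subset)
  then have "bounded (f ` ?K)"
    by (rule compact_imp_bounded)
  then obtain C where C: "C > 0" "\<And>x. x \<in> ?K \<Longrightarrow> cmod (f x) \<le> C"
    unfolding bounded_pos by blast
  have "cmod (f x) \<le> C" for x
    using C closure_subset[of "{x. f x \<noteq> 0}"] by (cases "f x = 0") auto
  with C(1) that show ?thesis by blast
qed

lemma test_function_borel: "test_function f \<Longrightarrow> f \<in> borel_measurable borel"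
  by (intro borel_measurable_continuous_onI test_function_continuous)

lemma test_function_zero: "test_function (\<lambda>x. 0)"
  by (auto simp: test_function_def C_k_const)

lemma test_function_mult_smooth:
  assumes f: "test_function f" and g: "\<And>k. C_k k g"
  shows "test_function (\<lambda>x. f x * g x)"
  by (rule test_functionI[where S = "closure {x. f x \<noteq> 0}"])
    (use assms closure_subset[of "{x. f x \<noteq> 0}"] in \<open>auto simp: test_function_def intro!: C_k_mult\<close>)

lemma test_function_add:
  assumes f: "test_function f" and g: "test_function g"
  shows "test_function (\<lambda>x. f x + g x)"
proof (rule test_functionI[where S = "closure {x. f x \<noteq> 0} \<union> closure {x. g x \<noteq> 0}"])
  fix x assume "f x + g x \<noteq> 0"
  then have "x \<in> {x. f x \<noteq> 0} \<union> {x. g x \<noteq> 0}" by auto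
  then show "x \<in> closure {x. f x \<noteq> 0} \<union> closure {x. g x \<noteq> 0}"
    using closure_subset[of "{x. f x \<noteq> 0}"] closure_subset[of "{x. g x \<noteq> 0}"] by blast
next
  show "C_k k (\<lambda>x. f x + g x)" for k
    using assms by (intro C_k_add) (simp_all only: test_function_C_k)
  show "compact (closure {x. f x \<noteq> 0} \<union> closure {x. g x \<noteq> 0})"
    using assms by (intro compact_Un) (simp_all only: test_function_def)
qed

lemma test_function_cmult: "test_function f \<Longrightarrow> test_function (\<lambda>x. c * f x)"
proof -
  assume "test_function f"
  then have "test_function (\<lambda>x. f x * c)"
    by (rule test_function_mult_smooth) (rule C_k_const)
  then show ?thesis by (simp only: mult.commute)
qed

lemma test_function_cnj:
  assumes "test_function f"
  shows "test_function (\<lambda>x. cnj (f x))"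
  using assms C_k_compose_bounded_linear[OF bounded_linear_cnj, of _ f] by (simp add: test_function_def)

lemma test_function_deriv:
  assumes "test_function f"
  shows "test_function (\<lambda>x. frechet_derivative f (at x) v)"
proof (rule test_functionI)
  show "C_k k (\<lambda>x. frechet_derivative f (at x) v)" for k
    using test_function_C_k[OF assms, of "Suc k"] by (simp only: C_k_Suc_iff)
  show "compact (closure {x. f x \<noteq> 0})"
    using assms by (simp add: test_function_def)
  fix x assume nz: "frechet_derivative f (at x) v \<noteq> 0"
  show "x \<in> closure {x. f x \<noteq> 0}"
  proof (rule ccontr)
    assume "x \<notin> closure {x. f x \<noteq> 0}"
    then have x: "x \<in> - closure {x. f x \<noteq> 0}" by simp
    have "(f has_derivative (\<lambda>v. 0)) (at x)"
    proof (rule has_derivative_transform_within_open[OF _ _ x])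
      fix y assume "y \<in> - closure {x. f x \<noteq> 0}"
      then have "y \<notin> {x. f x \<noteq> 0}"
        using closure_subset[of "{x. f x \<noteq> 0}"] by blast
      then show "0 = f y" by simp
    qed auto
    then show False
      using nz frechet_derivative_at[of f] by (metis)
  qed
qed

lemma test_function_has_derivative:
  "test_function f \<Longrightarrow> (f has_derivative frechet_derivative f (at x)) (at x)"
  using C_k_SucD test_function_C_k by blast

lemma integrable_bounded_support:
  fixes f :: "'a::euclidean_space \<Rightarrow> 'b::{banach, second_countable_topology}"
  assumes "f \<in> borel_measurable borel" "\<And>x. norm (f x) \<le> C" "\<And>x. f x \<noteq> 0 \<Longrightarrow> norm x \<le> R"
  shows "integrable lborel f"
proof (rule Bochner_Integration.integrable_bound)
  show "integrable lborel (\<lambda>x::'a. indicator (cball 0 R) x * C)"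
    by (intro integrable_mult_left integrable_real_indicator) (simp_all add: emeasure_lborel_cball_finite[unfolded infinity_ennreal_def])
  have "norm (f x) \<le> norm (indicator (cball 0 R) x * C)" for x
    using assms(2)[of x] assms(3)[of x] by (cases "f x = 0") (auto simp: indicator_def)
  then show "AE x in lborel. norm (f x) \<le> norm (indicator (cball 0 R) x * C)" by simp
qed (use assms in auto)

lemma test_function_integrable:
  assumes "test_function f"
  shows "integrable lborel f"
proof -
  obtain R where "\<And>x. f x \<noteq> 0 \<Longrightarrow> norm x \<le> R" using test_function_support[OF assms] by blast
  moreover obtain C where "\<And>x. cmod (f x) \<le> C" using test_function_bounded[OF assms] by blast
  ultimately show ?thesis
    using test_function_borel[OF assms] by (intro integrable_bounded_support[where C = C and R = R])
qed

lemma test_function_L2: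
  assumes "test_function f"
  shows "f \<in> L2 lborel"
proof -
  have "integrable lborel (\<lambda>x. f x * cnj (f x))"
    using test_function_mult_smooth[OF assms test_function_C_k[OF test_function_cnj[OF assms]]]
    by (rule test_function_integrable)
  from integrable_norm[OF this] show ?thesis
    using test_function_borel[OF assms] by (simp add: L2_def norm_mult power2_eq_square)
qed

section \<open>Translation invariance and integration by parts\<close>

lemma integral_lborel_translate:
  fixes f :: "'a::euclidean_space \<Rightarrow> 'b::{banach, second_countable_topology}"
  assumes "f \<in> borel_measurable borel"
  shows "(LINT x|lborel. f (c + x)) = (LINT x|lborel. f x)"
proof -
  have "(LINT x|lborel. f x) = (LINT x|distr lborel borel ((+) c). f x)"
    by (simp add: lborel_distr_plus)
  also have "\<dots> = (LINT x|lborel. f (c + x))"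
    by (rule integral_distr) (use assms in auto)
  finally show ?thesis ..
qed

lemma integrable_lborel_translate:
  fixes f :: "'a::euclidean_space \<Rightarrow> 'b::{banach, second_countable_topology}"
  assumes "integrable lborel f"
  shows "integrable lborel (\<lambda>x. f (c + x))"
proof -
  have "integrable (distr lborel borel ((+) c)) f"
    using assms by (simp add: lborel_distr_plus)
  then show ?thesis
    by (subst (asm) integrable_distr_eq) (use borel_measurable_integrable[OF assms] in auto)
qed

text \<open>The difference quotients have integral zero by translation invariance and converge dominatedly.\<close>

lemma integral_directional_derivative:
  fixes k :: "'a::euclidean_space \<Rightarrow> complex"
  assumes D: "\<And>x. (k has_derivative D x) (at x)"
    and supp: "\<And>x. k x \<noteq> 0 \<Longrightarrow> norm x \<le> R"
    and bound: "\<And>x. cmod (D x v) \<le> C"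
  shows "integrable lborel (\<lambda>x. D x v)" "(LINT x|lborel. D x v) = 0"
proof -
  define q where "q m x = of_nat (Suc m) * (k ((1 / real (Suc m)) *\<^sub>R v + x) - k x)" for m x
  have cont: "continuous_on UNIV k"
    using D by (intro has_derivative_continuous_on) (auto intro: has_derivative_at_withinI)
  have kborel [measurable]: "k \<in> borel_measurable borel"
    by (rule borel_measurable_continuous_onI[OF cont])
  have bk: "integrable lborel k"
  proof -
    have "compact (k ` cball 0 R)"
      by (intro compact_continuous_image continuous_on_subset[OF cont]) auto
    from compact_imp_bounded[OF this] obtain C' where C': "C' > 0" "\<And>x. norm x \<le> R \<Longrightarrow> cmod (k x) \<le> C'"
      unfolding bounded_pos by auto
    show ?thesis
      by (rule integrable_bounded_support[where C = C' and R = R])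
        (use C' supp in \<open>auto, metis less_imp_le norm_zero\<close>)
  qed
  have line: "((\<lambda>t. k (x + t *\<^sub>R v)) has_vector_derivative D (x + t *\<^sub>R v) v) (at t within S)" for x t S
  proof -
    have "((\<lambda>t. x + t *\<^sub>R v) has_vector_derivative v) (at t within S)"
      by (auto intro!: derivative_eq_intros)
    from vector_derivative_diff_chain_within[OF this has_derivative_at_withinI[OF D]]
    show ?thesis by (simp add: o_def)
  qed
  have lim: "(\<lambda>m. q m x) \<longlonglongrightarrow> D x v" for x
  proof -
    have "((\<lambda>t. k (x + t *\<^sub>R v)) has_vector_derivative D x v) (at 0)"
      using line[of x 0 UNIV] by simp
    then have "((\<lambda>h. (k (x + h *\<^sub>R v) - k x) /\<^sub>R h) \<longlongrightarrow> D x v) (at 0)"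
    proof -
      assume "((\<lambda>t. k (x + t *\<^sub>R v)) has_vector_derivative D x v) (at 0)"
      then have "((\<lambda>h. norm (k (x + h *\<^sub>R v) - k x - h *\<^sub>R D x v) / norm h) \<longlongrightarrow> 0) (at 0)"
        unfolding has_vector_derivative_def has_derivative_iff_norm by simp
      then have "((\<lambda>h. norm ((k (x + h *\<^sub>R v) - k x) /\<^sub>R h - D x v)) \<longlongrightarrow> 0) (at 0)"
      proof (rule Lim_transform_eventually)
        show "\<forall>\<^sub>F h in at 0. norm (k (x + h *\<^sub>R v) - k x - h *\<^sub>R D x v) / norm h
            = norm ((k (x + h *\<^sub>R v) - k x) /\<^sub>R h - D x v)"
        proof (rule eventually_at_filter[THEN iffD2], intro always_eventually allI impI)
          fix h :: real assume "h \<noteq> 0"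
          then have "(k (x + h *\<^sub>R v) - k x) /\<^sub>R h - D x v = inverse h *\<^sub>R (k (x + h *\<^sub>R v) - k x - h *\<^sub>R D x v)"
            by (simp add: scaleR_diff_right)
          then have "norm ((k (x + h *\<^sub>R v) - k x) /\<^sub>R h - D x v)
              = \<bar>inverse h\<bar> * norm (k (x + h *\<^sub>R v) - k x - h *\<^sub>R D x v)"
            by (simp only: norm_scaleR)
          then show "norm (k (x + h *\<^sub>R v) - k x - h *\<^sub>R D x v) / norm h
            = norm ((k (x + h *\<^sub>R v) - k x) /\<^sub>R h - D x v)"
            by (simp only: real_norm_def abs_inverse divide_inverse mult.commute)
        qed
      qed
      then show ?thesis
        by (rule LIM_zero_cancel[OF tendsto_norm_zero_cancel])
    qed
    moreover have "filterlim (\<lambda>m. 1 / real (Suc m)) (at 0) sequentially"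
      unfolding filterlim_at using LIMSEQ_Suc[OF lim_1_over_n] by (auto simp: inverse_eq_divide)
    ultimately have "(\<lambda>m. (k (x + (1 / real (Suc m)) *\<^sub>R v) - k x) /\<^sub>R (1 / real (Suc m))) \<longlonglongrightarrow> D x v"
      by (rule filterlim_compose)
    then show ?thesis
      by (simp add: q_def scaleR_conv_of_real add.commute)
  qed
  \<comment> \<open>Mean value inequality along the segment. It uses a bound for the derivative in
    the direction v rather than its continuity, which suits derivatives of holomorphic functions
    later.\<close>
  have bnd: "cmod (q m x) \<le> C" for m x
  proof -
    let ?h = "1 / real (Suc m)"
    have "norm (k (x + ?h *\<^sub>R v) - k (x + 0 *\<^sub>R v)) \<le> C * ?h - C * 0"
      by (rule differentiable_bound_general[where \<phi>' = "\<lambda>_. C" and f' = "\<lambda>t. D (x + t *\<^sub>R v) v"])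
        (auto intro!: continuous_intros continuous_on_compose2[OF cont] line bound derivative_eq_intros
          simp flip: has_real_derivative_iff_has_vector_derivative)
    moreover have "cmod (q m x) = real (Suc m) * norm (k (x + ?h *\<^sub>R v) - k (x + 0 *\<^sub>R v))"
      by (simp only: q_def norm_mult norm_of_nat add.commute[of x] scaleR_zero_left add_0_left)
    ultimately show ?thesis
      by (simp add: field_simps del: of_nat_Suc)
  qed
  have qi: "integrable lborel (q m)" "(LINT x|lborel. q m x) = 0" for m
    using bk integrable_lborel_translate[OF bk, of "(1 / real (Suc m)) *\<^sub>R v"]
    by (auto simp: q_def[abs_def] integral_lborel_translate)
  have wi: "integrable lborel (\<lambda>x::'a. indicator (cball 0 (R + norm v)) x * C)"
    by (intro integrable_mult_left integrable_real_indicator) (simp_all add: emeasure_lborel_cball_finite[unfolded infinity_ennreal_def])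
  \<comment> \<open>The step is at most \<open>norm v\<close> long, so all difference quotients are
    supported in one common ball.\<close>
  have dom: "cmod (q m x) \<le> indicator (cball 0 (R + norm v)) x * C" for m x
  proof (cases "norm x \<le> R + norm v")
    case True
    then show ?thesis using bnd by simp
  next
    case False
    have "norm (1 / real (Suc m) * norm v) \<le> norm v"
      by (simp add: divide_le_eq algebra_simps)
    then have "norm x \<le> norm ((1 / real (Suc m)) *\<^sub>R v + x) + norm v"
      using norm_triangle_ineq4[of "(1 / real (Suc m)) *\<^sub>R v + x" "(1 / real (Suc m)) *\<^sub>R v"] by simp
    then have "k x = 0" "k ((1 / real (Suc m)) *\<^sub>R v + x) = 0"
      using supp[of x] supp[of "(1 / real (Suc m)) *\<^sub>R v + x"] False norm_ge_zero[of v] by linarith+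
    then show ?thesis
      by (simp add: q_def False)
  qed
  have m: "(\<lambda>x. D x v) \<in> borel_measurable lborel"
    by (rule borel_measurable_LIMSEQ_metric[where f = q]) (auto simp: lim borel_measurable_integrable[OF qi(1), simplified])
  note dc = m borel_measurable_integrable[OF qi(1)] wi AE_I2[OF lim] AE_I2[OF dom]
  show "integrable lborel (\<lambda>x. D x v)"
    by (rule integrable_dominated_convergence[OF dc])
  show "(LINT x|lborel. D x v) = 0"
    using integral_dominated_convergence[OF dc] qi(2) by (simp add: LIMSEQ_const_iff)
qed

section \<open>Test functions separate and approximate\<close>

lemma box_approximation:
  obtains T :: "nat \<Rightarrow> 'a::euclidean_space \<Rightarrow> complex"
  where "\<And>m. test_function (T m)" "\<And>m x. cmod (T m x) \<le> indicator (box l u) x"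
    "\<And>x. (\<lambda>m. T m x) \<longlonglongrightarrow> complex_of_real (indicator (box l u) x)"
proof
  define T :: "nat \<Rightarrow> 'a \<Rightarrow> complex" where
    "T m x = complex_of_real (\<Prod>b\<in>Basis. bump (real m * (x \<bullet> b - l \<bullet> b)) * bump (real m * (u \<bullet> b - x \<bullet> b)))" for m x
  have zero: "T m x = 0" if "x \<notin> box l u" for m x
  proof -
    from that obtain b where "b \<in> Basis" "x \<bullet> b \<le> l \<bullet> b \<or> u \<bullet> b \<le> x \<bullet> b"
      by (force simp: mem_box)
    then have "bump (real m * (x \<bullet> b - l \<bullet> b)) * bump (real m * (u \<bullet> b - x \<bullet> b)) = 0"
      by (auto intro!: bump_nonpos mult_nonneg_nonpos)
    with \<open>b \<in> Basis\<close> show ?thesis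
      by (auto simp: T_def prod_zero_iff simp del: mult_eq_0_iff)
  qed
  show "test_function (T m)" for m
  proof (rule test_functionI[where S = "cbox l u"])
    have "C_k k (\<lambda>x. real m * (x \<bullet> b - c))" "C_k k (\<lambda>x. real m * (c - x \<bullet> b))" for k c and b :: 'a
      by (intro C_k_mult C_k_diff C_k_const C_k_bounded_linear[OF bounded_linear_inner_left])+
    then have "C_k k (\<lambda>x. bump (real m * (x \<bullet> b - l \<bullet> b)) * bump (real m * (u \<bullet> b - x \<bullet> b)))" for k b
      by (intro C_k_mult[of k "\<lambda>x. bump (real m * (x \<bullet> b - l \<bullet> b))"] C_k_compose_real[OF C_k_bump])
    then show "C_k k (T m)" for k
      unfolding T_def
      by (intro C_k_of_real C_k_prod)
    show "x \<in> cbox l u" if "T m x \<noteq> 0" for x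
      using zero that box_subset_cbox by blast
  qed simp
  show "cmod (T m x) \<le> indicator (box l u) x" for m x
  proof (cases "x \<in> box l u")
    case True
    have "cmod (T m x) \<le> (\<Prod>b\<in>(Basis::'a set). 1)"
      unfolding T_def norm_of_real abs_prod
      by (intro prod_mono) (auto simp: bump_nonneg bump_le_1 abs_mult intro!: mult_le_one)
    with True show ?thesis by simp
  qed (simp add: zero)
  show "(\<lambda>m. T m x) \<longlonglongrightarrow> complex_of_real (indicator (box l u) x)" for x
  proof -
    have "(\<lambda>m. T m x) \<longlonglongrightarrow> complex_of_real (\<Prod>b\<in>Basis. indicator {0<..} (x \<bullet> b - l \<bullet> b) * indicator {0<..} (u \<bullet> b - x \<bullet> b))"
      unfolding T_def by (intro tendsto_intros bump_tendsto)
    also have "(\<Prod>b\<in>Basis. indicator {0<..} (x \<bullet> b - l \<bullet> b) * indicator {0<..} (u \<bullet> b - x \<bullet> b)) = (indicator (box l u) x :: real)"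
    proof (cases "x \<in> box l u")
      case True
      then show ?thesis by (auto simp: mem_box intro!: prod.neutral)
    next
      case False
      then obtain b where "b \<in> Basis" "x \<bullet> b \<le> l \<bullet> b \<or> u \<bullet> b \<le> x \<bullet> b"
        by (force simp: mem_box)
      then have "\<exists>b\<in>Basis. indicator {0<..} (x \<bullet> b - l \<bullet> b) * indicator {0<..} (u \<bullet> b - x \<bullet> b) = (0::real)"
        by (intro bexI[of _ b]) auto
      then show ?thesis
        using False by (simp add: prod_zero_iff del: mult_eq_0_iff)
    qed
    finally show ?thesis .
  qed
qed

lemma sets_borel_boxes: "sets (borel :: 'a::euclidean_space measure) = sigma_sets UNIV (range (\<lambda>(a, b). box a b))"
  by (simp add: borel_eq_box)

lemma boxes_subset_Pow: "range (\<lambda>(a, b). box a b) \<subseteq> Pow (UNIV :: 'a::euclidean_space set)"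
  by simp

lemma Int_stable_boxes: "Int_stable (range (\<lambda>(a, b). box a b :: 'a::euclidean_space set))"
  by (auto simp: Int_stable_def box_Int_box)

text \<open>Dynkin's theorem passes from boxes to Borel sets. Since \<open>f\<close> is only locally
  integrable, it is first cut down to a large box; boxes are stable under intersection, so the
  cut-off function still has vanishing box integrals.\<close>

lemma AE_zero_of_box_integrals:
  fixes f :: "'a::euclidean_space \<Rightarrow> complex"
  assumes loc: "\<And>l u. integrable lborel (\<lambda>x. indicator (box l u) x *\<^sub>R f x)"
    and box0: "\<And>l u. (LINT x|lborel. indicator (box l u) x *\<^sub>R f x) = 0"
  shows "AE x in lborel. f x = 0"
proof -
  have "AE x in lborel. indicator (box (- (real N *\<^sub>R One)) (real N *\<^sub>R One)) x *\<^sub>R f x = 0" for N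
  proof (rule sigma_finite_measure.density_zero[OF sigma_finite_lborel])
    let ?F = "\<lambda>x. indicator (box (- (real N *\<^sub>R One)) (real N *\<^sub>R One)) x *\<^sub>R f x"
    show int: "integrable lborel ?F" by (rule loc)
    fix A :: "'a set" assume "A \<in> sets lborel"
    then have "A \<in> sigma_sets UNIV (range (\<lambda>(a, b). box a b))"
      by (simp add: sets_borel_boxes)
    then show "set_lebesgue_integral lborel A ?F = 0"
      unfolding set_lebesgue_integral_def
    proof (induction rule: sigma_sets_induct_disjoint[OF Int_stable_boxes boxes_subset_Pow, consumes 1, case_names basic empty compl union])
      case (basic A)
      then obtain a b where A: "A = box a b" by auto
      have "indicator A x *\<^sub>R ?F x = indicator (A \<inter> box (- (real N *\<^sub>R One)) (real N *\<^sub>R One)) x *\<^sub>R f x" for x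
        by (auto simp: indicator_def)
      then have "(\<lambda>x. indicator A x *\<^sub>R ?F x) = (\<lambda>x. indicator (A \<inter> box (- (real N *\<^sub>R One)) (real N *\<^sub>R One)) x *\<^sub>R f x)"
        by (rule ext)
      then show ?case
        using box0 by (simp only: A box_Int_box)
    next
      case (compl A)
      then have [measurable]: "A \<in> sets borel" by (simp add: sets_borel_boxes)
      have "indicator (UNIV - A) x *\<^sub>R ?F x = ?F x - indicator A x *\<^sub>R ?F x" for x
        by (auto simp: indicator_def)
      then have "(LINT x|lborel. indicator (UNIV - A) x *\<^sub>R ?F x)
          = (LINT x|lborel. ?F x) - (LINT x|lborel. indicator A x *\<^sub>R ?F x)"
        using int integrable_mult_indicator[OF _ int, of A] by simp
      then show ?case
        using box0 compl by simp
    next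
      case (union A)
      then have [measurable]: "A i \<in> sets borel" for i by (auto simp: sets_borel_boxes)
      have "set_lebesgue_integral lborel (\<Union>i. A i) ?F = (\<Sum>i. set_lebesgue_integral lborel (A i) ?F)"
        using union(1) by (intro lebesgue_integral_countable_add)
          (use integrable_mult_indicator[OF _ int, of "\<Union>i. A i"] in \<open>auto simp: disjoint_family_on_def set_integrable_def\<close>)
      with union(3) show ?case by (simp add: set_lebesgue_integral_def)
    qed auto
  qed
  then have "AE x in lborel. \<forall>N. indicator (box (- (real N *\<^sub>R One)) (real N *\<^sub>R One)) x *\<^sub>R f x = 0"
    unfolding AE_all_countable by blast
  then show ?thesis
  proof eventually_elim
    case (elim x)
    obtain N :: nat where N: "norm x < real N" using reals_Archimedean2 by blast
    have "x \<in> box (- (real N *\<^sub>R One)) (real N *\<^sub>R One)"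
      using Basis_le_norm[of _ x] N by (force simp: mem_box)
    with elim show ?case by (auto dest!: spec[of _ N])
  qed
qed

text \<open>Test functions increasing to the indicator of a box, dominated by that indicator, reduce
  the claim to box integrals.\<close>

lemma test_functions_separate:
  fixes f :: "'a::euclidean_space \<Rightarrow> complex"
  assumes [measurable]: "f \<in> borel_measurable borel"
    and loc: "\<And>l u. integrable lborel (\<lambda>x. indicator (box l u) x *\<^sub>R f x)"
    and zero: "\<And>g. test_function g \<Longrightarrow> (LINT x|lborel. f x * g x) = 0"
  shows "AE x in lborel. f x = 0"
proof -
  have "(LINT x|lborel. indicator (box l u) x *\<^sub>R f x) = 0" for l u
  proof -
    obtain T :: "nat \<Rightarrow> 'a \<Rightarrow> complex" where T: "\<And>m. test_function (T m)"
      "\<And>m x. cmod (T m x) \<le> indicator (box l u) x"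
      "\<And>x. (\<lambda>m. T m x) \<longlonglongrightarrow> complex_of_real (indicator (box l u) x)"
      using box_approximation[of l u] by blast
    have [measurable]: "T m \<in> borel_measurable borel" for m
      using T(1) by (rule test_function_borel)
    have "(\<lambda>m. LINT x|lborel. f x * T m x) \<longlonglongrightarrow> (LINT x|lborel. indicator (box l u) x *\<^sub>R f x)"
    proof (rule integral_dominated_convergence)
      show "integrable lborel (\<lambda>x. cmod (indicator (box l u) x *\<^sub>R f x))"
        using loc by (rule integrable_norm)
      have "(\<lambda>m. f x * T m x) \<longlonglongrightarrow> f x * complex_of_real (indicator (box l u) x)" for x
        by (intro tendsto_intros T)
      then show "AE x in lborel. (\<lambda>m. f x * T m x) \<longlonglongrightarrow> indicator (box l u) x *\<^sub>R f x"
        by (simp add: scaleR_conv_of_real mult.commute)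
      show "AE x in lborel. cmod (f x * T m x) \<le> cmod (indicator (box l u) x *\<^sub>R f x)" for m
        using mult_left_mono[OF T(2), of "cmod (f _)"] by (simp add: norm_mult mult.commute)
    qed auto
    then show ?thesis
      using zero[OF T(1)] by (simp add: LIMSEQ_const_iff)
  qed
  then show ?thesis
    by (intro AE_zero_of_box_integrals loc)
qed

definition approximable :: "('a::euclidean_space \<Rightarrow> complex) \<Rightarrow> bool" where
  "approximable f \<longleftrightarrow> f \<in> L2 lborel \<and> (\<forall>e>0. \<exists>g. test_function g \<and> nsq lborel (\<lambda>x. f x - g x) \<le> e)"

lemma approximable_test: "test_function f \<Longrightarrow> approximable f"
  unfolding approximable_def by (auto intro: test_function_L2 exI[of _ f] simp: nsq_def)

lemma approximable_add:
  assumes "approximable f" "approximable g"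
  shows "approximable (\<lambda>x. f x + g x)"
  unfolding approximable_def
proof (intro conjI allI impI)
  show "(\<lambda>x. f x + g x) \<in> L2 lborel"
    using assms by (auto simp: approximable_def intro: L2_add)
  fix e :: real assume "e > 0"
  then obtain a b where ab: "test_function a" "nsq lborel (\<lambda>x. f x - a x) \<le> e / 4"
      "test_function b" "nsq lborel (\<lambda>x. g x - b x) \<le> e / 4"
    using assms unfolding approximable_def by (meson divide_pos_pos zero_less_numeral)
  have "nsq lborel (\<lambda>x. (f x - a x) + (g x - b x)) \<le> 2 * nsq lborel (\<lambda>x. f x - a x) + 2 * nsq lborel (\<lambda>x. g x - b x)"
    by (intro nsq_add_le L2_diff) (use assms ab in \<open>auto simp: approximable_def intro: test_function_L2\<close>)
  then have "nsq lborel (\<lambda>x. f x + g x - (a x + b x)) \<le> e"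
    using ab by (simp add: algebra_simps)
  then show "\<exists>h. test_function h \<and> nsq lborel (\<lambda>x. f x + g x - h x) \<le> e"
    using ab by (intro exI[of _ "\<lambda>x. a x + b x"]) (auto intro: test_function_add)
qed

lemma approximable_cmult:
  assumes "approximable f"
  shows "approximable (\<lambda>x. c * f x)"
  unfolding approximable_def
proof (intro conjI allI impI)
  show "(\<lambda>x. c * f x) \<in> L2 lborel"
    using assms by (auto simp: approximable_def intro: L2_cmult)
  fix e :: real assume e: "e > 0"
  have pos: "(cmod c)\<^sup>2 + 1 > 0" by (simp add: add_nonneg_pos)
  then obtain a where a: "test_function a" "nsq lborel (\<lambda>x. f x - a x) \<le> e / ((cmod c)\<^sup>2 + 1)"
    using assms e unfolding approximable_def by (meson divide_pos_pos)
  have "nsq lborel (\<lambda>x. c * f x - c * a x) = (cmod c)\<^sup>2 * nsq lborel (\<lambda>x. f x - a x)"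
    by (simp add: nsq_cmult flip: right_diff_distrib)
  also have "\<dots> \<le> ((cmod c)\<^sup>2 + 1) * nsq lborel (\<lambda>x. f x - a x)"
    by (intro mult_right_mono) auto
  also have "\<dots> \<le> e"
    using a(2) pos by (simp add: field_simps)
  finally show "\<exists>h. test_function h \<and> nsq lborel (\<lambda>x. c * f x - h x) \<le> e"
    using a by (intro exI[of _ "\<lambda>x. c * a x"]) (auto intro: test_function_cmult)
qed

lemma approximable_sum:
  "(\<And>i. i \<in> I \<Longrightarrow> approximable (f i)) \<Longrightarrow> approximable (\<lambda>x. \<Sum>i\<in>I. f i x)"
  by (induction I rule: infinite_finite_induct)
    (auto intro: approximable_add approximable_test test_function_zero)

lemma approximable_limit:
  assumes h: "\<And>m. approximable (h m)" and f: "f \<in> borel_measurable lborel"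
    and lim: "\<And>x. (\<lambda>m. h m x) \<longlonglongrightarrow> f x"
    and dom: "\<And>m x. cmod (h m x) \<le> w x" and w: "integrable lborel (\<lambda>x. (w x)\<^sup>2)"
  shows "approximable f"
proof -
  have hL2: "h m \<in> L2 lborel" for m using h by (simp add: approximable_def)
  have [measurable]: "h m \<in> borel_measurable lborel" for m by (rule L2_measurable[OF hL2])
  note f [measurable]
  have fw: "cmod (f x) \<le> w x" for x
    by (rule LIMSEQ_le_const2[OF tendsto_norm[OF lim]]) (use dom in auto)
  have fL2: "f \<in> L2 lborel"
    by (rule L2_bound[OF f w]) (auto intro!: power_mono fw)
  have "(\<lambda>m. nsq lborel (\<lambda>x. f x - h m x)) \<longlonglongrightarrow> (LINT x|(lborel::'a measure). 0)"
    unfolding nsq_def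
  proof (rule integral_dominated_convergence[where w = "\<lambda>x. 4 * (w x)\<^sup>2"])
    show "AE x in lborel. (\<lambda>m. (cmod (f x - h m x))\<^sup>2) \<longlonglongrightarrow> 0"
    proof (intro AE_I2)
      fix x
      have "(\<lambda>m. (cmod (f x - h m x))\<^sup>2) \<longlonglongrightarrow> (cmod (f x - f x))\<^sup>2"
        by (intro tendsto_intros lim)
      then show "(\<lambda>m. (cmod (f x - h m x))\<^sup>2) \<longlonglongrightarrow> 0" by simp
    qed
    show "AE x in lborel. norm ((cmod (f x - h m x))\<^sup>2) \<le> 4 * (w x)\<^sup>2" for m
    proof (intro AE_I2)
      fix x
      have "cmod (f x - h m x) \<le> 2 * w x"
        using norm_triangle_ineq4[of "f x" "h m x"] fw[of x] dom[of m x] by linarith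
      then have "(cmod (f x - h m x))\<^sup>2 \<le> (2 * w x)\<^sup>2"
        by (intro power_mono) auto
      then show "norm ((cmod (f x - h m x))\<^sup>2) \<le> 4 * (w x)\<^sup>2" by (simp add: power_mult_distrib)
    qed
  qed (use w in auto)
  then have lim0: "(\<lambda>m. nsq lborel (\<lambda>x. f x - h m x)) \<longlonglongrightarrow> 0" by simp
  show ?thesis
    unfolding approximable_def
  proof (intro conjI allI impI fL2)
    fix e :: real assume e: "e > 0"
    then obtain m where m: "nsq lborel (\<lambda>x. f x - h m x) < e / 4"
      using order_tendstoD(2)[OF lim0, of "e / 4"] by (auto simp: eventually_sequentially)
    obtain g where g: "test_function g" "nsq lborel (\<lambda>x. h m x - g x) \<le> e / 4"
      using h[of m] e unfolding approximable_def by (meson divide_pos_pos zero_less_numeral)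
    have "nsq lborel (\<lambda>x. f x - g x) \<le> 2 * nsq lborel (\<lambda>x. f x - h m x) + 2 * nsq lborel (\<lambda>x. h m x - g x)"
      by (intro nsq_triangle fL2 hL2 test_function_L2 g)
    then show "\<exists>g. test_function g \<and> nsq lborel (\<lambda>x. f x - g x) \<le> e"
      using m g by (intro exI[of _ g]) auto
  qed
qed

lemma integrable_indicator_box_sq:
  "integrable lborel (\<lambda>x. (indicator (box l u) x :: real)\<^sup>2)"
proof -
  have "(\<lambda>x. (indicator (box l u) x :: real)\<^sup>2) = indicator (box l u)"
    by (auto simp: indicator_def)
  then show ?thesis by (simp add: integrable_real_indicator emeasure_lborel_box_finite[unfolded infinity_ennreal_def])
qed

lemma approximable_indicator_box:
  "approximable (\<lambda>x. complex_of_real (indicator (box l u) x))"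
proof -
  obtain T :: "nat \<Rightarrow> 'a \<Rightarrow> complex" where T: "\<And>m. test_function (T m)"
    "\<And>m x. cmod (T m x) \<le> indicator (box l u) x"
    "\<And>x. (\<lambda>m. T m x) \<longlonglongrightarrow> complex_of_real (indicator (box l u) x)"
    using box_approximation[of l u] by blast
  show ?thesis
    by (rule approximable_limit[of T, OF approximable_test[OF T(1)] _ T(3,2) integrable_indicator_box_sq]) simp
qed

text \<open>Dynkin's theorem again. Intersecting with a fixed box provides finite measure and one
  dominating function for complements and countable disjoint unions.\<close>

lemma approximable_indicator:
  fixes A :: "'a::euclidean_space set"
  assumes "A \<in> sets borel"
  shows "approximable (\<lambda>x. complex_of_real (indicator (A \<inter> box l u) x))"
proof -
  from assms have "A \<in> sigma_sets UNIV (range (\<lambda>(a, b). box a b))"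
    by (simp add: sets_borel_boxes)
  then show ?thesis
  proof (induction rule: sigma_sets_induct_disjoint[OF Int_stable_boxes boxes_subset_Pow, consumes 1, case_names basic empty compl union])
    case (basic A)
    then show ?case
      using approximable_indicator_box by (auto simp: box_Int_box)
  next
    case (compl A)
    have "complex_of_real (indicator (box l u) x) + (-1) * complex_of_real (indicator (A \<inter> box l u) x)
        = complex_of_real (indicator ((UNIV - A) \<inter> box l u) x)" for x
      by (auto simp: indicator_def)
    then show ?case
      using approximable_add[OF approximable_indicator_box[of l u] approximable_cmult[OF compl(2), of "-1"]] by simp
  next
    case (union A)
    have meas [measurable]: "A i \<in> sets borel" for i using union by (auto simp: sets_borel_boxes)
    have dis: "disjoint_family A" using union(1) .
    have part: "(\<Sum>i<m. complex_of_real (indicator (A i \<inter> box l u) x))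
        = complex_of_real (indicator ((\<Union>i<m. A i) \<inter> box l u) x)" for m x
    proof -
      have "(\<Sum>i<m. indicator (A i \<inter> box l u) x :: real) = indicator (\<Union>i<m. A i \<inter> box l u) x"
        by (subst indicator_UN_disjoint) (use dis in \<open>auto simp: disjoint_family_on_def\<close>)
      then show ?thesis by (simp flip: of_real_sum)
    qed
    show ?case
    proof (rule approximable_limit)
      show "approximable (\<lambda>x. \<Sum>i<m. complex_of_real (indicator (A i \<inter> box l u) x))" for m
        by (intro approximable_sum union)
      show "cmod (\<Sum>i<m. complex_of_real (indicator (A i \<inter> box l u) x)) \<le> indicator (box l u) x" for m x
        unfolding part by (auto simp: indicator_def)
      show "(\<lambda>m. \<Sum>i<m. complex_of_real (indicator (A i \<inter> box l u) x)) \<longlonglongrightarrow>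
          complex_of_real (indicator (\<Union> (range A) \<inter> box l u) x)" for x
        unfolding part
      proof (rule tendsto_eventually)
        show "\<forall>\<^sub>F m in sequentially. complex_of_real (indicator ((\<Union>i<m. A i) \<inter> box l u) x) =
            complex_of_real (indicator (\<Union> (range A) \<inter> box l u) x)"
        proof (cases "\<exists>i. x \<in> A i")
          case True
          then obtain i where i: "x \<in> A i" by blast
          show ?thesis
            using eventually_gt_at_top[of i] by eventually_elim (use i in \<open>auto simp: indicator_def\<close>)
        qed (auto simp: indicator_def)
      qed
    qed (use integrable_indicator_box_sq in auto)
  qed (auto intro: approximable_test test_function_zero)
qed

text \<open>Simple functions bounded by 2 |f| approximate f pointwise. Restricting the i-th one to a
  box of side 2 i makes it a finite combination of approximable indicators without spoiling the
  pointwise limit.\<close>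

lemma L2_approximable:
  fixes f :: "'a::euclidean_space \<Rightarrow> complex"
  assumes f: "f \<in> L2 lborel"
  shows "approximable f"
proof -
  have fm [measurable]: "f \<in> borel_measurable lborel" by (rule L2_measurable[OF f])
  then obtain s where s: "\<And>i. simple_function lborel (s i)" "\<And>x. (\<lambda>i. s i x) \<longlonglongrightarrow> f x"
      "\<And>i x. dist (s i x) 0 \<le> 2 * dist (f x) 0"
    using borel_measurable_implies_sequence_metric[OF fm, of 0] by auto
  let ?B = "\<lambda>i. box (- (real i *\<^sub>R One)) (real i *\<^sub>R One) :: 'a set"
  show ?thesis
  proof (rule approximable_limit)
    show "approximable (\<lambda>x. \<Sum>y\<in>range (s i). y * complex_of_real (indicator (s i -` {y} \<inter> ?B i) x))" for i
    proof (intro approximable_sum approximable_cmult approximable_indicator)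
      fix y
      show "s i -` {y} \<in> sets borel"
        using simple_functionD(2)[OF s(1), of i "{y}"] by simp
    qed
    have eq: "(\<Sum>y\<in>range (s i). y * complex_of_real (indicator (s i -` {y} \<inter> ?B i) x))
        = complex_of_real (indicator (?B i) x) * s i x" for i x
    proof -
      have "finite (range (s i))" using simple_functionD(1)[OF s(1), of i] by simp
      have "(\<Sum>y\<in>range (s i). y * complex_of_real (indicator (s i -` {y} \<inter> ?B i) x))
          = (\<Sum>y\<in>range (s i). if y = s i x then s i x * complex_of_real (indicator (?B i) x) else 0)"
        by (intro sum.cong) (auto simp: indicator_def)
      with \<open>finite (range (s i))\<close> show ?thesis by (simp add: sum.delta mult.commute)
    qed
    show "cmod (\<Sum>y\<in>range (s i). y * complex_of_real (indicator (s i -` {y} \<inter> ?B i) x)) \<le> 2 * cmod (f x)" for i x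
      unfolding eq using s(3)[of i x] by (auto simp: norm_mult indicator_def)
    show "(\<lambda>i. \<Sum>y\<in>range (s i). y * complex_of_real (indicator (s i -` {y} \<inter> ?B i) x)) \<longlonglongrightarrow> f x" for x
      unfolding eq
    proof (rule Lim_transform_eventually[OF s(2)])
      obtain N :: nat where N: "norm x < real N" using reals_Archimedean2 by blast
      show "\<forall>\<^sub>F i in sequentially. s i x = complex_of_real (indicator (?B i) x) * s i x"
        using eventually_ge_at_top[of N]
      proof eventually_elim
        case (elim i)
        then have "x \<in> ?B i"
          using Basis_le_norm[of _ x] N by (force simp: mem_box)
        then show ?case by simp
      qed
    qed
    show "integrable lborel (\<lambda>x. (2 * cmod (f x))\<^sup>2)"
      using f by (simp add: L2_def power_mult_distrib)
  qed simp
qed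

lemma test_functions_dense:
  fixes f :: "'a::euclidean_space \<Rightarrow> complex"
  assumes f: "f \<in> L2 lborel"
  obtains g where "\<And>k. test_function (g k)" "L2_tendsto lborel g f"
proof -
  have "\<exists>g. test_function g \<and> nsq lborel (\<lambda>x. f x - g x) \<le> 1 / real (Suc k)" for k
    using L2_approximable[OF f] unfolding approximable_def by (simp del: of_nat_Suc)
  then obtain g where g: "\<And>k. test_function (g k)" "\<And>k. nsq lborel (\<lambda>x. f x - g k x) \<le> 1 / real (Suc k)"
    by metis
  have "(\<lambda>k. nsq lborel (\<lambda>x. g k x - f x)) \<longlonglongrightarrow> 0"
    by (rule real_tendsto_sandwich[OF _ _ tendsto_const LIMSEQ_Suc[OF lim_1_over_n]])
      (use g(2) in \<open>auto simp: nsq_commute[of _ "g _"] inverse_eq_divide\<close>)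
  then have "L2_tendsto lborel g f"
    using g(1) f by (subst L2_tendsto_iff) (auto intro: test_function_L2)
  with g(1) that show ?thesis by blast
qed

text \<open>A non-integrable \<open>f\<close> has Bochner integral 0, so the bound holds for it as
  well; this is why only a pointwise estimate and the integrability of the majorant are
  demanded.\<close>

lemma norm_integral_le:
  fixes f :: "'a \<Rightarrow> 'b::{banach, second_countable_topology}"
  assumes g: "integrable M g" and le: "\<And>x. norm (f x) \<le> g x"
  shows "norm (integral\<^sup>L M f) \<le> integral\<^sup>L M g"
proof (cases "integrable M f")
  case True
  have "norm (integral\<^sup>L M f) \<le> (LINT x|M. norm (f x))" by (rule integral_norm_bound)
  also have "\<dots> \<le> integral\<^sup>L M g" using True g le by (intro integral_mono) auto
  finally show ?thesis .
next
  case False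
  have "0 \<le> integral\<^sup>L M g"
    using le order_trans[OF norm_ge_zero] by (intro integral_nonneg_AE AE_I2) blast
  then show ?thesis using False by (simp add: not_integrable_integral_eq)
qed

section \<open>Completeness of L2\<close>

lemma L2_complete:
  assumes f: "\<And>k. f k \<in> L2 M"
    and Cauchy: "\<And>e. e > 0 \<Longrightarrow> \<exists>N. \<forall>m\<ge>N. \<forall>k\<ge>N. nsq M (\<lambda>x. f m x - f k x) \<le> e"
  obtains F where "F \<in> L2 M" "L2_tendsto M f F"
proof -
  have [measurable]: "f k \<in> borel_measurable M" for k
    using f by (rule L2_measurable)
  \<comment> \<open>The rate 8^(-i) for squared norms leaves the summable 4^(-i) after the
    increments are weighted by 2^i.\<close>
  have "\<exists>N. \<forall>m\<ge>N. \<forall>k\<ge>N. nsq M (\<lambda>x. f m x - f k x) \<le> (1/8) ^ i" for i :: nat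
    by (rule Cauchy) simp
  then obtain N where N: "\<And>i m k. m \<ge> N i \<Longrightarrow> k \<ge> N i \<Longrightarrow> nsq M (\<lambda>x. f m x - f k x) \<le> (1/8) ^ i"
    by metis
  \<comment> \<open>One formula for an index that is increasing, lies beyond \<open>N i\<close>, and
    tends to infinity.\<close>
  define r where "r i = (\<Sum>j\<le>i. N j) + i" for i
  have rN: "r i \<ge> N i" for i
    using member_le_sum[of i "{..i}" N] by (simp add: r_def)
  have rS: "r (Suc i) \<ge> r i" and ri: "r i \<ge> i" for i
    by (simp_all add: r_def)
  define d where "d i x = f (r (Suc i)) x - f (r i) x" for i x
  have dL2: "d i \<in> L2 M" for i
    unfolding d_def by (intro L2_diff f)
  have [measurable]: "d i \<in> borel_measurable M" for i
    using dL2 by (rule L2_measurable)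
  have nd: "nsq M (d i) \<le> (1/8) ^ i" for i
    unfolding d_def by (intro N rN order_trans[OF rN rS])
  have "(\<integral>\<^sup>+x. (\<Sum>i. ennreal (2 ^ i * (cmod (d i x))\<^sup>2)) \<partial>M) = (\<Sum>i. \<integral>\<^sup>+x. ennreal (2 ^ i * (cmod (d i x))\<^sup>2) \<partial>M)"
    by (rule nn_integral_suminf) simp
  also have "\<dots> = (\<Sum>i. ennreal (2 ^ i * nsq M (d i)))"
    using dL2 by (simp add: ennreal_mult nn_integral_cmult nn_integral_nsq)
  also have "\<dots> \<le> (\<Sum>i. ennreal ((1/4) ^ i))"
  proof (intro suminf_le ennreal_leI)
    fix i
    have "2 ^ i * nsq M (d i) \<le> 2 ^ i * (1/8) ^ i"
      by (intro mult_left_mono nd) simp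
    then show "2 ^ i * nsq M (d i) \<le> (1/4) ^ i"
      by (simp add: power_mult_distrib[symmetric])
  qed auto
  also have "\<dots> = ennreal (\<Sum>i. (1/4) ^ i)"
    by (rule suminf_ennreal2) (auto intro: summable_geometric)
  also have "\<dots> < \<infinity>" by simp
  finally have "AE x in M. (\<Sum>i. ennreal (2 ^ i * (cmod (d i x))\<^sup>2)) \<noteq> \<infinity>"
    by (intro nn_integral_PInf_AE) auto
  then have conv: "AE x in M. convergent (\<lambda>i. f (r i) x)"
  proof eventually_elim
    case (elim x)
    then have s1: "summable (\<lambda>i. 2 ^ i * (cmod (d i x))\<^sup>2)"
      by (intro summable_suminf_not_top) auto
    have "summable (\<lambda>i. d i x)"
    proof (rule summable_comparison_test')
      show "summable (\<lambda>i. (1/2) ^ i + 2 ^ i * (cmod (d i x))\<^sup>2)"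
        by (intro summable_add s1 summable_geometric) auto
      fix i :: nat
      \<comment> \<open>Either the increment is below 2^(-i), or 2^i times it is at least 1 and it
        is dominated by its weighted square. So summability of weighted squares yields absolute
        summability.\<close>
      show "norm (d i x) \<le> (1/2) ^ i + 2 ^ i * (cmod (d i x))\<^sup>2"
      proof (cases "norm (d i x) \<le> (1/2) ^ i")
        case True
        then show ?thesis by (rule order_trans) simp
      next
        case False
        then have "1 \<le> 2 ^ i * norm (d i x)"
          by (simp add: power_divide field_simps)
        then have "norm (d i x) * 1 \<le> norm (d i x) * (2 ^ i * norm (d i x))"
          by (intro mult_left_mono) auto
        then have "norm (d i x) \<le> 2 ^ i * (cmod (d i x))\<^sup>2"
          by (simp add: power2_eq_square mult_ac)
        also have "\<dots> \<le> (1/2) ^ i + 2 ^ i * (cmod (d i x))\<^sup>2"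
          by simp
        finally show ?thesis .
      qed
    qed
    then have "convergent (\<lambda>n. \<Sum>i<n. d i x)"
      by (simp add: summable_iff_convergent)
    moreover have "(\<Sum>i<n. d i x) = f (r n) x - f (r 0) x" for n
      unfolding d_def by (rule sum_lessThan_telescope)
    ultimately have "convergent (\<lambda>n. f (r n) x - f (r 0) x)" by simp
    then obtain L where "(\<lambda>n. f (r n) x - f (r 0) x) \<longlonglongrightarrow> L"
      by (auto simp: convergent_def)
    from tendsto_add[OF this tendsto_const[of "f (r 0) x"]] show ?case
      by (auto simp: convergent_def)
  qed
  define F where "F x = lim (\<lambda>i. f (r i) x)" for x
  have Fm: "F \<in> borel_measurable M"
    unfolding F_def by measurable
  have sub: "\<exists>N. \<forall>m\<ge>N. \<forall>k\<ge>N. nsq M (\<lambda>x. f (r m) x - f (r k) x) \<le> e" if "e > 0" for e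
    using Cauchy[OF that] ri by (meson order_trans)
  have F: "F \<in> L2 M" "L2_tendsto M (\<lambda>i. f (r i)) F"
    by (rule L2_tendsto_of_pointwise[OF f Fm sub];
        use conv in \<open>auto simp: F_def convergent_LIMSEQ_iff elim!: AE_mp\<close>)+
  \<comment> \<open>From the subsequence back to the whole Cauchy sequence; the two factors 2 of
    \<open>nsq_triangle\<close> explain the tolerance e / 8.\<close>
  have "(\<lambda>k. nsq M (\<lambda>x. f k x - F x)) \<longlonglongrightarrow> 0"
  proof (rule LIMSEQ_I)
    fix e :: real assume e: "e > 0"
    obtain N where N: "\<And>m k. m \<ge> N \<Longrightarrow> k \<ge> N \<Longrightarrow> nsq M (\<lambda>x. f m x - f k x) \<le> e / 8"
      using Cauchy[of "e / 8"] e by auto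
    have "(\<lambda>k. nsq M (\<lambda>x. f (r k) x - F x)) \<longlonglongrightarrow> 0"
      using F f by (simp add: L2_tendsto_iff)
    then obtain i where i: "i \<ge> N" "nsq M (\<lambda>x. f (r i) x - F x) < e / 8"
      using order_tendstoD(2)[of _ 0 sequentially "e / 8"] e
      by (metis (no_types, lifting) eventually_sequentially divide_pos_pos nat_le_linear zero_less_numeral)
    have "norm (nsq M (\<lambda>x. f k x - F x) - 0) < e" if "k \<ge> N" for k
      using nsq_triangle[OF f[of k] f[of "r i"] F(1)] N[OF that order_trans[OF i(1) ri]] i(2) e by simp
    then show "\<exists>N. \<forall>k\<ge>N. norm (nsq M (\<lambda>x. f k x - F x) - 0) < e" by blast
  qed
  then have "L2_tendsto M f F"
    using f F(1) by (simp add: L2_tendsto_iff)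
  with F(1) that show ?thesis by blast
qed

section \<open>Lebesgue measure and its multiples\<close>

lemma integrable_scaleR_iff:
  fixes f :: "'a \<Rightarrow> 'b::{banach, second_countable_topology}"
  assumes "c \<noteq> 0"
  shows "integrable M (\<lambda>x. c *\<^sub>R f x) \<longleftrightarrow> integrable M f"
  using assms integrable_scaleR_right[of "inverse c" M "\<lambda>x. c *\<^sub>R f x"] by auto

lemma integrable_mu_iff:
  fixes f :: "complex^'n \<Rightarrow> 'b::{banach, second_countable_topology}"
  assumes "f \<in> borel_measurable borel"
  shows "integrable mu f \<longleftrightarrow> integrable lborel f"
  using assms unfolding mu_density by (subst integrable_density) (auto simp: integrable_scaleR_iff)

lemma integral_mu:
  fixes f :: "complex^'n \<Rightarrow> 'b::{banach, second_countable_topology}"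
  assumes "f \<in> borel_measurable borel"
  shows "integral\<^sup>L mu f = 2 ^ CARD('n) *\<^sub>R integral\<^sup>L lborel f"
  using assms unfolding mu_density by (subst integral_density) auto

lemma integrable_mu_heis_iff:
  fixes f :: "('n::finite) heis \<Rightarrow> 'b::{banach, second_countable_topology}"
  assumes "f \<in> borel_measurable borel"
  shows "integrable mu_heis f \<longleftrightarrow> integrable lborel f"
  using assms unfolding mu_heis_density by (subst integrable_density) (auto simp: integrable_scaleR_iff)

lemma integral_mu_heis:
  fixes f :: "('n::finite) heis \<Rightarrow> 'b::{banach, second_countable_topology}"
  assumes "f \<in> borel_measurable borel"
  shows "integral\<^sup>L mu_heis f = 2 ^ CARD('n) *\<^sub>R integral\<^sup>L lborel f"
  using assms unfolding mu_heis_density by (subst integral_density) auto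

lemma L2_mu_heis: "L2 (mu_heis :: ('n::finite) heis measure) = (L2 lborel :: (_ \<Rightarrow> 'b::euclidean_space) set)"
proof -
  have "integrable (mu_heis :: 'n heis measure) (\<lambda>x. (norm (f x))\<^sup>2) \<longleftrightarrow> integrable lborel (\<lambda>x. (norm (f x))\<^sup>2)"
    if "f \<in> borel_measurable borel" for f :: "'n heis \<Rightarrow> 'b"
    using that by (intro integrable_mu_heis_iff) measurable
  moreover have "borel_measurable (mu_heis :: 'n heis measure) = (borel_measurable borel :: (_ \<Rightarrow> 'b) set)"
    by (rule measurable_cong_sets) auto
  ultimately show ?thesis
    by (auto simp: L2_def)
qed

lemma nsq_mu_heis:
  "f \<in> borel_measurable borel \<Longrightarrow> nsq (mu_heis :: ('n::finite) heis measure) f = 2 ^ CARD('n) * nsq lborel f"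
  by (simp add: nsq_def integral_mu_heis)

lemma test_function_L2_heis: "test_function f \<Longrightarrow> f \<in> L2 mu_heis"
  by (simp add: L2_mu_heis test_function_L2)

lemma test_functions_dense_heis:
  fixes f :: "('n::finite) heis \<Rightarrow> complex"
  assumes f: "f \<in> L2 mu_heis"
  obtains g where "\<And>k. test_function (g k)" "L2_tendsto mu_heis g f"
proof -
  obtain g where g: "\<And>k. test_function (g k)" "L2_tendsto lborel g f"
    using test_functions_dense[of f] f by (auto simp: L2_mu_heis)
  have [measurable]: "g k \<in> borel_measurable borel" "f \<in> borel_measurable borel" for k
    using g(1) f by (auto intro: test_function_borel simp: L2_def)
  have "(\<lambda>k. 2 ^ CARD('n) * nsq lborel (\<lambda>x. g k x - f x)) \<longlonglongrightarrow> 2 ^ CARD('n) * 0"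
    using g f by (intro tendsto_intros) (subst L2_tendsto_iff[symmetric]; auto simp: L2_mu_heis intro: test_function_L2)
  then have "L2_tendsto mu_heis g f"
    using g(1) f by (subst L2_tendsto_iff) (auto intro: test_function_L2_heis simp: nsq_mu_heis)
  with g(1) that show ?thesis by blast
qed

lemma test_functions_separate_heis:
  fixes f :: "('n::finite) heis \<Rightarrow> complex"
  assumes "f \<in> borel_measurable borel"
    and "\<And>l u. integrable lborel (\<lambda>x. indicator (box l u) x *\<^sub>R f x)"
    and zero: "\<And>g. test_function g \<Longrightarrow> (LINT x|mu_heis. f x * g x) = 0"
  shows "AE x in mu_heis. f x = 0"
  unfolding AE_mu_heis_iff
proof (rule test_functions_separate[OF assms(1,2)])
  fix g :: "'n heis \<Rightarrow> complex" assume g: "test_function g"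
  note [measurable] = assms(1) test_function_borel[OF g]
  show "(LINT x|lborel. f x * g x) = 0"
    using zero[OF g] by (simp add: integral_mu_heis)
qed

lemma integrable_indicator_box_L2:
  fixes f :: "'a::euclidean_space \<Rightarrow> complex"
  assumes "f \<in> L2 lborel"
  shows "integrable lborel (\<lambda>x. indicator (box l u) x *\<^sub>R f x)"
proof -
  have "(\<lambda>x. complex_of_real (indicator (box l u) x)) \<in> L2 lborel"
    using integrable_indicator_box_sq[of l u] by (simp add: L2_def)
  from L2_mult_integrable[OF this assms] show ?thesis
    by (simp add: scaleR_conv_of_real)
qed

lemma L2_separate_heis:
  fixes f :: "('n::finite) heis \<Rightarrow> complex"
  assumes "f \<in> L2 mu_heis" "\<And>g. test_function g \<Longrightarrow> (LINT x|mu_heis. f x * g x) = 0"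
  shows "AE x in mu_heis. f x = 0"
proof (rule test_functions_separate_heis[OF _ _ assms(2)])
  have f: "f \<in> L2 lborel" using assms(1) by (simp add: L2_mu_heis)
  then show "f \<in> borel_measurable borel" by (simp add: L2_def)
  show "integrable lborel (\<lambda>x. indicator (box l u) x *\<^sub>R f x)" for l u
    by (rule integrable_indicator_box_L2[OF f])
qed

section \<open>The partial Fourier transform\<close>

lemma borel_measurable_cis [measurable]: "cis \<in> borel_measurable borel"
  by (intro borel_measurable_continuous_onI continuous_intros)

section \<open>The Fourier transform on the real line\<close>

lemma integrable_pair_mult:
  fixes f :: "'a \<Rightarrow> complex" and g :: "'b \<Rightarrow> complex"
  assumes "sigma_finite_measure M1" "sigma_finite_measure M2"
    and f: "integrable M1 f" and g: "integrable M2 g"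
  shows "integrable (M1 \<Otimes>\<^sub>M M2) (\<lambda>p. f (fst p) * g (snd p))"
proof -
  interpret sigma_finite_measure M1 by fact
  interpret M2: sigma_finite_measure M2 by fact
  interpret pair_sigma_finite M1 M2 ..
  have [measurable]: "f \<in> borel_measurable M1" "g \<in> borel_measurable M2"
    using f g by auto
  show ?thesis
    by (rule Fubini_integrable) (use f g in \<open>auto simp: norm_mult\<close>)
qed

text \<open>A rescaled form of the characteristic function of the standard normal law. It is the
  summation kernel of \<open>ft_parseval\<close>, and the case a = 0 supplies Gaussian
  integrability.\<close>

lemma gaussian_fourier:
  assumes "e > 0"
  shows "integrable lborel (\<lambda>t. cis (a * t) * complex_of_real (exp (- (e * t)\<^sup>2 / 2)))"
    "(LINT t|lborel. cis (a * t) * complex_of_real (exp (- (e * t)\<^sup>2 / 2)))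
      = complex_of_real (sqrt (2 * pi) / e * exp (- (a / e)\<^sup>2 / 2))"
proof -
  let ?h = "\<lambda>t. cis (a * t) * complex_of_real (exp (- (e * t)\<^sup>2 / 2))"
  have n: "integrable lborel std_normal_density" by (rule integrable_normal_density) simp
  have i0: "integrable lborel (\<lambda>x. cis (b * x) * complex_of_real (std_normal_density x))" for b
    by (rule Bochner_Integration.integrable_bound[OF n]) (auto simp: norm_mult normal_density_nonneg)
  have c: "(LINT x|lborel. cis (b * x) * complex_of_real (std_normal_density x)) = complex_of_real (exp (- b\<^sup>2 / 2))" for b
  proof -
    have "complex_of_real (exp (- b\<^sup>2 / 2)) = (CLINT x|density lborel std_normal_density. iexp (b * x))"
      using fun_cong[OF char_std_normal_distribution, of b] by (simp add: char_def)
    also have "\<dots> = (LINT x|lborel. std_normal_density x *\<^sub>R iexp (b * x))"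
      by (rule integral_density) (auto simp: normal_density_nonneg)
    finally show ?thesis
      by (simp add: cis_conv_exp scaleR_conv_of_real mult.commute)
  qed
  have e: "?h (0 + (1 / e) * x) = complex_of_real (sqrt (2 * pi)) * (cis (a / e * x) * complex_of_real (std_normal_density x))" for x
    using assms by (simp add: std_normal_density_def)
  have hb: "has_bochner_integral lborel (\<lambda>x. ?h (0 + (1 / e) * x)) (complex_of_real (sqrt (2 * pi)) * complex_of_real (exp (- (a / e)\<^sup>2 / 2)))"
    unfolding e by (intro has_bochner_integral_mult_right) (simp only: has_bochner_integral_iff i0 c simp_thms)
  have "has_bochner_integral lborel ?h (\<bar>1 / e\<bar> *\<^sub>R (complex_of_real (sqrt (2 * pi)) * complex_of_real (exp (- (a / e)\<^sup>2 / 2))))"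
    using hb assms lborel_has_bochner_integral_real_affine_iff[of "1 / e" ?h _ 0] by (auto simp: scaleR_scaleR)
  then show "integrable lborel ?h" "(LINT t|lborel. ?h t) = complex_of_real (sqrt (2 * pi) / e * exp (- (a / e)\<^sup>2 / 2))"
    using assms by (auto simp: has_bochner_integral_iff scaleR_conv_of_real)
qed

definition ft :: "real \<Rightarrow> (real \<Rightarrow> complex) \<Rightarrow> real \<Rightarrow> complex" where
  "ft \<sigma> f t = (LINT s|lborel. cis (\<sigma> * t * s) * f s)"

lemma integrable_cis_mult:
  assumes "integrable lborel (f :: real \<Rightarrow> complex)"
  shows "integrable lborel (\<lambda>s. cis (a * s) * f s)"
  using assms
proof (rule Bochner_Integration.integrable_bound)
  have [measurable]: "f \<in> borel_measurable borel" using assms by auto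
  show "(\<lambda>s. cis (a * s) * f s) \<in> borel_measurable lborel" by measurable
qed (simp add: norm_mult)

lemma ft_bound:
  assumes "integrable lborel f"
  shows "cmod (ft \<sigma> f t) \<le> (LINT s|lborel. cmod (f s))"
  unfolding ft_def using integral_norm_bound[of lborel "\<lambda>s. cis (\<sigma> * t * s) * f s"] by (simp add: norm_mult)

lemma ft_measurable:
  assumes [measurable]: "f \<in> borel_measurable borel"
  shows "ft \<sigma> f \<in> borel_measurable borel"
  unfolding ft_def by measurable

lemma ft_multiplication:
  assumes f: "integrable lborel f" and g: "integrable lborel g"
  shows "(LINT t|lborel. ft \<sigma> f t * g t) = (LINT s|lborel. f s * ft \<sigma> g s)"
proof -
  have [measurable]: "f \<in> borel_measurable borel" "g \<in> borel_measurable borel" using f g by auto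
  have int: "integrable (lborel \<Otimes>\<^sub>M lborel) (\<lambda>(s, t). cis (\<sigma> * t * s) * f s * g t)"
    by (rule Bochner_Integration.integrable_bound[OF integrable_pair_mult[OF sigma_finite_lborel sigma_finite_lborel f g]])
      (auto simp: norm_mult)
  have "(LINT t|lborel. ft \<sigma> f t * g t) = (LINT t|lborel. LINT s|lborel. cis (\<sigma> * t * s) * f s * g t)"
    by (simp add: ft_def)
  also have "\<dots> = (LINT s|lborel. LINT t|lborel. cis (\<sigma> * t * s) * f s * g t)"
    by (rule lborel_pair.Fubini_integral[OF int])
  also have "\<dots> = (LINT s|lborel. LINT t|lborel. f s * (cis (\<sigma> * s * t) * g t))"
    by (simp add: mult_ac)
  finally show ?thesis
    by (simp add: ft_def)
qed

text \<open>Gaussian summation: the factor exp (- (e t)^2 / 2) legitimises Fubini, the t-integral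
  then becomes an approximate identity of mass 2 pi, and e tends to 0. The integrability of the
  product of the transforms dominates the left side.\<close>

lemma ft_parseval:
  assumes f: "continuous_on UNIV f" "\<And>s. f s \<noteq> 0 \<Longrightarrow> \<bar>s\<bar> \<le> R"
    and g: "continuous_on UNIV g" "\<And>s. g s \<noteq> 0 \<Longrightarrow> \<bar>s\<bar> \<le> R"
    and FG: "integrable lborel (\<lambda>t. ft \<sigma> f t * cnj (ft \<sigma> g t))" and \<sigma>: "\<sigma>\<^sup>2 = 1"
  shows "(LINT t|lborel. ft \<sigma> f t * cnj (ft \<sigma> g t)) = 2 * pi * (LINT s|lborel. f s * cnj (g s))"
proof -
  have bdd: "\<exists>C>0. \<forall>s. cmod (h s) \<le> C"
    if h: "continuous_on UNIV h" "\<And>s. h s \<noteq> 0 \<Longrightarrow> \<bar>s\<bar> \<le> R" for h :: "real \<Rightarrow> complex"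
  proof -
    have "compact (h ` {-R..R})" by (intro compact_continuous_image continuous_on_subset[OF h(1)]) auto
    from compact_imp_bounded[OF this] obtain C where C: "C > 0" "\<And>s. s \<in> {-R..R} \<Longrightarrow> cmod (h s) \<le> C"
      unfolding bounded_pos by blast
    have "cmod (h s) \<le> C" for s
      using C(1) C(2)[of s] h(2)[of s] by (cases "h s = 0") (auto simp: abs_le_iff)
    with C(1) show ?thesis by blast
  qed
  obtain Cf where Cf: "Cf > 0" "\<And>s. cmod (f s) \<le> Cf" using bdd[OF f] by blast
  obtain Cg where Cg: "Cg > 0" "\<And>s. cmod (g s) \<le> Cg" using bdd[OF g] by blast
  have [measurable]: "f \<in> borel_measurable borel" "g \<in> borel_measurable borel"
    using f g by (auto intro: borel_measurable_continuous_onI)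
  have fi: "integrable lborel f" and gi: "integrable lborel g"
    using integrable_bounded_support[of f Cf R] integrable_bounded_support[of g Cg R] f g Cf Cg by auto
  have gci: "integrable lborel (\<lambda>s. cnj (g s))" using gi by simp
  define e where "e m = 1 / real (Suc m)" for m
  have e: "e m > 0" for m by (simp add: e_def)
  have e0: "e \<longlonglongrightarrow> 0"
    unfolding e_def using LIMSEQ_Suc[OF lim_1_over_n] by (simp add: inverse_eq_divide)
  let ?G = "\<lambda>m t. complex_of_real (exp (- (e m * t)\<^sup>2 / 2))"
  have lhs: "(\<lambda>m. LINT t|lborel. ft \<sigma> f t * cnj (ft \<sigma> g t) * ?G m t) \<longlonglongrightarrow> (LINT t|lborel. ft \<sigma> f t * cnj (ft \<sigma> g t))"
  proof (rule integral_dominated_convergence[where w = "\<lambda>t. cmod (ft \<sigma> f t * cnj (ft \<sigma> g t))"])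
    have "(\<lambda>m. ft \<sigma> f t * cnj (ft \<sigma> g t) * ?G m t) \<longlonglongrightarrow> ft \<sigma> f t * cnj (ft \<sigma> g t) * complex_of_real (exp (- (0 * t)\<^sup>2 / 2))" for t
      by (intro tendsto_intros e0) auto
    then show "AE t in lborel. (\<lambda>m. ft \<sigma> f t * cnj (ft \<sigma> g t) * ?G m t) \<longlonglongrightarrow> ft \<sigma> f t * cnj (ft \<sigma> g t)"
      by simp
    show "AE t in lborel. norm (ft \<sigma> f t * cnj (ft \<sigma> g t) * ?G m t) \<le> cmod (ft \<sigma> f t * cnj (ft \<sigma> g t))" for m
      by (intro AE_I2) (simp add: norm_mult mult_left_le)
  qed (use FG integrable_norm[OF FG] in \<open>auto intro!: borel_measurable_times simp: ft_measurable\<close>)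
  have step: "(LINT t|lborel. ft \<sigma> f t * cnj (ft \<sigma> g t) * ?G m t)
      = (LINT s'|lborel. cnj (g s') * (LINT r|lborel. f (s' + e m * r) * complex_of_real (sqrt (2 * pi) * exp (- r\<^sup>2 / 2))))" for m
  proof -
    have Gi: "integrable lborel (?G m)"
      using gaussian_fourier(1)[OF e, of 0 m] by simp
    have pairi: "integrable (lborel \<Otimes>\<^sub>M lborel) (\<lambda>p. f (fst p) * cnj (g (snd p)))"
      by (rule integrable_pair_mult[OF sigma_finite_lborel sigma_finite_lborel fi gci])
    have sfp: "sigma_finite_measure (lborel \<Otimes>\<^sub>M lborel :: (real \<times> real) measure)"
      by (simp add: lborel_prod sigma_finite_lborel)
    \<comment> \<open>Without the Gaussian the integrand has constant modulus in t; the factor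
      \<open>?G m\<close> is what makes the triple integral absolutely convergent.\<close>
    have tri: "integrable (lborel \<Otimes>\<^sub>M (lborel \<Otimes>\<^sub>M lborel)) (\<lambda>(t, p). ?G m t * (f (fst p) * cnj (g (snd p)) * cis (\<sigma> * t * (fst p - snd p))))"
      by (rule Bochner_Integration.integrable_bound[OF integrable_pair_mult[OF sigma_finite_lborel sfp Gi pairi]])
        (auto simp: norm_mult)
    interpret P: pair_sigma_finite lborel "lborel \<Otimes>\<^sub>M lborel :: (real \<times> real) measure"
      using sfp sigma_finite_lborel by (simp add: pair_sigma_finite_def)
    have inner: "ft \<sigma> f t * cnj (ft \<sigma> g t) = (LINT p|(lborel \<Otimes>\<^sub>M lborel). f (fst p) * cnj (g (snd p)) * cis (\<sigma> * t * (fst p - snd p)))" for t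
    proof -
      have "cnj (ft \<sigma> g t) = (LINT s|lborel. cnj (cis (\<sigma> * t * s) * g s))"
        unfolding ft_def by (rule Bochner_Integration.integral_cnj[symmetric])
      then have c: "cnj (ft \<sigma> g t) = (LINT s|lborel. cis (- (\<sigma> * t) * s) * cnj (g s))"
        by (simp add: cis_cnj del: Bochner_Integration.integral_cnj)
      have i: "integrable (lborel \<Otimes>\<^sub>M lborel) (\<lambda>(s, s'). (cis (\<sigma> * t * s) * f s) * (cis (- (\<sigma> * t) * s') * cnj (g s')))"
        using integrable_pair_mult[OF sigma_finite_lborel sigma_finite_lborel integrable_cis_mult[OF fi, of "\<sigma> * t"] integrable_cis_mult[OF gci, of "- (\<sigma> * t)"]]
        by (simp add: split_beta')
      have "ft \<sigma> f t * cnj (ft \<sigma> g t) = (LINT s|lborel. LINT s'|lborel. (cis (\<sigma> * t * s) * f s) * (cis (- (\<sigma> * t) * s') * cnj (g s')))"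
        unfolding c by (simp add: ft_def)
      also have "\<dots> = (LINT p|(lborel \<Otimes>\<^sub>M lborel). (\<lambda>(s, s'). (cis (\<sigma> * t * s) * f s) * (cis (- (\<sigma> * t) * s') * cnj (g s'))) p)"
        by (rule lborel_pair.integral_fst[OF i])
      also have "\<dots> = (LINT p|(lborel \<Otimes>\<^sub>M lborel). f (fst p) * cnj (g (snd p)) * cis (\<sigma> * t * (fst p - snd p)))"
      proof (intro Bochner_Integration.integral_cong refl)
        fix p :: "real \<times> real"
        have "cis (\<sigma> * t * (fst p - snd p)) = cis (\<sigma> * t * fst p) * cis (- (\<sigma> * t) * snd p)"
          by (simp add: cis_mult right_diff_distrib)
        then show "(\<lambda>(s, s'). (cis (\<sigma> * t * s) * f s) * (cis (- (\<sigma> * t) * s') * cnj (g s'))) p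
            = f (fst p) * cnj (g (snd p)) * cis (\<sigma> * t * (fst p - snd p))"
          by (simp add: split_beta' mult_ac)
      qed
      finally show ?thesis .
    qed
    have "(LINT t|lborel. ft \<sigma> f t * cnj (ft \<sigma> g t) * ?G m t)
        = (LINT t|lborel. LINT p|(lborel \<Otimes>\<^sub>M lborel). ?G m t * (f (fst p) * cnj (g (snd p)) * cis (\<sigma> * t * (fst p - snd p))))"
      unfolding inner by (simp add: mult.commute)
    also have "\<dots> = (LINT p|(lborel \<Otimes>\<^sub>M lborel). LINT t|lborel. ?G m t * (f (fst p) * cnj (g (snd p)) * cis (\<sigma> * t * (fst p - snd p))))"
      by (rule P.Fubini_integral[OF tri, symmetric])
    also have "\<dots> = (LINT p|(lborel \<Otimes>\<^sub>M lborel). f (fst p) * cnj (g (snd p)) * complex_of_real (sqrt (2 * pi) / e m * exp (- ((fst p - snd p) / e m)\<^sup>2 / 2)))"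
    proof (intro Bochner_Integration.integral_cong refl)
      fix p :: "real \<times> real"
      have "(LINT t|lborel. ?G m t * (f (fst p) * cnj (g (snd p)) * cis (\<sigma> * t * (fst p - snd p))))
          = (LINT t|lborel. (f (fst p) * cnj (g (snd p))) * (cis (\<sigma> * (fst p - snd p) * t) * ?G m t))"
        by (intro Bochner_Integration.integral_cong) (auto simp: mult_ac)
      also have "\<dots> = f (fst p) * cnj (g (snd p)) * complex_of_real (sqrt (2 * pi) / e m * exp (- (\<sigma> * (fst p - snd p) / e m)\<^sup>2 / 2))"
        by (subst gaussian_fourier(2)[OF e, symmetric]) (rule integral_mult_right_zero)
      also have "(\<sigma> * (fst p - snd p) / e m)\<^sup>2 = ((fst p - snd p) / e m)\<^sup>2"
        using \<sigma> by (simp add: power_divide power_mult_distrib)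
      finally show "(LINT t|lborel. ?G m t * (f (fst p) * cnj (g (snd p)) * cis (\<sigma> * t * (fst p - snd p))))
          = f (fst p) * cnj (g (snd p)) * complex_of_real (sqrt (2 * pi) / e m * exp (- ((fst p - snd p) / e m)\<^sup>2 / 2))" .
    qed
    also have "\<dots> = (LINT s'|lborel. LINT s|lborel. f s * cnj (g s') * complex_of_real (sqrt (2 * pi) / e m * exp (- ((s - s') / e m)\<^sup>2 / 2)))"
    proof (subst lborel_pair.integral_snd)
      show "integrable (lborel \<Otimes>\<^sub>M lborel) (\<lambda>(s, s'). f s * cnj (g s') * complex_of_real (sqrt (2 * pi) / e m * exp (- ((s - s') / e m)\<^sup>2 / 2)))"
      proof (rule Bochner_Integration.integrable_bound[OF integrable_mult_right[OF pairi, of "complex_of_real (sqrt (2 * pi) / e m)"]])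
        show "AE p in lborel \<Otimes>\<^sub>M lborel. norm (case p of (s, s') \<Rightarrow> f s * cnj (g s') * complex_of_real (sqrt (2 * pi) / e m * exp (- ((s - s') / e m)\<^sup>2 / 2)))
            \<le> norm (complex_of_real (sqrt (2 * pi) / e m) * (f (fst p) * cnj (g (snd p))))"
          using e[of m] by (intro AE_I2) (auto simp: norm_mult norm_divide split_beta' mult_ac intro!: mult_left_mono divide_right_mono mult_left_le)
      qed measurable
    qed (simp add: split_beta')
    also have "\<dots> = (LINT s'|lborel. cnj (g s') * (LINT r|lborel. f (s' + e m * r) * complex_of_real (sqrt (2 * pi) * exp (- r\<^sup>2 / 2))))"
    proof (intro Bochner_Integration.integral_cong refl)
      fix s'
      have "(LINT s|lborel. f s * cnj (g s') * complex_of_real (sqrt (2 * pi) / e m * exp (- ((s - s') / e m)\<^sup>2 / 2)))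
          = (LINT s|lborel. cnj (g s') * (f s * complex_of_real (sqrt (2 * pi) / e m * exp (- ((s - s') / e m)\<^sup>2 / 2))))"
        by (intro Bochner_Integration.integral_cong) (auto simp: mult_ac)
      also have "\<dots> = cnj (g s') * (LINT s|lborel. f s * complex_of_real (sqrt (2 * pi) / e m * exp (- ((s - s') / e m)\<^sup>2 / 2)))"
        by simp
      \<comment> \<open>The substitution s = s' + e r fixes the Gaussian and moves the parameter
        into the argument of \<open>f\<close>, where continuity supplies the limit.\<close>
      also have "(LINT s|lborel. f s * complex_of_real (sqrt (2 * pi) / e m * exp (- ((s - s') / e m)\<^sup>2 / 2)))
          = \<bar>e m\<bar> *\<^sub>R (LINT r|lborel. f (s' + e m * r) * complex_of_real (sqrt (2 * pi) / e m * exp (- ((s' + e m * r - s') / e m)\<^sup>2 / 2)))"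
        by (rule lborel_integral_real_affine) (use e[of m] in simp)
      also have "\<dots> = (LINT r|lborel. f (s' + e m * r) * complex_of_real (sqrt (2 * pi) * exp (- r\<^sup>2 / 2)))"
        unfolding integral_scaleR_right[symmetric]
        by (intro Bochner_Integration.integral_cong) (use e[of m] in \<open>auto simp: scaleR_conv_of_real\<close>)
      finally show "(LINT s|lborel. f s * cnj (g s') * complex_of_real (sqrt (2 * pi) / e m * exp (- ((s - s') / e m)\<^sup>2 / 2)))
          = cnj (g s') * (LINT r|lborel. f (s' + e m * r) * complex_of_real (sqrt (2 * pi) * exp (- r\<^sup>2 / 2)))" .
    qed
    finally show ?thesis .
  qed
  let ?N = "\<lambda>r. complex_of_real (sqrt (2 * pi) * exp (- r\<^sup>2 / 2))"
  have Ni: "integrable lborel ?N" and NI: "(LINT r|lborel. ?N r) = 2 * pi"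
  proof -
    have Ne: "?N = (\<lambda>r. complex_of_real (sqrt (2 * pi)) * (cis (0 * r) * complex_of_real (exp (- (1 * r)\<^sup>2 / 2))))"
      by (simp add: fun_eq_iff)
    show "integrable lborel ?N"
      unfolding Ne by (intro integrable_mult_right gaussian_fourier) simp
    show "(LINT r|lborel. ?N r) = 2 * pi"
      unfolding Ne integral_mult_right_zero
      by (subst gaussian_fourier(2)) (simp_all flip: of_real_mult)
  qed
  have Nint: "integrable lborel (\<lambda>r. Cf * cmod (?N r))"
    using integrable_norm[OF Ni] by (rule integrable_mult_right)
  define J where "J m s' = (LINT r|lborel. f (s' + e m * r) * ?N r)" for m s'
  have [measurable]: "J m \<in> borel_measurable borel" for m
    unfolding J_def by measurable
  have Jb: "cmod (J m s') \<le> (LINT r|lborel. Cf * cmod (?N r))" for m s'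
    unfolding J_def
    by (rule norm_integral_le[OF Nint]) (use Cf in \<open>auto simp: norm_mult intro!: mult_right_mono\<close>)
  have Jlim: "(\<lambda>m. J m s') \<longlonglongrightarrow> f s' * (2 * pi)" for s'
    unfolding J_def NI[symmetric] integral_mult_right_zero[symmetric]
  proof (rule integral_dominated_convergence[OF _ _ Nint])
    show "AE r in lborel. (\<lambda>m. f (s' + e m * r) * ?N r) \<longlonglongrightarrow> f s' * ?N r"
    proof (intro AE_I2)
      fix r
      have "isCont f s'" using f(1) by (simp add: continuous_on_eq_continuous_at)
      moreover have "(\<lambda>m. s' + e m * r) \<longlonglongrightarrow> s' + 0 * r" by (intro tendsto_intros e0)
      ultimately have "(\<lambda>m. f (s' + e m * r)) \<longlonglongrightarrow> f s'"
        by (intro isCont_tendsto_compose[of _ f]) auto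
      then show "(\<lambda>m. f (s' + e m * r) * ?N r) \<longlonglongrightarrow> f s' * ?N r" by (intro tendsto_intros)
    qed
    show "AE r in lborel. norm (f (s' + e m * r) * ?N r) \<le> Cf * cmod (?N r)" for m
      using Cf by (auto simp: norm_mult intro!: mult_right_mono)
  qed auto
  have "(\<lambda>m. LINT s'|lborel. cnj (g s') * J m s') \<longlonglongrightarrow> (LINT s'|lborel. cnj (g s') * (f s' * (2 * pi)))"
  proof (rule integral_dominated_convergence[where w = "\<lambda>s'. cmod (g s') * (LINT r|lborel. Cf * cmod (?N r))"])
    show "AE s' in lborel. (\<lambda>m. cnj (g s') * J m s') \<longlonglongrightarrow> cnj (g s') * (f s' * (2 * pi))"
      by (intro AE_I2 tendsto_intros Jlim)
    show "AE s' in lborel. norm (cnj (g s') * J m s') \<le> cmod (g s') * (LINT r|lborel. Cf * cmod (?N r))" for m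
      using Jb by (auto simp: norm_mult intro!: mult_left_mono)
  qed (use integrable_norm[OF gi] in auto)
  then have "(\<lambda>m. LINT t|lborel. ft \<sigma> f t * cnj (ft \<sigma> g t) * ?G m t) \<longlonglongrightarrow> (LINT s'|lborel. cnj (g s') * (f s' * (2 * pi)))"
    by (simp only: step J_def)
  moreover have "(LINT s'|lborel. cnj (g s') * (f s' * (2 * pi))) = (LINT s|lborel. 2 * pi * (f s * cnj (g s)))"
    by (intro Bochner_Integration.integral_cong) (auto simp: mult_ac)
  ultimately show ?thesis
    using LIMSEQ_unique[OF lhs] by simp
qed

section \<open>Slicewise transform of test functions\<close>

lemma integrable_inverse_1_plus_sq: "integrable lborel (\<lambda>t::real. 1 / (1 + t\<^sup>2))"
proof -
  have "set_integrable lborel (einterval (-\<infinity>) \<infinity>) (\<lambda>t. inverse (1 + t\<^sup>2))"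
    by (rule integrable_inverse_1_plus_square)
  then show ?thesis
    by (simp add: set_integrable_def inverse_eq_divide)
qed

lemma integrable_heis_dominated:
  fixes f :: "('n::finite) heis \<Rightarrow> 'b::{banach, second_countable_topology}"
  assumes "f \<in> borel_measurable borel" and a: "integrable mu a" and b: "integrable lborel b"
    and le: "\<And>z t. norm (f (z, t)) \<le> a z * b t"
  shows "integrable mu_heis f"
proof (rule Bochner_Integration.integrable_bound)
  have "integrable (mu \<Otimes>\<^sub>M lborel) (\<lambda>p. complex_of_real (a (fst p)) * complex_of_real (b (snd p)))"
    by (intro integrable_pair_mult sigma_finite_mu sigma_finite_lborel integrable_of_real a b)
  then show "integrable mu_heis (\<lambda>p. complex_of_real (a (fst p)) * complex_of_real (b (snd p)))"
    by (simp add: mu_heis_eq)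
  show "AE x in mu_heis. norm (f x) \<le> norm (complex_of_real (a (fst x)) * complex_of_real (b (snd x)))"
  proof (intro AE_I2)
    fix x :: "'n heis"
    show "norm (f x) \<le> norm (complex_of_real (a (fst x)) * complex_of_real (b (snd x)))"
      using le[of "fst x" "snd x"] abs_ge_self[of "a (fst x) * b (snd x)"]
      by (simp add: norm_mult abs_mult del: abs_ge_self)
  qed
qed (use assms in auto)

lemma integral_heis_iterated:
  fixes f :: "('n::finite) heis \<Rightarrow> 'b::{banach, second_countable_topology}"
  assumes "integrable mu_heis f"
  shows "integral\<^sup>L mu_heis f = (LINT z|mu. LINT t|lborel. f (z, t))"
  using heis.integral_fst'[of f] assms by (simp add: mu_heis_eq)

lemma integral_heis_iterated':
  fixes f :: "('n::finite) heis \<Rightarrow> 'b::{banach, second_countable_topology}"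
  assumes "integrable mu_heis f"
  shows "integral\<^sup>L mu_heis f = (LINT t|lborel. LINT z|mu. f (z, t))"
  using heis.integral_snd[of "\<lambda>z t. f (z, t)"] assms by (simp add: mu_heis_eq)

lemma slice_measurable:
  fixes f :: "('n::finite) heis \<Rightarrow> 'b::topological_space"
  assumes "f \<in> borel_measurable borel"
  shows "(\<lambda>s. f (z, s)) \<in> borel_measurable borel" "(\<lambda>z. f (z, s)) \<in> borel_measurable borel"
  using assms by (auto simp flip: borel_prod)

lemma pft_test_ft: "pft_test \<sigma> u (z, t) = ft \<sigma> (\<lambda>s. u (z, s)) t"
  by (simp add: pft_test_def ft_def)

lemma pft_test_measurable:
  fixes u :: "('n::finite) heis \<Rightarrow> complex"
  assumes "u \<in> borel_measurable borel"
  shows "pft_test \<sigma> u \<in> borel_measurable borel"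
proof -
  have [measurable]: "u \<in> borel_measurable (borel \<Otimes>\<^sub>M borel)" using assms by (simp add: borel_prod)
  have "pft_test \<sigma> u \<in> borel_measurable (borel \<Otimes>\<^sub>M borel)"
    unfolding pft_test_def by measurable
  then show ?thesis by (simp add: borel_prod)
qed

text \<open>The derivative of cis times h has integral zero by
  \<open>integral_directional_derivative\<close>; compact support replaces boundary terms.\<close>

lemma ft_deriv:
  assumes h: "\<And>s. (h has_vector_derivative h' s) (at s)"
    and supp: "\<And>s. h s \<noteq> 0 \<Longrightarrow> \<bar>s\<bar> \<le> R" and bound: "\<And>s. cmod (h s) \<le> C" "\<And>s. cmod (h' s) \<le> C'"
    and h': "integrable lborel h'"
  shows "ft \<sigma> h' t = - (\<i> * \<sigma> * t) * ft \<sigma> h t"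
proof -
  let ?D = "\<lambda>s. cis (\<sigma> * t * s) * h' s + (\<i> * \<sigma> * t) * (cis (\<sigma> * t * s) * h s)"
  have cont: "continuous_on UNIV h"
    using h by (auto simp: continuous_on_eq_continuous_at intro: has_vector_derivative_continuous)
  have hi: "integrable lborel h"
    by (rule integrable_bounded_support[where C = C and R = R])
      (use bound supp in \<open>auto intro: borel_measurable_continuous_onI cont\<close>)
  have cisd: "((\<lambda>s. cis (\<sigma> * t * s)) has_vector_derivative \<i> * \<sigma> * t * cis (\<sigma> * t * s)) (at s)" for s
    unfolding cis_conv_exp
    by (auto intro!: derivative_eq_intros has_vector_derivative_real_field)
  have der: "((\<lambda>s. cis (\<sigma> * t * s) * h s) has_derivative (\<lambda>v. v *\<^sub>R ?D s)) (at s)" for s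
  proof -
    have "((\<lambda>s. cis (\<sigma> * t * s) * h s) has_vector_derivative ?D s) (at s)"
      by (rule has_vector_derivative_eq_rhs[OF has_vector_derivative_mult[OF cisd h]]) (simp add: mult_ac)
    then show ?thesis by (simp add: has_vector_derivative_def)
  qed
  have "(LINT s|lborel. 1 *\<^sub>R ?D s) = 0"
  proof (rule integral_directional_derivative(2)[OF der])
    show "norm s \<le> R" if "cis (\<sigma> * t * s) * h s \<noteq> 0" for s
      using supp[of s] that by auto
    show "cmod (1 *\<^sub>R ?D s) \<le> C' + \<bar>\<sigma> * t\<bar> * C" for s
      using norm_triangle_ineq[of "cis (\<sigma> * t * s) * h' s" "(\<i> * \<sigma> * t) * (cis (\<sigma> * t * s) * h s)"]
        bound(2)[of s] mult_left_mono[OF bound(1)[of s], of "\<bar>\<sigma> * t\<bar>"]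
      by (simp add: norm_mult abs_mult)
  qed
  then have "(LINT s|lborel. cis (\<sigma> * t * s) * h' s) + (LINT s|lborel. (\<i> * \<sigma> * t) * (cis (\<sigma> * t * s) * h s)) = 0"
    using integrable_cis_mult[OF h', of "\<sigma> * t"] integrable_cis_mult[OF hi, of "\<sigma> * t"]
    by (simp add: Bochner_Integration.integral_add)
  then show ?thesis
    by (simp add: ft_def eq_neg_iff_add_eq_0)
qed

lemma test_slice_deriv:
  assumes "test_function u"
  shows "((\<lambda>s. u (z, s)) has_vector_derivative frechet_derivative u (at (z, s)) (0, 1)) (at s)"
proof -
  have "((\<lambda>s. (z, s)) has_derivative (\<lambda>v. (0, v))) (at s)"
    by (auto intro!: derivative_eq_intros)
  from has_derivative_compose[OF this test_function_has_derivative[OF assms]]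
  have "((\<lambda>s. u (z, s)) has_derivative (\<lambda>v. frechet_derivative u (at (z, s)) (0, v))) (at s)" .
  moreover have "(\<lambda>v. frechet_derivative u (at (z, s)) (0, v)) = (\<lambda>v. v *\<^sub>R frechet_derivative u (at (z, s)) (0, 1))"
  proof
    fix v
    show "frechet_derivative u (at (z, s)) (0, v) = v *\<^sub>R frechet_derivative u (at (z, s)) (0, 1)"
      using linear_simps(5)[OF has_derivative_bounded_linear[OF test_function_has_derivative[OF assms]], of "(z, s)" v "(0, 1)"]
      by (simp only: scaleR_Pair scaleR_zero_right real_scaleR_def mult_1_right)
  qed
  ultimately show ?thesis by (simp only: has_vector_derivative_def)
qed

lemma test_slice_continuous:
  "test_function u \<Longrightarrow> continuous_on UNIV (\<lambda>s. u (z, s))"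
  by (rule continuous_on_compose2[OF test_function_continuous]) (auto intro!: continuous_intros)

lemma test_slice_bounds:
  assumes "test_function (u :: ('n::finite) heis \<Rightarrow> complex)"
  shows "\<exists>R C. R > 0 \<and> C > 0 \<and> (\<forall>z s. u (z, s) \<noteq> 0 \<longrightarrow> norm z \<le> R \<and> \<bar>s\<bar> \<le> R) \<and> (\<forall>z s. cmod (u (z, s)) \<le> C)"
proof -
  obtain R where R: "R > 0" "\<And>x. u x \<noteq> 0 \<Longrightarrow> norm x \<le> R" using test_function_support[OF assms] by blast
  obtain C where C: "C > 0" "\<And>x. cmod (u x) \<le> C" using test_function_bounded[OF assms] by blast
  have supp: "norm z \<le> R \<and> \<bar>s\<bar> \<le> R" if "u (z, s) \<noteq> 0" for z s
    using R(2)[OF that] norm_fst_le[of z s] norm_snd_le[of s z] by simp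
  show ?thesis
    by (rule exI[of _ R], rule exI[of _ C]) (use R(1) C supp in auto)
qed

lemma test_slice_integrable:
  assumes "test_function (u :: ('n::finite) heis \<Rightarrow> complex)"
  shows "integrable lborel (\<lambda>s. u (z, s))"
proof -
  obtain R C where *: "R > 0" "C > 0" "\<forall>z s. u (z, s) \<noteq> 0 \<longrightarrow> norm z \<le> R \<and> \<bar>s\<bar> \<le> R" "\<forall>z s. cmod (u (z, s)) \<le> C"
    using test_slice_bounds[OF assms] by blast
  show ?thesis
    by (rule integrable_bounded_support[where C = C and R = R])
      (use * in \<open>auto intro: borel_measurable_continuous_onI test_slice_continuous[OF assms]\<close>)
qed

lemma test_slice_integral_bound:
  assumes "test_function (u :: ('n::finite) heis \<Rightarrow> complex)"
  shows "\<exists>B>0. \<forall>z. (LINT s|lborel. cmod (u (z, s))) \<le> B"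
proof -
  obtain R C where *: "R > 0" "C > 0" "\<forall>z s. u (z, s) \<noteq> 0 \<longrightarrow> norm z \<le> R \<and> \<bar>s\<bar> \<le> R" "\<forall>z s. cmod (u (z, s)) \<le> C"
    using test_slice_bounds[OF assms] by blast
  have "(LINT s|lborel. cmod (u (z, s))) \<le> C * (2 * R)" for z
  proof -
    have "emeasure lborel {-R..R} < \<infinity>" using *(1) by simp
    then have i: "integrable lborel (\<lambda>s. C * indicator {-R..R} s)"
      by (intro integrable_mult_right integrable_real_indicator) auto
    have "(LINT s|lborel. cmod (u (z, s))) \<le> (LINT s|lborel. C * indicator {-R..R} s)"
    proof (rule integral_mono[OF integrable_norm[OF test_slice_integrable[OF assms]] i])
      fix s show "cmod (u (z, s)) \<le> C * indicator {-R..R} s"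
      proof (cases "u (z, s) = 0")
        case False
        then have "\<bar>s\<bar> \<le> R" using *(3) by blast
        then show ?thesis using *(4) by (simp add: indicator_def abs_le_iff minus_le_iff)
      qed (use *(2) in simp)
    qed
    also have "\<dots> = C * (2 * R)" using *(1) by simp
    finally show ?thesis .
  qed
  then show ?thesis
    using *(1,2) by (intro exI[of _ "C * (2 * R)"]) auto
qed

text \<open>Two derivatives in the last variable buy the decay 1 / (1 + t^2), uniformly in z, while
  the support in z is inherited from \<open>u\<close>. This one bound yields square-integrability,
  absolute convergence and the final domination.\<close>

lemma pft_test_bound:
  assumes u: "test_function (u :: ('n::finite) heis \<Rightarrow> complex)" and \<sigma>: "\<sigma>\<^sup>2 = 1"
  shows "\<exists>R C. C > 0 \<and> (\<forall>z t. cmod (pft_test \<sigma> u (z, t)) \<le> indicator (cball 0 R) z * (C / (1 + t\<^sup>2)))"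
proof -
  let ?u1 = "\<lambda>x. frechet_derivative u (at x) (0, 1)"
  let ?u2 = "\<lambda>x. frechet_derivative ?u1 (at x) (0, 1)"
  have u1: "test_function ?u1" by (rule test_function_deriv[OF u])
  have u2: "test_function ?u2" by (rule test_function_deriv[OF u1])
  obtain R C where 0: "\<forall>z s. u (z, s) \<noteq> 0 \<longrightarrow> norm z \<le> R \<and> \<bar>s\<bar> \<le> R" "\<forall>z s. cmod (u (z, s)) \<le> C"
    using test_slice_bounds[OF u] by blast
  obtain R1 C1 where 1: "\<forall>z s. ?u1 (z, s) \<noteq> 0 \<longrightarrow> norm z \<le> R1 \<and> \<bar>s\<bar> \<le> R1" "\<forall>z s. cmod (?u1 (z, s)) \<le> C1"
    using test_slice_bounds[OF u1] by blast
  obtain C2 where 2: "\<forall>z s. cmod (?u2 (z, s)) \<le> C2"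
    using test_slice_bounds[OF u2] by blast
  obtain B where B: "B > 0" "\<forall>z. (LINT s|lborel. cmod (u (z, s))) \<le> B"
    using test_slice_integral_bound[OF u] by blast
  obtain B2 where B2: "B2 > 0" "\<forall>z. (LINT s|lborel. cmod (?u2 (z, s))) \<le> B2"
    using test_slice_integral_bound[OF u2] by blast
  have d1: "ft \<sigma> (\<lambda>s. ?u1 (z, s)) t = - (\<i> * \<sigma> * t) * ft \<sigma> (\<lambda>s. u (z, s)) t" for z t
    by (rule ft_deriv[OF test_slice_deriv[OF u], where R = R and C = C and C' = C1])
      (use 0 1(2) test_slice_integrable[OF u1] in auto)
  have d2: "ft \<sigma> (\<lambda>s. ?u2 (z, s)) t = - (\<i> * \<sigma> * t) * ft \<sigma> (\<lambda>s. ?u1 (z, s)) t" for z t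
    by (rule ft_deriv[OF test_slice_deriv[OF u1], where R = R1 and C = C1 and C' = C2])
      (use 1 2 test_slice_integrable[OF u2] in auto)
  \<comment> \<open>Since \<sigma> squares to 1, the two factors multiply to - t^2, so u minus its
    second derivative has the transform of u multiplied by 1 + t^2.\<close>
  have dd: "ft \<sigma> (\<lambda>s. ?u2 (z, s)) t = - complex_of_real (t\<^sup>2) * ft \<sigma> (\<lambda>s. u (z, s)) t" for z t
  proof -
    have "(\<i> * \<sigma> * t) * (\<i> * \<sigma> * t) = - complex_of_real (\<sigma>\<^sup>2 * t\<^sup>2)"
      by (simp add: power2_eq_square mult_ac)
    then show ?thesis unfolding d2 d1 \<sigma> by (simp flip: mult.assoc)
  qed
  let ?C = "B + B2"
  show ?thesis
  proof (rule exI[of _ R], rule exI[of _ ?C], intro conjI allI)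
    show "?C > 0" using B(1) B2(1) by simp
    fix z t
    show "cmod (pft_test \<sigma> u (z, t)) \<le> indicator (cball 0 R) z * (?C / (1 + t\<^sup>2))"
    proof (cases "norm z \<le> R")
      case True
      have "complex_of_real (1 + t\<^sup>2) * ft \<sigma> (\<lambda>s. u (z, s)) t = ft \<sigma> (\<lambda>s. u (z, s)) t - ft \<sigma> (\<lambda>s. ?u2 (z, s)) t"
        unfolding dd by (simp add: algebra_simps)
      then have "cmod (complex_of_real (1 + t\<^sup>2) * ft \<sigma> (\<lambda>s. u (z, s)) t) \<le> cmod (ft \<sigma> (\<lambda>s. u (z, s)) t) + cmod (ft \<sigma> (\<lambda>s. ?u2 (z, s)) t)"
        by (simp only: norm_triangle_ineq4)
      also have "\<dots> \<le> ?C"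
        using ft_bound[OF test_slice_integrable[OF u], of \<sigma> z t] ft_bound[OF test_slice_integrable[OF u2], of \<sigma> z t]
          B(2)[rule_format, of z] B2(2)[rule_format, of z] by linarith
      finally have "(1 + t\<^sup>2) * cmod (ft \<sigma> (\<lambda>s. u (z, s)) t) \<le> ?C"
        by (simp only: norm_mult norm_of_real) (simp add: abs_of_nonneg)
      moreover have "0 < 1 + t\<^sup>2" by (simp add: add_pos_nonneg)
      ultimately show ?thesis
        using True by (simp add: pft_test_ft pos_le_divide_eq mult.commute)
    next
      case False
      then have "u (z, s) = 0" for s using 0(1) by blast
      then show ?thesis using False by (simp add: pft_test_def)
    qed
  qed
qed

lemma integrable_indicator_cball_mu: "integrable mu (\<lambda>z::complex^'n. indicator (cball 0 R) z :: real)"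
  by (subst integrable_mu_iff)
    (auto intro!: integrable_real_indicator borel_measurable_indicator simp: emeasure_lborel_cball_finite[unfolded infinity_ennreal_def])

lemma inverse_1_plus_sq_le_1: "1 / (1 + (t::real)\<^sup>2) \<le> 1"
  by (simp add: divide_le_eq add_pos_nonneg)

lemma pft_test_L2:
  assumes u: "test_function (u :: ('n::finite) heis \<Rightarrow> complex)" and \<sigma>: "\<sigma>\<^sup>2 = 1"
  shows "pft_test \<sigma> u \<in> L2 mu_heis"
proof -
  obtain R C where RC: "C > 0" "\<forall>z t. cmod (pft_test \<sigma> u (z, t)) \<le> indicator (cball 0 R) z * (C / (1 + t\<^sup>2))"
    using pft_test_bound[OF u \<sigma>] by blast
  have m [measurable]: "pft_test \<sigma> u \<in> borel_measurable borel"
    by (rule pft_test_measurable[OF test_function_borel[OF u]])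
  have "integrable mu_heis (\<lambda>x. (cmod (pft_test \<sigma> u x))\<^sup>2)"
  proof (rule integrable_heis_dominated[OF _ integrable_indicator_cball_mu[of R] integrable_mult_right[OF integrable_inverse_1_plus_sq, of "C\<^sup>2"]])
    fix z t
    have "(cmod (pft_test \<sigma> u (z, t)))\<^sup>2 \<le> (indicator (cball 0 R) z * (C / (1 + t\<^sup>2)))\<^sup>2"
      by (intro power_mono RC(2)[rule_format]) simp
    also have "\<dots> = indicator (cball 0 R) z * (C\<^sup>2 * (1 / (1 + t\<^sup>2)) * (1 / (1 + t\<^sup>2)))"
      by (auto simp: indicator_def power2_eq_square)
    also have "\<dots> \<le> indicator (cball 0 R) z * (C\<^sup>2 * (1 / (1 + t\<^sup>2)) * 1)"
      by (intro mult_left_mono inverse_1_plus_sq_le_1) (auto simp: add_nonneg_nonneg)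
    finally show "norm ((cmod (pft_test \<sigma> u (z, t)))\<^sup>2) \<le> indicator (cball 0 R) z * (C\<^sup>2 * (1 / (1 + t\<^sup>2)))"
      by simp
  qed auto
  then show ?thesis using m by (simp add: L2_def measurable_cong_sets[OF sets_mu_heis refl])
qed

lemma pft_test_multiplication:
  fixes u v :: "('n::finite) heis \<Rightarrow> complex"
  assumes u: "\<And>z. integrable lborel (\<lambda>s. u (z, s))" and v: "\<And>z. integrable lborel (\<lambda>s. v (z, s))"
    and uv: "integrable mu_heis (\<lambda>x. pft_test \<sigma> u x * v x)" "integrable mu_heis (\<lambda>x. u x * pft_test \<sigma> v x)"
  shows "(LINT x|mu_heis. pft_test \<sigma> u x * v x) = (LINT x|mu_heis. u x * pft_test \<sigma> v x)"
  unfolding integral_heis_iterated[OF uv(1)] integral_heis_iterated[OF uv(2)]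
  by (simp add: pft_test_ft ft_multiplication[OF u v])

lemma pft_test_parseval:
  assumes u: "test_function (u :: ('n::finite) heis \<Rightarrow> complex)" and v: "test_function v" and \<sigma>: "\<sigma>\<^sup>2 = 1"
  shows "(LINT x|mu_heis. pft_test \<sigma> u x * cnj (pft_test \<sigma> v x)) = 2 * pi * (LINT x|mu_heis. u x * cnj (v x))"
proof -
  have i1: "integrable mu_heis (\<lambda>x. pft_test \<sigma> u x * cnj (pft_test \<sigma> v x))"
    by (intro L2_mult_integrable L2_cnj pft_test_L2 u v \<sigma>)
  have i2: "integrable mu_heis (\<lambda>x. u x * cnj (v x))"
    by (intro L2_mult_integrable L2_cnj test_function_L2_heis u v)
  obtain R C where RC: "\<forall>z s. u (z, s) \<noteq> 0 \<longrightarrow> norm z \<le> R \<and> \<bar>s\<bar> \<le> R" "\<forall>z s. cmod (u (z, s)) \<le> C"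
    using test_slice_bounds[OF u] by blast
  obtain R' C' where RC': "\<forall>z s. v (z, s) \<noteq> 0 \<longrightarrow> norm z \<le> R' \<and> \<bar>s\<bar> \<le> R'" "\<forall>z s. cmod (v (z, s)) \<le> C'"
    using test_slice_bounds[OF v] by blast
  obtain Ru Cu where Cu: "Cu > 0" "\<forall>z t. cmod (pft_test \<sigma> u (z, t)) \<le> indicator (cball 0 Ru) z * (Cu / (1 + t\<^sup>2))"
    using pft_test_bound[OF u \<sigma>] by blast
  obtain Rv Cv where Cv: "Cv > 0" "\<forall>z t. cmod (pft_test \<sigma> v (z, t)) \<le> indicator (cball 0 Rv) z * (Cv / (1 + t\<^sup>2))"
    using pft_test_bound[OF v \<sigma>] by blast
  have fub: "cmod (pft_test \<sigma> u (z, t)) \<le> Cu * (1 / (1 + t\<^sup>2))" for z t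
  proof -
    have "indicator (cball 0 Ru) z * (Cu / (1 + t\<^sup>2)) \<le> 1 * (Cu * (1 / (1 + t\<^sup>2)))"
      using Cu(1) by (intro mult_mono) (auto simp: indicator_def)
    then show ?thesis using Cu(2)[rule_format, of z t] by simp
  qed
  have fvb: "cmod (pft_test \<sigma> v (z, t)) \<le> Cv" for z t
  proof -
    have "indicator (cball 0 Rv) z * (Cv / (1 + t\<^sup>2)) \<le> 1 * (Cv * (1 / (1 + t\<^sup>2)))"
      using Cv(1) by (intro mult_mono) (auto simp: indicator_def)
    also have "\<dots> \<le> 1 * (Cv * 1)"
      using Cv(1) by (intro mult_left_mono inverse_1_plus_sq_le_1) auto
    finally show ?thesis using Cv(2)[rule_format, of z t] by simp
  qed
  have 1: "(LINT t|lborel. ft \<sigma> (\<lambda>s. u (z, s)) t * cnj (ft \<sigma> (\<lambda>s. v (z, s)) t))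
     = 2 * pi * (LINT s|lborel. u (z, s) * cnj (v (z, s)))" for z
  proof (rule ft_parseval[where R = "max R R'"])
    have [measurable]: "ft \<sigma> (\<lambda>s. u (z, s)) \<in> borel_measurable borel" "ft \<sigma> (\<lambda>s. v (z, s)) \<in> borel_measurable borel"
      by (intro ft_measurable borel_measurable_continuous_onI[OF test_slice_continuous] u v)+
    show "integrable lborel (\<lambda>t. ft \<sigma> (\<lambda>s. u (z, s)) t * cnj (ft \<sigma> (\<lambda>s. v (z, s)) t))"
    proof (rule Bochner_Integration.integrable_bound[OF integrable_mult_right[OF integrable_inverse_1_plus_sq, of "Cu * Cv"]])
      show "AE t in lborel. norm (ft \<sigma> (\<lambda>s. u (z, s)) t * cnj (ft \<sigma> (\<lambda>s. v (z, s)) t)) \<le> norm (Cu * Cv * (1 / (1 + t\<^sup>2)))"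
      proof (intro AE_I2)
        fix t :: real
        have "norm (ft \<sigma> (\<lambda>s. u (z, s)) t * cnj (ft \<sigma> (\<lambda>s. v (z, s)) t)) \<le> (Cu * (1 / (1 + t\<^sup>2))) * Cv"
          unfolding norm_mult complex_mod_cnj using fub[of z t] fvb[of z t] Cu(1)
          by (intro mult_mono) (auto simp: pft_test_ft intro: order_trans[OF norm_ge_zero])
        also have "\<dots> \<le> norm (Cu * Cv * (1 / (1 + t\<^sup>2)))"
          unfolding real_norm_def by (rule order_trans[OF _ abs_ge_self]) (simp add: mult_ac)
        finally show "norm (ft \<sigma> (\<lambda>s. u (z, s)) t * cnj (ft \<sigma> (\<lambda>s. v (z, s)) t)) \<le> norm (Cu * Cv * (1 / (1 + t\<^sup>2)))" .
      qed
    qed measurable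
    show "\<bar>s\<bar> \<le> max R R'" if "u (z, s) \<noteq> 0" for s using RC(1) that by fastforce
    show "\<bar>s\<bar> \<le> max R R'" if "v (z, s) \<noteq> 0" for s using RC'(1) that by fastforce
  qed (use test_slice_continuous u v \<sigma> in auto)
  show ?thesis
    unfolding integral_heis_iterated[OF i1] integral_heis_iterated[OF i2] pft_test_ft 1
    by simp
qed

lemma integrable_lborel_pft_slice:
  fixes V :: "('n::finite) heis \<Rightarrow> complex"
  assumes "V \<in> borel_measurable borel" "\<And>z t. cmod (V (z, t)) \<le> C / (1 + t\<^sup>2)"
  shows "integrable lborel (\<lambda>t. V (z, t))"
proof (rule Bochner_Integration.integrable_bound[OF integrable_mult_right[OF integrable_inverse_1_plus_sq, of C]])
  show "AE t in lborel. norm (V (z, t)) \<le> norm (C * (1 / (1 + t\<^sup>2)))"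
  proof (intro AE_I2)
    fix t
    have "norm (V (z, t)) \<le> C * (1 / (1 + t\<^sup>2))" using assms(2) by simp
    then show "norm (V (z, t)) \<le> norm (C * (1 / (1 + t\<^sup>2)))"
      unfolding real_norm_def by (rule order_trans[OF _ abs_ge_self])
  qed
qed (use slice_measurable(1)[OF assms(1)] in simp)

section \<open>The extended transform on L2\<close>

lemma pft_L2: "pft \<sigma> u U \<Longrightarrow> u \<in> L2 mu_heis" "pft \<sigma> u U \<Longrightarrow> U \<in> L2 mu_heis"
  by (simp_all add: pft_def)

lemma pft_testI:
  assumes "test_function u" "\<sigma>\<^sup>2 = 1"
  shows "pft \<sigma> u (pft_test \<sigma> u)"
  unfolding pft_def
proof (intro conjI exI[of _ "\<lambda>k. u"])
  show "pft_test \<sigma> u \<in> L2 mu_heis" by (rule pft_test_L2[OF assms])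
qed (use assms test_function_L2_heis in auto)

lemma pft_parseval:
  assumes u: "pft \<sigma> u U" and v: "pft \<sigma> v V" and \<sigma>: "\<sigma>\<^sup>2 = 1"
  shows "(LINT x|mu_heis. U x * cnj (V x)) = 2 * pi * (LINT x|mu_heis. u x * cnj (v x))"
proof -
  obtain g where g: "\<And>k. test_function (g k)" "L2_tendsto mu_heis g u" "L2_tendsto mu_heis (\<lambda>k. pft_test \<sigma> (g k)) U"
    using u unfolding pft_def by blast
  obtain h where h: "\<And>k. test_function (h k)" "L2_tendsto mu_heis h v" "L2_tendsto mu_heis (\<lambda>k. pft_test \<sigma> (h k)) V"
    using v unfolding pft_def by blast
  have "(\<lambda>k. LINT x|mu_heis. pft_test \<sigma> (g k) x * cnj (pft_test \<sigma> (h k) x)) \<longlonglongrightarrow> (LINT x|mu_heis. U x * cnj (V x))"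
    by (intro L2_tendsto_integral_mult L2_tendsto_cnj L2_cnj pft_test_L2 g h \<sigma> pft_L2[OF u] pft_L2[OF v])
  moreover have "(\<lambda>k. 2 * pi * (LINT x|mu_heis. g k x * cnj (h k x))) \<longlonglongrightarrow> 2 * pi * (LINT x|mu_heis. u x * cnj (v x))"
    by (intro tendsto_mult tendsto_const L2_tendsto_integral_mult L2_tendsto_cnj L2_cnj test_function_L2_heis g h pft_L2[OF u] pft_L2[OF v])
  ultimately show ?thesis
    using pft_test_parseval[OF g(1) h(1) \<sigma>] by (simp add: LIMSEQ_unique)
qed

lemma pft_multiplication:
  assumes u: "pft \<sigma> u U" and v: "pft \<sigma> v V" and \<sigma>: "\<sigma>\<^sup>2 = 1"
  shows "(LINT x|mu_heis. U x * v x) = (LINT x|mu_heis. u x * V x)"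
proof -
  obtain g where g: "\<And>k. test_function (g k)" "L2_tendsto mu_heis g u" "L2_tendsto mu_heis (\<lambda>k. pft_test \<sigma> (g k)) U"
    using u unfolding pft_def by blast
  obtain h where h: "\<And>k. test_function (h k)" "L2_tendsto mu_heis h v" "L2_tendsto mu_heis (\<lambda>k. pft_test \<sigma> (h k)) V"
    using v unfolding pft_def by blast
  have "(\<lambda>k. LINT x|mu_heis. pft_test \<sigma> (g k) x * h k x) \<longlonglongrightarrow> (LINT x|mu_heis. U x * v x)"
    by (intro L2_tendsto_integral_mult pft_test_L2 test_function_L2_heis g h \<sigma> pft_L2[OF u] pft_L2[OF v])
  moreover have "(\<lambda>k. LINT x|mu_heis. g k x * pft_test \<sigma> (h k) x) \<longlonglongrightarrow> (LINT x|mu_heis. u x * V x)"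
    by (intro L2_tendsto_integral_mult pft_test_L2 test_function_L2_heis g h \<sigma> pft_L2[OF u] pft_L2[OF v])
  moreover have "(LINT x|mu_heis. pft_test \<sigma> (g k) x * h k x) = (LINT x|mu_heis. g k x * pft_test \<sigma> (h k) x)" for k
    by (intro pft_test_multiplication L2_mult_integrable pft_test_L2 test_function_L2_heis g h \<sigma> test_slice_integrable)
  ultimately show ?thesis
    by (simp add: LIMSEQ_unique)
qed

lemma pft_test_diff:
  assumes "test_function u" "test_function v"
  shows "pft_test \<sigma> (\<lambda>x. u x - v x) = (\<lambda>x. pft_test \<sigma> u x - pft_test \<sigma> v x)"
proof (rule ext)
  fix x
  have "integrable lborel (\<lambda>s. cis (\<sigma> * snd x * s) * u (fst x, s))" "integrable lborel (\<lambda>s. cis (\<sigma> * snd x * s) * v (fst x, s))"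
    by (intro integrable_cis_mult test_slice_integrable assms)+
  then show "pft_test \<sigma> (\<lambda>x. u x - v x) x = pft_test \<sigma> u x - pft_test \<sigma> v x"
    by (simp add: pft_test_def right_diff_distrib)
qed

lemma test_function_diff: "test_function f \<Longrightarrow> test_function g \<Longrightarrow> test_function (\<lambda>x. f x - g x)"
  using test_function_add[of f "\<lambda>x. (-1) * g x"] test_function_cmult[of g "-1"] by simp

lemma L2_tendsto_cmult:
  assumes "\<And>k. f k \<in> L2 M" "F \<in> L2 M" "L2_tendsto M f F"
  shows "L2_tendsto M (\<lambda>k x. c * f k x) (\<lambda>x. c * F x)"
proof -
  have "(\<lambda>k. (cmod c)\<^sup>2 * nsq M (\<lambda>x. f k x - F x)) \<longlonglongrightarrow> (cmod c)\<^sup>2 * 0"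
    using assms by (intro tendsto_intros) (simp add: L2_tendsto_iff)
  then show ?thesis
    using assms by (subst L2_tendsto_iff) (auto intro: L2_cmult simp flip: right_diff_distrib nsq_cmult)
qed

lemma pft_cmult:
  assumes "pft \<sigma> u U" and \<sigma>: "\<sigma>\<^sup>2 = 1"
  shows "pft \<sigma> (\<lambda>x. c * u x) (\<lambda>x. c * U x)"
proof -
  obtain g where g: "\<And>k. test_function (g k)" "L2_tendsto mu_heis g u" "L2_tendsto mu_heis (\<lambda>k. pft_test \<sigma> (g k)) U"
    using assms unfolding pft_def by blast
  have "pft_test \<sigma> (\<lambda>x. c * g k x) = (\<lambda>x. c * pft_test \<sigma> (g k) x)" for k
    by (simp add: pft_test_def fun_eq_iff mult.left_commute)
  then show ?thesis
    unfolding pft_def using pft_L2[OF assms(1)] g(1) L2_tendsto_cmult[OF test_function_L2_heis[OF g(1)] _ g(2), of c]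
      L2_tendsto_cmult[OF pft_test_L2[OF g(1) \<sigma>] _ g(3), of c]
    by (auto intro!: L2_cmult exI[of _ "\<lambda>k x. c * g k x"] test_function_cmult)
qed

lemma pft_cong:
  assumes "pft \<sigma> u U" "U' \<in> borel_measurable borel" "AE x in mu_heis. U x = U' x"
  shows "pft \<sigma> u U'"
proof -
  have "U' \<in> L2 mu_heis"
    by (rule L2_cong_AE[OF pft_L2(2)[OF assms(1)] _ assms(3)])
      (use assms(2) in \<open>simp add: measurable_cong_sets[OF sets_mu_heis refl]\<close>)
  then show ?thesis
    using assms(1) L2_tendsto_cong_AE[OF assms(3)] unfolding pft_def by blast
qed

lemma pft_exists:
  fixes u :: "('n::finite) heis \<Rightarrow> complex"
  assumes u: "u \<in> L2 mu_heis" and \<sigma>: "\<sigma>\<^sup>2 = 1"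
  obtains U where "pft \<sigma> u U"
proof -
  obtain g where g: "\<And>k. test_function (g k)" "L2_tendsto mu_heis g u"
    using test_functions_dense_heis[OF u] by blast
  have gL2: "g k \<in> L2 mu_heis" for k by (rule test_function_L2_heis[OF g(1)])
  \<comment> \<open>Parseval for differences: up to the factor 2 pi the transform is an isometry on
    test functions, so an approximating sequence is mapped to a Cauchy sequence.\<close>
  have iso: "nsq mu_heis (\<lambda>x. pft_test \<sigma> (g m) x - pft_test \<sigma> (g k) x) = 2 * pi * nsq mu_heis (\<lambda>x. g m x - g k x)" for m k
  proof -
    have d: "test_function (\<lambda>x. g m x - g k x)" by (intro test_function_diff g)
    have e: "complex_of_real (nsq mu_heis h) = (LINT x|mu_heis. h x * cnj (h x))" for h :: "'n heis \<Rightarrow> complex"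
      by (simp add: nsq_def complex_norm_square flip: integral_complex_of_real of_real_power)
    have "complex_of_real (nsq mu_heis (pft_test \<sigma> (\<lambda>x. g m x - g k x))) = complex_of_real (2 * pi * nsq mu_heis (\<lambda>x. g m x - g k x))"
      unfolding of_real_mult e pft_test_parseval[OF d d \<sigma>] by simp
    then show ?thesis
      unfolding of_real_eq_iff by (simp add: pft_test_diff[OF g(1) g(1)])
  qed
  have gC: "(\<lambda>k. nsq mu_heis (\<lambda>x. g k x - u x)) \<longlonglongrightarrow> 0"
    using g(2) gL2 u by (simp add: L2_tendsto_iff)
  obtain U where U: "U \<in> L2 mu_heis" "L2_tendsto mu_heis (\<lambda>k. pft_test \<sigma> (g k)) U"
  proof (rule L2_complete[of "\<lambda>k. pft_test \<sigma> (g k)" mu_heis])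
    show "pft_test \<sigma> (g k) \<in> L2 mu_heis" for k by (rule pft_test_L2[OF g(1) \<sigma>])
    fix e :: real assume e: "e > 0"
    then have "e / (8 * pi) > 0" by simp
    from order_tendstoD(2)[OF gC this] obtain N where N: "\<And>k. k \<ge> N \<Longrightarrow> nsq mu_heis (\<lambda>x. g k x - u x) < e / (8 * pi)"
      by (auto simp: eventually_sequentially)
    show "\<exists>N. \<forall>m\<ge>N. \<forall>k\<ge>N. nsq mu_heis (\<lambda>x. pft_test \<sigma> (g m) x - pft_test \<sigma> (g k) x) \<le> e"
    proof (intro exI[of _ N] allI impI)
      fix m k assume "m \<ge> N" "k \<ge> N"
      then have "nsq mu_heis (\<lambda>x. g m x - g k x) \<le> e / (2 * pi)"
        using nsq_triangle[OF gL2[of m] u gL2[of k]] N[of m] N[of k] by (simp add: nsq_commute[of _ u])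
      then show "nsq mu_heis (\<lambda>x. pft_test \<sigma> (g m) x - pft_test \<sigma> (g k) x) \<le> e"
        unfolding iso by (simp add: field_simps)
    qed
  qed blast
  with g u that show ?thesis unfolding pft_def by blast
qed

lemma pft_test_cnj: "pft_test (- \<sigma>) u x = cnj (pft_test \<sigma> (\<lambda>x. cnj (u x)) x)"
  by (simp add: pft_test_def cis_cnj flip: Bochner_Integration.integral_cnj)

text \<open>Inversion by duality: against a test function g, the transform of U with the opposite
  sign is moved onto g, rewritten as the conjugate of the \<sigma>-transform of conj g, and
  evaluated by Parseval. Test functions then separate.\<close>

lemma pft_inversion:
  fixes u :: "('n::finite) heis \<Rightarrow> complex"
  assumes u: "pft \<sigma> u U" and \<sigma>: "\<sigma>\<^sup>2 = 1"
  shows "pft (- \<sigma>) U (\<lambda>x. 2 * pi * u x)"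
proof -
  have \<sigma>': "(- \<sigma>)\<^sup>2 = 1" using \<sigma> by simp
  obtain W where W: "pft (- \<sigma>) U W"
    using pft_exists[OF pft_L2(2)[OF u] \<sigma>'] by blast
  have "AE x in mu_heis. W x - 2 * pi * u x = 0"
  proof (rule L2_separate_heis)
    show "(\<lambda>x. W x - 2 * pi * u x) \<in> L2 mu_heis"
      by (intro L2_diff L2_cmult pft_L2[OF u] pft_L2[OF W])
    fix g :: "'n heis \<Rightarrow> complex" assume g: "test_function g"
    have gc: "test_function (\<lambda>x. cnj (g x))" by (rule test_function_cnj[OF g])
    have "(LINT x|mu_heis. W x * g x) = (LINT x|mu_heis. U x * pft_test (- \<sigma>) g x)"
      by (rule pft_multiplication[OF W pft_testI[OF g \<sigma>'] \<sigma>'])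
    also have "\<dots> = (LINT x|mu_heis. U x * cnj (pft_test \<sigma> (\<lambda>x. cnj (g x)) x))"
      by (simp only: pft_test_cnj)
    also have "\<dots> = 2 * pi * (LINT x|mu_heis. u x * cnj (cnj (g x)))"
      by (rule pft_parseval[OF u pft_testI[OF gc \<sigma>] \<sigma>])
    also have "\<dots> = (LINT x|mu_heis. 2 * pi * u x * g x)"
      by (simp add: mult.assoc)
    finally have "(LINT x|mu_heis. W x * g x) = (LINT x|mu_heis. 2 * pi * u x * g x)" .
    moreover have "integrable mu_heis (\<lambda>x. W x * g x)" "integrable mu_heis (\<lambda>x. 2 * pi * u x * g x)"
      by (intro L2_mult_integrable L2_cmult pft_L2[OF u] pft_L2[OF W] test_function_L2_heis g)+
    ultimately show "(LINT x|mu_heis. (W x - 2 * pi * u x) * g x) = 0"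
      by (simp add: left_diff_distrib)
  qed
  then show ?thesis
    using L2_measurable[OF pft_L2(1)[OF u]] by (intro pft_cong[OF W]) (auto simp: measurable_cong_sets[OF sets_mu_heis refl])
qed

text \<open>The abstract transform and the Fourier integral give the same value against every test
  function. The integral is bounded, hence locally integrable, so test functions separate the two;
  its square-integrability follows only afterwards from the agreement almost everywhere.\<close>

lemma pft_integrable:
  fixes V :: "('n::finite) heis \<Rightarrow> complex"
  assumes V: "V \<in> L2 mu_heis" and bound: "\<And>z t. cmod (V (z, t)) \<le> C / (1 + t\<^sup>2)" and \<sigma>: "\<sigma>\<^sup>2 = 1"
  shows "pft \<sigma> V (pft_test \<sigma> V)"
proof -
  obtain W where W: "pft \<sigma> V W" using pft_exists[OF V \<sigma>] by blast
  have Vm [measurable]: "V \<in> borel_measurable borel" using L2_measurable[OF V] by (simp add: measurable_cong_sets[OF sets_mu_heis refl])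
  have Wm [measurable]: "W \<in> borel_measurable borel" using L2_measurable[OF pft_L2(2)[OF W]] by (simp add: measurable_cong_sets[OF sets_mu_heis refl])
  have Fm [measurable]: "pft_test \<sigma> V \<in> borel_measurable borel" by (rule pft_test_measurable[OF Vm])
  have Vi: "integrable lborel (\<lambda>t. V (z, t))" for z
    by (rule integrable_lborel_pft_slice[OF Vm bound])
  define B where "B = (LINT t|lborel. C * (1 / (1 + t\<^sup>2)))"
  have B: "cmod (pft_test \<sigma> V x) \<le> B" for x
  proof -
    have "cmod (pft_test \<sigma> V (fst x, snd x)) \<le> (LINT t|lborel. cmod (V (fst x, t)))"
      unfolding pft_test_ft by (rule ft_bound[OF Vi])
    also have "\<dots> \<le> B"
      unfolding B_def using bound
      by (intro integral_mono integrable_norm Vi integrable_mult_right integrable_inverse_1_plus_sq) simp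
    finally show ?thesis by simp
  qed
  have Vg: "integrable mu_heis (\<lambda>x. pft_test \<sigma> V x * g x)" if g: "test_function g" for g
  proof (rule Bochner_Integration.integrable_bound)
    show "integrable mu_heis (\<lambda>x. B * cmod (g x))"
      using test_function_integrable[OF g] test_function_borel[OF g] by (intro integrable_mult_right integrable_norm) (simp add: integrable_mu_heis_iff)
    have [measurable]: "g \<in> borel_measurable borel" by (rule test_function_borel[OF g])
    show "(\<lambda>x. pft_test \<sigma> V x * g x) \<in> borel_measurable mu_heis" by measurable
    show "AE x in mu_heis. norm (pft_test \<sigma> V x * g x) \<le> norm (B * cmod (g x))"
      unfolding norm_mult real_norm_def by (intro AE_I2 order_trans[OF mult_right_mono[OF B norm_ge_zero] abs_ge_self])
  qed
  have "AE x in mu_heis. W x - pft_test \<sigma> V x = 0"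
  proof (rule test_functions_separate_heis)
    show "(\<lambda>x. W x - pft_test \<sigma> V x) \<in> borel_measurable borel" by measurable
    show "integrable lborel (\<lambda>x. indicator (box l u) x *\<^sub>R (W x - pft_test \<sigma> V x))" for l u
    proof -
      have "integrable lborel (\<lambda>x. indicator (box l u) x *\<^sub>R W x)"
        using pft_L2(2)[OF W] by (intro integrable_indicator_box_L2) (simp add: L2_mu_heis)
      moreover have "integrable lborel (\<lambda>x. indicator (box l u) x *\<^sub>R pft_test \<sigma> V x)"
      proof (rule Bochner_Integration.integrable_bound)
        show "integrable lborel (\<lambda>x. B * indicator (box l u) x)"
          by (intro integrable_mult_right integrable_real_indicator) (auto simp: emeasure_lborel_box_finite[unfolded infinity_ennreal_def])
        show "AE x in lborel. norm (indicator (box l u) x *\<^sub>R pft_test \<sigma> V x) \<le> norm (B * indicator (box l u) x)"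
          using B order_trans[OF B abs_ge_self] by (intro AE_I2) (auto simp: indicator_def)
      qed measurable
      ultimately show ?thesis
        using Bochner_Integration.integrable_diff by (simp add: scaleR_diff_right)
    qed
    fix g :: "'n heis \<Rightarrow> complex" assume g: "test_function g"
    have "(LINT x|mu_heis. W x * g x) = (LINT x|mu_heis. V x * pft_test \<sigma> g x)"
      by (rule pft_multiplication[OF W pft_testI[OF g \<sigma>] \<sigma>])
    also have "\<dots> = (LINT x|mu_heis. pft_test \<sigma> V x * g x)"
      by (intro pft_test_multiplication[symmetric] Vi Vg g L2_mult_integrable V pft_test_L2 \<sigma> test_slice_integrable)
    finally show "(LINT x|mu_heis. (W x - pft_test \<sigma> V x) * g x) = 0"
      using Vg[OF g] L2_mult_integrable[OF pft_L2(2)[OF W] test_function_L2_heis[OF g]]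
      by (simp add: left_diff_distrib)
  qed
  then show ?thesis
    by (intro pft_cong[OF W Fm]) auto
qed

section \<open>Gaussian kernels\<close>

text \<open>The imaginary part of the Hermitian form whose diagonal is \<open>psi\<close>. It is the
  symplectic form in the Heisenberg translations and the phase of the Bergman kernel.\<close>

definition om :: "real^'n \<Rightarrow> complex^'n \<Rightarrow> complex^'n \<Rightarrow> real" where
  "om lam z w = Im (\<Sum>j\<in>UNIV. complex_of_real (lam $ j) * z $ j * cnj (w $ j))"

lemma continuous_on_psi [continuous_intros]:
  "continuous_on S f \<Longrightarrow> continuous_on S (\<lambda>x. psi lam (f x))"
  unfolding psi_def by (intro continuous_intros)

lemma continuous_on_om [continuous_intros]:
  "continuous_on S f \<Longrightarrow> continuous_on S g \<Longrightarrow> continuous_on S (\<lambda>x. om lam (f x) (g x))"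
  unfolding om_def by (intro continuous_intros)

lemma borel_measurable_psi [measurable]: "psi lam \<in> borel_measurable borel"
  using continuous_on_psi[OF continuous_on_id] by (rule borel_measurable_continuous_onI)

lemma borel_measurable_om [measurable (raw)]:
  fixes f g :: "'a \<Rightarrow> complex^'n"
  assumes "f \<in> borel_measurable M" "g \<in> borel_measurable M"
  shows "(\<lambda>x. om lam (f x) (g x)) \<in> borel_measurable M"
proof -
  have "(\<lambda>p. om lam (fst p) (snd p)) \<in> borel_measurable (borel \<Otimes>\<^sub>M borel)"
    unfolding borel_prod by (intro borel_measurable_continuous_onI continuous_intros)
  moreover have "(\<lambda>x. (f x, g x)) \<in> M \<rightarrow>\<^sub>M borel \<Otimes>\<^sub>M borel" using assms by measurable
  ultimately have "(\<lambda>x. om lam (fst (f x, g x)) (snd (f x, g x))) \<in> borel_measurable M"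
    by (rule measurable_compose[rotated])
  then show ?thesis by simp
qed

lemma psi_scaleR: "psi lam (r *\<^sub>R z) = r\<^sup>2 * psi lam z"
  by (simp add: psi_def power_mult_distrib sum_distrib_left mult_ac)

lemma psi_minus_commute: "psi lam (z - w) = psi lam (w - z)"
  by (simp add: psi_def norm_minus_commute)

lemma om_self: "om lam z z = 0"
  by (simp add: om_def mult.assoc complex_mult_cnj flip: of_real_mult of_real_power of_real_add)

lemma om_add_left: "om lam (z + w) v = om lam z v + om lam w v"
  by (simp add: om_def algebra_simps sum.distrib)

lemma om_scaleR_left: "om lam (r *\<^sub>R z) v = r * om lam z v"
  by (simp add: om_def sum_distrib_left algebra_simps)

lemma om_antisym: "om lam w z = - om lam z w"
  by (simp add: om_def sum_negf[symmetric] algebra_simps)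

lemma power2_norm_vec: "(norm (z :: complex^'n))\<^sup>2 = (\<Sum>j\<in>UNIV. (cmod (z $ j))\<^sup>2)"
  by (simp add: norm_vec_def L2_set_def sum_nonneg)

section \<open>Gaussian integrals and affine substitutions\<close>

lemma integrable_gaussian_norm:
  assumes "a > 0"
  shows "integrable lborel (\<lambda>z::'a::euclidean_space. exp (- a * (norm z)\<^sup>2))"
proof (rule integrableI_bounded)
  have fin: "(\<integral>\<^sup>+x. ennreal (exp (- a * x\<^sup>2)) \<partial>lborel) < \<infinity>"
  proof -
    have "integrable lborel (\<lambda>t::real. exp (- a * t\<^sup>2))"
      using integrable_norm[OF gaussian_fourier(1)[of "sqrt (2 * a)" 0]] assms
      by (simp add: power_mult_distrib)
    then show ?thesis by (simp add: integrable_iff_bounded)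
  qed
  have "ennreal (norm (exp (- a * (norm z)\<^sup>2))) = (\<Prod>b\<in>Basis. ennreal (exp (- a * (z \<bullet> b)\<^sup>2)))" for z :: 'a
  proof -
    have "(norm z)\<^sup>2 = (\<Sum>b\<in>Basis. (z \<bullet> b)\<^sup>2)"
      unfolding power2_norm_eq_inner by (subst euclidean_inner) (simp add: power2_eq_square)
    then have "exp (- a * (norm z)\<^sup>2) = (\<Prod>b\<in>Basis. exp (- a * (z \<bullet> b)\<^sup>2))"
      by (simp add: sum_distrib_left exp_sum flip: sum_negf)
    then show ?thesis by (simp add: prod_ennreal abs_prod)
  qed
  then have "(\<integral>\<^sup>+z. ennreal (norm (exp (- a * (norm z)\<^sup>2))) \<partial>(lborel :: 'a measure))
      = (\<integral>\<^sup>+z. (\<Prod>b\<in>Basis. ennreal (exp (- a * (z \<bullet> b)\<^sup>2))) \<partial>(lborel :: 'a measure))" by simp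
  also have "\<dots> = (\<Prod>b\<in>(Basis::'a set). \<integral>\<^sup>+x. ennreal (exp (- a * x\<^sup>2)) \<partial>lborel)"
    by (rule nn_integral_lborel_prod) auto
  also have "\<dots> < \<infinity>"
    using fin by (simp add: power_less_top_ennreal)
  finally show "(\<integral>\<^sup>+z. ennreal (norm (exp (- a * (norm z)\<^sup>2))) \<partial>(lborel :: 'a measure)) < \<infinity>" .
qed simp

lemma integral_lborel_affine:
  fixes f :: "'a::euclidean_space \<Rightarrow> 'b::{banach, second_countable_topology}"
  assumes [measurable]: "f \<in> borel_measurable borel" and r: "r > 0"
  shows "(LINT x|lborel. f x) = r ^ DIM('a) *\<^sub>R (LINT y|lborel. f (z + r *\<^sub>R y))"
proof -
  have "(LINT x|lborel. f x) = (LINT x|density (distr lborel borel (\<lambda>x. z + r *\<^sub>R x)) (\<lambda>_. \<bar>r\<bar> ^ DIM('a)). f x)"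
    using lborel_affine[of r z] r by (simp flip: ennreal_power)
  also have "\<dots> = (LINT x|distr lborel borel (\<lambda>x. z + r *\<^sub>R x). (\<bar>r\<bar> ^ DIM('a)) *\<^sub>R f x)"
    by (rule integral_density) auto
  also have "\<dots> = (LINT y|lborel. (\<bar>r\<bar> ^ DIM('a)) *\<^sub>R f (z + r *\<^sub>R y))"
    by (rule integral_distr) auto
  finally show ?thesis using r by simp
qed

lemma integrable_lborel_affine:
  fixes f :: "'a::euclidean_space \<Rightarrow> 'b::{banach, second_countable_topology}"
  assumes f: "integrable lborel f" and r: "r > 0"
  shows "integrable lborel (\<lambda>y. f (z + r *\<^sub>R y))"
proof -
  have [measurable]: "f \<in> borel_measurable borel" using f by auto
  have "integrable (density (distr lborel borel (\<lambda>x. z + r *\<^sub>R x)) (\<lambda>_. \<bar>r\<bar> ^ DIM('a))) f"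
    using lborel_affine[of r z] r f by (simp flip: ennreal_power)
  then have "integrable (distr lborel borel (\<lambda>x. z + r *\<^sub>R x)) (\<lambda>x. (\<bar>r\<bar> ^ DIM('a)) *\<^sub>R f x)"
    by (subst (asm) integrable_density) auto
  then show ?thesis
    using r by (subst (asm) integrable_scaleR_iff) (auto simp: integrable_distr_eq)
qed

lemma integral_mu_affine:
  fixes f :: "complex^'n \<Rightarrow> 'b::{banach, second_countable_topology}"
  assumes [measurable]: "f \<in> borel_measurable borel" and r: "r > 0"
  shows "(LINT x|mu. f x) = (r\<^sup>2) ^ CARD('n) *\<^sub>R (LINT y|mu. f (z + r *\<^sub>R y))"
  using integral_lborel_affine[OF assms, of z]
  by (simp add: integral_mu mult_ac flip: power_mult)

lemma integrable_mu_affine: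
  fixes f :: "complex^'n \<Rightarrow> 'b::{banach, second_countable_topology}"
  assumes f: "integrable mu f" and r: "r > 0"
  shows "integrable mu (\<lambda>y. f (z + r *\<^sub>R y))"
proof -
  have m [measurable]: "f \<in> borel_measurable borel"
    using borel_measurable_integrable[OF f] by (simp add: measurable_cong_sets[OF sets_mu refl])
  show ?thesis
    using integrable_lborel_affine[OF _ r, of f z] f by (simp add: integrable_mu_iff)
qed

lemma integral_mu_translate:
  fixes f :: "complex^'n \<Rightarrow> 'b::{banach, second_countable_topology}"
  assumes "f \<in> borel_measurable borel"
  shows "(LINT y|mu. f (y - z)) = (LINT x|mu. f x)"
  using integral_mu_affine[OF assms, of 1 "- z"] by (simp add: add.commute)

lemma integrable_mu_translate:
  fixes f :: "complex^'n \<Rightarrow> 'b::{banach, second_countable_topology}"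
  assumes "integrable mu f"
  shows "integrable mu (\<lambda>y. f (y - z))"
  using integrable_mu_affine[OF assms, of 1 "- z"] by (simp add: add.commute)

locale positive_weights =
  fixes lam :: "real^'n"
  assumes lam_pos: "\<And>j. lam $ j > 0"
begin

lemma psi_nonneg: "0 \<le> psi lam z"
  unfolding psi_def using lam_pos by (intro sum_nonneg mult_nonneg_nonneg) (auto intro: less_imp_le)

lemma psi_lower_bound: "\<exists>l>0. \<forall>z. l * (norm z)\<^sup>2 \<le> psi lam z"
proof (intro exI conjI allI)
  let ?l = "Min (range (\<lambda>j. lam $ j))"
  show "?l > 0" using lam_pos by (subst Min_gr_iff) auto
  fix z
  show "?l * (norm z)\<^sup>2 \<le> psi lam z"
    unfolding psi_def power2_norm_vec sum_distrib_left
    by (intro sum_mono mult_right_mono) auto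
qed

lemma integrable_gaussian_psi:
  assumes "b > 0"
  shows "integrable mu (\<lambda>z. exp (- b * psi lam z))"
proof -
  obtain l where l: "l > 0" "\<forall>z. l * (norm z)\<^sup>2 \<le> psi lam z" using psi_lower_bound by blast
  have "integrable lborel (\<lambda>z. exp (- b * psi lam z))"
  proof (rule Bochner_Integration.integrable_bound[OF integrable_gaussian_norm])
    show "b * l > 0" using assms l by simp
    show "AE z in lborel. norm (exp (- b * psi lam z)) \<le> norm (exp (- (b * l) * (norm z)\<^sup>2))"
      using l assms by (auto intro!: mult_left_mono simp: mult.assoc)
  qed simp
  then show ?thesis by (simp add: integrable_mu_iff)
qed

text \<open>Half of the exponent pays for the polynomial factor, because y \<le> exp y. The same
  trade is made in all Gaussian bounds below.\<close>

lemma psi_exp_le: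
  assumes "b > 0"
  shows "psi lam z * exp (- b * psi lam z) \<le> (2 / b) * exp (- (b / 2) * psi lam z)"
proof -
  have "b / 2 * psi lam z \<le> exp (b / 2 * psi lam z)"
    using exp_ge_add_one_self[of "b / 2 * psi lam z"] by linarith
  then have "psi lam z * exp (- b * psi lam z) \<le> (2 / b) * exp (b / 2 * psi lam z) * exp (- b * psi lam z)"
    using assms by (intro mult_right_mono) (auto simp: field_simps)
  also have "\<dots> = (2 / b) * exp (- (b / 2) * psi lam z)"
    by (simp add: mult.assoc flip: exp_add)
  finally show ?thesis .
qed

lemma gaussian_L2: "b > 0 \<Longrightarrow> (\<lambda>z. complex_of_real (exp (- b * psi lam (z - z0)))) \<in> L2 mu"
proof -
  assume b: "b > 0"
  have "integrable mu (\<lambda>z. exp (- (2 * b) * psi lam (z - z0)))"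
    using b by (intro integrable_mu_translate[OF integrable_gaussian_psi]) simp
  moreover have "(cmod (complex_of_real (exp (- b * psi lam (z - z0)))))\<^sup>2 = exp (- (2 * b) * psi lam (z - z0))" for z
    by (simp flip: exp_double)
  ultimately show ?thesis by (simp add: L2_def)
qed

text \<open>Kept symbolic; its value is (2 pi)^n divided by the product of the weights. The
  estimates use its positivity and the scaling law \<open>integral_gaussian_psi\<close>.\<close>

definition gauss_integral :: real where "gauss_integral = (LINT z|(mu :: (complex^'n) measure). exp (- psi lam z))"

lemma gauss_integral_pos: "gauss_integral > 0"
proof -
  have i: "integrable mu (\<lambda>z. exp (- psi lam z))" using integrable_gaussian_psi[of 1] by simp
  have "gauss_integral \<noteq> 0"
  proof
    assume "gauss_integral = 0"
    then have "AE z in (mu :: (complex^'n) measure). exp (- psi lam z) = 0"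
      unfolding gauss_integral_def using i by (subst (asm) integral_nonneg_eq_0_iff_AE) auto
    then have "AE z in (lborel :: (complex^'n) measure). False"
      by (simp add: AE_mu_iff)
    then show False
      by (simp add: eventually_False ae_filter_eq_bot_iff)
  qed
  moreover have "gauss_integral \<ge> 0" by (simp add: gauss_integral_def)
  ultimately show ?thesis by simp
qed

lemma integral_gaussian_psi:
  assumes "b > 0"
  shows "(LINT z|mu. exp (- b * psi lam (z - w))) = gauss_integral / b ^ CARD('n)"
proof -
  have "(LINT z|mu. exp (- b * psi lam (z - w))) = (LINT z|mu. exp (- b * psi lam z))"
    by (rule integral_mu_translate) simp
  also have "\<dots> = ((1 / sqrt b)\<^sup>2) ^ CARD('n) *\<^sub>R (LINT y|mu. exp (- b * psi lam (0 + (1 / sqrt b) *\<^sub>R y)))"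
    using assms by (intro integral_mu_affine) auto
  also have "\<dots> = gauss_integral / b ^ CARD('n)"
    using assms by (simp add: psi_scaleR gauss_integral_def power_divide)
  finally show ?thesis .
qed

section \<open>The explicit kernel and its operator\<close>

text \<open>The explicit form of the Bergman kernel of \<open>t psi\<close>; the Bergman space is trivial for \<open>t < 0\<close>.\<close>

definition Pker :: "real \<Rightarrow> complex^'n \<Rightarrow> complex^'n \<Rightarrow> complex" where
  "Pker t z w = (if t > 0 then complex_of_real ((2 * t) ^ CARD('n) / gauss_integral * exp (- t * psi lam (z - w))) * cis (2 * t * om lam z w)
     else 0)"

lemma cmod_Pker: "cmod (Pker t z w) = (if t > 0 then (2 * t) ^ CARD('n) / gauss_integral * exp (- t * psi lam (z - w)) else 0)"
  using gauss_integral_pos by (simp add: Pker_def norm_mult norm_power norm_divide)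

lemma Pker_measurable [measurable (raw)]:
  assumes "t \<in> borel_measurable M" "f \<in> borel_measurable M" "g \<in> borel_measurable M"
  shows "(\<lambda>x. Pker (t x) (f x) (g x)) \<in> borel_measurable M"
  unfolding Pker_def using assms by measurable

lemma Pker_cnj: "cnj (Pker t z w) = Pker t w z"
  by (simp add: Pker_def cis_cnj om_antisym[of lam w z] psi_minus_commute[of lam w z])

lemma cmod_Pker_commute: "cmod (Pker t z w) = cmod (Pker t w z)"
  by (subst Pker_cnj[symmetric]) simp

lemma Pker_L2: "(\<lambda>w. Pker t z w) \<in> L2 mu"
proof (cases "t > 0")
  case True
  have "(\<lambda>w. (complex_of_real ((2 * t) ^ CARD('n) / gauss_integral) * cis (2 * t * om lam z w)) * complex_of_real (exp (- t * psi lam (w - z)))) \<in> L2 mu"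
    by (rule L2_mult_bounded[OF gaussian_L2[OF True], where C = "(2 * t) ^ CARD('n) / gauss_integral"])
      (use gauss_integral_pos True in \<open>auto simp: norm_mult norm_divide norm_power\<close>)
  then show ?thesis
    using True by (simp add: Pker_def psi_minus_commute[of lam z] mult_ac)
qed (simp add: Pker_def)

text \<open>The factor (2 t)^n meets a Gaussian of integral proportional to t^(-n), so the L1 norm
  is 2^n for every t > 0. This uniformity in t permits fibrewise application of the operator with
  one constant.\<close>

lemma Pker_integrable: "integrable mu (\<lambda>w. cmod (Pker t z w))"
  and Pker_integral_le: "(LINT w|mu. cmod (Pker t z w)) \<le> 2 ^ CARD('n)"
proof -
  have "integrable mu (\<lambda>w. cmod (Pker t z w)) \<and> (LINT w|mu. cmod (Pker t z w)) \<le> 2 ^ CARD('n)"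
  proof (cases "t > 0")
    case True
    have "integrable mu (\<lambda>w. (2 * t) ^ CARD('n) / gauss_integral * exp (- t * psi lam (w - z)))"
      using True by (intro integrable_mult_right integrable_mu_translate[OF integrable_gaussian_psi])
    moreover have "(LINT w|mu. (2 * t) ^ CARD('n) / gauss_integral * exp (- t * psi lam (w - z))) = 2 ^ CARD('n)"
      using True gauss_integral_pos unfolding integral_mult_right_zero integral_gaussian_psi[OF True]
      by (simp add: power_mult_distrib)
    ultimately show ?thesis
      using True by (simp add: cmod_Pker psi_minus_commute[of lam z])
  qed (simp add: cmod_Pker)
  then show "integrable mu (\<lambda>w. cmod (Pker t z w))" "(LINT w|mu. cmod (Pker t z w)) \<le> 2 ^ CARD('n)" by auto
qed

definition Pop :: "real \<Rightarrow> (complex^'n \<Rightarrow> complex) \<Rightarrow> complex^'n \<Rightarrow> complex" where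
  "Pop t \<phi> z = (LINT w|mu. Pker t z w * \<phi> w)"

lemma Pop_integrable: "\<phi> \<in> L2 mu \<Longrightarrow> integrable mu (\<lambda>w. Pker t z w * \<phi> w)"
  by (intro L2_mult_integrable Pker_L2)

lemma Pop_measurable:
  assumes "\<phi> \<in> borel_measurable borel"
  shows "Pop t \<phi> \<in> borel_measurable borel"
proof -
  note assms [measurable]
  show ?thesis unfolding Pop_def by measurable
qed

text \<open>Schur's test.\<close>

lemma Pop_nn_integral_le:
  assumes \<phi>: "\<phi> \<in> L2 mu"
  shows "(\<integral>\<^sup>+z. ennreal ((cmod (Pop t \<phi> z))\<^sup>2) \<partial>mu) \<le> ennreal (4 ^ CARD('n)) * (\<integral>\<^sup>+z. ennreal ((cmod (\<phi> z))\<^sup>2) \<partial>mu)"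
proof -
  have [measurable]: "\<phi> \<in> borel_measurable borel"
    using L2_measurable[OF \<phi>] by (simp add: measurable_cong_sets[OF sets_mu refl])
  have nn: "(\<integral>\<^sup>+w. ennreal (cmod (Pker t z w)) \<partial>mu) \<le> ennreal (2 ^ CARD('n))" for z
    using Pker_integrable Pker_integral_le by (simp add: nn_integral_eq_integral ennreal_leI)
  have nn': "(\<integral>\<^sup>+z. ennreal (cmod (Pker t z w)) \<partial>mu) \<le> ennreal (2 ^ CARD('n))" for w
    using nn[of w] unfolding cmod_Pker_commute[of t w] .
  have pt: "ennreal ((cmod (Pop t \<phi> z))\<^sup>2) \<le> ennreal (2 ^ CARD('n)) * (\<integral>\<^sup>+w. ennreal (cmod (Pker t z w)) * ennreal ((cmod (\<phi> w))\<^sup>2) \<partial>mu)" for z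
  proof -
    \<comment> \<open>The modulus of the kernel is split into two square roots before
      Cauchy-Schwarz: one root has controlled norm by the L1 bound, the other stays with
      \<open>\<phi>\<close>.\<close>
    let ?a = "\<lambda>w. complex_of_real (sqrt (cmod (Pker t z w)))"
    have asq: "(cmod (?a w))\<^sup>2 = cmod (Pker t z w)" for w by simp
    have a: "?a \<in> L2 mu"
      unfolding L2_def using Pker_integrable by simp
    show ?thesis
    proof (cases "(\<integral>\<^sup>+w. ennreal (cmod (Pker t z w)) * ennreal ((cmod (\<phi> w))\<^sup>2) \<partial>mu) = \<infinity>")
      case False
      have b: "(\<lambda>w. ?a w * \<phi> w) \<in> L2 mu"
        unfolding L2_iff_nn_integral using False by (auto simp: norm_mult power_mult_distrib ennreal_mult less_top)
      have "cmod (Pop t \<phi> z) \<le> (LINT w|mu. cmod (?a w) * cmod (?a w * \<phi> w))"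
      proof -
        have "cmod (Pop t \<phi> z) \<le> (LINT w|mu. cmod (Pker t z w * \<phi> w))"
          unfolding Pop_def by (rule integral_norm_bound)
        also have "\<dots> = (LINT w|mu. cmod (?a w) * cmod (?a w * \<phi> w))"
          by (simp add: norm_mult flip: mult.assoc)
        finally show ?thesis .
      qed
      then have "(cmod (Pop t \<phi> z))\<^sup>2 \<le> (LINT w|mu. cmod (?a w) * cmod (?a w * \<phi> w))\<^sup>2"
        by (intro power_mono) auto
      also have "\<dots> \<le> nsq mu ?a * nsq mu (\<lambda>w. ?a w * \<phi> w)"
        by (rule L2_Cauchy_Schwarz_abs[OF a b])
      also have "\<dots> \<le> 2 ^ CARD('n) * nsq mu (\<lambda>w. ?a w * \<phi> w)"
        using Pker_integral_le[of t z] by (intro mult_right_mono) (auto simp: nsq_def)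
      finally have "ennreal ((cmod (Pop t \<phi> z))\<^sup>2) \<le> ennreal (2 ^ CARD('n)) * ennreal (nsq mu (\<lambda>w. ?a w * \<phi> w))"
        by (simp add: ennreal_leI flip: ennreal_mult)
      also have "ennreal (nsq mu (\<lambda>w. ?a w * \<phi> w)) = (\<integral>\<^sup>+w. ennreal (cmod (Pker t z w)) * ennreal ((cmod (\<phi> w))\<^sup>2) \<partial>mu)"
        by (subst nn_integral_nsq[OF b, symmetric]) (simp add: norm_mult power_mult_distrib ennreal_mult)
      finally show ?thesis .
    qed (simp add: ennreal_mult_top)
  qed
  have "(\<integral>\<^sup>+z. ennreal ((cmod (Pop t \<phi> z))\<^sup>2) \<partial>mu) \<le> (\<integral>\<^sup>+z. ennreal (2 ^ CARD('n)) * (\<integral>\<^sup>+w. ennreal (cmod (Pker t z w)) * ennreal ((cmod (\<phi> w))\<^sup>2) \<partial>mu) \<partial>mu)"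
    by (intro nn_integral_mono pt)
  also have "\<dots> = ennreal (2 ^ CARD('n)) * (\<integral>\<^sup>+z. \<integral>\<^sup>+w. ennreal (cmod (Pker t z w)) * ennreal ((cmod (\<phi> w))\<^sup>2) \<partial>mu \<partial>mu)"
    by (rule nn_integral_cmult) measurable
  also have "(\<integral>\<^sup>+z. \<integral>\<^sup>+w. ennreal (cmod (Pker t z w)) * ennreal ((cmod (\<phi> w))\<^sup>2) \<partial>mu \<partial>mu)
      = (\<integral>\<^sup>+w. \<integral>\<^sup>+z. ennreal (cmod (Pker t z w)) * ennreal ((cmod (\<phi> w))\<^sup>2) \<partial>mu \<partial>mu)"
    by (rule mu_mu.Fubini') measurable
  also have "\<dots> = (\<integral>\<^sup>+w. (\<integral>\<^sup>+z. ennreal (cmod (Pker t z w)) \<partial>mu) * ennreal ((cmod (\<phi> w))\<^sup>2) \<partial>mu)"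
    by (intro nn_integral_cong nn_integral_multc) measurable
  also have "\<dots> \<le> (\<integral>\<^sup>+w. ennreal (2 ^ CARD('n)) * ennreal ((cmod (\<phi> w))\<^sup>2) \<partial>mu)"
    by (intro nn_integral_mono mult_right_mono nn') auto
  also have "\<dots> = ennreal (2 ^ CARD('n)) * (\<integral>\<^sup>+w. ennreal ((cmod (\<phi> w))\<^sup>2) \<partial>mu)"
    by (rule nn_integral_cmult) measurable
  also have "ennreal (2 ^ CARD('n)) * (ennreal (2 ^ CARD('n)) * (\<integral>\<^sup>+w. ennreal ((cmod (\<phi> w))\<^sup>2) \<partial>mu))
      = ennreal (4 ^ CARD('n)) * (\<integral>\<^sup>+w. ennreal ((cmod (\<phi> w))\<^sup>2) \<partial>mu)"
    by (simp add: mult.assoc[symmetric] ennreal_mult[symmetric] power_mult_distrib[symmetric])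
  finally show ?thesis
    by (simp add: mult_left_mono)
qed

lemma Pop_L2:
  assumes \<phi>: "\<phi> \<in> L2 mu"
  shows "Pop t \<phi> \<in> L2 mu"
proof -
  have m: "\<phi> \<in> borel_measurable borel"
    using L2_measurable[OF \<phi>] by (simp add: measurable_cong_sets[OF sets_mu refl])
  have "(\<integral>\<^sup>+z. ennreal ((cmod (\<phi> z))\<^sup>2) \<partial>mu) < \<infinity>" using \<phi> by (simp add: L2_iff_nn_integral)
  then have "ennreal (4 ^ CARD('n)) * (\<integral>\<^sup>+z. ennreal ((cmod (\<phi> z))\<^sup>2) \<partial>mu) < \<infinity>"
    by (auto simp: ennreal_mult_less_top)
  with Pop_nn_integral_le[OF \<phi>] show ?thesis
    unfolding L2_iff_nn_integral using Pop_measurable[OF m] by (auto intro: le_less_trans simp: measurable_cong_sets[OF sets_mu refl])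
qed

text \<open>Together with |a| |b| \<le> |a|^2 + |b|^2 these two majorants justify Fubini for the
  sesquilinear form of the kernel, although the modulus of the kernel itself is not integrable over
  both variables when t > 0.\<close>

lemma Pker_square_integrable:
  assumes f: "f \<in> L2 mu"
  shows "integrable (mu \<Otimes>\<^sub>M mu) (\<lambda>(z, w). cmod (Pker t z w) * (cmod (f z))\<^sup>2)"
    "integrable (mu \<Otimes>\<^sub>M mu) (\<lambda>(z, w). cmod (Pker t z w) * (cmod (f w))\<^sup>2)"
proof -
  have [measurable]: "f \<in> borel_measurable borel"
    using L2_measurable[OF f] by (simp add: measurable_cong_sets[OF sets_mu refl])
  show 1: "integrable (mu \<Otimes>\<^sub>M mu) (\<lambda>(z, w). cmod (Pker t z w) * (cmod (f z))\<^sup>2)"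
  proof (rule mu_mu.Fubini_integrable)
    show "integrable mu (\<lambda>z. LINT w|mu. norm (case (z, w) of (z, w) \<Rightarrow> cmod (Pker t z w) * (cmod (f z))\<^sup>2))"
    proof (rule Bochner_Integration.integrable_bound)
      show "integrable mu (\<lambda>z. 2 ^ CARD('n) * (cmod (f z))\<^sup>2)"
        using f by (simp add: L2_def)
      show "AE z in mu. norm (LINT w|mu. norm (case (z, w) of (z, w) \<Rightarrow> cmod (Pker t z w) * (cmod (f z))\<^sup>2))
          \<le> norm (2 ^ CARD('n) * (cmod (f z))\<^sup>2)"
        using Pker_integral_le[of t]
        by (intro AE_I2) (auto simp: abs_mult intro!: mult_right_mono)
    qed measurable
    show "AE z in mu. integrable mu (\<lambda>w. case (z, w) of (z, w) \<Rightarrow> cmod (Pker t z w) * (cmod (f z))\<^sup>2)"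
      using Pker_integrable by (intro AE_I2) simp
  qed measurable
  have "integrable (mu \<Otimes>\<^sub>M mu) (\<lambda>(z, w). case (w, z) of (z, w) \<Rightarrow> cmod (Pker t z w) * (cmod (f z))\<^sup>2)"
    using mu_mu.integrable_product_swap[OF 1] by (simp add: split_beta')
  moreover have "(\<lambda>(z, w). case (w, z) of (z, w) \<Rightarrow> cmod (Pker t z w) * (cmod (f z))\<^sup>2)
      = (\<lambda>(z, w). cmod (Pker t z w) * (cmod (f w))\<^sup>2)"
    by (auto simp: fun_eq_iff cmod_Pker_commute[of t])
  ultimately show "integrable (mu \<Otimes>\<^sub>M mu) (\<lambda>(z, w). cmod (Pker t z w) * (cmod (f w))\<^sup>2)"
    by (simp only:)
qed

lemma Pop_symmetric:
  assumes f: "f \<in> L2 mu" and g: "g \<in> L2 mu"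
  shows "(LINT z|mu. Pop t f z * cnj (g z)) = (LINT w|mu. f w * cnj (Pop t g w))"
proof -
  have [measurable]: "f \<in> borel_measurable borel" "g \<in> borel_measurable borel"
    using L2_measurable[OF f] L2_measurable[OF g] by (simp_all add: measurable_cong_sets[OF sets_mu refl])
  have int: "integrable (mu \<Otimes>\<^sub>M mu) (\<lambda>(z, w). Pker t z w * f w * cnj (g z))"
  proof (rule Bochner_Integration.integrable_bound[OF Bochner_Integration.integrable_add[OF
      Pker_square_integrable(2)[OF f, of t] Pker_square_integrable(1)[OF g, of t]]])
    show "AE p in mu \<Otimes>\<^sub>M mu. norm (case p of (z, w) \<Rightarrow> Pker t z w * f w * cnj (g z))
      \<le> norm ((case p of (z, w) \<Rightarrow> cmod (Pker t z w) * (cmod (f w))\<^sup>2) + (case p of (z, w) \<Rightarrow> cmod (Pker t z w) * (cmod (g z))\<^sup>2))"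
    proof (intro AE_I2)
      fix p :: "(complex^'n) \<times> (complex^'n)"
      obtain z w where p: "p = (z, w)" by fastforce
      have "cmod (f w) * cmod (g z) \<le> (cmod (f w))\<^sup>2 + (cmod (g z))\<^sup>2"
        using sum_squares_bound[of "cmod (f w)" "cmod (g z)"]
          mult_nonneg_nonneg[OF norm_ge_zero[of "f w"] norm_ge_zero[of "g z"]] by linarith
      then have "cmod (Pker t z w) * (cmod (f w) * cmod (g z)) \<le> cmod (Pker t z w) * ((cmod (f w))\<^sup>2 + (cmod (g z))\<^sup>2)"
        by (intro mult_left_mono) auto
      then show "norm (case p of (z, w) \<Rightarrow> Pker t z w * f w * cnj (g z))
        \<le> norm ((case p of (z, w) \<Rightarrow> cmod (Pker t z w) * (cmod (f w))\<^sup>2) + (case p of (z, w) \<Rightarrow> cmod (Pker t z w) * (cmod (g z))\<^sup>2))"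
        by (simp add: p norm_mult distrib_left mult.assoc)
    qed
  qed measurable
  have "(LINT z|mu. Pop t f z * cnj (g z)) = (LINT z|mu. LINT w|mu. Pker t z w * f w * cnj (g z))"
    by (simp add: Pop_def)
  also have "\<dots> = (LINT w|mu. LINT z|mu. Pker t z w * f w * cnj (g z))"
    by (rule mu_mu.Fubini_integral[OF int, symmetric])
  also have "\<dots> = (LINT w|mu. LINT z|mu. f w * cnj (Pker t w z * g z))"
    by (simp add: Pker_cnj mult_ac)
  also have "\<dots> = (LINT w|mu. f w * cnj (Pop t g w))"
    by (simp only: Pop_def integral_mult_right_zero Bochner_Integration.integral_cnj)
  finally show ?thesis .
qed

section \<open>Gaussian means of a slice\<close>

text \<open>\<open>Grad\<close> is, up to a factor, the derivative of \<open>Gmean\<close> in \<open>b\<close>; it vanishes on the slices of weak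
  solutions.\<close>

definition Gmean :: "real \<Rightarrow> (complex^'n \<Rightarrow> complex) \<Rightarrow> real \<Rightarrow> complex^'n \<Rightarrow> complex" where
  "Gmean t \<phi> b z0 = (LINT z|mu. complex_of_real ((b + t) ^ CARD('n) * exp (- b * psi lam (z - z0))) * cis (2 * t * om lam z0 z) * \<phi> z)"

definition Grad :: "real \<Rightarrow> (complex^'n \<Rightarrow> complex) \<Rightarrow> real \<Rightarrow> complex^'n \<Rightarrow> complex" where
  "Grad t \<phi> b z0 = (LINT z|mu. complex_of_real ((real CARD('n) - (b + t) * psi lam (z - z0)) * exp (- b * psi lam (z - z0))) * cis (2 * t * om lam z0 z) * \<phi> z)"

text \<open>One majorant for all b between b' and B, with y standing for psi (z - z0). It makes the
  integral over (z, b) absolutely convergent in \<open>Gmean_const\<close>.\<close>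

lemma gaussian_poly_bound:
  assumes b': "0 < b'" "b' \<le> b" and y: "0 \<le> y" and B: "b \<le> B"
  shows "\<bar>(b + t) ^ (n - 1) * ((real n - (b + t) * y) * exp (- b * y))\<bar>
    \<le> (B + \<bar>t\<bar>) ^ (n - 1) * (real n + (B + \<bar>t\<bar>) * (2 / b')) * exp (- (b' / 2) * y)"
proof -
  have bt: "\<bar>b + t\<bar> \<le> B + \<bar>t\<bar>" using b' B by linarith
  have e1: "exp (- b * y) \<le> exp (- b' * y)" using b' y by (simp add: mult_right_mono)
  have e2: "exp (- b' * y) \<le> exp (- (b' / 2) * y)" using b' y by (simp add: mult_right_mono)
  have "b' / 2 * y \<le> exp (b' / 2 * y)"
    using exp_ge_add_one_self[of "b' / 2 * y"] by linarith
  then have "y * exp (- b' * y) \<le> (2 / b') * exp (b' / 2 * y) * exp (- b' * y)"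
    using b' by (intro mult_right_mono) (auto simp: field_simps)
  also have "\<dots> = (2 / b') * exp (- (b' / 2) * y)"
    by (simp add: mult.assoc flip: exp_add)
  finally have e3: "y * exp (- b' * y) \<le> (2 / b') * exp (- (b' / 2) * y)" .
  have "\<bar>real n - (b + t) * y\<bar> \<le> real n + (B + \<bar>t\<bar>) * y"
    using abs_triangle_ineq4[of "real n" "(b + t) * y"] mult_right_mono[OF bt y] y by (simp add: abs_mult)
  then have "\<bar>real n - (b + t) * y\<bar> * exp (- b * y) \<le> (real n + (B + \<bar>t\<bar>) * y) * exp (- b' * y)"
    using e1 b' B y by (intro mult_mono) auto
  also have "\<dots> = real n * exp (- b' * y) + (B + \<bar>t\<bar>) * (y * exp (- b' * y))"
    by (simp add: algebra_simps)
  also have "\<dots> \<le> real n * exp (- (b' / 2) * y) + (B + \<bar>t\<bar>) * ((2 / b') * exp (- (b' / 2) * y))"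
    using e2 e3 b' B by (intro add_mono mult_left_mono) auto
  also have "\<dots> = (real n + (B + \<bar>t\<bar>) * (2 / b')) * exp (- (b' / 2) * y)"
    by (simp add: algebra_simps)
  finally have p1: "\<bar>real n - (b + t) * y\<bar> * exp (- b * y) \<le> (real n + (B + \<bar>t\<bar>) * (2 / b')) * exp (- (b' / 2) * y)" .
  have p2: "\<bar>b + t\<bar> ^ (n - 1) \<le> (B + \<bar>t\<bar>) ^ (n - 1)"
    using bt by (intro power_mono) auto
  have "\<bar>b + t\<bar> ^ (n - 1) * (\<bar>real n - (b + t) * y\<bar> * exp (- b * y))
      \<le> (B + \<bar>t\<bar>) ^ (n - 1) * ((real n + (B + \<bar>t\<bar>) * (2 / b')) * exp (- (b' / 2) * y))"
    by (rule mult_mono[OF p2 p1]) (use b' B in auto)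
  then show ?thesis by (simp add: abs_mult power_abs mult.assoc)
qed

lemma Gmean_deriv_integral:
  assumes "b' \<le> b"
  shows "(LINT \<beta>|lborel. ((\<beta> + t) ^ (CARD('n) - 1) * ((real CARD('n) - (\<beta> + t) * y) * exp (- \<beta> * y))) * indicator {b'..b} \<beta>)
    = (b + t) ^ CARD('n) * exp (- b * y) - (b' + t) ^ CARD('n) * exp (- b' * y)"
proof (rule integral_FTC_Icc_real)
  show "b' \<le> b" by fact
  \<comment> \<open>The dimension is at least 1, so the truncated subtraction in the exponent is
    exact.\<close>
  have n: "CARD('n) = Suc (CARD('n) - 1)" by simp
  fix x
  have "((\<lambda>\<beta>. (\<beta> + t) ^ CARD('n) * exp (- \<beta> * y)) has_real_derivative
      real CARD('n) * (x + t) ^ (CARD('n) - 1) * exp (- x * y) + (x + t) ^ CARD('n) * (- y * exp (- x * y))) (at x)"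
    by (auto intro!: derivative_eq_intros)
  moreover have "(x + t) ^ CARD('n) = (x + t) ^ (CARD('n) - 1) * (x + t)"
    by (subst n, subst power_Suc2) simp
  ultimately show "((\<lambda>\<beta>. (\<beta> + t) ^ CARD('n) * exp (- \<beta> * y)) has_real_derivative
      (x + t) ^ (CARD('n) - 1) * ((real CARD('n) - (x + t) * y) * exp (- x * y))) (at x)"
    by (simp add: algebra_simps)
qed (auto intro!: continuous_intros)

text \<open>\<open>Grad\<close> is known to vanish only for almost every b, so pointwise
  differentiation of \<open>Gmean\<close> would not do. Instead the difference of two means is an
  integral of \<open>Grad\<close> over b, by the fundamental theorem inside and Fubini
  outside.\<close>

lemma Gmean_const:
  assumes \<phi>: "\<phi> \<in> L2 mu" and zero: "AE b in lborel. 0 < b \<longrightarrow> Grad t \<phi> b z0 = 0" and b': "0 < b'" and "b' \<le> b"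
  shows "Gmean t \<phi> b z0 = Gmean t \<phi> b' z0"
proof -
  have m [measurable]: "\<phi> \<in> borel_measurable borel"
    using L2_measurable[OF \<phi>] by (simp add: measurable_cong_sets[OF sets_mu refl])
  let ?q = "\<lambda>\<beta> z. (\<beta> + t) ^ (CARD('n) - 1) * ((real CARD('n) - (\<beta> + t) * psi lam (z - z0)) * exp (- \<beta> * psi lam (z - z0)))"
  define K where "K = (b + \<bar>t\<bar>) ^ (CARD('n) - 1) * (real CARD('n) + (b + \<bar>t\<bar>) * (2 / b'))"
  have gi: "integrable mu (\<lambda>z. complex_of_real (exp (- \<beta> * psi lam (z - z0))) * \<phi> z)" if "\<beta> > 0" for \<beta>
    by (intro L2_mult_integrable gaussian_L2 that \<phi>)
  have gI: "integrable mu (\<lambda>z. complex_of_real ((\<beta> + t) ^ CARD('n) * exp (- \<beta> * psi lam (z - z0))) * cis (2 * t * om lam z0 z) * \<phi> z)"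
    if "\<beta> > 0" for \<beta>
    by (rule Bochner_Integration.integrable_bound[OF integrable_mult_right[OF gi[OF that], of "complex_of_real ((\<beta> + t) ^ CARD('n))"]])
      (auto simp: norm_mult norm_power)
  have ind: "integrable lborel (\<lambda>\<beta>. complex_of_real (indicator {b'..b} \<beta>))"
    using \<open>b' \<le> b\<close> by (intro integrable_of_real integrable_real_indicator) auto
  have dom: "integrable mu (\<lambda>z. complex_of_real K * (complex_of_real (exp (- (b' / 2) * psi lam (z - z0))) * \<phi> z))"
    using b' by (intro integrable_mult_right gi) simp
  have int: "integrable (mu \<Otimes>\<^sub>M lborel) (\<lambda>(z, \<beta>). complex_of_real (indicator {b'..b} \<beta> * ?q \<beta> z) * (cis (2 * t * om lam z0 z) * \<phi> z))"
  proof (rule Bochner_Integration.integrable_bound[OF integrable_pair_mult[OF sigma_finite_mu sigma_finite_lborel dom ind]])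
    show "AE p in mu \<Otimes>\<^sub>M lborel. norm (case p of (z, \<beta>) \<Rightarrow> complex_of_real (indicator {b'..b} \<beta> * ?q \<beta> z) * (cis (2 * t * om lam z0 z) * \<phi> z))
      \<le> norm (complex_of_real K * (complex_of_real (exp (- (b' / 2) * psi lam (fst p - z0))) * \<phi> (fst p)) * complex_of_real (indicator {b'..b} (snd p)))"
    proof (intro AE_I2)
      fix p :: "(complex^'n) \<times> real"
      obtain z \<beta> where p: "p = (z, \<beta>)" by fastforce
      show "norm (case p of (z, \<beta>) \<Rightarrow> complex_of_real (indicator {b'..b} \<beta> * ?q \<beta> z) * (cis (2 * t * om lam z0 z) * \<phi> z))
      \<le> norm (complex_of_real K * (complex_of_real (exp (- (b' / 2) * psi lam (fst p - z0))) * \<phi> (fst p)) * complex_of_real (indicator {b'..b} (snd p)))"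
      proof (cases "\<beta> \<in> {b'..b}")
        case True
        have "\<bar>?q \<beta> z\<bar> * cmod (\<phi> z) \<le> K * exp (- (b' / 2) * psi lam (z - z0)) * cmod (\<phi> z)"
          unfolding K_def using True b' by (intro mult_right_mono gaussian_poly_bound psi_nonneg) auto
        moreover have "K \<ge> 0" unfolding K_def using b' \<open>b' \<le> b\<close> by simp
        ultimately show ?thesis
          using True unfolding p by (simp only: prod.case fst_conv snd_conv norm_mult norm_of_real norm_cis abs_mult)
            (simp add: abs_mult mult.assoc)
      qed (simp add: p)
    qed
  qed measurable
  have "Gmean t \<phi> b z0 - Gmean t \<phi> b' z0
      = (LINT z|mu. complex_of_real ((b + t) ^ CARD('n) * exp (- b * psi lam (z - z0)) - (b' + t) ^ CARD('n) * exp (- b' * psi lam (z - z0)))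
          * (cis (2 * t * om lam z0 z) * \<phi> z))"
    unfolding Gmean_def using gI b' \<open>b' \<le> b\<close>
    by (subst Bochner_Integration.integral_diff[symmetric]) (auto simp: algebra_simps)
  also have "\<dots> = (LINT z|mu. LINT \<beta>|lborel. complex_of_real (indicator {b'..b} \<beta> * ?q \<beta> z) * (cis (2 * t * om lam z0 z) * \<phi> z))"
    unfolding Gmean_deriv_integral[OF \<open>b' \<le> b\<close>, symmetric] by (simp del: of_real_mult add: mult.commute[of _ "indicator _ _"])
  also have "\<dots> = (LINT \<beta>|lborel. LINT z|mu. complex_of_real (indicator {b'..b} \<beta> * ?q \<beta> z) * (cis (2 * t * om lam z0 z) * \<phi> z))"
    by (rule heis.Fubini_integral[OF int, symmetric])
  also have "\<dots> = (LINT \<beta>|lborel. complex_of_real (indicator {b'..b} \<beta> * (\<beta> + t) ^ (CARD('n) - 1)) * Grad t \<phi> \<beta> z0)"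
    unfolding Grad_def by (simp add: mult_ac flip: integral_mult_right_zero)
  also have "\<dots> = 0"
  proof (rule integral_eq_zero_AE)
    show "AE \<beta> in lborel. complex_of_real (indicator {b'..b} \<beta> * (\<beta> + t) ^ (CARD('n) - 1)) * Grad t \<phi> \<beta> z0 = 0"
      using zero by eventually_elim (use b' in \<open>auto simp: indicator_def\<close>)
  qed
  finally show ?thesis by simp
qed

end

lemma isCont_cis: "isCont cis x"
  using continuous_on_cis[OF continuous_on_id, of UNIV] by (simp add: continuous_on_eq_continuous_at)

lemma L2_mu_borel: "f \<in> L2 (mu :: (complex^'n) measure) \<Longrightarrow> f \<in> borel_measurable borel"
  using L2_measurable[of f mu] by (simp add: measurable_cong_sets[OF sets_mu refl])

lemma L2_mu: "L2 (mu :: (complex^'n) measure) = (L2 lborel :: (_ \<Rightarrow> 'b::euclidean_space) set)"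
proof -
  have "integrable (mu :: (complex^'n) measure) (\<lambda>x. (norm (f x))\<^sup>2) \<longleftrightarrow> integrable lborel (\<lambda>x. (norm (f x))\<^sup>2)"
    if "f \<in> borel_measurable borel" for f :: "complex^'n \<Rightarrow> 'b"
    using that by (intro integrable_mu_iff) measurable
  moreover have "borel_measurable (mu :: (complex^'n) measure) = (borel_measurable borel :: (_ \<Rightarrow> 'b) set)"
    by (rule measurable_cong_sets) auto
  ultimately show ?thesis
    by (auto simp: L2_def)
qed

lemma test_functions_separate_mu:
  fixes f :: "complex^'n \<Rightarrow> complex"
  assumes f: "f \<in> borel_measurable borel" "\<And>l u. integrable lborel (\<lambda>x. indicator (box l u) x *\<^sub>R f x)"
    and zero: "\<And>g. test_function g \<Longrightarrow> (LINT x|mu. g x * f x) = 0"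
  shows "AE x in mu. f x = 0"
  unfolding AE_mu_iff
proof (rule test_functions_separate[OF f])
  fix g :: "complex^'n \<Rightarrow> complex" assume g: "test_function g"
  note [measurable] = f(1) test_function_borel[OF g]
  show "(LINT x|lborel. f x * g x) = 0"
    using zero[OF g] by (simp add: integral_mu mult.commute)
qed

lemma integrable_indicator_box_bounded:
  fixes f :: "'a::euclidean_space \<Rightarrow> complex"
  assumes "f \<in> borel_measurable borel" "\<And>x. cmod (f x) \<le> B"
  shows "integrable lborel (\<lambda>x. indicator (box l u) x *\<^sub>R f x)"
proof (rule Bochner_Integration.integrable_bound)
  show "integrable lborel (\<lambda>x. B * indicator (box l u) x)"
    by (intro integrable_mult_right integrable_real_indicator) (auto simp: emeasure_lborel_box_finite[unfolded infinity_ennreal_def])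
  show "AE x in lborel. norm (indicator (box l u) x *\<^sub>R f x) \<le> norm (B * indicator (box l u) x)"
    using order_trans[OF assms(2) abs_ge_self] by (intro AE_I2) (auto simp: indicator_def)
qed (use assms in measurable)

context positive_weights
begin

lemma Gmean_measurable:
  assumes "\<phi> \<in> L2 mu"
  shows "Gmean t \<phi> b \<in> borel_measurable borel"
proof -
  note L2_mu_borel[OF assms, measurable]
  show ?thesis unfolding Gmean_def by measurable
qed

lemma Gmean_bounded:
  assumes \<phi>: "\<phi> \<in> L2 mu" and b: "b > 0"
  shows "\<exists>B. \<forall>z0. cmod (Gmean t \<phi> b z0) \<le> B"
proof (intro exI allI)
  fix z0
  let ?e = "\<lambda>z. (complex_of_real ((b + t) ^ CARD('n)) * cis (2 * t * om lam z0 z)) * complex_of_real (exp (- b * psi lam (z - z0)))"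
  have e: "?e \<in> L2 mu"
    by (rule L2_mult_bounded[OF gaussian_L2[OF b], where C = "\<bar>b + t\<bar> ^ CARD('n)"])
      (auto simp: norm_mult power_abs simp del: of_real_add of_real_power)
  have ne: "nsq mu ?e = (\<bar>b + t\<bar> ^ CARD('n))\<^sup>2 * (gauss_integral / (2 * b) ^ CARD('n))"
  proof -
    have "nsq mu ?e = (LINT z|mu. (\<bar>b + t\<bar> ^ CARD('n))\<^sup>2 * exp (- (2 * b) * psi lam (z - z0)))"
      unfolding nsq_def by (intro Bochner_Integration.integral_cong) (auto simp: norm_mult power_abs power_mult_distrib simp del: of_real_add of_real_power simp flip: exp_double)
    also have "\<dots> = (\<bar>b + t\<bar> ^ CARD('n))\<^sup>2 * (gauss_integral / (2 * b) ^ CARD('n))"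
      unfolding integral_mult_right_zero using b by (subst integral_gaussian_psi) auto
    finally show ?thesis .
  qed
  have "Gmean t \<phi> b z0 = (LINT z|mu. ?e z * \<phi> z)"
    unfolding Gmean_def by (intro Bochner_Integration.integral_cong) (auto simp: mult_ac)
  then have "(cmod (Gmean t \<phi> b z0))\<^sup>2 \<le> nsq mu ?e * nsq mu \<phi>"
    using L2_Cauchy_Schwarz[OF e \<phi>] by simp
  then show "cmod (Gmean t \<phi> b z0) \<le> sqrt ((\<bar>b + t\<bar> ^ CARD('n))\<^sup>2 * (gauss_integral / (2 * b) ^ CARD('n)) * nsq mu \<phi>)"
    unfolding ne by (rule real_le_rsqrt)
qed

text \<open>The Gaussian mean moved onto a test function, with r = 1 / sqrt b. After this rescaling
  the Gaussian is fixed and r occurs only in the argument of \<open>\<kappa>\<close> and in the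
  phase.\<close>

definition mollif :: "real \<Rightarrow> (complex^'n \<Rightarrow> complex) \<Rightarrow> real \<Rightarrow> complex^'n \<Rightarrow> complex" where
  "mollif t \<kappa> r z = (LINT y|mu. \<kappa> (z + r *\<^sub>R y) * (complex_of_real (exp (- psi lam y)) * cis (2 * t * r * om lam y z)))"

text \<open>The limit of large b cannot be taken pointwise for a merely square-integrable
  \<open>\<phi>\<close>. Pairing with \<open>\<kappa>\<close> shifts it to a smooth function, and
  what is left of the normalisation is ((b + t) / b)^n, which tends to 1.\<close>

lemma Gmean_test:
  assumes \<phi>: "\<phi> \<in> L2 mu" and \<kappa>: "test_function \<kappa>" and b: "b > 0"
  shows "(LINT z0|mu. \<kappa> z0 * Gmean t \<phi> b z0) = complex_of_real (((b + t) / b) ^ CARD('n)) * (LINT z|mu. \<phi> z * mollif t \<kappa> (1 / sqrt b) z)"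
proof -
  note [measurable] = L2_mu_borel[OF \<phi>] test_function_borel[OF \<kappa>]
  have \<kappa>2: "\<kappa> \<in> L2 mu" by (simp add: L2_mu test_function_L2 \<kappa>)
  let ?c = "(b + t) ^ CARD('n)"
  let ?e = "\<lambda>z0 z. complex_of_real (?c * exp (- b * psi lam (z - z0))) * cis (2 * t * om lam z0 z)"
  \<comment> \<open>Chosen so that \<open>?C\<close> times the modulus of \<open>Pker b z0 z\<close>
    equals |?c| exp (- b psi (z0 - z)). Here \<open>Pker b\<close> serves as a Gaussian with known
    integrability, for either sign of t.\<close>
  let ?C = "\<bar>?c\<bar> * gauss_integral / (2 * b) ^ CARD('n)"
  have int: "integrable (mu \<Otimes>\<^sub>M mu) (\<lambda>(z0, z). \<kappa> z0 * (?e z0 z * \<phi> z))"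
  proof (rule Bochner_Integration.integrable_bound[OF integrable_mult_right[OF Bochner_Integration.integrable_add[OF
      Pker_square_integrable(1)[OF \<kappa>2, of b] Pker_square_integrable(2)[OF \<phi>, of b]], of ?C]])
    show "AE p in mu \<Otimes>\<^sub>M mu. norm (case p of (z0, z) \<Rightarrow> \<kappa> z0 * (?e z0 z * \<phi> z))
      \<le> norm (?C * ((case p of (z, w) \<Rightarrow> cmod (Pker b z w) * (cmod (\<kappa> z))\<^sup>2) + (case p of (z, w) \<Rightarrow> cmod (Pker b z w) * (cmod (\<phi> w))\<^sup>2)))"
    proof (intro AE_I2)
      fix p :: "(complex^'n) \<times> (complex^'n)"
      obtain z0 z where p: "p = (z0, z)" by fastforce
      have "cmod (\<kappa> z0) * cmod (\<phi> z) \<le> (cmod (\<kappa> z0))\<^sup>2 + (cmod (\<phi> z))\<^sup>2"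
        using sum_squares_bound[of "cmod (\<kappa> z0)" "cmod (\<phi> z)"]
          mult_nonneg_nonneg[OF norm_ge_zero[of "\<kappa> z0"] norm_ge_zero[of "\<phi> z"]] by linarith
      then have i1: "\<bar>?c\<bar> * exp (- b * psi lam (z0 - z)) * (cmod (\<kappa> z0) * cmod (\<phi> z))
          \<le> \<bar>?c\<bar> * exp (- b * psi lam (z0 - z)) * ((cmod (\<kappa> z0))\<^sup>2 + (cmod (\<phi> z))\<^sup>2)"
        by (intro mult_left_mono) auto
      have i2: "\<bar>?c\<bar> * exp (- b * psi lam (z0 - z)) = ?C * cmod (Pker b z0 z)"
        using b gauss_integral_pos by (simp add: cmod_Pker)
      have i3: "norm (\<kappa> z0 * (?e z0 z * \<phi> z)) = \<bar>?c\<bar> * exp (- b * psi lam (z0 - z)) * (cmod (\<kappa> z0) * cmod (\<phi> z))"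
        by (simp add: norm_mult psi_minus_commute[of lam z] power_abs del: of_real_add of_real_power)
      have "norm (\<kappa> z0 * (?e z0 z * \<phi> z)) \<le> ?C * cmod (Pker b z0 z) * ((cmod (\<kappa> z0))\<^sup>2 + (cmod (\<phi> z))\<^sup>2)"
        using i1 unfolding i3 i2 .
      then have "norm (\<kappa> z0 * (?e z0 z * \<phi> z)) \<le> ?C * (cmod (Pker b z0 z) * (cmod (\<kappa> z0))\<^sup>2 + cmod (Pker b z0 z) * (cmod (\<phi> z))\<^sup>2)"
        by (simp only: distrib_left mult.assoc)
      then show "norm (case p of (z0, z) \<Rightarrow> \<kappa> z0 * (?e z0 z * \<phi> z))
      \<le> norm (?C * ((case p of (z, w) \<Rightarrow> cmod (Pker b z w) * (cmod (\<kappa> z))\<^sup>2) + (case p of (z, w) \<Rightarrow> cmod (Pker b z w) * (cmod (\<phi> w))\<^sup>2)))"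
        unfolding p prod.case real_norm_def[of "?C * _"] by (rule order_trans[OF _ abs_ge_self])
    qed
  qed measurable
  have inner: "(LINT z0|mu. \<kappa> z0 * ?e z0 z) = complex_of_real (((b + t) / b) ^ CARD('n)) * mollif t \<kappa> (1 / sqrt b) z" for z
  proof -
    have "(LINT z0|mu. \<kappa> z0 * ?e z0 z) = ((1 / sqrt b)\<^sup>2) ^ CARD('n) *\<^sub>R (LINT y|mu. \<kappa> (z + (1 / sqrt b) *\<^sub>R y) * ?e (z + (1 / sqrt b) *\<^sub>R y) z)"
      by (rule integral_mu_affine) (use b in auto)
    also have "(LINT y|mu. \<kappa> (z + (1 / sqrt b) *\<^sub>R y) * ?e (z + (1 / sqrt b) *\<^sub>R y) z)
        = (LINT y|mu. complex_of_real ?c * (\<kappa> (z + (1 / sqrt b) *\<^sub>R y) * (complex_of_real (exp (- psi lam y)) * cis (2 * t * (1 / sqrt b) * om lam y z))))"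
    proof (intro Bochner_Integration.integral_cong refl)
      fix y
      have "b * psi lam (z - (z + (1 / sqrt b) *\<^sub>R y)) = psi lam y"
        using b psi_scaleR[of lam "- (1 / sqrt b)" y] by (simp add: power_divide)
      moreover have "om lam (z + (1 / sqrt b) *\<^sub>R y) z = (1 / sqrt b) * om lam y z"
        by (simp only: om_add_left om_self om_scaleR_left add_0_left)
      ultimately show "\<kappa> (z + (1 / sqrt b) *\<^sub>R y) * ?e (z + (1 / sqrt b) *\<^sub>R y) z
        = complex_of_real ?c * (\<kappa> (z + (1 / sqrt b) *\<^sub>R y) * (complex_of_real (exp (- psi lam y)) * cis (2 * t * (1 / sqrt b) * om lam y z)))"
        by (simp only: mult_minus_left of_real_mult) (simp only: mult.assoc mult.left_commute)
    qed
    also have "\<dots> = complex_of_real ?c * mollif t \<kappa> (1 / sqrt b) z"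
      unfolding mollif_def by (rule integral_mult_right_zero)
    finally show ?thesis
      using b by (simp add: scaleR_conv_of_real power_divide)
  qed
  have "(LINT z0|mu. \<kappa> z0 * Gmean t \<phi> b z0) = (LINT z0|mu. LINT z|mu. \<kappa> z0 * (?e z0 z * \<phi> z))"
    unfolding Gmean_def by simp
  also have "\<dots> = (LINT z|mu. LINT z0|mu. \<kappa> z0 * (?e z0 z * \<phi> z))"
    by (rule mu_mu.Fubini_integral[OF int, symmetric])
  also have "\<dots> = (LINT z|mu. \<phi> z * (LINT z0|mu. \<kappa> z0 * ?e z0 z))"
    by (simp add: mult_ac flip: integral_mult_right_zero)
  also have "\<dots> = complex_of_real (((b + t) / b) ^ CARD('n)) * (LINT z|mu. \<phi> z * mollif t \<kappa> (1 / sqrt b) z)"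
    unfolding inner integral_mult_right_zero[symmetric]
    by (intro Bochner_Integration.integral_cong refl) (simp only: mult.left_commute)
  finally show ?thesis .
qed

text \<open>Dominated convergence twice: in y for fixed z, where \<open>\<kappa>\<close> is bounded,
  and in z, where a Gaussian majorant uniform in r is required.\<close>

lemma mollif_limit:
  assumes \<phi>: "\<phi> \<in> L2 mu" and \<kappa>: "test_function \<kappa>" and l: "l > 0" "\<forall>z. l * (norm z)\<^sup>2 \<le> psi lam z"
    and r: "\<And>m. 0 < r m" "\<And>m. (r m)\<^sup>2 \<le> l / 2" "r \<longlonglongrightarrow> 0"
  shows "(\<lambda>m. LINT z|mu. \<phi> z * mollif t \<kappa> (r m) z) \<longlonglongrightarrow> (LINT z|mu. \<phi> z * (\<kappa> z * complex_of_real gauss_integral))"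
proof -
  note [measurable] = L2_mu_borel[OF \<phi>] test_function_borel[OF \<kappa>]
  obtain R where R: "R > 0" "\<And>x. \<kappa> x \<noteq> 0 \<Longrightarrow> norm x \<le> R" using test_function_support[OF \<kappa>] by blast
  obtain M where M: "M > 0" "\<And>x. cmod (\<kappa> x) \<le> M" using test_function_bounded[OF \<kappa>] by blast
  \<comment> \<open>On the ball of radius R the Gaussian is at least exp (- R^2). Compact support is
    exchanged for Gaussian decay, which survives the translations by r y.\<close>
  define M' where "M' = M * exp (R\<^sup>2)"
  have M': "cmod (\<kappa> x) \<le> M' * exp (- (norm x)\<^sup>2)" for x
  proof (cases "\<kappa> x = 0")
    case False
    then have "(norm x)\<^sup>2 \<le> R\<^sup>2" using R by (intro power_mono) auto
    then have "M * 1 \<le> M * exp (R\<^sup>2 - (norm x)\<^sup>2)" using M(1) by (intro mult_left_mono) auto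
    then show ?thesis using M(2)[of x] by (simp add: M'_def mult.assoc flip: exp_add)
  qed (use M(1) in \<open>simp add: M'_def\<close>)
  have ig: "integrable mu (\<lambda>y. exp (- psi lam y))" using integrable_gaussian_psi[of 1] by simp
  have ig2: "integrable mu (\<lambda>y. exp (- (1/2) * psi lam y))" by (rule integrable_gaussian_psi) simp
  have pt: "(\<lambda>m. mollif t \<kappa> (r m) z) \<longlonglongrightarrow> \<kappa> z * complex_of_real gauss_integral" for z
  proof -
    have "(\<lambda>m. mollif t \<kappa> (r m) z) \<longlonglongrightarrow> (LINT y|mu. \<kappa> z * complex_of_real (exp (- psi lam y)))"
      unfolding mollif_def
    proof (rule integral_dominated_convergence[where w = "\<lambda>y. M * exp (- psi lam y)"])
      show "AE y in mu. (\<lambda>m. \<kappa> (z + r m *\<^sub>R y) * (complex_of_real (exp (- psi lam y)) * cis (2 * t * r m * om lam y z)))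
          \<longlonglongrightarrow> \<kappa> z * complex_of_real (exp (- psi lam y))"
      proof (intro AE_I2)
        fix y
        have "isCont \<kappa> z" using test_function_continuous[OF \<kappa>] by (simp add: continuous_on_eq_continuous_at)
        moreover have "(\<lambda>m. z + r m *\<^sub>R y) \<longlonglongrightarrow> z + 0 *\<^sub>R y" by (intro tendsto_intros r)
        ultimately have 1: "(\<lambda>m. \<kappa> (z + r m *\<^sub>R y)) \<longlonglongrightarrow> \<kappa> z" by (intro isCont_tendsto_compose[of _ \<kappa>]) auto
        have "(\<lambda>m. 2 * t * r m * om lam y z) \<longlonglongrightarrow> 2 * t * 0 * om lam y z" by (intro tendsto_intros r)
        then have 2: "(\<lambda>m. cis (2 * t * r m * om lam y z)) \<longlonglongrightarrow> cis (2 * t * 0 * om lam y z)"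
          by (intro isCont_tendsto_compose[of _ cis] isCont_cis)
        show "(\<lambda>m. \<kappa> (z + r m *\<^sub>R y) * (complex_of_real (exp (- psi lam y)) * cis (2 * t * r m * om lam y z)))
          \<longlonglongrightarrow> \<kappa> z * complex_of_real (exp (- psi lam y))"
          using tendsto_mult[OF 1 tendsto_mult[OF tendsto_const 2, of "complex_of_real (exp (- psi lam y))"]] by simp
      qed
      show "AE y in mu. norm (\<kappa> (z + r m *\<^sub>R y) * (complex_of_real (exp (- psi lam y)) * cis (2 * t * r m * om lam y z))) \<le> M * exp (- psi lam y)" for m
        using M by (auto simp: norm_mult intro!: mult_right_mono)
    qed (use ig in auto)
    then show ?thesis by (simp add: gauss_integral_def)
  qed
  have bound: "cmod (mollif t \<kappa> (r m) z) \<le> (M' * (LINT y|mu. exp (- (1/2) * psi lam y))) * exp (- (1/2) * (norm z)\<^sup>2)" for m z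
  proof -
    have "cmod (mollif t \<kappa> (r m) z) \<le> (LINT y|mu. (M' * exp (- (1/2) * (norm z)\<^sup>2)) * exp (- (1/2) * psi lam y))"
      unfolding mollif_def
    proof (rule norm_integral_le[OF integrable_mult_right[OF ig2]])
      fix y
      \<comment> \<open>As r^2 \<le> l / 2, the term 2 r^2 |y|^2 is at most psi y. Half of the
        exponent in y is spent; half remains for integration, along with half of the exponent in
        z.\<close>
      have "(norm z)\<^sup>2 \<le> 2 * (norm (z + r m *\<^sub>R y))\<^sup>2 + 2 * (norm (- (r m *\<^sub>R y)))\<^sup>2"
        using norm_add_sq_le[of "z + r m *\<^sub>R y" "- (r m *\<^sub>R y)"] by simp
      moreover have "(norm (- (r m *\<^sub>R y)))\<^sup>2 = (r m)\<^sup>2 * (norm y)\<^sup>2" by (simp add: power_mult_distrib)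
      moreover have "(r m)\<^sup>2 * (norm y)\<^sup>2 \<le> l / 2 * (norm y)\<^sup>2" using r by (intro mult_right_mono) auto
      moreover have "l * (norm y)\<^sup>2 \<le> psi lam y" using l by blast
      ultimately have "- (norm (z + r m *\<^sub>R y))\<^sup>2 + (- psi lam y) \<le> - (1/2) * (norm z)\<^sup>2 + - (1/2) * psi lam y"
        by linarith
      then have "exp (- (norm (z + r m *\<^sub>R y))\<^sup>2) * exp (- psi lam y) \<le> exp (- (1/2) * (norm z)\<^sup>2) * exp (- (1/2) * psi lam y)"
        unfolding exp_add[symmetric] by (simp only: exp_le_cancel_iff)
      then have "M' * (exp (- (norm (z + r m *\<^sub>R y))\<^sup>2) * exp (- psi lam y)) \<le> M' * (exp (- (1/2) * (norm z)\<^sup>2) * exp (- (1/2) * psi lam y))"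
        using M(1) by (intro mult_left_mono) (auto simp: M'_def)
      moreover have "cmod (\<kappa> (z + r m *\<^sub>R y)) * exp (- psi lam y) \<le> M' * exp (- (norm (z + r m *\<^sub>R y))\<^sup>2) * exp (- psi lam y)"
        by (intro mult_right_mono M') simp
      moreover have "norm (\<kappa> (z + r m *\<^sub>R y) * (complex_of_real (exp (- psi lam y)) * cis (2 * t * r m * om lam y z)))
          = cmod (\<kappa> (z + r m *\<^sub>R y)) * exp (- psi lam y)"
        by (simp add: norm_mult)
      ultimately show "norm (\<kappa> (z + r m *\<^sub>R y) * (complex_of_real (exp (- psi lam y)) * cis (2 * t * r m * om lam y z)))
          \<le> (M' * exp (- (1/2) * (norm z)\<^sup>2)) * exp (- (1/2) * psi lam y)"
        unfolding mult.assoc by linarith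
    qed
    then show ?thesis by (simp add: mult_ac)
  qed
  let ?B = "M' * (LINT y|mu. exp (- (1/2) * psi lam y))"
  have eL2: "(\<lambda>z. complex_of_real (exp (- (1/2) * (norm z)\<^sup>2))) \<in> L2 (mu :: (complex^'n) measure)"
  proof -
    have "(cmod (complex_of_real (exp (- (1/2) * (norm z)\<^sup>2))))\<^sup>2 = exp (- 1 * (norm z)\<^sup>2)" for z :: "complex^'n"
      by (simp flip: exp_double)
    then show ?thesis
      using integrable_gaussian_norm[of 1, where 'a = "complex^'n"] by (simp add: L2_def integrable_mu_iff)
  qed
  show ?thesis
  proof (rule integral_dominated_convergence[where w = "\<lambda>z. ?B * cmod (\<phi> z * complex_of_real (exp (- (1/2) * (norm z)\<^sup>2)))"])
    show "integrable mu (\<lambda>z. ?B * cmod (\<phi> z * complex_of_real (exp (- (1/2) * (norm z)\<^sup>2))))"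
      by (intro integrable_mult_right integrable_norm L2_mult_integrable \<phi> eL2)
    show "AE z in mu. (\<lambda>m. \<phi> z * mollif t \<kappa> (r m) z) \<longlonglongrightarrow> \<phi> z * (\<kappa> z * complex_of_real gauss_integral)"
      by (intro AE_I2 tendsto_intros pt)
    show "AE z in mu. norm (\<phi> z * mollif t \<kappa> (r m) z) \<le> ?B * cmod (\<phi> z * complex_of_real (exp (- (1/2) * (norm z)\<^sup>2)))" for m
    proof (intro AE_I2)
      fix z
      show "norm (\<phi> z * mollif t \<kappa> (r m) z) \<le> ?B * cmod (\<phi> z * complex_of_real (exp (- (1/2) * (norm z)\<^sup>2)))"
        using mult_left_mono[OF bound[of m z], of "cmod (\<phi> z)"] by (simp add: norm_mult mult_ac)
    qed
  qed (auto simp: mollif_def)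
qed

text \<open>The mean does not depend on b, so its value at b = |t| equals its limit as b grows. The
  former is the kernel operator and the latter is \<open>\<phi>\<close>, both up to
  \<open>gauss_integral\<close>.\<close>

lemma slice_reproducing:
  assumes \<phi>: "\<phi> \<in> L2 mu" and t: "t \<noteq> 0"
    and zero: "AE z0 in mu. AE b in lborel. 0 < b \<longrightarrow> Grad t \<phi> b z0 = 0"
  shows "AE z in mu. \<phi> z = Pop t \<phi> z"
proof -
  note [measurable] = L2_mu_borel[OF \<phi>]
  define G where "G = Gmean t \<phi> \<bar>t\<bar>"
  have Gm [measurable]: "G \<in> borel_measurable borel" unfolding G_def by (rule Gmean_measurable[OF \<phi>])
  obtain B where B: "\<And>z. cmod (G z) \<le> B" using Gmean_bounded[OF \<phi>, of "\<bar>t\<bar>" t] t unfolding G_def by auto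
  obtain l where l: "l > 0" "\<forall>z. l * (norm z)\<^sup>2 \<le> psi lam z" using psi_lower_bound by blast
  \<comment> \<open>The summand 2 / l ensures r^2 = 1 / b \<le> l / 2 from the first index on, as
    \<open>mollif_limit\<close> requires.\<close>
  define b where "b m = real (Suc m) + 2 / l" for m
  define r where "r m = 1 / sqrt (b m)" for m
  have b0: "b m > 0" for m using l by (simp add: b_def add_pos_pos)
  have blim: "filterlim b at_top sequentially"
    unfolding b_def
    by (rule filterlim_at_top_mono[OF filterlim_real_sequentially]) (use l in auto)
  have r: "0 < r m" "(r m)\<^sup>2 \<le> l / 2" for m
  proof -
    show "0 < r m" using b0[of m] by (simp add: r_def)
    have "2 / l \<le> b m" by (simp add: b_def)
    then have "1 / b m \<le> 1 / (2 / l)" using l by (intro divide_left_mono) (auto simp: b0)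
    then show "(r m)\<^sup>2 \<le> l / 2" using b0[of m] by (simp add: r_def power_divide)
  qed
  have r0: "r \<longlonglongrightarrow> 0"
    unfolding r_def using filterlim_compose[OF sqrt_at_top blim]
    by (auto intro: tendsto_divide_0 filterlim_at_top_imp_at_infinity)
  have c0: "(\<lambda>m. complex_of_real (((b m + t) / b m) ^ CARD('n))) \<longlonglongrightarrow> complex_of_real (1 ^ CARD('n))"
  proof -
    have "(\<lambda>m. 1 + t / b m) \<longlonglongrightarrow> 1 + 0"
      by (intro tendsto_intros tendsto_divide_0[OF tendsto_const] filterlim_at_top_imp_at_infinity blim)
    moreover have "1 + t / b m = (b m + t) / b m" for m using b0[of m] by (simp add: field_simps)
    ultimately show ?thesis by (intro tendsto_intros) simp
  qed
  have "AE z in mu. G z - complex_of_real gauss_integral * \<phi> z = 0"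
  proof (rule test_functions_separate_mu)
    show "(\<lambda>z. G z - complex_of_real gauss_integral * \<phi> z) \<in> borel_measurable borel" by measurable
    show "integrable lborel (\<lambda>x. indicator (box p q) x *\<^sub>R (G x - complex_of_real gauss_integral * \<phi> x))" for p q
    proof -
      have "integrable lborel (\<lambda>x. indicator (box p q) x *\<^sub>R (complex_of_real gauss_integral * \<phi> x))"
        using L2_cmult[OF \<phi>] by (intro integrable_indicator_box_L2) (simp add: L2_mu)
      moreover have "integrable lborel (\<lambda>x. indicator (box p q) x *\<^sub>R G x)"
        by (rule integrable_indicator_box_bounded[OF Gm B])
      ultimately show ?thesis by (simp add: scaleR_diff_right)
    qed
    fix \<kappa> :: "complex^'n \<Rightarrow> complex" assume \<kappa>: "test_function \<kappa>"
    note [measurable] = test_function_borel[OF \<kappa>]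
    have "(LINT z0|mu. \<kappa> z0 * Gmean t \<phi> (b m) z0) = (LINT z0|mu. \<kappa> z0 * G z0)" for m
    proof (rule Bochner_Integration.integral_cong_AE)
      have [measurable]: "Gmean t \<phi> (b m) \<in> borel_measurable borel" by (rule Gmean_measurable[OF \<phi>])
      show "(\<lambda>z0. \<kappa> z0 * Gmean t \<phi> (b m) z0) \<in> borel_measurable mu" by measurable
      show "AE z0 in mu. \<kappa> z0 * Gmean t \<phi> (b m) z0 = \<kappa> z0 * G z0"
        using zero
      proof eventually_elim
        case (elim z0)
        show ?case
        proof (cases "\<bar>t\<bar> \<le> b m")
          case True
          then show ?thesis using Gmean_const[OF \<phi> elim _ True] t by (simp add: G_def)
        next
          case False
          then show ?thesis using Gmean_const[OF \<phi> elim b0[of m], of "\<bar>t\<bar>"] by (simp add: G_def)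
        qed
      qed
    qed measurable
    then have "(LINT z0|mu. \<kappa> z0 * G z0) = complex_of_real (((b m + t) / b m) ^ CARD('n)) * (LINT z|mu. \<phi> z * mollif t \<kappa> (r m) z)" for m
      using Gmean_test[OF \<phi> \<kappa> b0] by (simp only: r_def)
    moreover have "(\<lambda>m. complex_of_real (((b m + t) / b m) ^ CARD('n)) * (LINT z|mu. \<phi> z * mollif t \<kappa> (r m) z))
        \<longlonglongrightarrow> complex_of_real (1 ^ CARD('n)) * (LINT z|mu. \<phi> z * (\<kappa> z * complex_of_real gauss_integral))"
      by (intro tendsto_mult c0 mollif_limit[OF \<phi> \<kappa> l r r0])
    ultimately have "(LINT z0|mu. \<kappa> z0 * G z0) = (LINT z|mu. \<phi> z * (\<kappa> z * complex_of_real gauss_integral))"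
      using LIMSEQ_unique[OF tendsto_const] by (simp del: of_real_power of_real_divide of_real_add)
    moreover have "(LINT z|mu. \<phi> z * (\<kappa> z * complex_of_real gauss_integral)) = (LINT z|mu. \<kappa> z * (complex_of_real gauss_integral * \<phi> z))"
      by (intro Bochner_Integration.integral_cong) (auto simp: mult_ac)
    moreover have "integrable mu (\<lambda>z. \<kappa> z * (complex_of_real gauss_integral * \<phi> z))"
      by (intro L2_mult_integrable L2_cmult \<phi>) (simp add: L2_mu test_function_L2 \<kappa>)
    moreover have "integrable mu (\<lambda>z. \<kappa> z * G z)"
    proof (rule Bochner_Integration.integrable_bound)
      show "integrable mu (\<lambda>z. B * cmod (\<kappa> z))"
        using test_function_integrable[OF \<kappa>] by (intro integrable_mult_right integrable_norm) (simp add: integrable_mu_iff)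
      show "AE z in mu. norm (\<kappa> z * G z) \<le> norm (B * cmod (\<kappa> z))"
      proof (intro AE_I2)
        fix z
        have "norm (\<kappa> z * G z) = cmod (G z) * cmod (\<kappa> z)" by (simp add: norm_mult)
        also have "\<dots> \<le> norm (B * cmod (\<kappa> z))"
          unfolding real_norm_def by (rule order_trans[OF mult_right_mono[OF B norm_ge_zero] abs_ge_self])
        finally show "norm (\<kappa> z * G z) \<le> norm (B * cmod (\<kappa> z))" .
      qed
    qed measurable
    ultimately show "(LINT x|mu. \<kappa> x * (G x - complex_of_real gauss_integral * \<phi> x)) = 0"
      by (simp add: right_diff_distrib)
  qed
  \<comment> \<open>For t > 0 the normalisation is (2 t)^n, as in \<open>Pker\<close>. For t < 0 it
    is 0^n with n \<ge> 1, in agreement with \<open>Pker\<close> being zero there.\<close>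
  moreover have "G z = complex_of_real gauss_integral * Pop t \<phi> z" for z
  proof (cases "t > 0")
    case True
    have "G z = (LINT w|mu. complex_of_real gauss_integral * (Pker t z w * \<phi> w))"
      unfolding G_def Gmean_def
      by (intro Bochner_Integration.integral_cong)
        (use True gauss_integral_pos in \<open>auto simp: Pker_def psi_minus_commute[of lam z]\<close>)
    then show ?thesis by (simp add: Pop_def)
  next
    case False
    then show ?thesis using t by (simp add: G_def Gmean_def Pop_def Pker_def power_0_left)
  qed
  ultimately show ?thesis
    using gauss_integral_pos by (auto elim!: eventually_mono)
qed

end

section \<open>The kernel of the Kohn Laplacian\<close>

lemma L2_mu_heis_borel: "f \<in> L2 (mu_heis :: ('n::finite) heis measure) \<Longrightarrow> f \<in> borel_measurable borel"
  using L2_measurable[of f mu_heis] by (simp add: measurable_cong_sets[OF sets_mu_heis refl])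

text \<open>Testing the adjoint relation against u = v itself gives the squared norm of f equal to
  the pairing of v with 0, so f vanishes. Conversely, the zero form lies in the domain of the
  adjoint. The second-order equation is thus replaced by the weak first-order one.\<close>

lemma ker_box_b_iff:
  fixes lam :: "real^'n"
  shows "v \<in> ker_box_b lam \<longleftrightarrow> v \<in> L2 mu_heis \<and> (\<forall>j g. test_function g \<longrightarrow> (LINT x|mu_heis. v x * Zbar lam j g x) = 0)"
proof
  assume "v \<in> ker_box_b lam"
  then obtain f where f: "dbar_b lam v f" "dbar_b_adj lam f (\<lambda>_. 0)"
    by (auto simp: ker_box_b_def box_b_def)
  have fL: "f \<in> L2 mu_heis" using f(1) by (simp add: dbar_b_def)
  have "L2_inner_forms mu_heis f f = L2_inner mu_heis v (\<lambda>_. 0)"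
    using f by (simp add: dbar_b_adj_def)
  moreover have "(\<Sum>j\<in>UNIV. f x $ j * cnj (f x $ j)) = complex_of_real ((norm (f x))\<^sup>2)" for x
    by (simp add: power2_norm_vec complex_norm_square flip: of_real_power)
  ultimately have "complex_of_real (LINT x|mu_heis. (norm (f x))\<^sup>2) = 0"
    by (simp add: L2_inner_forms_def L2_inner_def del: of_real_power)
  then have "(LINT x|mu_heis. (norm (f x))\<^sup>2) = 0"
    by (simp only: of_real_eq_0_iff)
  then have "AE x in mu_heis. f x = 0"
    using fL integral_nonneg_eq_0_iff_AE[of mu_heis "\<lambda>x. (norm (f x))\<^sup>2"] by (auto simp: L2_def)
  then have "AE x in mu_heis. f x $ j * g x = 0" for j g by eventually_elim simp
  then have "(LINT x|mu_heis. f x $ j * g x) = 0" for j g by (rule integral_eq_zero_AE)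
  then show "v \<in> L2 mu_heis \<and> (\<forall>j g. test_function g \<longrightarrow> (LINT x|mu_heis. v x * Zbar lam j g x) = 0)"
    using f(1) by (simp add: dbar_b_def)
next
  assume v: "v \<in> L2 mu_heis \<and> (\<forall>j g. test_function g \<longrightarrow> (LINT x|mu_heis. v x * Zbar lam j g x) = 0)"
  have "dbar_b lam v (\<lambda>_. 0)"
    using v by (simp add: dbar_b_def L2_def)
  moreover have "dbar_b_adj lam (\<lambda>_. 0) (\<lambda>_. 0)"
    by (simp add: dbar_b_adj_def L2_def L2_inner_forms_def L2_inner_def)
  ultimately show "v \<in> ker_box_b lam"
    by (auto simp: ker_box_b_def box_b_def)
qed

text \<open>\<open>Zbar\<close> at a point as a functional of the derivative. Explicit derivatives
  can be fed in, and the product rule becomes the algebraic identity \<open>ZD_mult\<close>.\<close>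

definition ZD :: "real^'n \<Rightarrow> 'n \<Rightarrow> 'n heis \<Rightarrow> ('n heis \<Rightarrow> complex) \<Rightarrow> complex" where
  "ZD lam j x D = (D (axis j 1, 0) + \<i> * D (axis j \<i>, 0)) / 2 + \<i> * complex_of_real (lam $ j) * (fst x $ j) * D (0, 1)"

lemma Zbar_eq_ZD:
  assumes "(u has_derivative D) (at x)"
  shows "Zbar lam j u x = ZD lam j x D"
proof -
  have "frechet_derivative u (at x) = D" using frechet_derivative_at[OF assms] by simp
  then show ?thesis by (simp add: Zbar_def ZD_def)
qed

lemma C_k_fst_nth: "C_k k (\<lambda>x :: ('n::finite) heis. fst x $ j)"
  by (intro C_k_bounded_linear bounded_linear_compose[OF bounded_linear_vec_nth bounded_linear_fst])

lemma test_function_Zbar: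
  assumes "test_function (g :: ('n::finite) heis \<Rightarrow> complex)"
  shows "test_function (Zbar lam j g)"
proof -
  have "test_function (\<lambda>x. (1/2) * (frechet_derivative g (at x) (axis j 1, 0) + \<i> * frechet_derivative g (at x) (axis j \<i>, 0))
      + (\<i> * complex_of_real (lam $ j)) * (frechet_derivative g (at x) (0, 1) * (fst x $ j)))"
    by (intro test_function_add test_function_cmult test_function_deriv test_function_mult_smooth assms C_k_fst_nth)
  then show ?thesis
    by (simp add: Zbar_def[abs_def] Let_def mult_ac)
qed

lemma derivative_zero_outside:
  fixes k :: "'a::euclidean_space \<Rightarrow> complex"
  assumes D: "(k has_derivative D) (at x)" and supp: "\<And>x. k x \<noteq> 0 \<Longrightarrow> norm x \<le> R" and x: "norm x > R"
  shows "D v = 0"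
proof -
  have "(k has_derivative (\<lambda>v. 0)) (at x)"
  proof (rule has_derivative_transform_within_open)
    show "((\<lambda>x. 0) has_derivative (\<lambda>v. 0)) (at x)" by simp
    show "open {x :: 'a. norm x > R}" by (intro open_Collect_less continuous_intros)
    fix y :: 'a assume "y \<in> {x. norm x > R}"
    then show "0 = k y" using supp[of y] by (cases "k y = 0") auto
  qed (use x in simp)
  from has_derivative_unique[OF D this] show ?thesis by simp
qed

text \<open>Only directional bounds on the derivative are assumed, since for products with
  holomorphic functions these come directly from Cauchy's inequality.\<close>

lemma integral_ZD_eq_0:
  fixes k :: "('n::finite) heis \<Rightarrow> complex"
  assumes D: "\<And>x. (k has_derivative D x) (at x)" and supp: "\<And>x. k x \<noteq> 0 \<Longrightarrow> norm x \<le> R"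
    and bound: "\<And>v. \<exists>C. \<forall>x. cmod (D x v) \<le> C"
  shows "(LINT x|mu_heis. ZD lam j x (D x)) = 0"
proof -
  obtain C1 where C1: "\<And>x. cmod (D x (axis j 1, 0)) \<le> C1" using bound by blast
  obtain C2 where C2: "\<And>x. cmod (D x (axis j \<i>, 0)) \<le> C2" using bound by blast
  obtain C where C: "\<And>x. cmod (D x (0, 1)) \<le> C" using bound by blast
  have 1: "integrable lborel (\<lambda>x. D x (axis j 1, 0))" "(LINT x|lborel. D x (axis j 1, 0)) = 0"
    by (rule integral_directional_derivative[OF D, where R = R and C = C1]; use supp C1 in blast)+
  have 2: "integrable lborel (\<lambda>x. D x (axis j \<i>, 0))" "(LINT x|lborel. D x (axis j \<i>, 0)) = 0"
    by (rule integral_directional_derivative[OF D, where R = R and C = C2]; use supp C2 in blast)+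
  \<comment> \<open>The coefficient z_j is constant along (0, 1), so z_j times that derivative of k
    is the derivative of the product z_j k; this handles the variable coefficient of
    \<open>Zbar\<close>.\<close>
  let ?D3 = "\<lambda>x v. (fst x $ j) * D x v + (fst v $ j) * k x"
  have d3: "((\<lambda>x. (fst x $ j) * k x) has_derivative ?D3 x) (at x)" for x
  proof -
    have "((\<lambda>x :: 'n heis. fst x $ j) has_derivative (\<lambda>v. fst v $ j)) (at x)"
      by (intro bounded_linear_imp_has_derivative bounded_linear_compose[OF bounded_linear_vec_nth bounded_linear_fst])
    from has_derivative_mult[OF this D] show ?thesis .
  qed
  have b3: "cmod (?D3 x (0, 1)) \<le> \<bar>R\<bar> * C" for x
  proof (cases "norm x \<le> R")
    case True
    have "cmod (fst x $ j) \<le> norm (fst x)" by (rule Finite_Cartesian_Product.norm_nth_le)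
    also have "\<dots> \<le> norm x" using norm_fst_le[of "fst x" "snd x"] by simp
    finally have "cmod (fst x $ j) \<le> \<bar>R\<bar>" using True by linarith
    then show ?thesis using C[of x] by (auto simp: norm_mult intro!: mult_mono)
  next
    case False
    then have "D x (0, 1) = 0" using derivative_zero_outside[where R = R, OF D supp] by simp
    moreover have "C \<ge> 0" using C[of x] norm_ge_zero order_trans by blast
    ultimately show ?thesis by simp
  qed
  have s3: "norm x \<le> R" if "(fst x $ j) * k x \<noteq> 0" for x
    using supp that by auto
  have 3: "integrable lborel (\<lambda>x. ?D3 x (0, 1))" "(LINT x|lborel. ?D3 x (0, 1)) = 0"
    by (rule integral_directional_derivative[OF d3, where R = R and C = "\<bar>R\<bar> * C"]; use s3 b3 in blast)+
  let ?F = "\<lambda>x. (1/2) * (D x (axis j 1, 0) + \<i> * D x (axis j \<i>, 0)) + (\<i> * complex_of_real (lam $ j)) * ?D3 x (0, 1)"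
  have F: "ZD lam j x (D x) = ?F x" for x by (simp add: ZD_def mult_ac)
  have meas: "?F \<in> borel_measurable borel"
    using borel_measurable_integrable[of lborel ?F,
      OF Bochner_Integration.integrable_add[OF integrable_mult_right[OF Bochner_Integration.integrable_add[OF 1(1) integrable_mult_right[OF 2(1)]]] integrable_mult_right[OF 3(1)]]]
    by (simp only: measurable_cong_sets[OF sets_lborel refl])
  have "(LINT x|lborel. ?F x) = 0"
    using 1 2 3 by (simp add: integral_add)
  then show ?thesis
    unfolding F using meas by (simp add: integral_mu_heis)
qed

lemma ZD_mult:
  "ZD lam j x (\<lambda>v. f * D' v + D v * g) = f * ZD lam j x D' + ZD lam j x D * g"
  by (simp add: ZD_def algebra_simps add_divide_distrib)

section \<open>Cut-offs and smooth tests without compact support\<close>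

definition cutoff :: "nat \<Rightarrow> 'a::euclidean_space \<Rightarrow> real" where
  "cutoff m x = exp 1 * bump (1 - (norm x)\<^sup>2 / (real (Suc m))\<^sup>2)"

definition bump' :: "real \<Rightarrow> real" where
  "bump' = bump_aux ([:0, 0, 1:] * (1 - pderiv 1))"

lemma bump_deriv: "(bump has_real_derivative bump' x) (at x)"
  unfolding bump_def bump'_def by (rule bump_aux_deriv)

lemma bump'_bounded: "\<exists>C>0. \<forall>y\<le>1. \<bar>bump' y\<bar> \<le> C"
proof -
  have "continuous_on UNIV bump'"
    unfolding bump'_def using C_k_continuous[OF C_k_bump_aux] .
  then have "compact (bump' ` {0..1})"
    by (intro compact_continuous_image) (auto intro: continuous_on_subset)
  from compact_imp_bounded[OF this] obtain C where C: "C > 0" "\<And>y. y \<in> {0..1} \<Longrightarrow> \<bar>bump' y\<bar> \<le> C"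
    unfolding bounded_pos by auto
  have "\<bar>bump' y\<bar> \<le> C" if "y \<le> 1" for y
    using C that by (cases "y \<ge> 0") (auto simp: bump'_def bump_aux_def)
  with C(1) show ?thesis by blast
qed

lemma C_k_cutoff: "C_k k (\<lambda>x. complex_of_real (cutoff m x))"
proof -
  have "C_k k (\<lambda>x::'a. x \<bullet> x)"
    by (rule C_k_bilinear[OF bounded_bilinear_inner C_k_id C_k_id])
  then have "C_k k (\<lambda>x::'a. (1 / (real (Suc m))\<^sup>2) * (x \<bullet> x))"
    by (rule C_k_mult[OF C_k_const])
  then have "C_k k (\<lambda>x::'a. 1 - (1 / (real (Suc m))\<^sup>2) * (x \<bullet> x))"
    by (rule C_k_diff[OF C_k_const])
  then have "C_k k (\<lambda>x::'a. bump (1 - (1 / (real (Suc m))\<^sup>2) * (x \<bullet> x)))"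
    by (rule C_k_compose_real[OF C_k_bump])
  then have "C_k k (\<lambda>x::'a. exp 1 * bump (1 - (1 / (real (Suc m))\<^sup>2) * (x \<bullet> x)))"
    by (rule C_k_mult[OF C_k_const])
  then show ?thesis
    unfolding cutoff_def by (intro C_k_of_real) (simp add: power2_norm_eq_inner)
qed

lemma cutoff_support: "cutoff m x \<noteq> 0 \<Longrightarrow> norm x \<le> real (Suc m)"
proof (rule ccontr)
  assume nz: "cutoff m x \<noteq> 0" and "\<not> norm x \<le> real (Suc m)"
  then have "(real (Suc m))\<^sup>2 \<le> (norm x)\<^sup>2" by (intro power_mono) auto
  then have "bump (1 - (norm x)\<^sup>2 / (real (Suc m))\<^sup>2) = 0"
    by (intro bump_nonpos) (simp add: divide_simps del: of_nat_Suc)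
  with nz show False by (simp add: cutoff_def)
qed

lemma cutoff_bounds: "0 \<le> cutoff m x" "cutoff m x \<le> 1"
proof -
  show "0 \<le> cutoff m x" by (simp add: cutoff_def bump_nonneg)
  let ?y = "1 - (norm x)\<^sup>2 / (real (Suc m))\<^sup>2"
  show "cutoff m x \<le> 1"
  proof (cases "?y > 0")
    case True
    moreover have "?y \<le> 1" by simp
    ultimately have "1 \<le> 1 / ?y" by simp
    then have "exp (1 + - 1 / ?y) \<le> exp 0" by (subst exp_le_cancel_iff) simp
    then show ?thesis unfolding cutoff_def bump_pos[OF True] exp_add[symmetric] by simp
  next
    case False
    then have "?y \<le> 0" by linarith
    then show ?thesis by (simp only: cutoff_def bump_nonpos)
  qed
qed

lemma inverse_Suc_sq_tendsto: "(\<lambda>m. c / (real (Suc m))\<^sup>2) \<longlonglongrightarrow> 0"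
proof -
  have "(\<lambda>m. c * (1 / real (Suc m)) * (1 / real (Suc m))) \<longlonglongrightarrow> c * 0 * 0"
    using LIMSEQ_Suc[OF lim_1_over_n] by (intro tendsto_intros) (simp_all add: inverse_eq_divide)
  then show ?thesis by (simp add: power2_eq_square del: of_nat_Suc)
qed

text \<open>The factor \<open>exp 1\<close> in \<open>cutoff\<close> compensates
  \<open>bump 1\<close>, which is exp (-1).\<close>

lemma cutoff_tendsto: "(\<lambda>m. cutoff m x) \<longlonglongrightarrow> 1"
proof -
  have "(\<lambda>m. 1 - (norm x)\<^sup>2 / (real (Suc m))\<^sup>2) \<longlonglongrightarrow> 1 - 0"
    by (intro tendsto_intros inverse_Suc_sq_tendsto)
  moreover have "isCont bump 1" using bump_deriv by (rule DERIV_isCont)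
  ultimately have "(\<lambda>m. bump (1 - (norm x)\<^sup>2 / (real (Suc m))\<^sup>2)) \<longlonglongrightarrow> bump 1"
    by (intro isCont_tendsto_compose[of _ bump]) auto
  then have "(\<lambda>m. cutoff m x) \<longlonglongrightarrow> exp 1 * bump 1"
    unfolding cutoff_def by (intro tendsto_intros)
  then show ?thesis by (simp add: bump_pos flip: exp_add)
qed

lemma cutoff_deriv:
  "((\<lambda>x. complex_of_real (cutoff m x)) has_derivative
    (\<lambda>v. complex_of_real (- (2 * exp 1 * bump' (1 - (norm x)\<^sup>2 / (real (Suc m))\<^sup>2) * (x \<bullet> v) / (real (Suc m))\<^sup>2)))) (at x)"
proof -
  let ?c = "inverse ((real (Suc m))\<^sup>2)"
  have 1: "((\<lambda>x. 1 - (x \<bullet> x) * ?c) has_derivative (\<lambda>v. - (2 * (x \<bullet> v) * ?c))) (at x)"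
    by (auto intro!: derivative_eq_intros simp: inner_commute algebra_simps simp del: of_nat_Suc)
  have "((\<lambda>x. bump (1 - (x \<bullet> x) * ?c)) has_derivative
      (\<lambda>v. bump' (1 - (x \<bullet> x) * ?c) * - (2 * (x \<bullet> v) * ?c))) (at x)"
    using has_derivative_compose[OF 1 bump_deriv[unfolded has_field_derivative_def]] .
  from has_derivative_mult_right[OF this, of "exp 1"]
  have "((\<lambda>x. cutoff m x) has_derivative
    (\<lambda>v. - (2 * exp 1 * bump' (1 - (norm x)\<^sup>2 / (real (Suc m))\<^sup>2) * (x \<bullet> v) / (real (Suc m))\<^sup>2))) (at x)"
    unfolding cutoff_def power2_norm_eq_inner divide_inverse by (simp add: mult_ac del: of_nat_Suc)
  from has_derivative_of_real[OF this] show ?thesis .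
qed

text \<open>The derivative of the cut-off is of order |x| / m^2 and the coefficient of
  \<open>Zbar\<close> grows like |x|. Their product is of order |x|^2 / m^2, hence bounded on the
  support |x| \<le> m + 1 and pointwise null in the limit. The Euclidean ball therefore suffices
  despite the unbounded coefficient.\<close>

lemma Zbar_cutoff_bound:
  obtains C where "C > 0"
    "\<And>m (x :: ('n::finite) heis). cmod (Zbar lam j (\<lambda>x. complex_of_real (cutoff m x)) x) \<le> C"
    "\<And>(x :: 'n heis). (\<lambda>m. Zbar lam j (\<lambda>x. complex_of_real (cutoff m x)) x) \<longlonglongrightarrow> 0"
proof -
  obtain C where C: "C > 0" "\<forall>y\<le>1. \<bar>bump' y\<bar> \<le> C" using bump'_bounded by blast
  let ?D = "\<lambda>m x v. complex_of_real (- (2 * exp 1 * bump' (1 - (norm x)\<^sup>2 / (real (Suc m))\<^sup>2) * (x \<bullet> v) / (real (Suc m))\<^sup>2))"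
  let ?L = "\<bar>lam $ j\<bar>"
  have v1: "norm (axis j (1::complex), 0::real) \<le> 1" "norm (axis j \<i>, 0::real) \<le> 1" "norm (0 :: complex^'n, 1::real) \<le> 1"
    by (simp_all add: norm_Pair)
  have D: "cmod (?D m x v) \<le> 2 * exp 1 * C * norm x / (real (Suc m))\<^sup>2" if v: "norm v \<le> 1" for m v and x :: "'n heis"
  proof -
    have "\<bar>x \<bullet> v\<bar> \<le> norm x * norm v" by (rule Cauchy_Schwarz_ineq2)
    also have "\<dots> \<le> norm x" using v by (simp add: mult_left_le)
    finally have "\<bar>bump' (1 - (norm x)\<^sup>2 / (real (Suc m))\<^sup>2)\<bar> * \<bar>x \<bullet> v\<bar> \<le> C * norm x"
      using C by (intro mult_mono) auto
    then have "2 * exp 1 * (\<bar>bump' (1 - (norm x)\<^sup>2 / (real (Suc m))\<^sup>2)\<bar> * \<bar>x \<bullet> v\<bar>) / (real (Suc m))\<^sup>2 \<le> 2 * exp 1 * (C * norm x) / (real (Suc m))\<^sup>2"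
      by (intro divide_right_mono mult_left_mono) auto
    moreover have "cmod (?D m x v) = 2 * exp 1 * (\<bar>bump' (1 - (norm x)\<^sup>2 / (real (Suc m))\<^sup>2)\<bar> * \<bar>x \<bullet> v\<bar>) / (real (Suc m))\<^sup>2"
      by (simp only: norm_of_real abs_minus_cancel abs_divide abs_mult abs_power2 abs_numeral abs_exp_cancel mult.assoc)
    ultimately show ?thesis by (simp only: mult.assoc)
  qed
  have Z: "cmod (Zbar lam j (\<lambda>x. complex_of_real (cutoff m x)) x) \<le> (2 * exp 1 * C * norm x * (1 + ?L * norm x)) / (real (Suc m))\<^sup>2" for m and x :: "'n heis"
  proof -
    let ?e = "2 * exp 1 * C * norm x / (real (Suc m))\<^sup>2"
    have "cmod (fst x $ j) \<le> norm (fst x)" by (rule Finite_Cartesian_Product.norm_nth_le)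
    also have "\<dots> \<le> norm x" using norm_fst_le[of "fst x" "snd x"] by simp
    finally have xj: "cmod (fst x $ j) \<le> norm x" .
    have "cmod (Zbar lam j (\<lambda>x. complex_of_real (cutoff m x)) x)
        \<le> cmod ((?D m x (axis j 1, 0) + \<i> * ?D m x (axis j \<i>, 0)) / 2) + cmod (\<i> * complex_of_real (lam $ j) * (fst x $ j) * ?D m x (0, 1))"
      unfolding Zbar_eq_ZD[OF cutoff_deriv] ZD_def by (rule norm_triangle_ineq)
    also have "cmod ((?D m x (axis j 1, 0) + \<i> * ?D m x (axis j \<i>, 0)) / 2) \<le> (cmod (?D m x (axis j 1, 0)) + cmod (\<i> * ?D m x (axis j \<i>, 0))) / 2"
      unfolding norm_divide by (intro divide_mono norm_triangle_ineq) auto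
    also have "\<dots> \<le> (?e + ?e) / 2"
      using D[OF v1(1), of x m] D[OF v1(2), of x m] unfolding norm_mult norm_ii mult_1 by (intro divide_right_mono add_mono) auto
    also have "cmod (\<i> * complex_of_real (lam $ j) * (fst x $ j) * ?D m x (0, 1)) \<le> ?L * norm x * ?e"
      unfolding norm_mult[of _ "?D m x (0, 1)"] norm_mult[of _ "fst x $ j"]
      using D[OF v1(3), of x m] xj C(1) by (intro mult_mono mult_nonneg_nonneg) (auto simp: norm_mult)
    finally have "cmod (Zbar lam j (\<lambda>x. complex_of_real (cutoff m x)) x) \<le> (?e + ?e) / 2 + ?L * norm x * ?e" by simp
    also have "\<dots> = (2 * exp 1 * C * norm x * (1 + ?L * norm x)) / (real (Suc m))\<^sup>2"
      by (simp add: field_simps del: of_nat_Suc)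
    finally show ?thesis .
  qed
  show ?thesis
  proof
    show "2 * exp 1 * C * (1 + ?L) > 0" using C(1) by (intro mult_pos_pos add_pos_nonneg) auto
    show "cmod (Zbar lam j (\<lambda>x. complex_of_real (cutoff m x)) x) \<le> 2 * exp 1 * C * (1 + ?L)" for m and x :: "'n heis"
    proof (cases "norm x \<le> real (Suc m)")
      case True
      let ?m = "real (Suc m)"
      have m: "1 \<le> ?m" by simp
      have "norm x * (1 + ?L * norm x) \<le> ?m * (1 + ?L * ?m)"
        using True by (intro mult_mono add_mono mult_left_mono) auto
      also have "\<dots> \<le> ?m * (?m + ?L * ?m)" using m by (intro mult_left_mono add_mono) auto
      also have "\<dots> = (1 + ?L) * ?m\<^sup>2" by (simp add: power2_eq_square algebra_simps del: of_nat_Suc)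
      finally have "(2 * exp 1 * C) * (norm x * (1 + ?L * norm x)) \<le> (2 * exp 1 * C) * ((1 + ?L) * ?m\<^sup>2)"
        using C(1) by (intro mult_left_mono) auto
      then have "(2 * exp 1 * C * norm x * (1 + ?L * norm x)) / ?m\<^sup>2 \<le> 2 * exp 1 * C * (1 + ?L)"
        by (simp add: divide_le_eq mult.assoc del: of_nat_Suc)
      with Z[of m x] show ?thesis by linarith
    next
      case False
      have "?D m x v = 0" for v
      proof (rule derivative_zero_outside[where D = "?D m x" and x = x])
        show "((\<lambda>x. complex_of_real (cutoff m x)) has_derivative ?D m x) (at x)" by (rule cutoff_deriv)
        show "norm y \<le> real (Suc m)" if "complex_of_real (cutoff m y) \<noteq> 0" for y :: "'n heis"
          by (rule cutoff_support) (use that in simp)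
        show "real (Suc m) < norm x" using False by simp
      qed
      then have "Zbar lam j (\<lambda>x. complex_of_real (cutoff m x)) x = 0"
        unfolding Zbar_eq_ZD[OF cutoff_deriv] ZD_def by (simp only: mult_zero_right add_0_left div_0)
      then show ?thesis using C(1) by simp
    qed
    show "(\<lambda>m. Zbar lam j (\<lambda>x. complex_of_real (cutoff m x)) x) \<longlonglongrightarrow> 0" for x :: "'n heis"
      by (rule Lim_null_comparison[OF _ inverse_Suc_sq_tendsto[of "2 * exp 1 * C * norm x * (1 + ?L * norm x)"]])
        (intro always_eventually allI Z)
  qed
qed

text \<open>The tests used below are band-limited in the last variable, which compact support would
  not allow. The product rule with the cut-off leaves an error \<open>Zbar\<close> of the cut-off
  times g; it is bounded and tends to zero, so dominated convergence removes it.\<close>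

lemma ker_box_b_smooth:
  fixes h :: "('n::finite) heis \<Rightarrow> complex"
  assumes h: "h \<in> ker_box_b lam" and g: "\<And>k. C_k k g" "g \<in> L2 mu_heis" "Zbar lam j g \<in> L2 mu_heis"
  shows "(LINT x|mu_heis. h x * Zbar lam j g x) = 0"
proof -
  have hL: "h \<in> L2 mu_heis" using h by (simp add: ker_box_b_iff)
  let ?c = "\<lambda>m x. complex_of_real (cutoff m (x :: 'n heis))"
  obtain C where C: "C > 0" "\<And>m x. cmod (Zbar lam j (?c m) x) \<le> C" "\<And>x. (\<lambda>m. Zbar lam j (?c m) x) \<longlonglongrightarrow> 0"
    using Zbar_cutoff_bound[of lam j] by blast
  have ct: "test_function (?c m)" for m
    by (rule test_functionI[where S = "cball 0 (real (Suc m))", OF C_k_cutoff]) (use cutoff_support[of m] in auto)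
  have prod: "Zbar lam j (\<lambda>x. ?c m x * g x) x = ?c m x * Zbar lam j g x + Zbar lam j (?c m) x * g x" for m x
  proof -
    note dg = C_k_SucD[OF g(1), of x]
    show ?thesis
      unfolding Zbar_eq_ZD[OF has_derivative_mult[OF cutoff_deriv dg]] Zbar_eq_ZD[OF dg] Zbar_eq_ZD[OF cutoff_deriv]
      by (rule ZD_mult)
  qed
  have [measurable]: "h \<in> borel_measurable borel" "g \<in> borel_measurable borel" "Zbar lam j g \<in> borel_measurable borel"
    using hL g by (auto intro: L2_mu_heis_borel)
  have [measurable]: "?c m \<in> borel_measurable borel" "Zbar lam j (?c m) \<in> borel_measurable borel" for m
    using ct test_function_Zbar by (blast intro: test_function_borel)+
  have "(\<lambda>m. LINT x|mu_heis. h x * Zbar lam j (\<lambda>x. ?c m x * g x) x) \<longlonglongrightarrow> (LINT x|mu_heis. h x * Zbar lam j g x)"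
    unfolding prod
  proof (rule integral_dominated_convergence[where w = "\<lambda>x. cmod (h x * Zbar lam j g x) + C * cmod (h x * g x)"])
    show "integrable mu_heis (\<lambda>x. cmod (h x * Zbar lam j g x) + C * cmod (h x * g x))"
      by (intro Bochner_Integration.integrable_add integrable_mult_right integrable_norm L2_mult_integrable hL g)
    show "AE x in mu_heis. (\<lambda>m. h x * (?c m x * Zbar lam j g x + Zbar lam j (?c m) x * g x)) \<longlonglongrightarrow> h x * Zbar lam j g x"
    proof (intro AE_I2)
      fix x
      have "(\<lambda>m. h x * (?c m x * Zbar lam j g x + Zbar lam j (?c m) x * g x)) \<longlonglongrightarrow> h x * (complex_of_real 1 * Zbar lam j g x + 0 * g x)"
        by (intro tendsto_intros cutoff_tendsto C)
      then show "(\<lambda>m. h x * (?c m x * Zbar lam j g x + Zbar lam j (?c m) x * g x)) \<longlonglongrightarrow> h x * Zbar lam j g x" by simp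
    qed
    show "AE x in mu_heis. norm (h x * (?c m x * Zbar lam j g x + Zbar lam j (?c m) x * g x))
        \<le> cmod (h x * Zbar lam j g x) + C * cmod (h x * g x)" for m
    proof (intro AE_I2)
      fix x
      have "norm (?c m x * Zbar lam j g x + Zbar lam j (?c m) x * g x) \<le> cmod (?c m x) * cmod (Zbar lam j g x) + cmod (Zbar lam j (?c m) x) * cmod (g x)"
        unfolding norm_mult[symmetric] by (rule norm_triangle_ineq)
      also have "\<dots> \<le> 1 * cmod (Zbar lam j g x) + C * cmod (g x)"
        using cutoff_bounds[of m x] by (intro add_mono mult_right_mono C) auto
      finally have "cmod (h x) * norm (?c m x * Zbar lam j g x + Zbar lam j (?c m) x * g x) \<le> cmod (h x) * (cmod (Zbar lam j g x) + C * cmod (g x))"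
        by (intro mult_left_mono) auto
      then show "norm (h x * (?c m x * Zbar lam j g x + Zbar lam j (?c m) x * g x))
        \<le> cmod (h x * Zbar lam j g x) + C * cmod (h x * g x)"
        unfolding norm_mult[of "h x"] by (simp only: distrib_left mult.left_commute[of "cmod (h x)" C])
    qed
  qed measurable
  moreover have "(LINT x|mu_heis. h x * Zbar lam j (\<lambda>x. ?c m x * g x) x) = 0" for m
    using h test_function_mult_smooth[OF ct g(1)] by (auto simp: ker_box_b_iff)
  ultimately show ?thesis
    by (simp add: LIMSEQ_const_iff)
qed

section \<open>Band-limited Gaussian tests\<close>

definition band_kernel :: "real \<Rightarrow> real \<Rightarrow> nat \<Rightarrow> real \<Rightarrow> complex" where
  "band_kernel A B q s = integral {A..B} (\<lambda>t. (\<i> * complex_of_real t) ^ q * cis (s * t))"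

text \<open>Differentiation under the integral multiplies by i t, that is, raises q by one. With q
  as a parameter the family is closed under derivatives and \<open>C_k_family\<close> gives
  smoothness.\<close>

lemma band_kernel_deriv: "(band_kernel A B q has_vector_derivative band_kernel A B (Suc q) s) (at s)"
proof -
  have d: "((\<lambda>s. (\<i> * complex_of_real t) ^ q * cis (s * t)) has_vector_derivative (\<i> * complex_of_real t) ^ Suc q * cis (s * t)) (at s)" for t s
  proof -
    have "((\<lambda>s. cis (s * t)) has_vector_derivative \<i> * complex_of_real t * cis (s * t)) (at s)"
      unfolding cis_conv_exp by (auto intro!: derivative_eq_intros has_vector_derivative_real_field)
    from has_vector_derivative_mult_right[OF this, of "(\<i> * complex_of_real t) ^ q"] show ?thesis
      by (simp add: mult_ac)
  qed
  have "((\<lambda>s. integral (cbox A B) (\<lambda>t. (\<i> * complex_of_real t) ^ q * cis (s * t))) has_vector_derivative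
      integral (cbox A B) (\<lambda>t. (\<i> * complex_of_real t) ^ Suc q * cis (s * t))) (at s within UNIV)"
    by (rule leibniz_rule_vector_derivative)
      (auto intro!: d[THEN has_vector_derivative_at_within] integrable_continuous_real continuous_intros
        simp: split_beta' simp del: power_Suc)
  then show ?thesis by (simp add: band_kernel_def[abs_def] del: power_Suc)
qed

lemma C_k_band_kernel: "C_k k (band_kernel A B q)"
  by (rule C_k_family[of "range (band_kernel A B)"]) (auto intro: band_kernel_deriv)

lemma integral_indicator_continuous:
  fixes c :: "real \<Rightarrow> complex"
  assumes "continuous_on {A..B} c"
  shows "(LINT t|lborel. indicator {A..B} t *\<^sub>R c t) = integral {A..B} c"
    "integrable lborel (\<lambda>t. indicator {A..B} t *\<^sub>R c t)"
proof -
  have "set_integrable lborel {A..B} c" by (rule borel_integrable_atLeastAtMost'[OF assms])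
  then show "(LINT t|lborel. indicator {A..B} t *\<^sub>R c t) = integral {A..B} c"
    "integrable lborel (\<lambda>t. indicator {A..B} t *\<^sub>R c t)"
    using set_borel_integral_eq_integral(2)[of "{A..B}" c]
    by (simp_all add: set_lebesgue_integral_def set_integrable_def)
qed

context positive_weights
begin

text \<open>On [A, B] the weight 1 + t^2 is at most 1 + A^2 + B^2, so the decay required by
  \<open>pft_integrable\<close> comes from the bounded frequency band.\<close>

lemma gaussian_decay:
  fixes W :: "'n heis \<Rightarrow> complex"
  assumes [measurable]: "W \<in> borel_measurable borel" and b: "b > 0"
    and le: "\<And>z t. cmod (W (z, t)) \<le> K * indicator {A..B} t * exp (- (b / 2) * psi lam (z - z0))"
  shows "W \<in> L2 mu_heis" "\<exists>C. \<forall>z t. cmod (W (z, t)) \<le> C / (1 + t\<^sup>2)"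
proof -
  have ind: "integrable lborel (\<lambda>t. K\<^sup>2 * indicator {A..B} t)"
  proof -
    have "emeasure lborel {A..B} < \<infinity>" by (cases "A \<le> B") auto
    then show ?thesis by (intro integrable_mult_right integrable_real_indicator) auto
  qed
  have "integrable mu_heis (\<lambda>x. (cmod (W x))\<^sup>2)"
  proof (rule integrable_heis_dominated[OF _ integrable_mu_translate[OF integrable_gaussian_psi[OF b], of z0] ind])
    fix z t
    have "(cmod (W (z, t)))\<^sup>2 \<le> (K * indicator {A..B} t * exp (- (b / 2) * psi lam (z - z0)))\<^sup>2"
      by (intro power_mono le) simp
    also have "\<dots> = exp (- b * psi lam (z - z0)) * (K\<^sup>2 * indicator {A..B} t)"
      by (auto simp: indicator_def power_mult_distrib simp flip: exp_double)
    finally show "norm ((cmod (W (z, t)))\<^sup>2) \<le> exp (- b * psi lam (z - z0)) * (K\<^sup>2 * indicator {A..B} t)" by simp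
  qed measurable
  then show "W \<in> L2 mu_heis" by (simp add: L2_def measurable_cong_sets[OF sets_mu_heis refl])
  show "\<exists>C. \<forall>z t. cmod (W (z, t)) \<le> C / (1 + t\<^sup>2)"
  proof (intro exI allI)
    fix z :: "complex^'n" and t :: real
    let ?T = "A\<^sup>2 + B\<^sup>2"
    have pos: "0 < 1 + t\<^sup>2" by (simp add: add_pos_nonneg)
    show "cmod (W (z, t)) \<le> (\<bar>K\<bar> * (1 + ?T)) / (1 + t\<^sup>2)"
    proof (cases "t \<in> {A..B}")
      case True
      have e: "exp (- (b / 2) * psi lam (z - z0)) \<le> 1" using b psi_nonneg[of "z - z0"] by simp
      have "cmod (W (z, t)) \<le> K * exp (- (b / 2) * psi lam (z - z0))" using le[of z t] True by simp
      also have "\<dots> \<le> \<bar>K\<bar> * 1" using e by (intro mult_mono) auto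
      finally have w: "cmod (W (z, t)) \<le> \<bar>K\<bar>" by simp
      have "t\<^sup>2 \<le> ?T"
      proof (cases "t \<ge> 0")
        case True
        then have "t\<^sup>2 \<le> B\<^sup>2" using \<open>t \<in> {A..B}\<close> by (intro power_mono) auto
        then show ?thesis using zero_le_power2[of A] by linarith
      next
        case False
        then have "(- t)\<^sup>2 \<le> (- A)\<^sup>2" using \<open>t \<in> {A..B}\<close> by (intro power_mono) auto
        then have "t\<^sup>2 \<le> A\<^sup>2" by simp
        then show ?thesis using zero_le_power2[of B] by linarith
      qed
      then have "cmod (W (z, t)) * (1 + t\<^sup>2) \<le> \<bar>K\<bar> * (1 + ?T)"
        using w pos by (intro mult_mono) auto
      then show ?thesis using pos by (simp add: pos_le_divide_eq)
    next
      case False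
      then have "cmod (W (z, t)) \<le> 0" using le[of z t] by simp
      also have "0 \<le> (\<bar>K\<bar> * (1 + ?T)) / (1 + t\<^sup>2)" using pos by (intro divide_nonneg_pos) auto
      finally show ?thesis .
    qed
  qed
qed

text \<open>\<open>gauss_test\<close> is the smooth function on the Heisenberg group that is used to test the weak equation: a
  Gaussian around \<open>z0\<close> with frequencies in \<open>[A, B]\<close>. It is the transform of \<open>gauss_band\<close>, and \<open>Zbar lam j\<close> of
  it is the transform of \<open>gauss_band_Zbar\<close>.\<close>

definition gauss_band :: "real \<Rightarrow> real \<Rightarrow> complex^'n \<Rightarrow> real \<Rightarrow> 'n \<Rightarrow> 'n heis \<Rightarrow> complex" where
  "gauss_band A B z0 b j x = indicator {A..B} (snd x) *\<^sub>R (complex_of_real (exp (- b * psi lam (fst x - z0))) *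
      (cnj ((fst x - z0) $ j) * cis (2 * om lam z0 (fst x) * snd x)))"

definition gauss_band_Zbar :: "real \<Rightarrow> real \<Rightarrow> complex^'n \<Rightarrow> real \<Rightarrow> 'n \<Rightarrow> 'n heis \<Rightarrow> complex" where
  "gauss_band_Zbar A B z0 b j x = indicator {A..B} (snd x) *\<^sub>R (complex_of_real (exp (- b * psi lam (fst x - z0))) *
      (complex_of_real (1 - (b + snd x) * (lam $ j * (cmod ((fst x - z0) $ j))\<^sup>2)) * cis (2 * om lam z0 (fst x) * snd x)))"

definition gauss_test :: "real \<Rightarrow> real \<Rightarrow> complex^'n \<Rightarrow> real \<Rightarrow> 'n \<Rightarrow> 'n heis \<Rightarrow> complex" where
  "gauss_test A B z0 b j x = (cnj ((fst x - z0) $ j) * complex_of_real (exp (- b * psi lam (fst x - z0)))) *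
      band_kernel A B 0 (snd x + 2 * om lam z0 (fst x))"

lemma borel_measurable_nth [measurable (raw)]:
  fixes f :: "'a \<Rightarrow> complex^'n"
  assumes "f \<in> borel_measurable M"
  shows "(\<lambda>x. f x $ j) \<in> borel_measurable M"
proof -
  have "(\<lambda>v :: complex^'n. v $ j) \<in> borel_measurable borel"
    by (intro borel_measurable_continuous_onI continuous_intros)
  from measurable_compose[OF assms this] show ?thesis .
qed

lemma gauss_band_measurable [measurable]: "gauss_band A B z0 b j \<in> borel_measurable borel"
  and gauss_band_Zbar_measurable [measurable]: "gauss_band_Zbar A B z0 b j \<in> borel_measurable borel"
proof -
  have "gauss_band A B z0 b j \<in> borel_measurable (borel \<Otimes>\<^sub>M borel)" "gauss_band_Zbar A B z0 b j \<in> borel_measurable (borel \<Otimes>\<^sub>M borel)"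
    unfolding gauss_band_def[abs_def] gauss_band_Zbar_def[abs_def] by measurable
  then show "gauss_band A B z0 b j \<in> borel_measurable borel" "gauss_band_Zbar A B z0 b j \<in> borel_measurable borel"
    by (simp_all add: borel_prod)
qed

lemma lam_nth_le_psi: "lam $ j * (cmod (z $ j))\<^sup>2 \<le> psi lam z"
  unfolding psi_def using lam_pos
  by (intro member_le_sum[where f = "\<lambda>j. lam $ j * (cmod (z $ j))\<^sup>2"]) (auto intro!: mult_nonneg_nonneg intro: less_imp_le)

lemma gauss_band_bound:
  assumes "b > 0"
  shows "cmod (gauss_band A B z0 b j (z, t)) \<le> (1 + (2 / b) / (lam $ j)) * indicator {A..B} t * exp (- (b / 2) * psi lam (z - z0))"
proof (cases "t \<in> {A..B}")
  case True
  let ?v = "z - z0"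
  have e1: "exp (- b * psi lam ?v) \<le> exp (- (b / 2) * psi lam ?v)" using assms psi_nonneg[of ?v] by (simp add: mult_right_mono)
  have "2 * cmod (?v $ j) \<le> 1 + (cmod (?v $ j))\<^sup>2"
    using sum_squares_bound[of 1 "cmod (?v $ j)"] by simp
  then have "cmod (?v $ j) \<le> 1 + (cmod (?v $ j))\<^sup>2"
    using norm_ge_zero[of "?v $ j"] by linarith
  also have "\<dots> \<le> 1 + psi lam ?v / (lam $ j)"
    using lam_nth_le_psi[of j ?v] lam_pos[of j] by (simp add: pos_le_divide_eq mult.commute)
  finally have "exp (- b * psi lam ?v) * cmod (?v $ j) \<le> exp (- b * psi lam ?v) * (1 + psi lam ?v / (lam $ j))"
    by (intro mult_left_mono) auto
  also have "\<dots> = exp (- b * psi lam ?v) + (psi lam ?v * exp (- b * psi lam ?v)) / (lam $ j)"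
    by (simp add: field_simps)
  also have "\<dots> \<le> exp (- (b / 2) * psi lam ?v) + ((2 / b) * exp (- (b / 2) * psi lam ?v)) / (lam $ j)"
    using lam_pos[of j] by (intro add_mono e1 divide_right_mono psi_exp_le assms) auto
  also have "\<dots> = (1 + (2 / b) / (lam $ j)) * exp (- (b / 2) * psi lam ?v)"
    by (simp add: field_simps)
  finally have main: "exp (- b * psi lam ?v) * cmod (?v $ j) \<le> (1 + (2 / b) / (lam $ j)) * exp (- (b / 2) * psi lam ?v)" .
  have "cmod (gauss_band A B z0 b j (z, t)) = exp (- b * psi lam ?v) * cmod (?v $ j)"
    using True unfolding gauss_band_def fst_conv snd_conv norm_scaleR norm_mult norm_cis norm_of_real complex_mod_cnj by simp
  with main True show ?thesis by simp
qed (simp add: gauss_band_def)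

lemma gauss_band_Zbar_bound:
  assumes "b > 0"
  shows "cmod (gauss_band_Zbar A B z0 b j (z, t)) \<le> (1 + (b + \<bar>A\<bar> + \<bar>B\<bar>) * (2 / b)) * indicator {A..B} t * exp (- (b / 2) * psi lam (z - z0))"
proof (cases "t \<in> {A..B}")
  case True
  let ?v = "z - z0" and ?T = "b + \<bar>A\<bar> + \<bar>B\<bar>"
  let ?y = "lam $ j * (cmod (?v $ j))\<^sup>2"
  have y: "0 \<le> ?y" "?y \<le> psi lam ?v" using lam_nth_le_psi[of j ?v] lam_pos[of j] by auto
  have e1: "exp (- b * psi lam ?v) \<le> exp (- (b / 2) * psi lam ?v)" using assms psi_nonneg[of ?v] by (simp add: mult_right_mono)
  have "\<bar>1 - (b + t) * ?y\<bar> \<le> 1 + \<bar>b + t\<bar> * ?y"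
    using abs_triangle_ineq4[of 1 "(b + t) * ?y"] by (simp only: abs_mult[of "b + t"] abs_of_nonneg[OF y(1)] abs_one)
  also have "\<dots> \<le> 1 + ?T * psi lam ?v"
    using True assms y by (intro add_mono mult_mono) auto
  finally have "exp (- b * psi lam ?v) * \<bar>1 - (b + t) * ?y\<bar> \<le> exp (- b * psi lam ?v) * (1 + ?T * psi lam ?v)"
    by (intro mult_left_mono) auto
  also have "\<dots> = exp (- b * psi lam ?v) + ?T * (psi lam ?v * exp (- b * psi lam ?v))"
    by (simp add: algebra_simps)
  also have "\<dots> \<le> exp (- (b / 2) * psi lam ?v) + ?T * ((2 / b) * exp (- (b / 2) * psi lam ?v))"
    using assms by (intro add_mono e1 mult_left_mono psi_exp_le) auto
  also have "\<dots> = (1 + ?T * (2 / b)) * exp (- (b / 2) * psi lam ?v)"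
    by (simp only: distrib_right[of 1] mult.assoc mult_1_left)
  finally have main: "exp (- b * psi lam ?v) * \<bar>1 - (b + t) * ?y\<bar> \<le> (1 + ?T * (2 / b)) * exp (- (b / 2) * psi lam ?v)" .
  have "cmod (gauss_band_Zbar A B z0 b j (z, t)) = exp (- b * psi lam ?v) * \<bar>1 - (b + t) * ?y\<bar>"
    using True unfolding gauss_band_Zbar_def fst_conv snd_conv norm_scaleR norm_mult norm_cis norm_of_real by simp
  with main True show ?thesis by simp
qed (simp add: gauss_band_Zbar_def)

lemma pft_test_gauss_band: "pft_test 1 (gauss_band A B z0 b j) = gauss_test A B z0 b j"
proof
  fix x :: "'n heis"
  let ?c = "cnj ((fst x - z0) $ j) * complex_of_real (exp (- b * psi lam (fst x - z0)))"
  have "pft_test 1 (gauss_band A B z0 b j) x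
      = (LINT t|lborel. ?c * (indicator {A..B} t *\<^sub>R ((\<i> * complex_of_real t) ^ 0 * cis ((snd x + 2 * om lam z0 (fst x)) * t))))"
    unfolding pft_test_def
  proof (intro Bochner_Integration.integral_cong refl)
    fix t
    have "cis (1 * snd x * t) * cis (2 * om lam z0 (fst x) * t) = cis ((snd x + 2 * om lam z0 (fst x)) * t)"
      by (simp add: cis_mult algebra_simps)
    then show "cis (1 * snd x * t) * gauss_band A B z0 b j (fst x, t)
      = ?c * (indicator {A..B} t *\<^sub>R ((\<i> * complex_of_real t) ^ 0 * cis ((snd x + 2 * om lam z0 (fst x)) * t)))"
      unfolding gauss_band_def by (simp add: mult_ac scaleR_conv_of_real)
  qed
  also have "\<dots> = ?c * band_kernel A B 0 (snd x + 2 * om lam z0 (fst x))"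
    unfolding band_kernel_def integral_mult_right_zero
    by (subst integral_indicator_continuous(1)) (auto intro!: continuous_intros)
  finally show "pft_test 1 (gauss_band A B z0 b j) x = gauss_test A B z0 b j x" by (simp add: gauss_test_def)
qed

lemma pft_test_gauss_band_Zbar:
  "pft_test 1 (gauss_band_Zbar A B z0 b j) x = complex_of_real (exp (- b * psi lam (fst x - z0))) *
    (complex_of_real (1 - b * (lam $ j * (cmod ((fst x - z0) $ j))\<^sup>2)) * band_kernel A B 0 (snd x + 2 * om lam z0 (fst x))
     + \<i> * complex_of_real (lam $ j * (cmod ((fst x - z0) $ j))\<^sup>2) * band_kernel A B 1 (snd x + 2 * om lam z0 (fst x)))"
proof -
  let ?e = "complex_of_real (exp (- b * psi lam (fst x - z0)))" and ?y = "lam $ j * (cmod ((fst x - z0) $ j))\<^sup>2"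
  let ?s = "snd x + 2 * om lam z0 (fst x)"
  let ?k = "\<lambda>q t. indicator {A..B} t *\<^sub>R ((\<i> * complex_of_real t) ^ q * cis (?s * t))"
  have ki: "integrable lborel (?k q)" and kI: "(LINT t|lborel. ?k q t) = band_kernel A B q ?s" for q
    unfolding band_kernel_def by (intro integral_indicator_continuous; auto intro!: continuous_intros)+
  have "pft_test 1 (gauss_band_Zbar A B z0 b j) x
      = (LINT t|lborel. ?e * (complex_of_real (1 - b * ?y) * ?k 0 t + \<i> * complex_of_real ?y * ?k 1 t))"
    unfolding pft_test_def
  proof (intro Bochner_Integration.integral_cong refl)
    fix t
    have c: "cis (1 * snd x * t) * cis (2 * om lam z0 (fst x) * t) = cis (?s * t)"
      by (simp add: cis_mult algebra_simps)
    have "cis (1 * snd x * t) * gauss_band_Zbar A B z0 b j (fst x, t)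
      = ?e * complex_of_real (indicator {A..B} t) * complex_of_real (1 - (b + t) * ?y) * (cis (1 * snd x * t) * cis (2 * om lam z0 (fst x) * t))"
      unfolding gauss_band_Zbar_def by (simp add: scaleR_conv_of_real mult_ac)
    also have "\<dots> = ?e * (complex_of_real (1 - b * ?y) * ?k 0 t + \<i> * complex_of_real ?y * ?k 1 t)"
      unfolding c by (simp add: scaleR_conv_of_real algebra_simps)
    finally show "cis (1 * snd x * t) * gauss_band_Zbar A B z0 b j (fst x, t)
      = ?e * (complex_of_real (1 - b * ?y) * ?k 0 t + \<i> * complex_of_real ?y * ?k 1 t)" .
  qed
  also have "\<dots> = ?e * (complex_of_real (1 - b * ?y) * (LINT t|lborel. ?k 0 t) + \<i> * complex_of_real ?y * (LINT t|lborel. ?k 1 t))"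
    using ki[of 0] ki[of 1] by (simp only: integral_mult_right_zero Bochner_Integration.integral_add integrable_mult_right)
  finally show ?thesis unfolding kI .
qed

lemma C_k_psi_translate: "C_k k (\<lambda>x :: 'n heis. psi lam (fst x - z0))"
proof -
  have "C_k k (\<lambda>x :: 'n heis. \<Sum>j\<in>UNIV. lam $ j * ((fst x $ j - z0 $ j) \<bullet> (fst x $ j - z0 $ j)))"
    by (intro C_k_sum C_k_mult[OF C_k_const] C_k_bilinear[OF bounded_bilinear_inner] C_k_diff C_k_fst_nth C_k_const)
  then show ?thesis by (simp add: psi_def power2_norm_eq_inner)
qed

lemma bounded_linear_om: "bounded_linear (\<lambda>x :: 'n heis. snd x + 2 * om lam z0 (fst x))"
  unfolding om_def
  by (intro bounded_linear_add bounded_linear_snd bounded_linear_const_mult bounded_linear_compose[OF bounded_linear_Im]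
      bounded_linear_sum bounded_linear_const_mult bounded_linear_compose[OF bounded_linear_cnj]
      bounded_linear_compose[OF bounded_linear_vec_nth bounded_linear_fst])

lemma C_k_gauss_test: "C_k k (gauss_test A B z0 b j)"
proof -
  have "C_k k (\<lambda>x :: 'n heis. cnj (fst x $ j - z0 $ j))"
    by (intro C_k_compose_bounded_linear[OF bounded_linear_cnj] C_k_diff C_k_fst_nth C_k_const)
  moreover have "C_k k (\<lambda>x :: 'n heis. complex_of_real (exp (- b * psi lam (fst x - z0))))"
    by (intro C_k_of_real C_k_compose_real[OF C_k_exp] C_k_mult[OF C_k_const] C_k_psi_translate)
  moreover have "C_k k (\<lambda>x :: 'n heis. band_kernel A B 0 (snd x + 2 * om lam z0 (fst x)))"
    by (intro C_k_compose_real[OF C_k_band_kernel] C_k_bounded_linear bounded_linear_om)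
  ultimately show ?thesis
    unfolding gauss_test_def[abs_def] vector_minus_component by (intro C_k_mult)
qed

text \<open>Twice the conjugate derivative of the phase. It shifts the coefficient z_j of
  \<open>Zbar\<close> to (z - z0)_j, an expression of the invariance of \<open>Zbar\<close> under
  Heisenberg translations.\<close>

lemma om_axis:
  "complex_of_real (om lam z0 (axis j 1)) + \<i> * complex_of_real (om lam z0 (axis j \<i>)) = - (\<i> * complex_of_real (lam $ j) * (z0 $ j))"
proof -
  have "(\<Sum>i\<in>UNIV. complex_of_real (lam $ i) * z0 $ i * cnj (axis j a $ i)) = complex_of_real (lam $ j) * z0 $ j * cnj a" for a
    by (subst sum.remove[of _ j]) (auto simp: axis_def intro!: sum.neutral)
  then show ?thesis unfolding om_def by (simp add: complex_eq_iff)
qed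

lemma has_derivative_psi_translate:
  "((\<lambda>x :: 'n heis. psi lam (fst x - z0)) has_derivative (\<lambda>w. \<Sum>i\<in>UNIV. lam $ i * (2 * (((fst x - z0) $ i) \<bullet> (fst w $ i))))) (at x)"
proof -
  have c: "((\<lambda>x :: 'n heis. (fst x - z0) $ i) has_derivative (\<lambda>w. fst w $ i)) (at x)" for i
  proof -
    have "((\<lambda>x :: 'n heis. fst x $ i) has_derivative (\<lambda>w. fst w $ i)) (at x)"
      by (intro bounded_linear_imp_has_derivative bounded_linear_compose[OF bounded_linear_vec_nth bounded_linear_fst])
    from has_derivative_diff[OF this has_derivative_const[of "z0 $ i"]] show ?thesis by simp
  qed
  have "((\<lambda>x :: 'n heis. \<Sum>i\<in>UNIV. lam $ i * (((fst x - z0) $ i) \<bullet> ((fst x - z0) $ i))) has_derivative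
      (\<lambda>w. \<Sum>i\<in>UNIV. lam $ i * (((fst x - z0) $ i) \<bullet> (fst w $ i) + (fst w $ i) \<bullet> ((fst x - z0) $ i)))) (at x)"
    by (intro has_derivative_sum has_derivative_mult_right has_derivative_inner c)
  then show ?thesis by (simp add: psi_def power2_norm_eq_inner inner_commute)
qed

lemma has_derivative_exp_psi_translate:
  "((\<lambda>x :: 'n heis. complex_of_real (exp (- b * psi lam (fst x - z0)))) has_derivative
      (\<lambda>w. complex_of_real (exp (- b * psi lam (fst x - z0)) * (- b * (\<Sum>i\<in>UNIV. lam $ i * (2 * (((fst x - z0) $ i) \<bullet> (fst w $ i)))))))) (at x)"
  by (intro has_derivative_of_real has_derivative_compose[OF has_derivative_mult_right[OF has_derivative_psi_translate] DERIV_exp[unfolded has_field_derivative_def]])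

lemma ZD_exp_psi:
  fixes x :: "'n heis"
  shows "ZD lam j x (\<lambda>w. complex_of_real (exp (- b * psi lam (fst x - z0)) * (- b * (\<Sum>i\<in>UNIV. lam $ i * (2 * (((fst x - z0) $ i) \<bullet> (fst w $ i)))))))
      = complex_of_real (exp (- b * psi lam (fst x - z0))) * (- complex_of_real (b * lam $ j) * ((fst x - z0) $ j))"
proof -
  have s: "(\<Sum>i\<in>UNIV. lam $ i * (2 * (((fst x - z0) $ i) \<bullet> (axis j a $ i)))) = lam $ j * (2 * (((fst x - z0) $ j) \<bullet> a))" for a
    by (subst sum.remove[of _ j]) (auto simp: axis_def intro!: sum.neutral)
  have v: "complex_of_real (((fst x - z0) $ j) \<bullet> 1) + \<i> * complex_of_real (((fst x - z0) $ j) \<bullet> \<i>) = (fst x - z0) $ j"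
    by (simp add: complex_eq_iff inner_complex_def)
  have aux: "(complex_of_real (e * (- b * (l * (2 * p)))) + \<i> * complex_of_real (e * (- b * (l * (2 * q))))) / 2
      = complex_of_real e * (- complex_of_real (b * l) * (complex_of_real p + \<i> * complex_of_real q))" for e l p q
    by (simp add: field_simps)
  have z: "(\<Sum>i\<in>UNIV. lam $ i * (2 * (((fst x - z0) $ i) \<bullet> (0 $ i)))) = 0" by simp
  show ?thesis unfolding ZD_def fst_conv s aux v z by simp
qed

text \<open>Three contributions: the conjugate coordinate gives 1, the Gaussian gives - b lam_j |(z
  - z0)_j|^2, and the twisted band kernel gives - t lam_j |(z - z0)_j|^2 at frequency t. Together
  they form the symbol in \<open>gauss_band_Zbar\<close>.\<close>

lemma Zbar_gauss_test: "Zbar lam j (gauss_test A B z0 b j) x = pft_test 1 (gauss_band_Zbar A B z0 b j) x"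
proof -
  let ?v = "fst x - z0"
  let ?s = "snd x + 2 * om lam z0 (fst x)"
  let ?e = "complex_of_real (exp (- b * psi lam ?v))"
  have da: "((\<lambda>x :: 'n heis. cnj ((fst x - z0) $ j)) has_derivative (\<lambda>w. cnj (fst w $ j))) (at x)"
  proof -
    have "((\<lambda>x :: 'n heis. cnj (fst x $ j)) has_derivative (\<lambda>w. cnj (fst w $ j))) (at x)"
      by (intro bounded_linear_imp_has_derivative bounded_linear_compose[OF bounded_linear_cnj]
          bounded_linear_compose[OF bounded_linear_vec_nth bounded_linear_fst])
    from has_derivative_diff[OF this has_derivative_const[of "cnj (z0 $ j)"]] show ?thesis by simp
  qed
  have dk: "((\<lambda>x :: 'n heis. band_kernel A B 0 (snd x + 2 * om lam z0 (fst x))) has_derivative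
      (\<lambda>w. (snd w + 2 * om lam z0 (fst w)) *\<^sub>R band_kernel A B 1 ?s)) (at x)"
    using has_derivative_compose[OF bounded_linear_imp_has_derivative[OF bounded_linear_om] band_kernel_deriv[unfolded has_vector_derivative_def]]
    by simp
  have Za: "ZD lam j x (\<lambda>w. cnj (fst w $ j)) = 1"
    by (simp add: ZD_def)
  have Zk: "ZD lam j x (\<lambda>w. (snd w + 2 * om lam z0 (fst w)) *\<^sub>R band_kernel A B 1 ?s) = \<i> * complex_of_real (lam $ j) * (?v $ j) * band_kernel A B 1 ?s"
  proof -
    have om0: "om lam z0 0 = 0" by (simp add: om_def)
    have "ZD lam j x (\<lambda>w. (snd w + 2 * om lam z0 (fst w)) *\<^sub>R band_kernel A B 1 ?s)
        = ((complex_of_real (om lam z0 (axis j 1)) + \<i> * complex_of_real (om lam z0 (axis j \<i>))) + \<i> * complex_of_real (lam $ j) * (fst x $ j)) * band_kernel A B 1 ?s"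
      unfolding ZD_def by (simp add: scaleR_conv_of_real om0 algebra_simps add_divide_distrib)
    then show ?thesis unfolding om_axis by (simp add: algebra_simps)
  qed
  have "Zbar lam j (gauss_test A B z0 b j) x = (cnj (?v $ j) * ?e) * (\<i> * complex_of_real (lam $ j) * (?v $ j) * band_kernel A B 1 ?s)
      + (cnj (?v $ j) * (?e * (- complex_of_real (b * lam $ j) * (?v $ j))) + 1 * ?e) * band_kernel A B 0 ?s"
    unfolding gauss_test_def[abs_def]
      Zbar_eq_ZD[OF has_derivative_mult[OF has_derivative_mult[OF da has_derivative_exp_psi_translate] dk]] ZD_mult Zk ZD_exp_psi Za ..
  also have "\<dots> = pft_test 1 (gauss_band_Zbar A B z0 b j) x"
  proof -
    have n: "complex_of_real ((cmod (?v $ j))\<^sup>2) = (?v $ j) * cnj (?v $ j)" by (rule complex_norm_square)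
    show ?thesis unfolding pft_test_gauss_band_Zbar of_real_mult of_real_diff n by (simp add: algebra_simps)
  qed
  finally show ?thesis .
qed

text \<open>The test function and its \<open>Zbar\<close> derivative are both transforms of explicit
  band functions. The multiplication formula moves the transform onto h, and the weak equation
  becomes a statement about H in frequency space.\<close>

lemma ker_transform_gauss_band_Zbar:
  assumes h: "h \<in> ker_box_b lam" and H: "pft 1 h H" and b: "b > 0"
  shows "(LINT x|mu_heis. H x * gauss_band_Zbar A B z0 b j x) = 0"
proof -
  obtain C0 where C0: "\<And>z t. cmod (gauss_band A B z0 b j (z, t)) \<le> C0 / (1 + t\<^sup>2)"
    using gaussian_decay(2)[OF gauss_band_measurable b gauss_band_bound[OF b]] by blast
  obtain C1 where C1: "\<And>z t. cmod (gauss_band_Zbar A B z0 b j (z, t)) \<le> C1 / (1 + t\<^sup>2)"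
    using gaussian_decay(2)[OF gauss_band_Zbar_measurable b gauss_band_Zbar_bound[OF b]] by blast
  have p0: "pft 1 (gauss_band A B z0 b j) (pft_test 1 (gauss_band A B z0 b j))"
    by (rule pft_integrable[OF gaussian_decay(1)[OF gauss_band_measurable b gauss_band_bound[OF b]] C0]) simp
  have p1: "pft 1 (gauss_band_Zbar A B z0 b j) (pft_test 1 (gauss_band_Zbar A B z0 b j))"
    by (rule pft_integrable[OF gaussian_decay(1)[OF gauss_band_Zbar_measurable b gauss_band_Zbar_bound[OF b]] C1]) simp
  have Z: "Zbar lam j (gauss_test A B z0 b j) = pft_test 1 (gauss_band_Zbar A B z0 b j)"
    by (rule ext) (rule Zbar_gauss_test)
  have "(LINT x|mu_heis. h x * Zbar lam j (gauss_test A B z0 b j) x) = 0"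
    by (rule ker_box_b_smooth[OF h C_k_gauss_test])
      (use pft_L2(2)[OF p0] pft_L2(2)[OF p1] in \<open>simp_all only: pft_test_gauss_band Z\<close>)
  then show ?thesis
    using pft_multiplication[OF H p1] by (simp add: Z)
qed

end

section \<open>From weak solutions to reproduced slices\<close>

lemma L2_slice_AE:
  fixes H :: "('n::finite) heis \<Rightarrow> complex"
  assumes H: "H \<in> L2 mu_heis"
  shows "AE t in lborel. (\<lambda>z. H (z, t)) \<in> L2 mu"
proof -
  have "integrable (mu \<Otimes>\<^sub>M lborel) (\<lambda>(z, t). (cmod (H (z, t)))\<^sup>2)"
    using H by (simp add: L2_def mu_heis_eq split_beta')
  from heis.AE_integrable_snd[OF this] show ?thesis
    using slice_measurable(2)[OF L2_mu_heis_borel[OF H]]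
    by (auto elim!: eventually_mono simp: L2_def measurable_cong_sets[OF sets_mu refl])
qed

lemma AE_lborel_ex:
  assumes "AE t in lborel. P t" "a < (b::real)"
  shows "\<exists>t\<in>{a<..<b}. P t"
proof (rule ccontr)
  assume "\<not> (\<exists>t\<in>{a<..<b}. P t)"
  then have "AE t in lborel. t \<notin> {a<..<b}"
    using assms(1) by (auto elim!: eventually_mono)
  then have "{a<..<b} \<in> null_sets lborel"
    by (simp add: AE_iff_null_sets)
  then show False using assms(2) by (simp add: null_sets_def)
qed

context positive_weights
begin

text \<open>Summing the symbols over j produces n - (b + t) psi (z - z0), the radial expression of
  \<open>Grad\<close>. Single components would not add up to a b-derivative of a Gaussian
  mean.\<close>

lemma sum_gauss_band_Zbar:
  "(\<Sum>j\<in>UNIV. gauss_band_Zbar A B z0 b j (z, t)) = indicator {A..B} t *\<^sub>R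
    (complex_of_real ((real CARD('n) - (b + t) * psi lam (z - z0)) * exp (- b * psi lam (z - z0))) * cis (2 * t * om lam z0 z))"
proof -
  have "(\<Sum>j\<in>UNIV. gauss_band_Zbar A B z0 b j (z, t))
      = (\<Sum>j\<in>UNIV. complex_of_real (1 - (b + t) * (lam $ j * (cmod ((z - z0) $ j))\<^sup>2))
          * (indicator {A..B} t *\<^sub>R (complex_of_real (exp (- b * psi lam (z - z0))) * cis (2 * t * om lam z0 z))))"
    unfolding gauss_band_Zbar_def by (intro sum.cong refl) (simp add: scaleR_conv_of_real mult_ac)
  also have "\<dots> = complex_of_real (\<Sum>j\<in>UNIV. 1 - (b + t) * (lam $ j * (cmod ((z - z0) $ j))\<^sup>2))
          * (indicator {A..B} t *\<^sub>R (complex_of_real (exp (- b * psi lam (z - z0))) * cis (2 * t * om lam z0 z)))"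
    unfolding of_real_sum sum_distrib_right ..
  also have "(\<Sum>j\<in>UNIV. 1 - (b + t) * (lam $ j * (cmod ((z - z0) $ j))\<^sup>2)) = real CARD('n) - (b + t) * psi lam (z - z0)"
    by (simp add: sum_subtractf psi_def sum_distrib_left)
  finally show ?thesis by (simp add: scaleR_conv_of_real mult_ac)
qed

text \<open>The band [A, B] is arbitrary, so the vanishing integrals localise in frequency. The null
  set of exceptional t depends on b and z0. Closed and open bands differ by two points only.\<close>

lemma ker_transform_Grad:
  assumes h: "h \<in> ker_box_b lam" and H: "pft 1 h H" and b: "b > 0"
  shows "AE t in lborel. Grad t (\<lambda>z. H (z, t)) b z0 = 0"
proof (rule AE_zero_of_box_integrals)
  have HL: "H \<in> L2 mu_heis" by (rule pft_L2(2)[OF H])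
  note [measurable] = L2_mu_heis_borel[OF HL]
  have WL: "gauss_band_Zbar A B z0 b j \<in> L2 mu_heis" for A B j
    by (rule gaussian_decay(1)[OF gauss_band_Zbar_measurable b gauss_band_Zbar_bound[OF b]])
  have int: "integrable mu_heis (\<lambda>x. H x * (\<Sum>j\<in>UNIV. gauss_band_Zbar A B z0 b j x))" for A B
    by (intro L2_mult_integrable HL L2_sum WL)
  have zero: "(LINT x|mu_heis. H x * (\<Sum>j\<in>UNIV. gauss_band_Zbar A B z0 b j x)) = 0" for A B
    unfolding sum_distrib_left
    by (subst Bochner_Integration.integral_sum) (auto intro!: L2_mult_integrable HL WL simp: ker_transform_gauss_band_Zbar[OF h H b])
  have sl: "(LINT z|mu. H (z, t) * (\<Sum>j\<in>UNIV. gauss_band_Zbar A B z0 b j (z, t))) = indicator {A..B} t *\<^sub>R Grad t (\<lambda>z. H (z, t)) b z0" for A B t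
    unfolding sum_gauss_band_Zbar Grad_def integral_scaleR_right[symmetric]
    by (intro Bochner_Integration.integral_cong refl) (simp add: scaleR_conv_of_real mult_ac)
  have "integrable lborel (\<lambda>t. LINT z|mu. H (z, t) * (\<Sum>j\<in>UNIV. gauss_band_Zbar A B z0 b j (z, t)))" for A B
    using heis.integrable_snd[of "\<lambda>z t. H (z, t) * (\<Sum>j\<in>UNIV. gauss_band_Zbar A B z0 b j (z, t))"] int[of A B]
    by (simp add: mu_heis_eq split_beta')
  then have i: "integrable lborel (\<lambda>t. indicator {A..B} t *\<^sub>R Grad t (\<lambda>z. H (z, t)) b z0)" for A B
    unfolding sl .
  have I: "(LINT t|lborel. indicator {A..B} t *\<^sub>R Grad t (\<lambda>z. H (z, t)) b z0) = 0" for A B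
    using zero[of A B] unfolding integral_heis_iterated'[OF int] sl .
  have Gm [measurable]: "(\<lambda>t. Grad t (\<lambda>z. H (z, t)) b z0) \<in> borel_measurable borel"
  proof -
    have [measurable]: "H \<in> borel_measurable (borel \<Otimes>\<^sub>M borel)" using L2_mu_heis_borel[OF HL] by (simp add: borel_prod)
    show ?thesis unfolding Grad_def by measurable
  qed
  have ae: "AE t in lborel. indicator {A..B} t *\<^sub>R Grad t (\<lambda>z. H (z, t)) b z0 = indicator (box A B) t *\<^sub>R Grad t (\<lambda>z. H (z, t)) b z0" for A B
    using AE_lborel_singleton[of A] AE_lborel_singleton[of B]
    by eventually_elim (auto simp: indicator_def)
  show "integrable lborel (\<lambda>t. indicator (box A B) t *\<^sub>R Grad t (\<lambda>z. H (z, t)) b z0)" for A B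
    by (rule Bochner_Integration.integrable_cong_AE_imp[OF i _ ae]) measurable
  show "(LINT t|lborel. indicator (box A B) t *\<^sub>R Grad t (\<lambda>z. H (z, t)) b z0) = 0" for A B
    unfolding I[of A B, symmetric] by (rule Bochner_Integration.integral_cong_AE[symmetric, OF _ _ ae]) measurable
qed

text \<open>The remaining issue is the order of the quantifiers: \<open>slice_reproducing\<close>
  wants one t to work for almost all z0 and b, while the frequency argument fixes z0 and b
  first.\<close>

lemma ker_reproducing:
  assumes h: "h \<in> ker_box_b lam" and H: "pft 1 h H"
  shows "AE t in lborel. AE z in mu. H (z, t) = Pop t (\<lambda>z. H (z, t)) z"
proof -
  have HL: "H \<in> L2 mu_heis" by (rule pft_L2(2)[OF H])
  have Hm [measurable]: "H \<in> borel_measurable (borel \<Otimes>\<^sub>M borel)" using L2_mu_heis_borel[OF HL] by (simp add: borel_prod)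
  have [measurable]: "H \<in> borel_measurable borel" by (rule L2_mu_heis_borel[OF HL])
  have 1: "AE p in (lborel :: 'n heis measure). AE t in lborel. 0 < snd p \<longrightarrow> Grad t (\<lambda>z. H (z, t)) (snd p) (fst p) = 0"
  proof (rule AE_I2)
    fix p :: "'n heis"
    show "AE t in lborel. 0 < snd p \<longrightarrow> Grad t (\<lambda>z. H (z, t)) (snd p) (fst p) = 0"
      by (cases "0 < snd p") (use ker_transform_Grad[OF h H, of "snd p" "fst p"] in auto)
  qed
  have Gm: "(\<lambda>x. Grad (snd x) (\<lambda>z. H (z, snd x)) (snd (fst x)) (fst (fst x))) \<in> borel_measurable ((borel \<Otimes>\<^sub>M borel) \<Otimes>\<^sub>M borel)"
    unfolding Grad_def by measurable
  have "{x \<in> space ((lborel :: 'n heis measure) \<Otimes>\<^sub>M (lborel :: real measure)). 0 < snd (fst x) \<longrightarrow> Grad (snd x) (\<lambda>z. H (z, snd x)) (snd (fst x)) (fst (fst x)) = 0}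
      \<in> sets ((lborel :: 'n heis measure) \<Otimes>\<^sub>M (lborel :: real measure))"
  proof -
    have g [measurable]: "(\<lambda>x. Grad (snd x) (\<lambda>z. H (z, snd x)) (snd (fst x)) (fst (fst x))) \<in> borel_measurable ((lborel :: 'n heis measure) \<Otimes>\<^sub>M (lborel :: real measure))"
      using Gm by (simp add: borel_prod measurable_cong_sets[OF sets_pair_measure_cong[OF sets_lborel sets_lborel] refl])
    have [measurable]: "(\<lambda>x. snd (fst x)) \<in> borel_measurable ((lborel :: 'n heis measure) \<Otimes>\<^sub>M (lborel :: real measure))"
      by (rule measurable_compose[OF measurable_fst]) (simp add: borel_measurable_continuous_onI continuous_on_snd)
    show ?thesis by measurable
  qed
  \<comment> \<open>Fubini for null sets: the joint measurability just shown makes (z0, b) generic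
    for almost every t, instead of t generic for each (z0, b).\<close>
  from lborel_pair.AE_commute[OF this[unfolded fst_conv]]
  have "AE t in lborel. AE p in (lborel :: 'n heis measure). 0 < snd p \<longrightarrow> Grad t (\<lambda>z. H (z, t)) (snd p) (fst p) = 0"
    using 1 by simp
  moreover have "AE t in lborel. (\<lambda>z. H (z, t)) \<in> L2 mu" by (rule L2_slice_AE[OF HL])
  moreover have "AE t in lborel. t \<noteq> (0::real)" by (rule AE_lborel_singleton)
  ultimately show ?thesis
  proof eventually_elim
    case (elim t)
    have "AE p in (lborel :: (complex^'n) measure) \<Otimes>\<^sub>M (lborel :: real measure). 0 < snd p \<longrightarrow> Grad t (\<lambda>z. H (z, t)) (snd p) (fst p) = 0"
      unfolding lborel_prod by (rule elim(1))
    then have "AE z0 in lborel. AE b in lborel. 0 < b \<longrightarrow> Grad t (\<lambda>z. H (z, t)) b z0 = 0"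
      using lborel_pair.AE_pair by fastforce
    then have "AE z0 in mu. AE b in lborel. 0 < b \<longrightarrow> Grad t (\<lambda>z. H (z, t)) b z0 = 0"
      by (simp add: AE_mu_iff)
    from slice_reproducing[OF elim(2,3) this] show ?case .
  qed
qed

end

section \<open>Holomorphic slices\<close>

lemma continuous_bounded_cball:
  fixes k :: "'a::euclidean_space \<Rightarrow> complex"
  assumes "continuous_on UNIV k"
  shows "\<exists>C>0. \<forall>x. norm x \<le> R \<longrightarrow> cmod (k x) \<le> C"
proof -
  have "compact (k ` cball 0 R)" by (intro compact_continuous_image continuous_on_subset[OF assms]) auto
  from compact_imp_bounded[OF this] obtain C where C: "C > 0" "\<forall>y\<in>k ` cball 0 R. cmod y \<le> C"
    unfolding bounded_pos by blast
  have "cmod (k x) \<le> C" if "norm x \<le> R" for x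
    using C(2) that by (metis imageI mem_cball_0)
  with C(1) show ?thesis by blast
qed

lemma holomorphic_Cn_continuous: "holomorphic_Cn f \<Longrightarrow> continuous_on UNIV f"
  unfolding holomorphic_Cn_def continuous_on_eq_continuous_at[OF open_UNIV]
  using has_derivative_continuous by blast

text \<open>\<open>holomorphic_Cn\<close> does not include continuity of the derivative. Cauchy's
  inequality on the unit disc of the complex line through z in direction v bounds it by the maximum
  of |f| on the ball of radius R + |v|.\<close>

lemma holomorphic_Cn_derivative_bound:
  fixes f :: "complex^'n \<Rightarrow> complex"
  assumes D: "\<And>z. (f has_derivative D z) (at z)" "\<And>z c v. D z (c *s v) = c * D z v"
  shows "\<exists>C. \<forall>z. norm z \<le> R \<longrightarrow> cmod (D z v) \<le> C"
proof -
  have contf: "continuous_on UNIV f"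
    unfolding continuous_on_eq_continuous_at[OF open_UNIV] using has_derivative_continuous[OF D(1)] by blast
  obtain B where B: "\<And>z. norm z \<le> R + norm v \<Longrightarrow> cmod (f z) \<le> B"
    using continuous_bounded_cball[OF contf] by blast
  have "cmod (D z v) \<le> B" if z: "norm z \<le> R" for z
  proof -
    let ?F = "\<lambda>\<zeta>. f (z + \<zeta> *s v)"
    have dl: "((\<lambda>\<zeta>. z + \<zeta> *s v) has_derivative (\<lambda>\<eta>. \<eta> *s v)) (at \<zeta>)" for \<zeta> :: complex
    proof -
      have "bounded_linear (\<lambda>\<eta> :: complex. \<eta> *s v)"
        by (rule bounded_linear_intro[where K = "norm v"])
          (auto simp: vec_eq_iff algebra_simps norm_vec_def norm_mult L2_set_right_distrib)
      from has_derivative_add[OF has_derivative_const bounded_linear_imp_has_derivative[OF this], of z]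
      show ?thesis by simp
    qed
    have F: "(?F has_field_derivative D (z + \<zeta> *s v) v) (at \<zeta>)" for \<zeta>
    proof -
      have "(?F has_derivative (\<lambda>\<eta>. D (z + \<zeta> *s v) (\<eta> *s v))) (at \<zeta>)"
        by (rule has_derivative_compose[OF dl D(1)])
      then show ?thesis unfolding has_field_derivative_def D(2) mult_commute_abs .
    qed
    have hol: "?F holomorphic_on UNIV"
      by (rule holomorphic_onI) (use F field_differentiable_def field_differentiable_at_within in blast)
    have "cmod ((deriv ^^ 1) ?F 0) \<le> fact 1 * B / 1 ^ 1"
    proof (rule Cauchy_inequality)
      show "?F holomorphic_on ball 0 1" using hol by (rule holomorphic_on_subset) simp
      show "continuous_on (cball 0 1) ?F" using holomorphic_on_imp_continuous_on[OF hol] by (rule continuous_on_subset) simp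
      fix \<zeta> :: complex assume "cmod (0 - \<zeta>) = 1"
      then have "norm (\<zeta> *s v) = norm v"
        by (simp add: norm_vec_def norm_mult)
      then have "norm (z + \<zeta> *s v) \<le> R + norm v" using z norm_triangle_ineq[of z "\<zeta> *s v"] by simp
      then show "cmod (?F \<zeta>) \<le> B" by (rule B)
    qed simp
    moreover have "deriv ?F 0 = D (z + 0 *s v) v" by (rule DERIV_imp_deriv[OF F])
    ultimately show ?thesis by simp
  qed
  then show ?thesis by blast
qed

context positive_weights
begin

text \<open>Integration by parts: every \<open>Zbar lam j\<close> annihilates \<open>f z exp (- t psi z - \<i> t s)\<close>.\<close>

lemma integral_Zbar_holomorphic:
  assumes f: "holomorphic_Cn f" and g: "test_function g"
  shows "(LINT x|mu_heis. (f (fst x) * (complex_of_real (exp (- t * psi lam (fst x))) * cis (- t * snd x))) * Zbar lam j g x) = 0"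
proof -
  obtain D where D: "\<And>z. (f has_derivative D z) (at z)" "\<And>z c v. D z (c *s v) = c * D z v"
    using f unfolding holomorphic_Cn_def by metis
  let ?e = "\<lambda>x :: 'n heis. complex_of_real (exp (- t * psi lam (fst x)))"
  let ?de = "\<lambda>x w :: 'n heis. complex_of_real (exp (- t * psi lam (fst x)) * (- t * (\<Sum>i\<in>UNIV. lam $ i * (2 * ((fst x $ i) \<bullet> (fst w $ i))))))"
  let ?c = "\<lambda>x :: 'n heis. cis (- t * snd x)"
  let ?dc = "\<lambda>x w :: 'n heis. snd w *\<^sub>R (- (\<i> * complex_of_real t) * ?c x)"
  let ?E = "\<lambda>x. f (fst x) * (?e x * ?c x)"
  let ?dE = "\<lambda>x w. f (fst x) * (?e x * ?dc x w + ?de x w * ?c x) + D (fst x) (fst w) * (?e x * ?c x)"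
  have de: "(?e has_derivative ?de x) (at x)" for x
    using has_derivative_exp_psi_translate[of t 0 x] by simp
  have dc: "(?c has_derivative ?dc x) (at x)" for x
  proof -
    have "((\<lambda>s. cis (- t * s)) has_vector_derivative - (\<i> * complex_of_real t) * cis (- t * s)) (at s)" for s
      unfolding cis_conv_exp by (auto intro!: derivative_eq_intros has_vector_derivative_real_field)
    from has_derivative_compose[OF bounded_linear_imp_has_derivative[OF bounded_linear_snd] this[unfolded has_vector_derivative_def]]
    show ?thesis .
  qed
  have df: "((\<lambda>x :: 'n heis. f (fst x)) has_derivative (\<lambda>w. D (fst x) (fst w))) (at x)" for x
    by (rule has_derivative_compose[OF bounded_linear_imp_has_derivative[OF bounded_linear_fst] D(1)])
  have dE: "(?E has_derivative ?dE x) (at x)" for x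
    by (rule has_derivative_mult[OF df has_derivative_mult[OF de dc]])
  \<comment> \<open>The holomorphic factor contributes 0, the weight contributes - t lam_j z_j, and
    the character in the last variable contributes + t lam_j z_j.\<close>
  have ZE: "ZD lam j x (?dE x) = 0" for x
  proof -
    have Ze: "ZD lam j x (?de x) = ?e x * (- complex_of_real (t * lam $ j) * (fst x $ j))"
      using ZD_exp_psi[of j x t 0] by simp
    have Zc: "ZD lam j x (?dc x) = complex_of_real (t * lam $ j) * (fst x $ j) * ?c x"
      by (simp add: ZD_def scaleR_conv_of_real mult_ac)
    have D0: "D (fst x) 0 = 0" using D(2)[of "fst x" 0 0] by simp
    have "axis j \<i> = \<i> *s (axis j 1 :: complex^'n)"
      by (simp add: vec_eq_iff axis_def)
    then have "D (fst x) (axis j \<i>) = \<i> * D (fst x) (axis j 1)" using D(2) by metis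
    then have Zf: "ZD lam j x (\<lambda>w. D (fst x) (fst w)) = 0"
      by (simp add: ZD_def D0)
    show ?thesis unfolding ZD_mult Ze Zc Zf by (simp add: algebra_simps)
  qed
  obtain R where R: "R > 0" "\<And>x. g x \<noteq> 0 \<Longrightarrow> norm x \<le> R" using test_function_support[OF g] by blast
  let ?dg = "\<lambda>x w. frechet_derivative g (at x) w"
  have dg: "(g has_derivative ?dg x) (at x)" for x by (rule test_function_has_derivative[OF g])
  have contf: "continuous_on UNIV f" by (rule holomorphic_Cn_continuous[OF f])
  have contE: "continuous_on UNIV ?E"
    by (intro continuous_intros continuous_on_compose2[OF contf]) auto
  have prod0: "(LINT x|mu_heis. ZD lam j x (\<lambda>w. ?E x * ?dg x w + ?dE x w * g x)) = 0"
  proof (rule integral_ZD_eq_0)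
    show "((\<lambda>x. ?E x * g x) has_derivative (\<lambda>w. ?E x * ?dg x w + ?dE x w * g x)) (at x)" for x
      by (rule has_derivative_mult[OF dE dg])
    show "norm x \<le> R" if "?E x * g x \<noteq> 0" for x using R(2) that by simp
    fix v :: "'n heis"
    obtain CE where CE: "\<And>x. norm x \<le> R \<Longrightarrow> cmod (?E x) \<le> CE" using continuous_bounded_cball[OF contE] by blast
    obtain Cg where Cg: "\<And>x. cmod (?dg x v) \<le> Cg" using test_function_bounded[OF test_function_deriv[OF g]] by metis
    obtain Cg' where Cg': "\<And>x. cmod (g x) \<le> Cg'" using test_function_bounded[OF g] by metis
    have c1: "continuous_on UNIV (\<lambda>x. f (fst x) * (?e x * ?dc x v + ?de x v * ?c x))"
      by (intro continuous_intros continuous_on_compose2[OF contf]) auto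
    obtain C1 where C1: "\<And>x. norm x \<le> R \<Longrightarrow> cmod (f (fst x) * (?e x * ?dc x v + ?de x v * ?c x)) \<le> C1"
      using continuous_bounded_cball[OF c1] by blast
    have c2: "continuous_on UNIV (\<lambda>x. ?e x * ?c x)" by (intro continuous_intros)
    obtain C2 where C2: "\<And>x. norm x \<le> R \<Longrightarrow> cmod (?e x * ?c x) \<le> C2"
      using continuous_bounded_cball[OF c2] by blast
    obtain C3 where C3: "\<And>z. norm z \<le> R \<Longrightarrow> cmod (D z (fst v)) \<le> C3"
      using holomorphic_Cn_derivative_bound[OF D] by blast
    show "\<exists>C. \<forall>x. cmod (?E x * ?dg x v + ?dE x v * g x) \<le> C"
    proof (intro exI allI)
      fix x
      show "cmod (?E x * ?dg x v + ?dE x v * g x) \<le> \<bar>CE\<bar> * \<bar>Cg\<bar> + (\<bar>C1\<bar> + \<bar>C3\<bar> * \<bar>C2\<bar>) * \<bar>Cg'\<bar>"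
      proof (cases "norm x \<le> R")
        case True
        have z: "norm (fst x) \<le> R" using True norm_fst_le[of "fst x" "snd x"] by simp
        have n1: "cmod (?E x * ?dg x v + ?dE x v * g x) \<le> cmod (?E x) * cmod (?dg x v) + cmod (?dE x v) * cmod (g x)"
          unfolding norm_mult[of "?E x", symmetric] norm_mult[of "?dE x v", symmetric] by (rule norm_triangle_ineq)
        have "cmod (?dE x v) \<le> cmod (f (fst x) * (?e x * ?dc x v + ?de x v * ?c x)) + cmod (D (fst x) (fst v)) * cmod (?e x * ?c x)"
          unfolding norm_mult[of "D (fst x) (fst v)", symmetric] by (rule norm_triangle_ineq)
        also have "\<dots> \<le> \<bar>C1\<bar> + \<bar>C3\<bar> * \<bar>C2\<bar>"
        proof -
          have "cmod (f (fst x) * (?e x * ?dc x v + ?de x v * ?c x)) \<le> \<bar>C1\<bar>" "cmod (?e x * ?c x) \<le> \<bar>C2\<bar>" "cmod (D (fst x) (fst v)) \<le> \<bar>C3\<bar>"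
            using C1[OF True] C2[OF True] C3[OF z] by linarith+
          then show ?thesis by (intro add_mono mult_mono abs_ge_zero norm_ge_zero)
        qed
        finally have n2: "cmod (?dE x v) \<le> \<bar>C1\<bar> + \<bar>C3\<bar> * \<bar>C2\<bar>" .
        have "cmod (?E x) \<le> \<bar>CE\<bar>" "cmod (?dg x v) \<le> \<bar>Cg\<bar>" "cmod (g x) \<le> \<bar>Cg'\<bar>"
          using CE[OF True] Cg[of x] Cg'[of x] by linarith+
        then show ?thesis
          by (intro order_trans[OF n1] add_mono mult_mono n2) simp_all
      next
        case False
        then have "g x = 0" using R(2)[of x] by auto
        moreover have "?dg x v = 0"
          by (rule derivative_zero_outside[where D = "?dg x" and R = R, OF dg R(2)]) (use False in auto)
        ultimately show ?thesis by simp
      qed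
    qed
  qed
  have "ZD lam j x (\<lambda>w. ?E x * ?dg x w + ?dE x w * g x) = ?E x * Zbar lam j g x" for x
    unfolding ZD_mult[where f = "?E x" and D' = "?dg x" and D = "?dE x" and g = "g x"] ZE Zbar_eq_ZD[OF dg] by simp
  then show ?thesis using prod0 by simp
qed

text \<open>The transform is moved to the test function, after which the equation can be checked
  slice by slice. Each slice then becomes a pairing of the smooth solution f exp (- t psi) cis (- t
  s) with a \<open>Zbar\<close> derivative.\<close>

lemma holomorphic_slices_ker:
  assumes V: "V \<in> L2 mu_heis" and W: "pft (- 1) V W"
    and slices: "AE t in lborel. \<exists>f. holomorphic_Cn f \<and> (AE z in mu. V (z, t) = f z * complex_of_real (exp (- t * psi lam z)))"
  shows "(\<lambda>x. 1 / (2 * complex_of_real pi) * W x) \<in> ker_box_b lam"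
  unfolding ker_box_b_iff
proof (intro conjI allI impI)
  have WL: "W \<in> L2 mu_heis" by (rule pft_L2(2)[OF W])
  then show "(\<lambda>x. 1 / (2 * complex_of_real pi) * W x) \<in> L2 mu_heis" by (rule L2_cmult)
  fix j g assume g: "test_function (g :: 'n heis \<Rightarrow> complex)"
  let ?Z = "Zbar lam j g"
  have Z: "test_function ?Z" by (rule test_function_Zbar[OF g])
  note [measurable] = L2_mu_heis_borel[OF V] test_function_borel[OF Z] pft_test_measurable[OF test_function_borel[OF Z]]
  have int: "integrable mu_heis (\<lambda>x. V x * pft_test (- 1) ?Z x)"
    by (intro L2_mult_integrable V pft_test_L2 Z) simp
  have "(LINT x|mu_heis. W x * ?Z x) = (LINT x|mu_heis. V x * pft_test (- 1) ?Z x)"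
    by (rule pft_multiplication[OF W pft_testI[OF Z]]) simp_all
  also have "\<dots> = (LINT t|lborel. LINT z|mu. V (z, t) * pft_test (- 1) ?Z (z, t))"
    by (rule integral_heis_iterated'[OF int])
  also have "\<dots> = 0"
  proof (rule integral_eq_zero_AE)
    show "AE t in lborel. (LINT z|mu. V (z, t) * pft_test (- 1) ?Z (z, t)) = 0"
      using slices
    proof eventually_elim
      case (elim t)
      then obtain f where f: "holomorphic_Cn f" "AE z in mu. V (z, t) = f z * complex_of_real (exp (- t * psi lam z))" by blast
      note contf = holomorphic_Cn_continuous[OF f(1)]
      note [measurable] = borel_measurable_continuous_onI[OF contf]
      have m1: "(\<lambda>z. V (z, t)) \<in> borel_measurable borel" and m2: "(\<lambda>z. pft_test (- 1) ?Z (z, t)) \<in> borel_measurable borel"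
        by (intro slice_measurable(2); measurable)+
      note [measurable] = m1 m2
      let ?E = "\<lambda>x. f (fst x) * (complex_of_real (exp (- t * psi lam (fst x))) * cis (- t * snd x))"
      have contE: "continuous_on UNIV ?E"
        by (intro continuous_intros continuous_on_compose2[OF contf]) auto
      \<comment> \<open>\<open>?E\<close> has constant modulus in the last variable and is not
        square-integrable unless zero; integrability comes from the compact support of the test
        function.\<close>
      have Ei: "integrable mu_heis (\<lambda>x. ?E x * ?Z x)"
      proof -
        have c: "continuous_on UNIV (\<lambda>x. ?E x * ?Z x)" by (intro continuous_on_mult contE test_function_continuous Z)
        obtain R where R: "\<And>x. ?Z x \<noteq> 0 \<Longrightarrow> norm x \<le> R" using test_function_support[OF Z] by blast
        obtain C where C: "C > 0" "\<And>x. norm x \<le> R \<Longrightarrow> cmod (?E x * ?Z x) \<le> C"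
          using continuous_bounded_cball[OF c] by blast
        have "integrable lborel (\<lambda>x. ?E x * ?Z x)"
        proof (rule integrable_bounded_support[where C = C and R = R])
          show "(\<lambda>x. ?E x * ?Z x) \<in> borel_measurable borel" by (rule borel_measurable_continuous_onI[OF c])
          show "norm x \<le> R" if "?E x * ?Z x \<noteq> 0" for x using R that by simp
          show "cmod (?E x * ?Z x) \<le> C" for x
          proof (cases "norm x \<le> R")
            case False
            then have "?Z x = 0" using R by blast
            then show ?thesis using C(1) by simp
          qed (rule C(2))
        qed
        then show ?thesis using borel_measurable_continuous_onI[OF c] by (simp add: integrable_mu_heis_iff)
      qed
      have "(LINT z|mu. V (z, t) * pft_test (- 1) ?Z (z, t))
          = (LINT z|mu. (f z * complex_of_real (exp (- t * psi lam z))) * pft_test (- 1) ?Z (z, t))"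
        by (rule Bochner_Integration.integral_cong_AE) (use f(2) in \<open>measurable, auto elim!: eventually_mono\<close>)
      also have "\<dots> = (LINT z|mu. LINT s|lborel. ?E (z, s) * ?Z (z, s))"
        unfolding pft_test_def by (simp add: mult_ac flip: integral_mult_right_zero)
      also have "\<dots> = (LINT x|mu_heis. ?E x * ?Z x)"
        by (rule integral_heis_iterated[OF Ei, symmetric])
      also have "\<dots> = 0" by (rule integral_Zbar_holomorphic[OF f(1) g])
      finally show ?case .
    qed
  qed
  finally have "(LINT x|mu_heis. W x * ?Z x) = 0" .
  then show "(LINT x|mu_heis. 1 / (2 * complex_of_real pi) * W x * ?Z x) = 0"
    by (simp add: mult.assoc)
qed

end

section \<open>Bergman kernels\<close>

context positive_weights
begin

definition hform :: "complex^'n \<Rightarrow> complex^'n \<Rightarrow> complex" where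
  "hform z w = (\<Sum>j\<in>UNIV. complex_of_real (lam $ j) * z $ j * cnj (w $ j))"

lemma psi_diff: "psi lam (z - w) = psi lam z + psi lam w - 2 * Re (hform z w)"
proof -
  have "(cmod (z $ j - w $ j))\<^sup>2 = (cmod (z $ j))\<^sup>2 + (cmod (w $ j))\<^sup>2 - 2 * Re (z $ j * cnj (w $ j))" for j
    by (simp only: cmod_power2) (simp add: power2_eq_square algebra_simps)
  then have "lam $ j * (cmod ((z - w) $ j))\<^sup>2 = lam $ j * (cmod (z $ j))\<^sup>2 + lam $ j * (cmod (w $ j))\<^sup>2
      - 2 * Re (complex_of_real (lam $ j) * z $ j * cnj (w $ j))" for j
    by (simp add: mult.assoc right_diff_distrib distrib_left)
  then show ?thesis
    by (simp only: psi_def hform_def Re_sum sum.distrib sum_subtractf sum_distrib_left)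
qed

lemma om_hform: "om lam z w = Im (hform z w)"
  by (simp only: om_def hform_def)

definition bergman_unweighted :: "real \<Rightarrow> complex^'n \<Rightarrow> complex^'n \<Rightarrow> complex" where
  "bergman_unweighted t z w = complex_of_real ((2 * t) ^ CARD('n) / gauss_integral) * exp (2 * t * hform z w)"

text \<open>Completing the square: - t psi (z - w) + 2 i t om z w = - t psi z - t psi w + 2 t
  \<open>hform z w\<close>. Real part and phase of the explicit kernel combine into an exponential
  that is holomorphic in z.\<close>

lemma Pker_bergman_unweighted:
  assumes "t > 0"
  shows "Pker t z w = complex_of_real (exp (- t * psi lam z)) * complex_of_real (exp (- t * psi lam w)) * bergman_unweighted t z w"
proof -
  have "complex_of_real (exp (- t * psi lam (z - w))) * cis (2 * t * om lam z w)
      = exp (complex_of_real (- t * psi lam (z - w)) + \<i> * complex_of_real (2 * t * om lam z w))"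
    unfolding exp_add cis_conv_exp exp_of_real ..
  also have "complex_of_real (- t * psi lam (z - w)) + \<i> * complex_of_real (2 * t * om lam z w)
      = complex_of_real (- t * psi lam z) + complex_of_real (- t * psi lam w) + 2 * t * hform z w"
    unfolding om_hform psi_diff by (simp add: complex_eq_iff algebra_simps)
  finally have "complex_of_real (exp (- t * psi lam (z - w))) * cis (2 * t * om lam z w)
      = complex_of_real (exp (- t * psi lam z)) * complex_of_real (exp (- t * psi lam w)) * exp (2 * t * hform z w)"
    by (simp only: exp_add exp_of_real)
  moreover have "Pker t z w = complex_of_real ((2 * t) ^ CARD('n) / gauss_integral) *
      (complex_of_real (exp (- t * psi lam (z - w))) * cis (2 * t * om lam z w))"
    unfolding Pker_def of_real_mult mult.assoc using assms by (simp only: if_True)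
  ultimately show ?thesis by (simp only: bergman_unweighted_def mult_ac of_real_mult of_real_numeral)
qed

lemma hform_bound: "\<exists>L>0. \<forall>z w. cmod (hform z w) \<le> L * norm z * norm w"
proof (intro exI conjI allI)
  show "(\<Sum>j\<in>UNIV. lam $ j) > 0" using lam_pos by (intro sum_pos) auto
  fix z w
  have "cmod (hform z w) \<le> (\<Sum>j\<in>UNIV. cmod (complex_of_real (lam $ j) * z $ j * cnj (w $ j)))"
    unfolding hform_def by (rule norm_sum)
  also have "\<dots> \<le> (\<Sum>j\<in>UNIV. lam $ j * norm z * norm w)"
  proof (rule sum_mono)
    fix j
    have "lam $ j * cmod (z $ j) * cmod (w $ j) \<le> lam $ j * norm z * norm w"
      using lam_pos[of j] by (intro mult_mono mult_nonneg_nonneg Finite_Cartesian_Product.norm_nth_le) auto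
    then show "cmod (complex_of_real (lam $ j) * z $ j * cnj (w $ j)) \<le> lam $ j * norm z * norm w"
      using lam_pos[of j] by (simp add: norm_mult)
  qed
  finally show "cmod (hform z w) \<le> (\<Sum>j\<in>UNIV. lam $ j) * norm z * norm w"
    by (simp add: sum_distrib_right)
qed

lemma hform_add_left: "hform (z + v) w = hform z w + hform v w"
  and hform_cmult_left: "hform (c *s z) w = c * hform z w"
  by (simp_all add: hform_def algebra_simps sum.distrib sum_distrib_left)

lemma hform_scaleR_left: "hform (r *\<^sub>R z) w = r *\<^sub>R hform z w"
  by (simp add: hform_def scaleR_sum_right)

lemma hform_measurable [measurable (raw)]:
  assumes "f \<in> borel_measurable M" "g \<in> borel_measurable M"
  shows "(\<lambda>x. hform (f x) (g x)) \<in> borel_measurable M"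
  unfolding hform_def using assms
  by (intro borel_measurable_sum borel_measurable_times borel_measurable_const borel_measurable_nth
      measurable_compose[OF _ borel_measurable_cnj])

text \<open>Complex differentiation under the integral, with the derivative written down and a
  quadratic Taylor remainder estimated. The derivative is complex linear because
  \<open>hform\<close> is linear in its first argument.\<close>

lemma Pop_holomorphic:
  assumes \<phi>: "\<phi> \<in> L2 mu"
  shows "\<exists>f. holomorphic_Cn f \<and> (\<forall>z. Pop t \<phi> z = f z * complex_of_real (exp (- t * psi lam z)))"
proof (cases "t > 0")
  case False
  then have "Pop t \<phi> z = 0 * complex_of_real (exp (- t * psi lam z))" for z by (simp add: Pop_def Pker_def)
  moreover have "holomorphic_Cn (\<lambda>z. 0)"
    unfolding holomorphic_Cn_def by (intro allI exI[of _ "\<lambda>v. 0"]) auto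
  ultimately show ?thesis by blast
next
  case True
  note [measurable] = L2_mu_borel[OF \<phi>]
  obtain l where l: "l > 0" "\<forall>z. l * (norm z)\<^sup>2 \<le> psi lam z" using psi_lower_bound by blast
  obtain L where L: "L > 0" "\<forall>z w. cmod (hform z w) \<le> L * norm z * norm w" using hform_bound by blast
  let ?e = "\<lambda>w. complex_of_real (exp (- t * psi lam w)) * \<phi> w"
  define G where "G z w = ?e w * exp (2 * t * hform z w)" for z w
  define f where "f z = complex_of_real ((2 * t) ^ CARD('n) / gauss_integral) * (LINT w|mu. G z w)" for z
  have Pf: "Pop t \<phi> z = f z * complex_of_real (exp (- t * psi lam z))" for z
  proof -
    have "Pop t \<phi> z = (LINT w|mu. (complex_of_real ((2 * t) ^ CARD('n) / gauss_integral) * complex_of_real (exp (- t * psi lam z))) * G z w)"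
      unfolding Pop_def G_def by (intro Bochner_Integration.integral_cong refl) (simp add: Pker_bergman_unweighted[OF True] bergman_unweighted_def mult_ac)
    then show ?thesis by (simp add: f_def mult_ac)
  qed
  \<comment> \<open>The common envelope: half of the available Gaussian decay stays with
    \<open>\<phi>\<close>, enough for integrability by Cauchy-Schwarz; the other half absorbs
    exponential growth.\<close>
  define m where "m w = complex_of_real (exp (- (t * l / 2) * (norm w)\<^sup>2)) * \<phi> w" for w
  have mi: "integrable mu m"
    unfolding m_def
  proof (rule L2_mult_integrable[OF _ \<phi>])
    have "integrable lborel (\<lambda>w :: complex^'n. exp (- (t * l) * (norm w)\<^sup>2))"
      using True l by (intro integrable_gaussian_norm) simp
    then have "integrable mu (\<lambda>w :: complex^'n. exp (- (t * l) * (norm w)\<^sup>2))"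
      by (subst integrable_mu_iff) auto
    moreover have "(cmod (complex_of_real (exp (- (t * l / 2) * (norm w)\<^sup>2))))\<^sup>2 = exp (- (t * l) * (norm w)\<^sup>2)" for w :: "complex^'n"
      by (simp flip: exp_double)
    ultimately show "(\<lambda>w :: complex^'n. complex_of_real (exp (- (t * l / 2) * (norm w)\<^sup>2))) \<in> L2 mu"
      unfolding L2_def by simp
  qed
  \<comment> \<open>Exponential growth against Gaussian decay: the constant a^2 / (2 t l) comes from
    the square (a - t l |w|)^2 \<ge> 0.\<close>
  have dom: "exp (a * norm w) * cmod (?e w) \<le> exp (a\<^sup>2 / (2 * t * l)) * cmod (m w)" if "a \<ge> 0" for a w
  proof -
    let ?x = "norm w"
    have "0 \<le> (a - t * l * ?x)\<^sup>2 / (2 * t * l)" using True l by simp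
    also have "\<dots> = a\<^sup>2 / (2 * t * l) - a * ?x + t * l / 2 * ?x\<^sup>2"
      using True l by (simp add: power2_eq_square field_simps)
    finally have 1: "a * ?x \<le> a\<^sup>2 / (2 * t * l) + t * l / 2 * ?x\<^sup>2" by linarith
    have "t * (l * ?x\<^sup>2) \<le> t * psi lam w" using l True by (intro mult_left_mono) auto
    then have "a * ?x + - t * psi lam w \<le> a\<^sup>2 / (2 * t * l) + - (t * l / 2) * ?x\<^sup>2" using 1 by (simp add: algebra_simps)
    then have "exp (a * ?x) * exp (- t * psi lam w) \<le> exp (a\<^sup>2 / (2 * t * l)) * exp (- (t * l / 2) * ?x\<^sup>2)"
      unfolding exp_add[symmetric] by (simp only: exp_le_cancel_iff)
    then have "exp (a * ?x) * exp (- t * psi lam w) * cmod (\<phi> w) \<le> exp (a\<^sup>2 / (2 * t * l)) * exp (- (t * l / 2) * ?x\<^sup>2) * cmod (\<phi> w)"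
      by (intro mult_right_mono) auto
    then show ?thesis by (simp add: m_def norm_mult mult.assoc)
  qed
  let ?c = "2 * t * L"
  have c0: "?c > 0" using True L by simp
  have h2: "cmod (2 * t * hform z w) \<le> ?c * norm z * norm w" for z w
    using mult_left_mono[of "cmod (hform z w)" "L * norm z * norm w" "2 * t"] L True by (simp add: norm_mult mult.assoc)
  have G1: "cmod (G z w) \<le> exp ((?c * norm z)\<^sup>2 / (2 * t * l)) * cmod (m w)" for z w
  proof -
    have "cmod (exp (2 * t * hform z w)) \<le> exp (?c * norm z * norm w)"
      using order_trans[OF norm_exp h2[of z w, THEN exp_le_cancel_iff[THEN iffD2]]] .
    then have "cmod (G z w) \<le> exp (?c * norm z * norm w) * cmod (?e w)"
      unfolding G_def norm_mult[of "?e w"] mult.commute[of "cmod (?e w)"] by (intro mult_right_mono) auto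
    also have "\<dots> \<le> exp ((?c * norm z)\<^sup>2 / (2 * t * l)) * cmod (m w)"
      using c0 by (intro dom) simp
    finally show ?thesis .
  qed
  have Gi: "integrable mu (G z)" for z
  proof (rule Bochner_Integration.integrable_bound[OF integrable_mult_right[OF integrable_norm[OF mi]]])
    show "G z \<in> borel_measurable mu" unfolding G_def by measurable
    show "AE w in mu. norm (G z w) \<le> norm (exp ((?c * norm z)\<^sup>2 / (2 * t * l)) * cmod (m w))"
      using G1 by (intro AE_I2) simp
  qed
  define K1 where "K1 z = exp ((?c * norm z + 1)\<^sup>2 / (2 * t * l))" for z :: "complex^'n"
  define D where "D z v = (LINT w|mu. (2 * t * hform v w) * G z w)" for z v
  have lin_bound: "cmod ((2 * t * hform v w) * G z w) \<le> ?c * norm v * (K1 z * cmod (m w))" for v w z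
  proof -
    \<comment> \<open>Linear factors are turned into exponentials so that \<open>dom\<close> applies
      again; this is the + 1 in \<open>K1\<close>.\<close>
    have x: "norm w \<le> exp (norm w)" using exp_ge_add_one_self[of "norm w"] by linarith
    have "cmod (exp (2 * t * hform z w)) \<le> exp (?c * norm z * norm w)"
      using order_trans[OF norm_exp h2[of z w, THEN exp_le_cancel_iff[THEN iffD2]]] .
    then have "cmod ((2 * t * hform v w) * G z w) \<le> (?c * norm v * norm w) * (exp (?c * norm z * norm w) * cmod (?e w))"
      unfolding G_def norm_mult[of "2 * t * hform v w"] norm_mult[of "?e w"] mult.commute[of "cmod (?e w)"]
      using c0 by (intro mult_mono h2 mult_right_mono) auto
    also have "\<dots> \<le> (?c * norm v * exp (norm w)) * (exp (?c * norm z * norm w) * cmod (?e w))"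
      using c0 by (intro mult_right_mono mult_left_mono x) auto
    also have "\<dots> = ?c * norm v * (exp ((?c * norm z + 1) * norm w) * cmod (?e w))"
      unfolding distrib_right[of _ 1] exp_add mult_1_left by (simp only: mult_ac)
    also have "\<dots> \<le> ?c * norm v * (K1 z * cmod (m w))"
      unfolding K1_def using c0 by (intro mult_left_mono dom) auto
    finally show ?thesis .
  qed
  have Di: "integrable mu (\<lambda>w. (2 * t * hform v w) * G z w)" for v z
  proof (rule Bochner_Integration.integrable_bound[OF integrable_mult_right[OF integrable_mult_right[OF integrable_norm[OF mi], of "K1 z"], of "?c * norm v"]])
    show "(\<lambda>w. (2 * t * hform v w) * G z w) \<in> borel_measurable mu" unfolding G_def by measurable
    show "AE w in mu. norm ((2 * t * hform v w) * G z w) \<le> norm (?c * norm v * (K1 z * cmod (m w)))"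
      unfolding real_norm_def by (intro AE_I2 order_trans[OF lin_bound abs_ge_self])
  qed
  \<comment> \<open>In the exponent c |z| comes from the kernel at z, c from the Taylor remainder
    with |y - z| \<le> 1, and 2 from |w|^2 \<le> exp (2 |w|).\<close>
  define K2 where "K2 z = exp ((?c * norm z + (?c + 2))\<^sup>2 / (2 * t * l))" for z :: "complex^'n"
  define M where "M = (LINT w|mu. cmod (m w))"
  have rem: "cmod ((LINT w|mu. G y w) - (LINT w|mu. G z w) - D z (y - z)) \<le> (?c\<^sup>2 * K2 z * M) * (norm (y - z))\<^sup>2"
    if y: "norm (y - z) \<le> 1" for y z
  proof -
    let ?v = "y - z"
    have "(LINT w|mu. G y w) - (LINT w|mu. G z w) - D z ?v = (LINT w|mu. G y w - G z w - (2 * t * hform ?v w) * G z w)"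
      unfolding D_def using Gi Di by simp
    also have "cmod \<dots> \<le> (LINT w|mu. (?c\<^sup>2 * K2 z * (norm ?v)\<^sup>2) * cmod (m w))"
    proof (rule norm_integral_le[OF integrable_mult_right[OF integrable_norm[OF mi]]])
      fix w
      let ?u = "2 * t * hform ?v w"
      have "hform y w = hform z w + hform ?v w" using hform_add_left[of z ?v w] by simp
      then have "exp (2 * t * hform y w) = exp (2 * t * hform z w) * exp ?u"
        by (simp add: distrib_left exp_add)
      \<comment> \<open>Additivity of \<open>hform\<close> reduces the increment to the second-order
        Taylor remainder of exp at \<open>?u\<close>.\<close>
      then have "G y w - G z w - ?u * G z w = G z w * (exp ?u - (\<Sum>k\<le>1. ?u ^ k / fact k))"
        unfolding G_def by (simp add: algebra_simps)
      then have "cmod (G y w - G z w - ?u * G z w) = cmod (G z w) * cmod (exp ?u - (\<Sum>k\<le>1. ?u ^ k / fact k))"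
        by (simp only: norm_mult)
      also have "\<dots> \<le> cmod (G z w) * (exp \<bar>Re ?u\<bar> * (cmod ?u) ^ Suc 1 / fact 1)"
        by (intro mult_left_mono Taylor_exp) auto
      also have "\<dots> \<le> cmod (G z w) * (exp (?c * norm w) * (?c * norm ?v * norm w)\<^sup>2)"
      proof (intro mult_left_mono)
        have "\<bar>Re ?u\<bar> \<le> cmod ?u" by (rule abs_Re_le_cmod)
        also have "\<dots> \<le> ?c * norm ?v * norm w" by (rule h2)
        also have "\<dots> \<le> ?c * 1 * norm w" using y c0 by (intro mult_right_mono mult_left_mono) auto
        finally have "exp \<bar>Re ?u\<bar> \<le> exp (?c * norm w)" by simp
        moreover have "(cmod ?u)\<^sup>2 \<le> (?c * norm ?v * norm w)\<^sup>2" by (intro power_mono h2) auto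
        ultimately have "exp \<bar>Re ?u\<bar> * (cmod ?u)\<^sup>2 \<le> exp (?c * norm w) * (?c * norm ?v * norm w)\<^sup>2"
          by (intro mult_mono) auto
        then show "exp \<bar>Re ?u\<bar> * (cmod ?u) ^ Suc 1 / fact 1 \<le> exp (?c * norm w) * (?c * norm ?v * norm w)\<^sup>2"
          by (simp add: numeral_2_eq_2)
      qed auto
      also have "\<dots> \<le> (exp (?c * norm z * norm w) * cmod (?e w)) * (exp (?c * norm w) * (?c\<^sup>2 * (norm ?v)\<^sup>2 * exp (2 * norm w)))"
      proof (intro mult_mono mult_left_mono)
        have "cmod (exp (2 * t * hform z w)) \<le> exp (?c * norm z * norm w)"
          using order_trans[OF norm_exp h2[of z w, THEN exp_le_cancel_iff[THEN iffD2]]] .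
        then show "cmod (G z w) \<le> exp (?c * norm z * norm w) * cmod (?e w)"
          unfolding G_def norm_mult[of "?e w"] mult.commute[of "cmod (?e w)"] by (intro mult_right_mono) auto
        have "norm w \<le> exp (norm w)" using exp_ge_add_one_self[of "norm w"] by linarith
        then have "(norm w)\<^sup>2 \<le> (exp (norm w))\<^sup>2" by (intro power_mono) auto
        then have "?c\<^sup>2 * (norm ?v)\<^sup>2 * (norm w)\<^sup>2 \<le> ?c\<^sup>2 * (norm ?v)\<^sup>2 * exp (2 * norm w)"
          by (intro mult_left_mono) (auto simp: exp_double)
        then show "(?c * norm ?v * norm w)\<^sup>2 \<le> ?c\<^sup>2 * (norm ?v)\<^sup>2 * exp (2 * norm w)"
          by (simp only: power_mult_distrib)
      qed auto
      also have "\<dots> = (?c\<^sup>2 * (norm ?v)\<^sup>2) * (exp ((?c * norm z + (?c + 2)) * norm w) * cmod (?e w))"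
        unfolding distrib_right[of _ "?c + 2"] distrib_right[of _ 2] exp_add by (simp only: mult_ac)
      also have "\<dots> \<le> (?c\<^sup>2 * (norm ?v)\<^sup>2) * (K2 z * cmod (m w))"
        unfolding K2_def using c0 by (intro mult_left_mono dom) auto
      finally show "norm (G y w - G z w - ?u * G z w) \<le> (?c\<^sup>2 * K2 z * (norm ?v)\<^sup>2) * cmod (m w)"
        by (simp add: mult_ac)
    qed
    finally show ?thesis by (simp add: M_def mult_ac)
  qed
  have blD: "bounded_linear (D z)" for z
  proof (rule bounded_linear_intro)
    show "D z (v + v') = D z v + D z v'" for v v'
      unfolding D_def using Di by (simp add: hform_add_left distrib_left distrib_right)
    show "D z (r *\<^sub>R v) = r *\<^sub>R D z v" for r v
      unfolding D_def integral_scaleR_right[symmetric]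
      by (intro Bochner_Integration.integral_cong refl) (simp only: hform_scaleR_left mult_scaleR_left mult_scaleR_right)
    show "norm (D z v) \<le> norm v * (?c * (K1 z * M))" for v
    proof -
      have "cmod (D z v) \<le> (LINT w|mu. ?c * norm v * (K1 z * cmod (m w)))"
        unfolding D_def by (rule norm_integral_le[OF integrable_mult_right[OF integrable_mult_right[OF integrable_norm[OF mi]]] lin_bound])
      also have "\<dots> = norm v * (?c * (K1 z * M))" by (simp add: M_def mult_ac)
      finally show ?thesis .
    qed
  qed
  have dG: "((\<lambda>z. LINT w|mu. G z w) has_derivative D z) (at z)" for z
  proof (rule has_derivativeI_sandwich[where e = 1 and H = "\<lambda>y. (?c\<^sup>2 * K2 z * M) * norm (y - z)"])
    show "((\<lambda>y. (?c\<^sup>2 * K2 z * M) * norm (y - z)) \<longlongrightarrow> 0) (at z)"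
      by (auto intro!: tendsto_eq_intros)
    fix y assume y: "y \<noteq> z" "dist y z < 1"
    then have "norm (y - z) \<le> 1" "norm (y - z) > 0" by (simp_all add: dist_norm)
    with rem[of y z] show "norm ((LINT w|mu. G y w) - (LINT w|mu. G z w) - D z (y - z)) / norm (y - z) \<le> (?c\<^sup>2 * K2 z * M) * norm (y - z)"
      by (simp add: divide_le_eq power2_eq_square mult.assoc)
  qed (use blD in auto)
  have "holomorphic_Cn f"
    unfolding holomorphic_Cn_def
  proof (intro allI exI conjI)
    fix z
    show "(f has_derivative (\<lambda>v. complex_of_real ((2 * t) ^ CARD('n) / gauss_integral) * D z v)) (at z)"
      unfolding f_def by (rule has_derivative_mult_right[OF dG])
    fix c v
    have "D z (c *s v) = c * D z v"
      unfolding D_def hform_cmult_left integral_mult_right_zero[symmetric]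
      by (intro Bochner_Integration.integral_cong refl) (simp add: mult_ac)
    then show "complex_of_real ((2 * t) ^ CARD('n) / gauss_integral) * D z (c *s v) = c * (complex_of_real ((2 * t) ^ CARD('n) / gauss_integral) * D z v)"
      by (simp only: mult.left_commute)
  qed
  with Pf show ?thesis by blast
qed

text \<open>Multiplication by the weight embeds the Bergman space isometrically into the unweighted
  \<open>L2 mu\<close>. The exponential prefactor of \<open>bergman_kernel\<close> is then absorbed
  into the basis functions.\<close>

definition wt :: "real \<Rightarrow> (complex^'n \<Rightarrow> complex) \<Rightarrow> complex^'n \<Rightarrow> complex" where
  "wt t f z = f z * complex_of_real (exp (- t * psi lam z))"

lemma cmod_wt_sq: "(cmod (wt t f z))\<^sup>2 = (cmod (f z))\<^sup>2 * exp (- 2 * (t * psi lam z))"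
  by (simp add: wt_def norm_mult power_mult_distrib flip: exp_double)

lemma wt_borel: "holomorphic_Cn f \<Longrightarrow> wt t f \<in> borel_measurable borel"
  unfolding wt_def[abs_def]
  by (intro borel_measurable_continuous_onI continuous_intros holomorphic_Cn_continuous)

lemma bergman_space_iff: "f \<in> bergman_space (\<lambda>z. t * psi lam z) \<longleftrightarrow> holomorphic_Cn f \<and> wt t f \<in> L2 mu"
  using wt_borel[of f t] unfolding bergman_space_def L2_def
  by (auto simp: cmod_wt_sq measurable_cong_sets[OF sets_mu refl])

lemma Pop_continuous:
  assumes "\<phi> \<in> L2 mu"
  shows "continuous_on UNIV (Pop t \<phi>)"
proof -
  obtain f where f: "holomorphic_Cn f" "\<And>z. Pop t \<phi> z = f z * complex_of_real (exp (- t * psi lam z))"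
    using Pop_holomorphic[OF assms] by blast
  have "continuous_on UNIV (\<lambda>z. f z * complex_of_real (exp (- t * psi lam z)))"
    by (intro continuous_intros holomorphic_Cn_continuous f)
  then show ?thesis using f(2) by (simp add: continuous_on_def cong: tendsto_cong)
qed

lemma AE_eq_imp_eq:
  fixes f g :: "complex^'n \<Rightarrow> complex"
  assumes "AE z in mu. f z = g z" "continuous_on UNIV f" "continuous_on UNIV g"
  shows "f z = g z"
proof (rule ccontr)
  assume ne: "f z \<noteq> g z"
  let ?U = "{z. f z \<noteq> g z}"
  have "open ?U" by (rule open_Collect_neq[OF assms(2,3)])
  have "AE z in lborel. z \<notin> ?U" using assms(1) by (simp add: AE_mu_iff)
  moreover have "?U \<in> sets borel" using \<open>open ?U\<close> by (rule borel_open)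
  ultimately have "?U \<in> null_sets lborel" by (simp add: AE_iff_null_sets)
  then have "negligible ?U"
    by (simp add: negligible_iff_null_sets null_sets_completionI)
  then show False
    using open_not_negligible[OF \<open>open ?U\<close>] ne by blast
qed

text \<open>For \<open>t'\<close> in the short interval, the functions \<open>f exp (- t' psi)\<close> are the slices of an element
  of the kernel of the Kohn Laplacian.\<close>

lemma bergman_reproducing_AE:
  assumes f: "holomorphic_Cn f" "wt t f \<in> L2 mu" and d: "d > 0"
  shows "AE t' in lborel. t < t' \<and> t' < t + d \<longrightarrow> (\<forall>z. wt t' f z = Pop t' (wt t' f) z)"
proof -
  define H where "H x = indicator {t..t + d} (snd x) *\<^sub>R wt (snd x) f (fst x)" for x :: "'n heis"
  note contf = holomorphic_Cn_continuous[OF f(1)]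
  have cw: "continuous_on UNIV (wt s f)" for s
    unfolding wt_def[abs_def] by (intro continuous_intros contf)
  have "continuous_on UNIV (\<lambda>x :: 'n heis. wt (snd x) f (fst x))"
    unfolding wt_def by (intro continuous_intros continuous_on_compose2[OF contf]) auto
  then have [measurable]: "(\<lambda>x :: 'n heis. wt (snd x) f (fst x)) \<in> borel_measurable borel"
    by (rule borel_measurable_continuous_onI)
  have [measurable]: "(snd :: 'n heis \<Rightarrow> real) \<in> borel_measurable borel"
    by (intro borel_measurable_continuous_onI continuous_intros)
  have Hm: "H \<in> borel_measurable borel" unfolding H_def[abs_def] by measurable
  \<comment> \<open>Since psi \<ge> 0, the weights decrease in the parameter; this is why the
    interval extends to the right of t.\<close>
  have wle: "cmod (wt s f z) \<le> cmod (wt t f z)" if "s \<ge> t" for s z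
    using that psi_nonneg[of z] by (auto simp: wt_def norm_mult intro!: mult_left_mono mult_right_mono)
  have HL: "H \<in> L2 mu_heis"
  proof -
    have "integrable mu_heis (\<lambda>x. (cmod (H x))\<^sup>2)"
    proof (rule integrable_heis_dominated)
      show "integrable mu (\<lambda>z. (cmod (wt t f z))\<^sup>2)" using f(2) by (simp add: L2_def)
      have "emeasure lborel {t..t + d} < \<infinity>" using d by simp
      then show "integrable lborel (\<lambda>s. indicator {t..t + d} s :: real)" by (intro integrable_real_indicator) auto
      show "norm ((cmod (H (z, s)))\<^sup>2) \<le> (cmod (wt t f z))\<^sup>2 * indicator {t..t + d} s" for z s
        using power_mono[OF wle[of s z], of 2] by (auto simp: H_def indicator_def)
    qed (use Hm in measurable)
    then show ?thesis using Hm by (simp add: L2_def measurable_cong_sets[OF sets_mu_heis refl])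
  qed
  \<comment> \<open>H is prescribed on the frequency side. Transforming back and dividing by 2 pi
    gives a kernel element, and inversion shows that H is its transform.\<close>
  obtain W where W: "pft (- 1) H W" using pft_exists[OF HL, of "- 1"] by auto
  have "(\<lambda>x. 1 / (2 * complex_of_real pi) * W x) \<in> ker_box_b lam"
  proof (rule holomorphic_slices_ker[OF HL W AE_I2])
    fix s :: real
    have "holomorphic_Cn (\<lambda>z. 0)" unfolding holomorphic_Cn_def by (intro allI exI[of _ "\<lambda>v. 0"]) auto
    then show "\<exists>g. holomorphic_Cn g \<and> (AE z in mu. H (z, s) = g z * complex_of_real (exp (- s * psi lam z)))"
      using f(1) by (cases "s \<in> {t..t + d}") (auto simp: H_def wt_def intro: exI[of _ f] exI[of _ "\<lambda>z. 0"])
  qed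
  moreover have "pft 1 (\<lambda>x. 1 / (2 * complex_of_real pi) * W x) H"
    using pft_cmult[OF pft_inversion[OF W], of "1 / (2 * complex_of_real pi)"] by simp
  ultimately have "AE s in lborel. AE z in mu. H (z, s) = Pop s (\<lambda>z. H (z, s)) z"
    by (rule ker_reproducing)
  then show ?thesis
  proof eventually_elim
    case (elim s)
    show ?case
    proof (intro impI allI)
      fix z assume s: "t < s \<and> s < t + d"
      then have Hz: "H (z, s) = wt s f z" for z by (auto simp: H_def)
      then have Hs: "(\<lambda>z. H (z, s)) = wt s f" by (rule ext)
      have "wt s f \<in> L2 mu"
        by (rule L2_bound[where w = "\<lambda>z. (cmod (wt t f z))\<^sup>2"])
          (use f s wle[of s] wt_borel[OF f(1), of s] in \<open>auto simp: L2_def measurable_cong_sets[OF sets_mu refl] intro!: power_mono\<close>)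
      then show "wt s f z = Pop s (wt s f) z"
        using elim unfolding Hs Hz by (intro AE_eq_imp_eq cw Pop_continuous)
    qed
  qed
qed

text \<open>For negative parameters the reproducing operator is zero, so reproduction at a single s
  already kills f. The interval length - t / 2 keeps s below 0.\<close>

lemma bergman_trivial:
  assumes t: "t < 0" and f: "f \<in> bergman_space (\<lambda>z. t * psi lam z)"
  shows "f z = 0"
proof -
  have "\<exists>s\<in>{t<..<t / 2}. t < s \<and> s < t + (- t / 2) \<longrightarrow> (\<forall>z. wt s f z = Pop s (wt s f) z)"
    by (rule AE_lborel_ex[OF bergman_reproducing_AE]) (use f t in \<open>auto simp: bergman_space_iff\<close>)
  then obtain s where "s \<in> {t<..<t / 2}" "t < s \<and> s < t + (- t / 2) \<longrightarrow> (\<forall>z. wt s f z = Pop s (wt s f) z)" by blast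
  then have s: "s < 0" "wt s f z = Pop s (wt s f) z" using t by auto
  then have "wt s f z = 0" by (simp add: Pop_def Pker_def)
  then show ?thesis by (simp add: wt_def)
qed

text \<open>Almost every parameter in each interval to the right of t reproduces f, so a sequence of
  good parameters decreases to t in the limit; kernel and weight are continuous in the
  parameter.\<close>

lemma bergman_reproducing:
  assumes t: "t > 0" and f: "f \<in> bergman_space (\<lambda>z. t * psi lam z)"
  shows "wt t f z = Pop t (wt t f) z"
proof -
  have fh: "holomorphic_Cn f" and fL: "wt t f \<in> L2 mu" using f by (auto simp: bergman_space_iff)
  define d where "d m = 1 / real (Suc m)" for m
  have d: "d m > 0" "d m \<le> 1" for m by (simp_all add: d_def)
  have "\<exists>s\<in>{t<..<t + d m}. t < s \<and> s < t + d m \<longrightarrow> (\<forall>z. wt s f z = Pop s (wt s f) z)" for m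
    by (rule AE_lborel_ex[OF bergman_reproducing_AE[OF fh fL d(1)]]) (simp add: d)
  then have "\<exists>s. t < s \<and> s < t + d m \<and> (\<forall>z. wt s f z = Pop s (wt s f) z)" for m by fastforce
  then obtain s where s: "\<And>m. t < s m" "\<And>m. s m < t + d m" "\<And>m z. wt (s m) f z = Pop (s m) (wt (s m) f) z"
    by metis
  have "(\<lambda>m. t + d m) \<longlonglongrightarrow> t + 0"
    unfolding d_def using LIMSEQ_Suc[OF lim_1_over_n] by (intro tendsto_intros) (simp add: inverse_eq_divide)
  then have dl: "(\<lambda>m. t + d m) \<longlonglongrightarrow> t" by simp
  have sl: "s \<longlonglongrightarrow> t"
  proof (rule real_tendsto_sandwich[OF _ _ tendsto_const dl])
    show "\<forall>\<^sub>F m in sequentially. t \<le> s m" by (intro always_eventually allI less_imp_le s)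
    show "\<forall>\<^sub>F m in sequentially. s m \<le> t + d m" by (intro always_eventually allI less_imp_le s)
  qed
  have s0: "s m > 0" for m using s(1)[of m] t by linarith
  have wlim: "(\<lambda>m. wt (s m) f w) \<longlonglongrightarrow> wt t f w" for w
    unfolding wt_def by (intro tendsto_intros sl)
  have plim: "(\<lambda>m. Pker (s m) z w) \<longlonglongrightarrow> Pker t z w" for w
  proof -
    have "(\<lambda>m. 2 * s m * om lam z w) \<longlonglongrightarrow> 2 * t * om lam z w" by (intro tendsto_intros sl)
    then have c: "(\<lambda>m. cis (2 * s m * om lam z w)) \<longlonglongrightarrow> cis (2 * t * om lam z w)"
      by (rule isCont_tendsto_compose[OF isCont_cis])
    have "(\<lambda>m. complex_of_real ((2 * s m) ^ CARD('n) / gauss_integral * exp (- s m * psi lam (z - w))) * cis (2 * s m * om lam z w))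
        \<longlonglongrightarrow> complex_of_real ((2 * t) ^ CARD('n) / gauss_integral * exp (- t * psi lam (z - w))) * cis (2 * t * om lam z w)"
      using gauss_integral_pos by (intro tendsto_intros c sl) auto
    then show ?thesis using s0 t by (simp add: Pker_def)
  qed
  \<comment> \<open>All parameters lie between t and t + 1: the polynomial factor is bounded at the
    right end, the exponentials at the left end.\<close>
  let ?C = "(2 * (t + 1)) ^ CARD('n) / gauss_integral"
  have "(\<lambda>m. LINT w|mu. Pker (s m) z w * wt (s m) f w) \<longlonglongrightarrow> (LINT w|mu. Pker t z w * wt t f w)"
  proof (rule integral_dominated_convergence)
    show "integrable mu (\<lambda>w. ?C * cmod (complex_of_real (exp (- t * psi lam (w - z))) * wt t f w))"
      by (intro integrable_mult_right integrable_norm L2_mult_integrable gaussian_L2 t fL)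
    show "AE w in mu. (\<lambda>m. Pker (s m) z w * wt (s m) f w) \<longlonglongrightarrow> Pker t z w * wt t f w"
      by (intro AE_I2 tendsto_mult plim wlim)
    show "AE w in mu. norm (Pker (s m) z w * wt (s m) f w) \<le> ?C * cmod (complex_of_real (exp (- t * psi lam (w - z))) * wt t f w)" for m
    proof (intro AE_I2)
      fix w
      have "(2 * s m) ^ CARD('n) \<le> (2 * (t + 1)) ^ CARD('n)"
        using s0[of m] s(2)[of m] d(2)[of m] by (intro power_mono) auto
      then have "(2 * s m) ^ CARD('n) / gauss_integral \<le> ?C" using gauss_integral_pos by (intro divide_right_mono) auto
      moreover have "exp (- s m * psi lam (w - z)) \<le> exp (- t * psi lam (w - z))"
        using s(1)[of m] psi_nonneg[of "w - z"] by (simp add: mult_right_mono)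
      ultimately have "cmod (Pker (s m) z w) \<le> ?C * exp (- t * psi lam (w - z))"
        using s0[of m] t gauss_integral_pos unfolding cmod_Pker psi_minus_commute[of lam z w]
        by (simp only: if_True) (rule mult_mono, simp_all)
      moreover have "cmod (wt (s m) f w) \<le> cmod (wt t f w)"
        using s(1)[of m] psi_nonneg[of w] by (auto simp: wt_def norm_mult intro!: mult_left_mono mult_right_mono)
      ultimately have "cmod (Pker (s m) z w) * cmod (wt (s m) f w) \<le> (?C * exp (- t * psi lam (w - z))) * cmod (wt t f w)"
        using t gauss_integral_pos by (intro mult_mono) auto
      then show "norm (Pker (s m) z w * wt (s m) f w) \<le> ?C * cmod (complex_of_real (exp (- t * psi lam (w - z))) * wt t f w)"
        by (simp add: norm_mult mult.assoc)
    qed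
  next
    have [measurable]: "wt q f \<in> borel_measurable borel" for q by (rule wt_borel[OF fh])
    show "(\<lambda>w. Pker t z w * wt t f w) \<in> borel_measurable mu" by measurable
    show "(\<lambda>w. Pker (s m) z w * wt (s m) f w) \<in> borel_measurable mu" for m
      using Pker_measurable[of "\<lambda>w. s m" mu "\<lambda>w. z" "\<lambda>w. w"] by measurable
  qed
  moreover have "(\<lambda>m. wt (s m) f z) = (\<lambda>m. LINT w|mu. Pker (s m) z w * wt (s m) f w)"
    by (rule ext) (rule s(3)[unfolded Pop_def])
  ultimately have "(\<lambda>m. wt (s m) f z) \<longlonglongrightarrow> Pop t (wt t f) z"
    unfolding Pop_def[of t] by (simp only:)
  from LIMSEQ_unique[OF wlim this] show ?thesis .
qed

end

section \<open>Reproducing kernel Hilbert spaces\<close>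

lemma L2_inner_diff_left:
  assumes "f \<in> L2 M" "g \<in> L2 M" "h \<in> L2 M"
  shows "L2_inner M (\<lambda>x. f x - c * g x) h = L2_inner M f h - c * L2_inner M g h"
proof -
  have "integrable M (\<lambda>x. f x * cnj (h x))" "integrable M (\<lambda>x. g x * cnj (h x))"
    using assms by (auto intro!: L2_mult_integrable L2_cnj)
  then show ?thesis by (simp add: L2_inner_def left_diff_distrib mult.assoc)
qed

lemma L2_inner_sum_left:
  assumes "\<And>s. s \<in> F \<Longrightarrow> s \<in> L2 M" "h \<in> L2 M"
  shows "L2_inner M (\<lambda>x. \<Sum>s\<in>F. c s * s x) h = (\<Sum>s\<in>F. c s * L2_inner M s h)"
proof -
  have i: "integrable M (\<lambda>x. s x * cnj (h x))" if "s \<in> F" for s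
    using assms that by (auto intro!: L2_mult_integrable L2_cnj)
  have "L2_inner M (\<lambda>x. \<Sum>s\<in>F. c s * s x) h = (LINT x|M. (\<Sum>s\<in>F. c s * (s x * cnj (h x))))"
    by (simp add: L2_inner_def sum_distrib_right mult.assoc)
  also have "\<dots> = (\<Sum>s\<in>F. c s * L2_inner M s h)"
    using i by (subst Bochner_Integration.integral_sum) (auto simp: L2_inner_def)
  finally show ?thesis .
qed

lemma L2_inner_commute: "L2_inner M g f = cnj (L2_inner M f g)"
  by (simp add: L2_inner_def mult.commute flip: Bochner_Integration.integral_cnj)

lemma L2_inner_self: "L2_inner M f f = complex_of_real (nsq M f)"
  by (simp add: L2_inner_def nsq_def complex_norm_square flip: integral_complex_of_real of_real_power)

lemma L2_inner_Cauchy_Schwarz: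
  assumes "f \<in> L2 M" "g \<in> L2 M"
  shows "(cmod (L2_inner M f g))\<^sup>2 \<le> nsq M f * nsq M g"
  using L2_Cauchy_Schwarz[OF assms(1) L2_cnj[OF assms(2)]] by (simp add: L2_inner_def nsq_def)

lemma nsq_diff_cmult:
  assumes r: "r \<in> L2 M" and s: "s \<in> L2 M" and n: "nsq M s = 1"
  shows "nsq M (\<lambda>x. r x - d * s x) = nsq M r - (cmod (L2_inner M r s))\<^sup>2 + (cmod (L2_inner M r s - d))\<^sup>2"
proof -
  let ?c = "L2_inner M r s" and ?h = "\<lambda>x. r x - d * s x"
  have h: "?h \<in> L2 M" by (intro L2_diff L2_cmult r s)
  have "complex_of_real (nsq M ?h) = L2_inner M r ?h - d * L2_inner M s ?h"
    unfolding L2_inner_self[symmetric] by (rule L2_inner_diff_left[OF r s h])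
  also have "\<dots> = cnj (L2_inner M ?h r) - d * cnj (L2_inner M ?h s)"
    by (simp only: L2_inner_commute[of M _ ?h])
  also have "\<dots> = complex_of_real (nsq M r) - cnj d * ?c - d * (cnj ?c - cnj d)"
    unfolding L2_inner_diff_left[OF r s r] L2_inner_diff_left[OF r s s] L2_inner_self n L2_inner_commute[of M s r]
    by simp
  also have "\<dots> = complex_of_real (nsq M r - (cmod ?c)\<^sup>2 + (cmod (?c - d))\<^sup>2)"
    by (simp add: cmod_power2 complex_eq_iff) (simp add: power2_eq_square algebra_simps)
  finally show ?thesis by (simp only: of_real_eq_iff)
qed

definition orthonormal_in :: "'a measure \<Rightarrow> ('a \<Rightarrow> complex) set \<Rightarrow> bool" where
  "orthonormal_in M B \<longleftrightarrow> (\<forall>s\<in>B. \<forall>s'\<in>B. L2_inner M s s' = (if s = s' then 1 else 0))"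

lemma orthonormal_in_subset: "orthonormal_in M B \<Longrightarrow> F \<subseteq> B \<Longrightarrow> orthonormal_in M F"
  unfolding orthonormal_in_def by blast

lemma nsq_orthonormal: "orthonormal_in M B \<Longrightarrow> s \<in> B \<Longrightarrow> nsq M s = 1"
  using L2_inner_self[of M s] by (simp add: orthonormal_in_def)

text \<open>Pythagoras for arbitrary coefficients: the last sum measures the deviation from the
  Fourier coefficients. Bessel's inequality and the best approximation property are both read off
  from it.\<close>

lemma nsq_diff_sum:
  assumes f: "f \<in> L2 M" and F: "finite F" "F \<subseteq> L2 M" "orthonormal_in M F"
  shows "nsq M (\<lambda>x. f x - (\<Sum>s\<in>F. d s * s x))
    = nsq M f - (\<Sum>s\<in>F. (cmod (L2_inner M f s))\<^sup>2) + (\<Sum>s\<in>F. (cmod (L2_inner M f s - d s))\<^sup>2)"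
  using F
proof (induction F rule: finite_induct)
  case empty
  show ?case by simp
next
  case (insert s F)
  let ?r = "\<lambda>x. f x - 1 * (\<Sum>s\<in>F. d s * s x)"
  have F: "F \<subseteq> L2 M" "orthonormal_in M F" and s: "s \<in> L2 M" "nsq M s = 1"
    using insert.prems nsq_orthonormal[OF insert.prems(2)] by (auto simp: orthonormal_in_def)
  have Fs: "(\<lambda>x. \<Sum>s\<in>F. d s * s x) \<in> L2 M" using F by (intro L2_sum L2_cmult) auto
  have r: "?r \<in> L2 M" by (intro L2_diff L2_cmult Fs f)
  have z: "L2_inner M (\<lambda>x. \<Sum>s\<in>F. d s * s x) s = 0"
    using F insert by (subst L2_inner_sum_left) (auto simp: orthonormal_in_def intro!: sum.neutral)
  have rs: "L2_inner M ?r s = L2_inner M f s"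
    by (subst L2_inner_diff_left[OF f Fs s(1)]) (simp add: z)
  have "(\<lambda>x. f x - (\<Sum>s\<in>insert s F. d s * s x)) = (\<lambda>x. ?r x - d s * s x)"
    using insert.hyps by (simp add: algebra_simps)
  then show ?case
    using nsq_diff_cmult[OF r s, of "d s"] insert.IH[OF F] insert.hyps unfolding rs by simp
qed

text \<open>Elements of \<open>H\<close> are genuine functions, so point evaluation makes sense.
  Closedness enters through \<open>projection\<close>: pairing with the kernel sends every L2
  function to an element of \<open>H\<close>, hence also an L2 limit of elements.\<close>

locale rkhs =
  fixes M :: "'a measure" and H :: "('a \<Rightarrow> complex) set" and k :: "'a \<Rightarrow> 'a \<Rightarrow> complex"
  assumes H_L2: "H \<subseteq> L2 M"
    and k_H: "k z \<in> H"
    and H_diff: "f \<in> H \<Longrightarrow> g \<in> H \<Longrightarrow> (\<lambda>x. f x - c * g x) \<in> H"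
    and reproducing: "f \<in> H \<Longrightarrow> f z = L2_inner M f (k z)"
    and projection: "F \<in> L2 M \<Longrightarrow> (\<lambda>z. L2_inner M F (k z)) \<in> H"
begin

definition onb :: "('a \<Rightarrow> complex) set \<Rightarrow> bool" where
  "onb B \<longleftrightarrow> B \<subseteq> H \<and> orthonormal_in M B \<and>
     (\<forall>f\<in>H. \<forall>e>0. \<exists>F c. finite F \<and> F \<subseteq> B \<and> nsq M (\<lambda>x. f x - (\<Sum>s\<in>F. c s * s x)) < e)"

lemma zero_H: "(\<lambda>x. 0) \<in> H"
  using H_diff[OF k_H k_H, of undefined 1 undefined] by simp

lemma cmult_H: "f \<in> H \<Longrightarrow> (\<lambda>x. c * f x) \<in> H"
  using H_diff[OF zero_H, of f "- c"] by simp

lemma sum_H: "finite F \<Longrightarrow> F \<subseteq> H \<Longrightarrow> (\<lambda>x. \<Sum>s\<in>F. c s * s x) \<in> H"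
proof (induction F rule: finite_induct)
  case empty
  show ?case by (simp add: zero_H)
next
  case (insert s F)
  then show ?case using H_diff[of "\<lambda>x. \<Sum>s\<in>F. c s * s x" s "- c s"] by (simp add: add.commute)
qed

lemma evaluation_bound: "f \<in> H \<Longrightarrow> (cmod (f z))\<^sup>2 \<le> nsq M f * nsq M (k z)"
  using L2_inner_Cauchy_Schwarz[of f M "k z"] reproducing[of f z] H_L2 k_H[of z] by auto

text \<open>The basis coefficients of \<open>k w\<close> are conj (s w) by the reproducing property.
  Convergence in norm becomes convergence at z because evaluation is bounded on \<open>H\<close>.
  The sum is thus \<open>k w z\<close> for every orthonormal basis.\<close>

lemma onb_has_sum:
  assumes B: "onb B"
  shows "((\<lambda>s. s z * cnj (s w)) has_sum k w z) B"
proof -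
  have BH: "B \<subseteq> H" and on: "orthonormal_in M B" using B by (auto simp: onb_def)
  have kL: "k w \<in> L2 M" using H_L2 k_H by auto
  have inner: "L2_inner M (k w) s = cnj (s w)" if "s \<in> B" for s
    using reproducing[of s w] BH that L2_inner_commute[of M "k w" s] by auto
  show ?thesis
    unfolding has_sum_def tendsto_iff eventually_finite_subsets_at_top
  proof (intro allI impI)
    fix e :: real assume e: "e > 0"
    \<comment> \<open>The tolerance in squared norm that makes the value at z smaller than e; the +
      1 avoids division by zero.\<close>
    define e' where "e' = e\<^sup>2 / (nsq M (k z) + 1)"
    have e': "e' > 0" using e nsq_nonneg[of M "k z"] by (simp add: e'_def add_nonneg_pos)
    obtain F c where F: "finite F" "F \<subseteq> B" "nsq M (\<lambda>x. k w x - (\<Sum>s\<in>F. c s * s x)) < e'"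
      using B k_H e' unfolding onb_def by meson
    show "\<exists>X. finite X \<and> X \<subseteq> B \<and> (\<forall>Y. finite Y \<and> X \<subseteq> Y \<and> Y \<subseteq> B \<longrightarrow> dist (\<Sum>s\<in>Y. s z * cnj (s w)) (k w z) < e)"
    proof (intro exI[of _ F] conjI allI impI F)
      fix Y assume Y: "finite Y \<and> F \<subseteq> Y \<and> Y \<subseteq> B"
      let ?r = "\<lambda>x. k w x - 1 * (\<Sum>s\<in>Y. cnj (s w) * s x)"
      have YF: "Y \<subseteq> L2 M" "orthonormal_in M Y" "F \<subseteq> L2 M" "orthonormal_in M F"
        using Y F BH H_L2 orthonormal_in_subset[OF on] by auto
      have z: "(\<Sum>s\<in>Y. (cmod (L2_inner M (k w) s - cnj (s w)))\<^sup>2) = 0"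
        using Y inner by (intro sum.neutral) auto
      have "nsq M ?r = nsq M (k w) - (\<Sum>s\<in>Y. (cmod (L2_inner M (k w) s))\<^sup>2)"
        using nsq_diff_sum[OF kL _ YF(1,2), of "\<lambda>s. cnj (s w)"] Y z by simp
      \<comment> \<open>A larger set with Fourier coefficients approximates at least as well as F
        with any coefficients, so closeness persists along the net of finite sets.\<close>
      also have "\<dots> \<le> nsq M (k w) - (\<Sum>s\<in>F. (cmod (L2_inner M (k w) s))\<^sup>2)"
        using Y by (intro diff_left_mono sum_mono2) auto
      also have "\<dots> \<le> nsq M (\<lambda>x. k w x - (\<Sum>s\<in>F. c s * s x))"
        using nsq_diff_sum[OF kL F(1) YF(3,4), of c] by (simp add: sum_nonneg)
      finally have r: "nsq M ?r < e'" using F(3) by linarith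
      have "?r \<in> H" using Y BH by (intro H_diff sum_H k_H) auto
      then have "(cmod (?r z))\<^sup>2 \<le> nsq M ?r * nsq M (k z)" by (rule evaluation_bound)
      also have "\<dots> \<le> nsq M ?r * (nsq M (k z) + 1)" by (intro mult_left_mono) auto
      also have "\<dots> < e' * (nsq M (k z) + 1)" using r by (intro mult_strict_right_mono add_nonneg_pos) auto
      also have "\<dots> = e\<^sup>2" using nsq_nonneg[of M "k z"] by (simp add: e'_def add_nonneg_eq_0_iff)
      finally have "cmod (?r z) < e" using e by (intro power_less_imp_less_base[of _ 2 e]) auto
      then show "dist (\<Sum>s\<in>Y. s z * cnj (s w)) (k w z) < e"
        by (simp add: dist_norm norm_minus_commute mult.commute)
    qed
  qed
qed

text \<open>The Fourier sums of \<open>f\<close> along finite sets that nearly exhaust the Bessel sum form a Cauchy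
  sequence, and \<open>f\<close> minus its limit is orthogonal to \<open>B\<close>, hence zero by maximality.\<close>

lemma maximal_orthonormal_complete:
  assumes BH: "B \<subseteq> H" and on: "orthonormal_in M B"
    and max: "\<And>B'. B' \<subseteq> H \<Longrightarrow> orthonormal_in M B' \<Longrightarrow> B \<subseteq> B' \<Longrightarrow> B' = B"
    and f: "f \<in> H" and e: "e > 0"
  shows "\<exists>F c. finite F \<and> F \<subseteq> B \<and> nsq M (\<lambda>x. f x - (\<Sum>s\<in>F. c s * s x)) < e"
proof -
  have fL: "f \<in> L2 M" and BL: "B \<subseteq> L2 M" using f BH H_L2 by auto
  have onF: "F \<subseteq> L2 M" "orthonormal_in M F" if "F \<subseteq> B" for F
    using that BL orthonormal_in_subset[OF on] by auto
  let ?c = "L2_inner M f"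
  define N where "N F = (\<Sum>s\<in>F. (cmod (?c s))\<^sup>2)" for F
  define p where "p F x = (\<Sum>s\<in>F. ?c s * s x)" for F x
  have pH: "p F \<in> H" if "finite F" "F \<subseteq> B" for F
    unfolding p_def[abs_def] using that BH by (intro sum_H) auto
  have nsq_p: "nsq M (\<lambda>x. f x - p F x) = nsq M f - N F" if "finite F" "F \<subseteq> B" for F
    unfolding p_def N_def using nsq_diff_sum[OF fL that(1) onF[OF that(2)], of ?c] by simp
  \<comment> \<open>The basis may be of any cardinality; the supremum of the Bessel sums extracts a
    sequence of finite sets that captures all of \<open>f\<close>.\<close>
  define S where "S = Sup (N ` {F. finite F \<and> F \<subseteq> B})"
  have bdd: "bdd_above (N ` {F. finite F \<and> F \<subseteq> B})"
  proof (rule bdd_aboveI2)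
    fix F assume "F \<in> {F. finite F \<and> F \<subseteq> B}"
    then show "N F \<le> nsq M f" using nsq_p[of F] nsq_nonneg[of M "\<lambda>x. f x - p F x"] by simp
  qed
  have NS: "N F \<le> S" if "finite F" "F \<subseteq> B" for F
    unfolding S_def using that by (intro cSUP_upper bdd) auto
  have "\<exists>F. finite F \<and> F \<subseteq> B \<and> N F > S - 1 / real (Suc m)" for m
  proof -
    have "S - 1 / real (Suc m) < S" by simp
    moreover have "{F. finite F \<and> F \<subseteq> B} \<noteq> {}" by blast
    ultimately have "\<exists>F\<in>{F. finite F \<and> F \<subseteq> B}. S - 1 / real (Suc m) < N F"
      using less_cSUP_iff[OF _ bdd, of "S - 1 / real (Suc m)"] unfolding S_def[symmetric] by blast
    then show ?thesis by blast
  qed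
  then obtain F where F: "\<And>m. finite (F m)" "\<And>m. F m \<subseteq> B" "\<And>m. N (F m) > S - 1 / real (Suc m)" by metis
  \<comment> \<open>Unions make the sets increasing, so a difference of Fourier sums is again a
    Fourier sum with squared norm N (G n) - N (G m).\<close>
  define G where "G m = (\<Union>i\<le>m. F i)" for m
  have G: "finite (G m)" "G m \<subseteq> B" for m unfolding G_def using F by auto
  have Gmono: "G m \<subseteq> G n" if "m \<le> n" for m n unfolding G_def using that by (intro UN_mono) auto
  have GN: "S - 1 / real (Suc m) < N (G m)" for m
  proof -
    have "N (F m) \<le> N (G m)" unfolding N_def using G by (intro sum_mono2) (auto simp: G_def)
    then show ?thesis using F(3)[of m] by linarith
  qed
  have pL: "p (G m) \<in> L2 M" for m using pH[OF G, of m] H_L2 by auto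
  have diff: "nsq M (\<lambda>x. p (G n) x - p (G m) x) \<le> 1 / real (Suc m)" if "m \<le> n" for m n
  proof -
    let ?D = "G n - G m"
    have D: "finite ?D" "?D \<subseteq> B" using G by auto
    have "p (G n) x - p (G m) x = p ?D x" for x
      unfolding p_def using sum_diff[OF G(1)[of n] Gmono[OF that], of "\<lambda>s. ?c s * s x"] by simp
    then have "nsq M (\<lambda>x. p (G n) x - p (G m) x) = nsq M (\<lambda>x. 0 - p ?D x)"
      by (simp add: nsq_def)
    also have "\<dots> = nsq M (\<lambda>x. 0 - (\<Sum>s\<in>?D. ?c s * s x))" by (simp add: p_def)
    also have "\<dots> = N ?D"
      by (subst nsq_diff_sum[OF L2_zero D(1) onF[OF D(2)]]) (simp add: N_def L2_inner_def nsq_def)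
    also have "\<dots> = N (G n) - N (G m)"
      unfolding N_def by (rule sum_diff[OF G(1) Gmono[OF that]])
    also have "\<dots> \<le> 1 / real (Suc m)" using NS[OF G, of n] GN[of m] by linarith
    finally show ?thesis .
  qed
  have Cauchy: "\<exists>K. \<forall>m\<ge>K. \<forall>n\<ge>K. nsq M (\<lambda>x. p (G m) x - p (G n) x) \<le> \<epsilon>" if "\<epsilon> > 0" for \<epsilon>
  proof -
    obtain K where K: "1 / real (Suc K) < \<epsilon>" using nat_approx_posE[OF \<open>\<epsilon> > 0\<close>] by auto
    have "nsq M (\<lambda>x. p (G m) x - p (G n) x) \<le> \<epsilon>" if "m \<ge> K" "n \<ge> K" for m n
    proof -
      have "nsq M (\<lambda>x. p (G m) x - p (G n) x) \<le> 1 / real (Suc (min m n))"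
        using diff[of n m] diff[of m n] by (cases "m \<le> n") (simp_all add: min_def nsq_commute[of M "p (G m)"])
      also have "\<dots> \<le> 1 / real (Suc K)" using that by (intro divide_left_mono) auto
      finally show ?thesis using K by linarith
    qed
    then show ?thesis by blast
  qed
  obtain P where P: "P \<in> L2 M" "L2_tendsto M (\<lambda>m. p (G m)) P" using L2_complete[OF pL Cauchy] by blast
  \<comment> \<open>\<open>P\<close> is a limit only up to null sets. Its projection
    \<open>g\<close> lies in \<open>H\<close> and is the pointwise limit of the Fourier sums, so it
    is an L2 limit as well.\<close>
  define g where "g z = L2_inner M P (k z)" for z
  have gH: "g \<in> H" unfolding g_def[abs_def] by (rule projection[OF P(1)])
  then have gL: "g \<in> L2 M" using H_L2 by auto
  have lim: "(\<lambda>m. p (G m) z) \<longlonglongrightarrow> g z" for z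
  proof -
    have "k z \<in> L2 M" using k_H H_L2 by auto
    then have "(\<lambda>m. L2_inner M (p (G m)) (k z)) \<longlonglongrightarrow> L2_inner M P (k z)"
      unfolding L2_inner_def by (intro L2_tendsto_integral_mult pL P L2_tendsto_const L2_cnj)
    then show ?thesis using reproducing[OF pH[OF G]] by (simp add: g_def)
  qed
  have tg: "L2_tendsto M (\<lambda>m. p (G m)) g"
    by (rule L2_tendsto_of_pointwise[OF pL L2_measurable[OF gL] Cauchy AE_I2[OF lim]])
  define h where "h x = f x - 1 * g x" for x
  have hH: "h \<in> H" unfolding h_def[abs_def] by (intro H_diff f gH)
  then have hL: "h \<in> L2 M" using H_L2 by auto
  have orth: "L2_inner M h s = 0" if s: "s \<in> B" for s
  proof -
    have sL: "s \<in> L2 M" using s BL by auto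
    \<comment> \<open>For s in \<open>G m\<close> the pairing is zero. Otherwise adding s to
      \<open>G m\<close> cannot push the Bessel sum beyond \<open>S\<close>, of which
      \<open>G m\<close> already captures all but 1 / (m + 1).\<close>
    have "(cmod (L2_inner M (\<lambda>x. f x - 1 * p (G m) x) s))\<^sup>2 \<le> 1 / real (Suc m)" for m
    proof -
      have ps: "L2_inner M (p (G m)) s = (\<Sum>s'\<in>G m. ?c s' * L2_inner M s' s)"
        unfolding p_def[abs_def] using G BL sL by (intro L2_inner_sum_left) auto
      also have "\<dots> = (\<Sum>s'\<in>G m. if s' = s then ?c s' else 0)"
      proof (intro sum.cong refl)
        fix s' assume "s' \<in> G m"
        then have "L2_inner M s' s = (if s' = s then 1 else 0)"
          using G(2)[of m] s on unfolding orthonormal_in_def by blast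
        then show "?c s' * L2_inner M s' s = (if s' = s then ?c s' else 0)" by simp
      qed
      also have "\<dots> = (if s \<in> G m then ?c s else 0)" using G by simp
      finally have "L2_inner M (\<lambda>x. f x - 1 * p (G m) x) s = (if s \<in> G m then 0 else ?c s)"
        by (subst L2_inner_diff_left[OF fL pL sL]) simp
      moreover have "(cmod (?c s))\<^sup>2 \<le> 1 / real (Suc m)" if "s \<notin> G m"
      proof -
        have "N (insert s (G m)) = (cmod (?c s))\<^sup>2 + N (G m)" unfolding N_def using that G by simp
        then show ?thesis using NS[of "insert s (G m)"] G s GN[of m] by simp
      qed
      ultimately show ?thesis by simp
    qed
    moreover have "L2_inner M (\<lambda>x. f x - 1 * p (G m) x) s = ?c s - L2_inner M (p (G m)) s" for m
      by (subst L2_inner_diff_left[OF fL pL sL]) simp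
    ultimately have le: "(cmod (?c s - L2_inner M (p (G m)) s))\<^sup>2 \<le> 1 / real (Suc m)" for m
      by simp
    have "(\<lambda>m. L2_inner M (p (G m)) s) \<longlonglongrightarrow> L2_inner M g s"
      unfolding L2_inner_def by (intro L2_tendsto_integral_mult pL gL tg L2_tendsto_const L2_cnj sL)
    then have l: "(\<lambda>m. (cmod (?c s - L2_inner M (p (G m)) s))\<^sup>2) \<longlonglongrightarrow> (cmod (?c s - L2_inner M g s))\<^sup>2"
      by (intro tendsto_intros)
    have "(\<lambda>m. 1 / real (Suc m)) \<longlonglongrightarrow> 0"
      using LIMSEQ_Suc[OF lim_1_over_n] by simp
    then have "(cmod (?c s - L2_inner M g s))\<^sup>2 \<le> 0"
      by (rule LIMSEQ_le[OF l]) (use le in auto)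
    moreover have "L2_inner M h s = ?c s - L2_inner M g s"
      unfolding h_def[abs_def] by (subst L2_inner_diff_left[OF fL gL sL]) simp
    ultimately show ?thesis by simp
  qed
  \<comment> \<open>Otherwise the normalised \<open>h\<close> could be adjoined to \<open>B\<close>.
    It is not already in \<open>B\<close>, because it is orthogonal to \<open>B\<close> and has norm
    1.\<close>
  have "nsq M h = 0"
  proof (rule ccontr)
    assume "nsq M h \<noteq> 0"
    then have pos: "nsq M h > 0" using nsq_nonneg[of M h] by linarith
    define r where "r = complex_of_real (1 / sqrt (nsq M h))"
    let ?q = "\<lambda>x. r * h x"
    have qH: "?q \<in> H" by (rule cmult_H[OF hH])
    have qL: "?q \<in> L2 M" using qH H_L2 by auto
    have qq: "L2_inner M ?q ?q = 1"
      unfolding L2_inner_self nsq_cmult using pos by (simp add: r_def norm_divide power_divide)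
    have qs: "L2_inner M ?q s = 0" "L2_inner M s ?q = 0" if "s \<in> B" for s
    proof -
      show "L2_inner M ?q s = 0"
        using orth[OF that] by (simp add: L2_inner_def mult.assoc)
      then show "L2_inner M s ?q = 0" by (subst L2_inner_commute) simp
    qed
    have "orthonormal_in M (insert ?q B)"
      unfolding orthonormal_in_def
    proof (intro ballI)
      fix s s' assume s: "s \<in> insert ?q B" "s' \<in> insert ?q B"
      show "L2_inner M s s' = (if s = s' then 1 else 0)"
      proof (cases "s \<in> B \<and> s' \<in> B")
        case True
        then show ?thesis using on by (auto simp: orthonormal_in_def)
      next
        case False
        moreover have "?q \<notin> B" using qs(1)[of ?q] qq by auto
        ultimately show ?thesis using s qq qs by auto
      qed
    qed
    then have "insert ?q B = B" using max[of "insert ?q B"] qH BH by auto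
    then have "?q \<in> B" by blast
    then show False using qs(1)[of ?q] qq by simp
  qed
  have "(\<lambda>m. nsq M (\<lambda>x. f x - p (G m) x)) \<longlonglongrightarrow> nsq M h"
  proof (rule L2_tendsto_nsq[OF _ hL])
    show "(\<lambda>x. f x - p (G m) x) \<in> L2 M" for m by (intro L2_diff fL pL)
    show "L2_tendsto M (\<lambda>m x. f x - p (G m) x) h"
      using tg by (simp add: L2_tendsto_def h_def[abs_def] norm_minus_commute)
  qed
  then have "\<forall>\<^sub>F m in sequentially. nsq M (\<lambda>x. f x - p (G m) x) < e"
    using e \<open>nsq M h = 0\<close> by (intro order_tendstoD) auto
  then obtain m where "nsq M (\<lambda>x. f x - p (G m) x) < e"
    by (meson eventually_sequentially order_refl)
  then show ?thesis using G[of m] unfolding p_def by blast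
qed

text \<open>The choice operator in \<open>bergman_kernel\<close> yields a basis only if some basis
  exists. Zorn's lemma provides a maximal orthonormal set, and maximality gives density.\<close>

lemma onb_exists: "\<exists>B. onb B"
proof -
  let ?A = "{B. B \<subseteq> H \<and> orthonormal_in M B}"
  have "\<exists>B\<in>?A. \<forall>B'\<in>?A. B \<subseteq> B' \<longrightarrow> B' = B"
  proof (rule subset_Zorn')
    fix C assume C: "subset.chain ?A C"
    have "orthonormal_in M (\<Union>C)"
      unfolding orthonormal_in_def
    proof (intro ballI)
      fix s s' assume "s \<in> \<Union>C" "s' \<in> \<Union>C"
      then obtain X X' where X: "s \<in> X" "X \<in> C" "s' \<in> X'" "X' \<in> C" by blast
      then have "X \<subseteq> X' \<or> X' \<subseteq> X" using C by (auto simp: subset_chain_def)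
      then obtain Y where "Y \<in> C" "s \<in> Y" "s' \<in> Y" using X by blast
      moreover have "orthonormal_in M Y" using C \<open>Y \<in> C\<close> by (auto simp: subset_chain_def)
      ultimately show "L2_inner M s s' = (if s = s' then 1 else 0)" by (simp add: orthonormal_in_def)
    qed
    then show "\<Union>C \<in> ?A" using C by (auto simp: subset_chain_def)
  qed
  then obtain B where "B \<subseteq> H" "orthonormal_in M B"
    and "\<And>B'. B' \<subseteq> H \<Longrightarrow> orthonormal_in M B' \<Longrightarrow> B \<subseteq> B' \<Longrightarrow> B' = B" by auto
  then have "onb B"
    unfolding onb_def by (intro conjI ballI allI impI maximal_orthonormal_complete)
  then show ?thesis ..
qed

end

section \<open>Identification of the Bergman kernel\<close>

context positive_weights
begin

lemma Pop_idem:
  assumes "t \<noteq> 0" "\<phi> \<in> L2 mu"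
  shows "\<exists>f\<in>bergman_space (\<lambda>z. t * psi lam z). Pop t \<phi> = wt t f"
proof -
  obtain f where f: "holomorphic_Cn f" "\<And>z. Pop t \<phi> z = f z * complex_of_real (exp (- t * psi lam z))"
    using Pop_holomorphic[OF assms(2)] by blast
  then have "Pop t \<phi> = wt t f" by (simp add: wt_def fun_eq_iff)
  then show ?thesis using f Pop_L2[OF assms(2), of t] by (auto simp: bergman_space_iff)
qed

lemma bergman_reproducing':
  assumes "t \<noteq> 0" "f \<in> bergman_space (\<lambda>z. t * psi lam z)"
  shows "wt t f z = Pop t (wt t f) z"
proof (cases "t > 0")
  case True
  then show ?thesis by (rule bergman_reproducing[OF _ assms(2)])
next
  case False
  then have "f z = 0" using assms bergman_trivial[of t f] by simp
  then show ?thesis using False by (simp add: wt_def Pop_def Pker_def)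
qed

lemma L2_inner_Pker: "L2_inner mu f (\<lambda>w. Pker t w z) = Pop t f z"
  by (simp add: L2_inner_def Pop_def Pker_cnj mult.commute)

lemma Pker_L2': "(\<lambda>w. Pker t w z) \<in> L2 mu"
  using L2_cnj[OF Pker_L2[of t z]] by (simp add: Pker_cnj)

text \<open>With k = Pker t (.) z and F = k - P k, symmetry and reproduction of P F give that the
  pairings of F with P k and with k both equal P F at z. Hence F is orthogonal to itself; continuity
  upgrades equality almost everywhere to equality.\<close>

lemma Pker_in_range:
  assumes t: "t \<noteq> 0"
  shows "Pop t (\<lambda>w. Pker t w z) = (\<lambda>w. Pker t w z)"
proof -
  let ?k = "\<lambda>w. Pker t w z"
  let ?P = "Pop t ?k"
  have k: "?k \<in> L2 mu" by (rule Pker_L2')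
  have P: "?P \<in> L2 mu" by (rule Pop_L2[OF k])
  define F where "F w = ?k w - 1 * ?P w" for w
  have F: "F \<in> L2 mu" unfolding F_def[abs_def] by (intro L2_diff L2_cmult k P)
  obtain f where f: "f \<in> bergman_space (\<lambda>z. t * psi lam z)" "Pop t F = wt t f" using Pop_idem[OF t F] by blast
  have PP: "Pop t (Pop t F) z = Pop t F z" using bergman_reproducing'[OF t f(1)] f(2) by simp
  have "L2_inner mu F ?P = L2_inner mu (Pop t F) ?k"
    unfolding L2_inner_def by (rule Pop_symmetric[OF F k, symmetric])
  then have "L2_inner mu F ?P = L2_inner mu F ?k"
    unfolding L2_inner_Pker PP .
  then have "L2_inner mu ?k F - 1 * L2_inner mu ?P F = 0"
    by (simp add: L2_inner_commute[of mu _ F])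
  then have "L2_inner mu F F = 0"
    using L2_inner_diff_left[OF k P F, of 1] by (simp add: F_def[abs_def])
  then have "nsq mu F = 0" by (simp add: L2_inner_self)
  then have "AE w in mu. F w = 0" by (rule nsq_eq_0[OF F])
  then have ae: "AE w in mu. ?k w = ?P w" by (simp add: F_def)
  have ck: "continuous_on UNIV ?k"
  proof (cases "t > 0")
    case True
    then show ?thesis
      unfolding Pker_def cis_conv_exp using gauss_integral_pos by (simp, intro continuous_intros) auto
  qed (simp add: Pker_def)
  show ?thesis by (rule ext) (rule AE_eq_imp_eq[OF ae ck Pop_continuous[OF k], symmetric])
qed

lemma bergman_rkhs:
  assumes t: "t \<noteq> 0"
  shows "rkhs mu (wt t ` bergman_space (\<lambda>z. t * psi lam z)) (\<lambda>z w. Pker t w z)"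
proof
  let ?H = "wt t ` bergman_space (\<lambda>z. t * psi lam z)"
  show "?H \<subseteq> L2 mu" by (auto simp: bergman_space_iff)
  show "(\<lambda>w. Pker t w z) \<in> ?H" for z
    using Pop_idem[OF t Pker_L2'[of t z]] by (auto simp: Pker_in_range[OF t])
  show "f z = L2_inner mu f (\<lambda>w. Pker t w z)" if "f \<in> ?H" for f z
    using that bergman_reproducing'[OF t] by (auto simp: L2_inner_Pker)
  show *: "(\<lambda>z. L2_inner mu F (\<lambda>w. Pker t w z)) \<in> ?H" if "F \<in> L2 mu" for F
    using Pop_idem[OF t that] by (auto simp: L2_inner_Pker)
  show "(\<lambda>x. f x - c * g x) \<in> ?H" if "f \<in> ?H" "g \<in> ?H" for f g c
  proof -
    \<comment> \<open>Linearity is taken from the projection: a combination of reproduced functions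
      is reproduced, hence lies in its range.\<close>
    have L: "f \<in> L2 mu" "g \<in> L2 mu" using that by (auto simp: bergman_space_iff)
    then have "(\<lambda>z. L2_inner mu (\<lambda>x. f x - c * g x) (\<lambda>w. Pker t w z)) = (\<lambda>x. f x - c * g x)"
      using that bergman_reproducing'[OF t]
      by (subst L2_inner_diff_left[OF _ _ Pker_L2']) (auto simp: L2_inner_Pker fun_eq_iff)
    then show ?thesis using *[OF L2_diff[OF L(1) L2_cmult[OF L(2)]], of c] by simp
  qed
qed

lemma bergman_inner_wt: "bergman_inner (\<lambda>z. t * psi lam z) f g = L2_inner mu (wt t f) (wt t g)"
  unfolding bergman_inner_def L2_inner_def
  by (intro Bochner_Integration.integral_cong refl)
    (simp add: wt_def exp_double[of "- (t * psi lam _)", simplified] power2_eq_square)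

lemma wt_inj: "inj (wt t)"
  by (auto simp: inj_def wt_def fun_eq_iff)

lemma bergman_onb_wt:
  assumes t: "t \<noteq> 0" and B: "B \<subseteq> bergman_space (\<lambda>z. t * psi lam z)"
  shows "bergman_onb (\<lambda>z. t * psi lam z) B \<longleftrightarrow> rkhs.onb mu (wt t ` bergman_space (\<lambda>z. t * psi lam z)) (wt t ` B)"
proof -
  interpret rkhs mu "wt t ` bergman_space (\<lambda>z. t * psi lam z)" "\<lambda>z w. Pker t w z" by (rule bergman_rkhs[OF t])
  have eq: "wt t s = wt t s' \<longleftrightarrow> s = s'" for s s' using wt_inj by (auto simp: inj_def)
  have sum: "nsq mu (\<lambda>z. wt t f z - (\<Sum>s\<in>wt t ` F. c s * s z))
     = (LINT z|mu. (cmod (f z - (\<Sum>s\<in>F. c (wt t s) * s z)))\<^sup>2 * exp (- 2 * (t * psi lam z)))" for f F c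
  proof -
    have "wt t f z - (\<Sum>s\<in>wt t ` F. c s * s z) = wt t (\<lambda>z. f z - (\<Sum>s\<in>F. c (wt t s) * s z)) z" for z
      by (subst sum.reindex[OF inj_on_subset[OF wt_inj subset_UNIV]])
        (simp add: wt_def left_diff_distrib sum_distrib_right mult.assoc)
    then show ?thesis by (simp only: nsq_def cmod_wt_sq)
  qed
  have dense: "(\<exists>F c. finite F \<and> F \<subseteq> B \<and>
        (LINT z|mu. (cmod (f z - (\<Sum>s\<in>F. c s * s z)))\<^sup>2 * exp (- 2 * (t * psi lam z))) < e)
     \<longleftrightarrow> (\<exists>F c. finite F \<and> F \<subseteq> wt t ` B \<and> nsq mu (\<lambda>z. wt t f z - (\<Sum>s\<in>F. c s * s z)) < e)" for f e
  proof (intro iffI; elim exE conjE)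
    fix F c assume F: "finite F" "F \<subseteq> B" "(LINT z|mu. (cmod (f z - (\<Sum>s\<in>F. c s * s z)))\<^sup>2 * exp (- 2 * (t * psi lam z))) < e"
    \<comment> \<open>Coefficients are indexed by the functions themselves, so they are transported
      along the injection \<open>wt t\<close>.\<close>
    have "c (inv (wt t) (wt t s)) = c s" for s by (simp add: inv_f_f[OF wt_inj])
    then show "\<exists>F c. finite F \<and> F \<subseteq> wt t ` B \<and> nsq mu (\<lambda>z. wt t f z - (\<Sum>s\<in>F. c s * s z)) < e"
      using F by (intro exI[of _ "wt t ` F"] exI[of _ "\<lambda>s. c (inv (wt t) s)"]) (auto simp only: sum finite_imageI)
  next
    fix F c assume F: "finite F" "F \<subseteq> wt t ` B" "nsq mu (\<lambda>z. wt t f z - (\<Sum>s\<in>F. c s * s z)) < e"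
    then obtain F' where F': "F' \<subseteq> B" "finite F'" "F = wt t ` F'" by (meson finite_subset_image)
    with F(3) show "\<exists>F c. finite F \<and> F \<subseteq> B \<and>
        (LINT z|mu. (cmod (f z - (\<Sum>s\<in>F. c s * s z)))\<^sup>2 * exp (- 2 * (t * psi lam z))) < e"
      unfolding F'(3) sum by (intro exI[of _ F'] exI[of _ "\<lambda>s. c (wt t s)"]) auto
  qed
  have image: "(\<forall>h\<in>wt t ` A. Q h) \<longleftrightarrow> (\<forall>h\<in>A. Q (wt t h))" for A Q by blast
  show ?thesis
    unfolding bergman_onb_def onb_def dense orthonormal_in_def bergman_inner_wt
    using B image_mono[OF B, of "wt t"] by (simp only: image eq simp_thms)
qed

text \<open>The chosen set is a genuine basis once one exists, and \<open>onb_has_sum\<close>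
  evaluates the kernel sum for it. Multiplying each basis function by its weight accounts for the
  exponential prefactor.\<close>

lemma bergman_t_eq:
  assumes t: "t \<noteq> 0"
  shows "bergman_t lam t z w = Pker t z w"
proof -
  let ?A = "bergman_space (\<lambda>z. t * psi lam z)"
  interpret rkhs mu "wt t ` ?A" "\<lambda>z w. Pker t w z" by (rule bergman_rkhs[OF t])
  obtain C where C: "onb C" using onb_exists by blast
  then have "C \<subseteq> wt t ` ?A" by (simp add: onb_def)
  then obtain B where "B \<subseteq> ?A" "C = wt t ` B" by (meson subset_imageE)
  then have "bergman_onb (\<lambda>z. t * psi lam z) B" using C bergman_onb_wt[OF t] by simp
  define B' where "B' = (SOME B. bergman_onb (\<lambda>z. t * psi lam z) B)"
  have B': "bergman_onb (\<lambda>z. t * psi lam z) B'"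
    unfolding B'_def by (rule someI) fact
  then have "onb (wt t ` B')" using bergman_onb_wt[OF t, of B'] by (simp add: bergman_onb_def)
  then have "((\<lambda>s. s z * cnj (s w)) has_sum Pker t z w) (wt t ` B')" by (rule onb_has_sum)
  then have "((\<lambda>s. wt t s z * cnj (wt t s w)) has_sum Pker t z w) B'"
    by (subst (asm) has_sum_reindex[OF inj_on_subset[OF wt_inj subset_UNIV]]) (simp add: o_def)
  then have "((\<lambda>s. complex_of_real (exp (- (t * psi lam z + t * psi lam w))) * (s z * cnj (s w))) has_sum Pker t z w) B'"
  proof (rule has_sum_cong[THEN iffD1, rotated])
    have "exp (- (t * psi lam z + t * psi lam w)) = exp (- t * psi lam z) * exp (- t * psi lam w)"
      by (simp flip: exp_add)
    then show "wt t s z * cnj (wt t s w) = complex_of_real (exp (- (t * psi lam z + t * psi lam w))) * (s z * cnj (s w))" for s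
      by (simp add: wt_def)
  qed
  then have "Pker t z w = (\<Sum>\<^sub>\<infinity>s\<in>B'. complex_of_real (exp (- (t * psi lam z + t * psi lam w))) * (s z * cnj (s w)))"
    by (rule infsumI[symmetric])
  also have "\<dots> = bergman_t lam t z w"
    unfolding bergman_kernel_def B'_def[symmetric] by (rule infsum_cmult_right') 
  finally show ?thesis by simp
qed

end

section \<open>The Szego projection\<close>

lemma integral_heis_slices_cong:
  fixes f g :: "('n::finite) heis \<Rightarrow> complex"
  assumes f: "integrable mu_heis f" "f \<in> borel_measurable borel" and g: "integrable mu_heis g" "g \<in> borel_measurable borel"
    and eq: "AE t in lborel. (LINT z|mu. f (z, t)) = (LINT z|mu. g (z, t))"
  shows "integral\<^sup>L mu_heis f = integral\<^sup>L mu_heis g"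
proof -
  have [measurable]: "f \<in> borel_measurable (borel \<Otimes>\<^sub>M borel)" "g \<in> borel_measurable (borel \<Otimes>\<^sub>M borel)"
    using f g by (simp_all add: borel_prod)
  show ?thesis
    unfolding integral_heis_iterated'[OF f(1)] integral_heis_iterated'[OF g(1)]
    by (rule integral_cong_AE[OF _ _ eq]) measurable
qed

context positive_weights
begin

definition Pop_heis :: "('n heis \<Rightarrow> complex) \<Rightarrow> 'n heis \<Rightarrow> complex" where
  "Pop_heis U x = Pop (snd x) (\<lambda>w. U (w, snd x)) (fst x)"

lemma Pop_heis_measurable:
  assumes "U \<in> borel_measurable borel"
  shows "Pop_heis U \<in> borel_measurable borel"
proof -
  have [measurable]: "U \<in> borel_measurable (borel \<Otimes>\<^sub>M borel)" using assms by (simp add: borel_prod)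
  have "Pop_heis U \<in> borel_measurable (borel \<Otimes>\<^sub>M borel)"
    unfolding Pop_heis_def Pop_def by measurable
  then show ?thesis by (simp add: borel_prod)
qed

text \<open>The Schur bound holds on almost every slice with the constant 4^n, the same for all t,
  so it integrates over t.\<close>

lemma Pop_heis_L2:
  assumes U: "U \<in> L2 mu_heis"
  shows "Pop_heis U \<in> L2 mu_heis"
proof -
  note m = L2_mu_heis_borel[OF U]
  have [measurable]: "U \<in> borel_measurable (borel \<Otimes>\<^sub>M borel)" "Pop_heis U \<in> borel_measurable (borel \<Otimes>\<^sub>M borel)"
    using m Pop_heis_measurable[OF m] by (simp_all add: borel_prod)
  have "(\<integral>\<^sup>+x. ennreal ((cmod (Pop_heis U x))\<^sup>2) \<partial>mu_heis)
      = (\<integral>\<^sup>+t. \<integral>\<^sup>+z. ennreal ((cmod (Pop_heis U (z, t)))\<^sup>2) \<partial>mu \<partial>lborel)"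
    unfolding mu_heis_eq by (subst heis.nn_integral_snd[symmetric]) auto
  also have "\<dots> \<le> (\<integral>\<^sup>+t. ennreal (4 ^ CARD('n)) * (\<integral>\<^sup>+z. ennreal ((cmod (U (z, t)))\<^sup>2) \<partial>mu) \<partial>lborel)"
  proof (rule nn_integral_mono_AE)
    show "AE t in lborel. (\<integral>\<^sup>+z. ennreal ((cmod (Pop_heis U (z, t)))\<^sup>2) \<partial>mu)
        \<le> ennreal (4 ^ CARD('n)) * (\<integral>\<^sup>+z. ennreal ((cmod (U (z, t)))\<^sup>2) \<partial>mu)"
      using L2_slice_AE[OF U] by eventually_elim (simp add: Pop_heis_def Pop_nn_integral_le)
  qed
  also have "\<dots> = ennreal (4 ^ CARD('n)) * (\<integral>\<^sup>+t. \<integral>\<^sup>+z. ennreal ((cmod (U (z, t)))\<^sup>2) \<partial>mu \<partial>lborel)"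
    by (rule nn_integral_cmult) measurable
  also have "(\<integral>\<^sup>+t. \<integral>\<^sup>+z. ennreal ((cmod (U (z, t)))\<^sup>2) \<partial>mu \<partial>lborel) = (\<integral>\<^sup>+x. ennreal ((cmod (U x))\<^sup>2) \<partial>mu_heis)"
    unfolding mu_heis_eq by (subst heis.nn_integral_snd[symmetric]) auto
  also have "ennreal (4 ^ CARD('n)) * \<dots> < \<infinity>"
    using U by (simp add: L2_iff_nn_integral ennreal_mult_less_top)
  finally show ?thesis
    using Pop_heis_measurable[OF m] by (simp add: L2_iff_nn_integral measurable_cong_sets[OF sets_mu_heis refl])
qed

text \<open>For almost every t the frequency is nonzero and the slice is square-integrable. Then the
  kernel is explicit and the inner integral converges absolutely for every z, so the Bochner
  condition reduces to an equality.\<close>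

lemma P_tilde_iff:
  "P_tilde lam u v \<longleftrightarrow> (\<exists>U V W. pft 1 u U \<and> V \<in> L2 mu_heis \<and>
     (AE t in lborel. AE z in mu. V (z, t) = Pop t (\<lambda>w. U (w, t)) z) \<and>
     pft (-1) V W \<and> v = (\<lambda>x. 1 / (2 * complex_of_real pi) * W x))"
proof -
  have "(AE t in lborel. AE z in mu. has_bochner_integral mu (\<lambda>w. bergman_t lam t z w * U (w, t)) (V (z, t)))
      \<longleftrightarrow> (AE t in lborel. AE z in mu. V (z, t) = Pop t (\<lambda>w. U (w, t)) z)"
    if "pft 1 u U" for U V
  proof -
    have "AE t in lborel. (AE z in mu. has_bochner_integral mu (\<lambda>w. bergman_t lam t z w * U (w, t)) (V (z, t)))
      \<longleftrightarrow> (AE z in mu. V (z, t) = Pop t (\<lambda>w. U (w, t)) z)"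
      using L2_slice_AE[OF pft_L2(2)[OF that]] AE_lborel_singleton[of 0]
    proof eventually_elim
      case (elim t)
      then have "has_bochner_integral mu (\<lambda>w. bergman_t lam t z w * U (w, t)) (V (z, t)) \<longleftrightarrow> V (z, t) = Pop t (\<lambda>w. U (w, t)) z" for z
        using Pop_integrable[OF elim(1), of t z] by (auto simp: bergman_t_eq has_bochner_integral_iff Pop_def)
      then show ?case by simp
    qed
    then show ?thesis by (auto elim: eventually_elim2)
  qed
  then show ?thesis unfolding P_tilde_def by blast
qed

lemma P_tilde_exists:
  assumes "u \<in> L2 mu_heis"
  shows "\<exists>v. P_tilde lam u v"
proof -
  obtain U where U: "pft 1 u U" using pft_exists[OF assms, of 1] by auto
  have V: "Pop_heis U \<in> L2 mu_heis" by (rule Pop_heis_L2[OF pft_L2(2)[OF U]])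
  obtain W where W: "pft (-1) (Pop_heis U) W" using pft_exists[OF V, of "-1"] by auto
  have "AE t in lborel. AE z in mu. Pop_heis U (z, t) = Pop t (\<lambda>w. U (w, t)) z"
    by (simp add: Pop_heis_def)
  then show ?thesis using U V W unfolding P_tilde_iff by blast
qed

lemma P_tilde_szego:
  assumes "P_tilde lam u v"
  shows "szego lam u v"
proof -
  obtain U V W where U: "pft 1 u U" and V: "V \<in> L2 mu_heis"
    and VU: "AE t in lborel. AE z in mu. V (z, t) = Pop t (\<lambda>w. U (w, t)) z"
    and W: "pft (-1) V W" and v: "v = (\<lambda>x. 1 / (2 * complex_of_real pi) * W x)"
    using assms unfolding P_tilde_iff by blast
  have UL: "U \<in> L2 mu_heis" and uL: "u \<in> L2 mu_heis" by (rule pft_L2[OF U])+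
  have vk: "v \<in> ker_box_b lam"
    unfolding v
  proof (rule holomorphic_slices_ker[OF V W])
    show "AE t in lborel. \<exists>f. holomorphic_Cn f \<and> (AE z in mu. V (z, t) = f z * complex_of_real (exp (- t * psi lam z)))"
      using VU L2_slice_AE[OF UL]
    proof eventually_elim
      case (elim t)
      obtain f where "holomorphic_Cn f" "\<And>z. Pop t (\<lambda>w. U (w, t)) z = f z * complex_of_real (exp (- t * psi lam z))"
        using Pop_holomorphic[OF elim(2), of t] by blast
      then show ?case using elim(1) by auto
    qed
  qed
  then have vL: "v \<in> L2 mu_heis" by (simp add: ker_box_b_iff)
  have vV: "pft 1 v V"
    using pft_cmult[OF pft_inversion[OF W], of "1 / (2 * complex_of_real pi)"] by (simp add: v)
  have "L2_inner mu_heis (\<lambda>x. u x - v x) h = 0" if h: "h \<in> ker_box_b lam" for h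
  proof -
    have hL: "h \<in> L2 mu_heis" using h by (simp add: ker_box_b_iff)
    obtain H where H: "pft 1 h H" using pft_exists[OF hL, of 1] by auto
    have HL: "H \<in> L2 mu_heis" by (rule pft_L2[OF H])
    note b = L2_mu_heis_borel[OF UL] L2_mu_heis_borel[OF V] L2_mu_heis_borel[OF HL]
    \<comment> \<open>On almost every slice: replace H by P H because H comes from the kernel, move
      P to U by symmetry, and recognise V.\<close>
    have "(LINT x|mu_heis. U x * cnj (H x)) = (LINT x|mu_heis. V x * cnj (H x))"
    proof (rule integral_heis_slices_cong)
      show "AE t in lborel. (LINT z|mu. U (z, t) * cnj (H (z, t))) = (LINT z|mu. V (z, t) * cnj (H (z, t)))"
        using VU L2_slice_AE[OF UL] L2_slice_AE[OF HL] L2_slice_AE[OF V] ker_reproducing[OF h H]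
      proof eventually_elim
        case (elim t)
        note [measurable] = L2_mu_borel[OF elim(2)] L2_mu_borel[OF elim(3)] L2_mu_borel[OF elim(4)]
          L2_mu_borel[OF Pop_L2[OF elim(2), of t]] L2_mu_borel[OF Pop_L2[OF elim(3), of t]]
        have "(LINT z|mu. U (z, t) * cnj (H (z, t))) = (LINT z|mu. U (z, t) * cnj (Pop t (\<lambda>z. H (z, t)) z))"
          by (rule integral_cong_AE) (use elim(5) in \<open>measurable, auto elim: eventually_mono\<close>)
        also have "\<dots> = (LINT z|mu. Pop t (\<lambda>z. U (z, t)) z * cnj (H (z, t)))"
          by (rule Pop_symmetric[OF elim(2,3), symmetric])
        also have "\<dots> = (LINT z|mu. V (z, t) * cnj (H (z, t)))"
          by (rule integral_cong_AE) (use elim(1) in \<open>measurable, auto elim: eventually_mono\<close>)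
        finally show ?case .
      qed
    qed (use b UL V HL in \<open>auto intro!: L2_mult_integrable L2_cnj borel_measurable_times measurable_compose[OF _ borel_measurable_cnj]\<close>)
    then have "L2_inner mu_heis u h = L2_inner mu_heis v h"
      using pft_parseval[OF U H] pft_parseval[OF vV H] by (simp add: L2_inner_def)
    then show ?thesis using L2_inner_diff_left[OF uL vL hL, of 1] by simp
  qed
  then show ?thesis unfolding szego_def using vk uL by blast
qed

lemma szego_unique:
  assumes v: "szego lam u v" and v': "szego lam u v'"
  shows "AE x in mu_heis. v x = v' x"
proof -
  have L: "u \<in> L2 mu_heis" "v \<in> L2 mu_heis" "v' \<in> L2 mu_heis"
    using v v' by (auto simp: szego_def ker_box_b_iff)
  let ?d = "\<lambda>x. v x - 1 * v' x"
  have d: "?d \<in> L2 mu_heis" by (intro L2_diff L2_cmult L)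
  have "?d \<in> ker_box_b lam"
    unfolding ker_box_b_iff
  proof (intro conjI allI impI d)
    fix j and g :: "'n heis \<Rightarrow> complex" assume g: "test_function g"
    have "Zbar lam j g \<in> L2 mu_heis" by (rule test_function_L2_heis[OF test_function_Zbar[OF g]])
    then have "integrable mu_heis (\<lambda>x. v x * Zbar lam j g x)" "integrable mu_heis (\<lambda>x. v' x * Zbar lam j g x)"
      using L by (auto intro: L2_mult_integrable)
    moreover have "(LINT x|mu_heis. v x * Zbar lam j g x) = 0" "(LINT x|mu_heis. v' x * Zbar lam j g x) = 0"
      using v v' g by (auto simp: szego_def ker_box_b_iff)
    ultimately show "(LINT x|mu_heis. ?d x * Zbar lam j g x) = 0"
      by (simp add: left_diff_distrib)
  qed
  then have "L2_inner mu_heis u ?d - 1 * L2_inner mu_heis v ?d = 0" "L2_inner mu_heis u ?d - 1 * L2_inner mu_heis v' ?d = 0"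
    using v v' unfolding L2_inner_diff_left[OF L(1,2) d, symmetric] L2_inner_diff_left[OF L(1,3) d, symmetric]
    by (simp_all add: szego_def)
  then have "L2_inner mu_heis ?d ?d = 0"
    unfolding L2_inner_diff_left[OF L(2,3) d] by simp
  then have "nsq mu_heis ?d = 0" by (simp add: L2_inner_self)
  from nsq_eq_0[OF d this] show ?thesis by simp
qed

text \<open>The relation \<open>szego\<close> fixes v only up to null sets, whereas v determines W
  pointwise in \<open>P_tilde\<close>. The converse therefore adjusts W on a null set, which
  \<open>pft\<close> tolerates by \<open>pft_cong\<close>.\<close>

lemma P_tilde_iff_szego: "P_tilde lam u v \<longleftrightarrow> szego lam u v"
proof
  assume v: "szego lam u v"
  then have "u \<in> L2 mu_heis" and vL: "v \<in> L2 mu_heis" by (simp_all add: szego_def ker_box_b_iff)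
  then obtain v' where v': "P_tilde lam u v'" using P_tilde_exists by blast
  then obtain U V W where W: "pft 1 u U" "V \<in> L2 mu_heis"
    "AE t in lborel. AE z in mu. V (z, t) = Pop t (\<lambda>w. U (w, t)) z"
    "pft (-1) V W" "v' = (\<lambda>x. 1 / (2 * complex_of_real pi) * W x)"
    unfolding P_tilde_iff by blast
  let ?W = "\<lambda>x. 2 * complex_of_real pi * v x"
  have "pft (-1) V ?W"
  proof (rule pft_cong[OF W(4)])
    show "?W \<in> borel_measurable borel"
      using L2_mu_heis_borel[OF vL] by (intro borel_measurable_times borel_measurable_const)
    show "AE x in mu_heis. W x = ?W x"
      using szego_unique[OF P_tilde_szego[OF v'] v] by eventually_elim (simp add: W(5) field_simps)
  qed
  moreover have "v = (\<lambda>x. 1 / (2 * complex_of_real pi) * ?W x)" by (simp add: fun_eq_iff)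
  ultimately show "P_tilde lam u v" unfolding P_tilde_iff using W(1-3) by blast
qed (rule P_tilde_szego)

text \<open>The exponential splits into a phase constant in y and the character of the transform of
  u; c stands for the cut-off value, constant in y as well. For fixed t the kernel is bounded, so
  Fubini needs just the integrability of u.\<close>

lemma inner_oscillatory_integral:
  fixes u :: "'n heis \<Rightarrow> complex"
  assumes u: "test_function u" and t: "t \<noteq> 0"
  shows "(LINT y|mu_heis. c * exp (- (\<i> * complex_of_real (t * (s - snd y)))) * bergman_t lam t z (fst y) * u y)
    = c * (cis (- t * s) * Pop_heis (pft_test 1 u) (z, t))"
proof -
  note [measurable] = test_function_borel[OF u]
  have ui: "integrable mu_heis u" using test_function_integrable[OF u] by (simp add: integrable_mu_heis_iff)
  let ?f = "\<lambda>y. Pker t z (fst y) * (cis (t * snd y) * u y)"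
  have "exp (- (\<i> * complex_of_real (t * (s - r)))) = cis (- t * s) * cis (t * r)" for r
    unfolding cis_conv_exp exp_add[symmetric] by (simp add: algebra_simps)
  then have "(LINT y|mu_heis. c * exp (- (\<i> * complex_of_real (t * (s - snd y)))) * bergman_t lam t z (fst y) * u y)
      = (LINT y|mu_heis. (c * cis (- t * s)) * ?f y)"
    by (simp add: bergman_t_eq[OF t] mult_ac)
  also have "\<dots> = c * cis (- t * s) * (LINT y|mu_heis. ?f y)" by simp
  also have "(LINT y|mu_heis. ?f y) = (LINT w|mu. LINT r|lborel. ?f (w, r))"
  proof (rule integral_heis_iterated[OF Bochner_Integration.integrable_bound[OF integrable_mult_right[OF integrable_norm[OF ui]]]])
    have [measurable]: "(fst :: 'n heis \<Rightarrow> _) \<in> borel_measurable borel" "(snd :: 'n heis \<Rightarrow> _) \<in> borel_measurable borel"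
      by (intro borel_measurable_continuous_onI continuous_intros)+
    have "?f \<in> borel_measurable borel"
      unfolding cis_conv_exp by measurable
    then show "?f \<in> borel_measurable mu_heis" by (simp add: measurable_cong_sets[OF sets_mu_heis refl])
    let ?C = "(2 * t) ^ CARD('n) / gauss_integral"
    have "cmod (Pker t z w) \<le> \<bar>?C\<bar>" for w
    proof (cases "t > 0")
      case True
      then have "?C * exp (- t * psi lam (z - w)) \<le> ?C * 1"
        using gauss_integral_pos psi_nonneg[of "z - w"] by (intro mult_left_mono) auto
      then show ?thesis using True gauss_integral_pos by (simp add: cmod_Pker)
    qed (simp add: cmod_Pker)
    then have "cmod (Pker t z (fst y)) * cmod (u y) \<le> \<bar>?C\<bar> * cmod (u y)" for y
      by (intro mult_right_mono) auto
    then show "AE y in mu_heis. norm (?f y) \<le> norm (\<bar>?C\<bar> * norm (u y))"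
      by (intro AE_I2) (simp only: norm_mult norm_cis mult_1_left real_norm_def abs_mult abs_abs abs_norm_cancel)
  qed
  also have "\<dots> = Pop_heis (pft_test 1 u) (z, t)"
    by (simp add: Pop_heis_def Pop_def pft_test_def)
  finally show ?thesis by (simp add: mult.assoc)
qed

text \<open>The limit is claimed at every point, while the projection is a class modulo null sets.
  The witness v is therefore a specific representative, the absolutely convergent inverse Fourier
  integral, chosen before and independently of the cut-off.\<close>

lemma szego_oscillatory_limit:
  fixes u :: "'n heis \<Rightarrow> complex"
  assumes u: "test_function u"
  shows "\<exists>v. szego lam u v \<and>
        (\<forall>chi :: real \<Rightarrow> complex.
          test_function chi \<and> (\<forall>s. \<bar>s\<bar> \<le> 1 \<longrightarrow> chi s = 1) \<and> (\<forall>s. \<bar>s\<bar> > 2 \<longrightarrow> chi s = 0) \<longrightarrow>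
          (\<forall>x. ((\<lambda>\<epsilon>. 1 / (2 * complex_of_real pi) *
                 (LINT t|lborel. (LINT y|mu_heis.
                    chi (\<epsilon> * t) * exp (- (\<i> * complex_of_real (t * (snd x - snd y)))) *
                    bergman_t lam t (fst x) (fst y) * u y)))
               \<longlongrightarrow> v x) (at_right 0)))"
proof -
  let ?U = "pft_test 1 u"
  let ?V = "Pop_heis ?U"
  have U: "pft 1 u ?U" by (rule pft_testI[OF u]) simp
  note V = Pop_heis_L2[OF pft_L2(2)[OF U]]
  obtain R C where RC: "C > 0" "\<And>w t. cmod (?U (w, t)) \<le> indicator (cball 0 R) w * (C / (1 + t\<^sup>2))"
    using pft_test_bound[OF u, of 1] by auto
  have Ub: "cmod (?U (w, t)) \<le> C / (1 + t\<^sup>2)" for w t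
    using RC(2)[of w t] RC(1) by (cases "w \<in> cball 0 R") (auto intro: order_trans)
  let ?D = "2 ^ CARD('n) * C"
  \<comment> \<open>The L1 bound 2^n of the kernel is uniform in z and t, so the decay of the
    transformed test function survives at every z. This gives the majorant for the limit.\<close>
  have Vb: "cmod (?V (z, t)) \<le> ?D / (1 + t\<^sup>2)" for z t
  proof -
    have "cmod (?V (z, t)) \<le> (LINT w|mu. cmod (Pker t z w) * (C / (1 + t\<^sup>2)))"
      unfolding Pop_heis_def Pop_def fst_conv snd_conv
    proof (rule norm_integral_le)
      show "integrable mu (\<lambda>w. cmod (Pker t z w) * (C / (1 + t\<^sup>2)))" by (intro integrable_mult_left Pker_integrable)
      show "cmod (Pker t z w * ?U (w, t)) \<le> cmod (Pker t z w) * (C / (1 + t\<^sup>2))" for w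
        unfolding norm_mult by (intro mult_left_mono Ub) auto
    qed
    also have "\<dots> = (LINT w|mu. cmod (Pker t z w)) * (C / (1 + t\<^sup>2))" by (rule integral_mult_left_zero)
    also have "\<dots> \<le> 2 ^ CARD('n) * (C / (1 + t\<^sup>2))"
      using RC(1) by (intro mult_right_mono Pker_integral_le divide_nonneg_nonneg) auto
    finally show ?thesis by simp
  qed
  define v where "v x = 1 / (2 * complex_of_real pi) * pft_test (- 1) ?V x" for x
  have W: "pft (- 1) ?V (pft_test (- 1) ?V)" by (rule pft_integrable[OF V Vb]) simp
  have "AE t in lborel. AE z in mu. ?V (z, t) = Pop t (\<lambda>w. ?U (w, t)) z"
    by (simp add: Pop_heis_def)
  then have "P_tilde lam u v"
    unfolding P_tilde_iff v_def[abs_def] using U V W by blast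
  then have sz: "szego lam u v" by (rule P_tilde_szego)
  show ?thesis
  proof (intro exI[of _ v] conjI allI impI sz)
    fix chi :: "real \<Rightarrow> complex" and x :: "'n heis"
    assume chi: "test_function chi \<and> (\<forall>s. \<bar>s\<bar> \<le> 1 \<longrightarrow> chi s = 1) \<and> (\<forall>s. \<bar>s\<bar> > 2 \<longrightarrow> chi s = 0)"
    obtain z s where x: "x = (z, s)" by (cases x)
    obtain K where K: "K > 0" "\<And>r. cmod (chi r) \<le> K" using test_function_bounded chi by blast
    have cc: "isCont chi r" for r
      using test_function_continuous[of chi] chi by (simp add: continuous_on_eq_continuous_at)
    note [measurable] = test_function_borel[of chi, OF conjunct1[OF chi]]
    have Vm [measurable]: "(\<lambda>t. ?V (z, t)) \<in> borel_measurable borel"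
      by (rule slice_measurable[OF L2_mu_heis_borel[OF V]])
    have cm [measurable]: "(\<lambda>t. cis (- t * s)) \<in> borel_measurable borel"
      by (intro borel_measurable_continuous_onI continuous_intros)
    define F where "F \<epsilon> t = (LINT y|mu_heis. chi (\<epsilon> * t) * exp (- (\<i> * complex_of_real (t * (s - snd y)))) *
                    bergman_t lam t z (fst y) * u y)" for \<epsilon> t
    have F: "F \<epsilon> t = chi (\<epsilon> * t) * (cis (- t * s) * ?V (z, t))" if "t \<noteq> 0" for \<epsilon> t
      unfolding F_def by (rule inner_oscillatory_integral[OF u that])
    \<comment> \<open>At t = 0 the kernel has not been identified; the integrands are compared off
      this point, and measurability of \<open>F \<epsilon>\<close> is obtained by treating the value
      there separately.\<close>
    have intF: "(LINT t|lborel. F \<epsilon> t) = (LINT t|lborel. chi (\<epsilon> * t) * (cis (- t * s) * ?V (z, t)))" for \<epsilon>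
    proof (rule integral_cong_AE)
      have "F \<epsilon> = (\<lambda>t. if t = 0 then F \<epsilon> 0 else chi (\<epsilon> * t) * (cis (- t * s) * ?V (z, t)))"
        using F by (auto simp: fun_eq_iff)
      moreover have "(\<lambda>t. if t = 0 then F \<epsilon> 0 else chi (\<epsilon> * t) * (cis (- t * s) * ?V (z, t))) \<in> borel_measurable lborel"
        by measurable
      ultimately show "F \<epsilon> \<in> borel_measurable lborel" by (simp only:)
      show "AE t in lborel. F \<epsilon> t = chi (\<epsilon> * t) * (cis (- t * s) * ?V (z, t))"
        using AE_lborel_singleton[of 0] by eventually_elim (rule F)
    qed measurable
    have "((\<lambda>\<epsilon>. LINT t|lborel. F \<epsilon> t) \<longlongrightarrow> (LINT t|lborel. cis (- t * s) * ?V (z, t))) (at_right 0)"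
      unfolding tendsto_at_iff_sequentially
    proof (intro allI impI)
      fix X :: "nat \<Rightarrow> real" assume X: "X \<longlonglongrightarrow> 0"
      have "(\<lambda>i. LINT t|lborel. chi (X i * t) * (cis (- t * s) * ?V (z, t))) \<longlonglongrightarrow> (LINT t|lborel. cis (- t * s) * ?V (z, t))"
      proof (rule integral_dominated_convergence)
        show "integrable lborel (\<lambda>t. K * ?D * (1 / (1 + t\<^sup>2)))"
          by (intro integrable_mult_right integrable_inverse_1_plus_sq)
        show "AE t in lborel. (\<lambda>i. chi (X i * t) * (cis (- t * s) * ?V (z, t))) \<longlonglongrightarrow> cis (- t * s) * ?V (z, t)"
        proof (intro AE_I2)
          fix t
          have "(\<lambda>i. X i * t) \<longlonglongrightarrow> 0 * t" by (intro tendsto_intros X)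
          then have "(\<lambda>i. chi (X i * t)) \<longlonglongrightarrow> chi 0" using isCont_tendsto_compose[OF cc[of 0], of "\<lambda>i. X i * t"] by simp
          moreover have "chi 0 = 1" using chi by simp
          ultimately have "(\<lambda>i. chi (X i * t) * (cis (- t * s) * ?V (z, t))) \<longlonglongrightarrow> 1 * (cis (- t * s) * ?V (z, t))"
            by (intro tendsto_mult tendsto_const) simp
          then show "(\<lambda>i. chi (X i * t) * (cis (- t * s) * ?V (z, t))) \<longlonglongrightarrow> cis (- t * s) * ?V (z, t)" by simp
        qed
        show "AE t in lborel. norm (chi (X i * t) * (cis (- t * s) * ?V (z, t))) \<le> K * ?D * (1 / (1 + t\<^sup>2))" for i
        proof (intro AE_I2)
          fix t
          have "cmod (chi (X i * t)) * cmod (?V (z, t)) \<le> K * (?D / (1 + t\<^sup>2))"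
            using K(1) by (intro mult_mono K Vb) auto
          then show "norm (chi (X i * t) * (cis (- t * s) * ?V (z, t))) \<le> K * ?D * (1 / (1 + t\<^sup>2))"
            by (simp add: norm_mult)
        qed
      qed measurable
      then show "((\<lambda>\<epsilon>. LINT t|lborel. F \<epsilon> t) \<circ> X) \<longlonglongrightarrow> (LINT t|lborel. cis (- t * s) * ?V (z, t))"
        by (simp add: o_def intF)
    qed
    then have "((\<lambda>\<epsilon>. 1 / (2 * complex_of_real pi) * (LINT t|lborel. F \<epsilon> t)) \<longlongrightarrow> 1 / (2 * complex_of_real pi) * (LINT t|lborel. cis (- t * s) * ?V (z, t))) (at_right 0)"
      by (intro tendsto_mult tendsto_const)
    moreover have "v x = 1 / (2 * complex_of_real pi) * (LINT t|lborel. cis (- t * s) * ?V (z, t))"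
      by (simp add: v_def pft_test_def x mult.commute)
    ultimately show "((\<lambda>\<epsilon>. 1 / (2 * complex_of_real pi) *
                 (LINT t|lborel. (LINT y|mu_heis.
                    chi (\<epsilon> * t) * exp (- (\<i> * complex_of_real (t * (snd x - snd y)))) *
                    bergman_t lam t (fst x) (fst y) * u y)))
               \<longlongrightarrow> v x) (at_right 0)"
      unfolding F_def by (simp only: x fst_conv snd_conv)
  qed
qed

end

theorem theorem7p6:
  fixes lam :: "real^'n"
  assumes lam_pos: "\<And>j. lam $ j > 0"
  shows "(\<forall>u\<in>L2 mu_heis. \<exists>v. P_tilde lam u v) \<and>
    (\<forall>u v. P_tilde lam u v \<longleftrightarrow> szego lam u v) \<and>
    (\<forall>u. test_function u \<longrightarrow>
      (\<exists>v. szego lam u v \<and>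
        (\<forall>chi :: real \<Rightarrow> complex.
          test_function chi \<and> (\<forall>s. \<bar>s\<bar> \<le> 1 \<longrightarrow> chi s = 1) \<and> (\<forall>s. \<bar>s\<bar> > 2 \<longrightarrow> chi s = 0) \<longrightarrow>
          (\<forall>x. ((\<lambda>\<epsilon>. 1 / (2 * complex_of_real pi) *
                 (LINT t|lborel. (LINT y|mu_heis.
                    chi (\<epsilon> * t) * exp (- (\<i> * complex_of_real (t * (snd x - snd y)))) *
                    bergman_t lam t (fst x) (fst y) * u y)))
               \<longlongrightarrow> v x) (at_right 0)))))"
proof -
  interpret positive_weights lam by unfold_locales (rule lam_pos)
  show ?thesis
    using P_tilde_exists P_tilde_iff_szego szego_oscillatory_limit by blast
qed

end
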